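(* Let $Y$ be a MUCOGARCH(1,1) volatility process in $\mathbb{S}_d^+$ driven by a compound Poisson process $L$ in $\mathbb{R}^d$, with parameters $A\in GL_d(\mathbb{R})$, $B\in M_d(\mathbb{R})$ such that every eigenvalue of $B$ has strictly negative real part, and $C\in\mathbb{S}_d^{++}$. If the jump distribution of $L$ has a non-trivial absolutely continuous component equivalent to the Lebesgue measure on $\mathbb{R}^d$ restricted to an open neighborhood of zero, then $Y$ is irreducible with respect to the Lebesgue measure restricted to an open neighborhood of zero in $\mathbb{S}_d^+$ (that is, there exists such a neighborhood for which this holds) and aperiodic.
   Context: Notation: $M_d(\mathbb{R})$ are the real $d\times d$ matrices, $GL_d(\mathbb{R})$ the invertible ones, $\mathbb{S}_d$ the symmetric ones, $\mathbb{S}_d^+$ the closed cone of positive semi-definite and $\mathbb{S}_d^{++}$ the open cone of positive definite matrices. The Lebesgue measure on $\mathbb{S}_d^+$ is the restriction to $\mathbb{S}_d^+$ of the Lebesgue measure on the vector space $\mathbb{S}_d\cong\mathbb{R}^{d(d+1)/2}$; "open neighborhood of zero in $\mathbb{S}_d^+$" refers to the relative topology. MUCOGARCH(1,1) volatility process: $L$ is an $\mathbb{R}^d$-valued càdlàg Lévy process and $[L,L]^{\mathfrak d}_t=\sum_{0<s\le t}(\Delta L_s)(\Delta L_s)^\top$ is the discontinuous part of its quadratic variation. For $A,B\in M_d(\mathbb{R})$, $C\in\mathbb{S}_d^{++}$ and $Y_0\in\mathbb{S}_d^+$, the process $Y=(Y_t)_{t\ge0}$ is the unique $\mathbb{S}_d^+$-valued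 solution (known to exist) of $$dY_t=(BY_{t-}+Y_{t-}B^\top)\,dt+A(C+Y_{t-})^{1/2}\,d[L,L]^{\mathfrak d}_t\,(C+Y_{t-})^{1/2}A^\top .$$ It is a time-homogeneous strong Markov process on $X=\mathbb{S}_d^+$ with transition probabilities $\mathbb{P}^t(x,D)=\mathbb{P}_x(Y_t\in D)$, $D\in\mathcal{B}(X)$. Compound Poisson: $L_t=\sum_{i=1}^{N_t}X_i$ with $N$ a Poisson process of positive rate and $(X_i)$ i.i.d. with the jump distribution as law, independent of $N$. Markov process notions: for a $\sigma$-finite measure $\mu$ on $\mathcal{B}(X)$, the process is $\mu$-irreducible (irreducible with respect to $\mu$) if $\int_0^\infty\mathbb{P}^t(x,D)\,dt>0$ for all $x\in X$ and all $D\in\mathcal{B}(X)$ with $\mu(D)>0$. Then there is a maximal irreducibility measure $\psi$ (every other irreducibility measure is absolutely continuous with respect to $\psi$); $\mathcal{B}^+(X)$ denotes the sets $D\in\mathcal B(X)$ with $\psi(D)>0$. A nonempty $D\in\mathcal{B}(X)$ is small if there are $m>0$ and a nontrivial measure $\nu_m$ on $\mathcal{B}(X)$ with $\mathbb{P}^m(x,E)\ge\nu_m(E)$ for all $x\in D$, $E\in\mathcal{B}(X)$. A $\psi$-irreducible process is aperiodic if for some small set $D\in\mathcal{B}^+(X)$ there is $T$ with $\mathbb{P}^t(x,D)>0$ for all $t\ge T$ and all $x\in D$. *)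

theory Defs
  imports "HOL-Probability.Probability"
begin

section \<open>Matrices\<close>

definition psd :: "(real^'n^'n) set" where
  "psd = {S. transpose S = S \<and> (\<forall>x. 0 \<le> x \<bullet> (S *v x))}"

definition pd :: "(real^'n^'n) set" where
  "pd = {S. transpose S = S \<and> (\<forall>x. x \<noteq> 0 \<longrightarrow> 0 < x \<bullet> (S *v x))}"

definition psd_sqrt :: "real^'n^'n \<Rightarrow> real^'n^'n" where
  "psd_sqrt S = (THE R. R \<in> psd \<and> R ** R = S)"

definition outer :: "real^'n \<Rightarrow> real^'n^'n" where
  "outer x = (\<chi> i j. x $ i * x $ j)"

text \<open>The eigenvalues of a real matrix are its complex eigenvalues.\<close>

definition eigenvalue :: "real^'n^'n \<Rightarrow> complex \<Rightarrow> bool" where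
  "eigenvalue B z \<longleftrightarrow> (\<exists>v. v \<noteq> 0 \<and> map_matrix complex_of_real B *v v = z *s v)"

abbreviation psd_space :: "(real^'n^'n) measure" where
  "psd_space \<equiv> restrict_space borel psd"

text \<open>Lebesgue measure on the symmetric matrices, as a Borel measure on all matrices. The
  coordinates of a symmetric matrix are indexed by the sets \<open>{i, j}\<close>, of which there are
  \<open>d (d + 1) / 2\<close>; thus no order on the index type is needed to single out the entries on
  and above the diagonal.\<close>

definition lebesgue_sym :: "(real^'n^'n) measure" where
  "lebesgue_sym = distr (\<Pi>\<^sub>M s\<in>{s. \<exists>i j. s = {i, j}}. lborel) borel (\<lambda>v. \<chi> i j. v {i, j})"

definition lebesgue_psd_on :: "(real^'n^'n) set \<Rightarrow> (real^'n^'n) measure" where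
  "lebesgue_psd_on U = density (restrict_space lebesgue_sym psd) (indicator U)"

section \<open>Paths and pathwise integrals\<close>

definition left_lim :: "(real \<Rightarrow> 'a::t2_space) \<Rightarrow> real \<Rightarrow> 'a" where
  "left_lim f s = Lim (at_left s) f"

definition jump :: "(real \<Rightarrow> 'a::real_normed_vector) \<Rightarrow> real \<Rightarrow> 'a" where
  "jump f s = f s - left_lim f s"

definition cadlag :: "(real \<Rightarrow> 'a::t2_space) \<Rightarrow> bool" where
  "cadlag f \<longleftrightarrow> (\<forall>t\<ge>0. (f \<longlongrightarrow> f t) (at_right t)) \<and> (\<forall>t>0. \<exists>l. (f \<longlongrightarrow> l) (at_left t))"

text \<open>Discontinuous part of the quadratic variation of a path.\<close>

definition qv_disc :: "(real \<Rightarrow> real^'n) \<Rightarrow> real \<Rightarrow> real^'n^'n" where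
  "qv_disc l t = (\<Sum>\<^sub>\<infinity>s\<in>{0<..t}. outer (jump l s))"

text \<open>Lebesgue-Stieltjes integral \<open>\<integral>\<^bsub>(0,t]\<^esub> g dV = I\<close> for \<open>V\<close> of finite variation on \<open>[0,t]\<close>. The
  signed measure \<open>dV\<close> is written as a difference \<open>p - n\<close> of finite measures. The value does not
  depend on their choice.\<close>

definition has_LS_integral :: "(real \<Rightarrow> real) \<Rightarrow> (real \<Rightarrow> real) \<Rightarrow> real \<Rightarrow> real \<Rightarrow> bool" where
  "has_LS_integral g V t I \<longleftrightarrow>
    (\<exists>p n. sets p = sets borel \<and> sets n = sets borel \<and> finite_measure p \<and> finite_measure n \<and>
       (\<forall>a b. 0 \<le> a \<and> a \<le> b \<and> b \<le> t \<longrightarrow> V b - V a = measure p {a<..b} - measure n {a<..b}) \<and>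
       set_integrable p {0<..t} g \<and> set_integrable n {0<..t} g \<and>
       I = (LINT s:{0<..t}|p. g s) - (LINT s:{0<..t}|n. g s))"

text \<open>Matrix version \<open>\<integral>\<^bsub>(0,t]\<^esub> H dV K = J\<close>, defined entrywise by
  \<open>J\<^sub>i\<^sub>j = \<Sum>\<^sub>k\<^sub>l \<integral> H\<^sub>i\<^sub>k K\<^sub>l\<^sub>j dV\<^sub>k\<^sub>l\<close>.\<close>

definition has_matrix_LS_integral ::
  "(real \<Rightarrow> real^'n^'n) \<Rightarrow> (real \<Rightarrow> real^'n^'n) \<Rightarrow> (real \<Rightarrow> real^'n^'n) \<Rightarrow> real \<Rightarrow> real^'n^'n \<Rightarrow> bool"
where
  "has_matrix_LS_integral H V K t J \<longleftrightarrow>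
    (\<exists>I. (\<forall>i j k l. has_LS_integral (\<lambda>s. H s $ i $ k * K s $ l $ j) (\<lambda>s. V s $ k $ l) t (I i j k l)) \<and>
         J = (\<chi> i j. \<Sum>k\<in>UNIV. \<Sum>l\<in>UNIV. I i j k l))"

section \<open>Compound Poisson processes\<close>

definition poisson_process :: "'w measure \<Rightarrow> real \<Rightarrow> (real \<Rightarrow> 'w \<Rightarrow> nat) \<Rightarrow> bool" where
  "poisson_process M rate N \<longleftrightarrow>
    prob_space M \<and> 0 < rate \<and>
    (\<forall>t\<ge>0. N t \<in> measurable M (count_space UNIV)) \<and>
    (AE \<omega> in M. N 0 \<omega> = 0 \<and> mono_on {0..} (\<lambda>t. N t \<omega>) \<and>
       (\<forall>t\<ge>0. ((\<lambda>s. N s \<omega>) \<longlongrightarrow> N t \<omega>) (at_right t))) \<and>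
    (\<forall>s t. 0 \<le> s \<and> s < t \<longrightarrow>
       distr M (count_space UNIV) (\<lambda>\<omega>. N t \<omega> - N s \<omega>) = measure_pmf (poisson_pmf (rate * (t - s)))) \<and>
    (\<forall>(\<tau> :: nat \<Rightarrow> real) m. 0 \<le> \<tau> 0 \<and> mono \<tau> \<longrightarrow>
       prob_space.indep_vars M (\<lambda>_. count_space UNIV) (\<lambda>i \<omega>. N (\<tau> (Suc i)) \<omega> - N (\<tau> i) \<omega>) {..<m})"

text \<open>\<open>L\<^sub>t\<close> is the sum of the first \<open>N\<^sub>t\<close> elements of the sequence \<open>X\<close>, here indexed from 0.
  The distribution \<open>F\<close> of the jumps may have an atom at 0.\<close>

definition compound_poisson_process ::
  "'w measure \<Rightarrow> (real \<Rightarrow> 'w \<Rightarrow> real^'n) \<Rightarrow> (real^'n) measure \<Rightarrow> bool"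
where
  "compound_poisson_process M L F \<longleftrightarrow>
    (\<exists>rate N (X :: nat \<Rightarrow> 'w \<Rightarrow> real^'n).
       poisson_process M rate N \<and>
       prob_space.indep_vars M (\<lambda>_. borel) X UNIV \<and>
       (\<forall>i. distr M borel (X i) = F) \<and>
       prob_space.indep_set M
         (sets (vimage_algebra (space M) (\<lambda>\<omega> i. X i \<omega>) (\<Pi>\<^sub>M i\<in>UNIV. borel)))
         (sets (vimage_algebra (space M) (\<lambda>\<omega>. \<lambda>t\<in>{0..}. N t \<omega>) (\<Pi>\<^sub>M t\<in>{0..}. count_space UNIV))) \<and>
       (\<forall>t\<ge>0. \<forall>\<omega>\<in>space M. L t \<omega> = (\<Sum>i<N t \<omega>. X i \<omega>)))"

text \<open>\<open>F\<close> splits as \<open>\<nu> + \<rho>\<close>, where \<open>\<nu>\<close> is equivalent to Lebesgue measure restricted to an open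
  neighborhood of 0 (and hence non-trivial and absolutely continuous).\<close>

definition has_ac_component_near_0 :: "(real^'n) measure \<Rightarrow> bool" where
  "has_ac_component_near_0 F \<longleftrightarrow>
    (\<exists>\<nu> \<rho> V. sets \<nu> = sets borel \<and> sets \<rho> = sets borel \<and>
       (\<forall>E\<in>sets borel. emeasure F E = emeasure \<nu> E + emeasure \<rho> E) \<and>
       open V \<and> 0 \<in> V \<and>
       absolutely_continuous \<nu> (density lborel (indicator V)) \<and>
       absolutely_continuous (density lborel (indicator V)) \<nu>)"

section \<open>The MUCOGARCH(1,1) volatility process\<close>

definition mucogarch_volatility ::
  "'w measure \<Rightarrow> (real \<Rightarrow> 'w \<Rightarrow> real^'n) \<Rightarrow> real^'n^'n \<Rightarrow> real^'n^'n \<Rightarrow> real^'n^'n \<Rightarrow>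
   (real \<Rightarrow> 'w \<Rightarrow> real^'n^'n) \<Rightarrow> bool"
where
  "mucogarch_volatility M L A B C Y \<longleftrightarrow>
    (\<forall>t\<ge>0. Y t \<in> measurable M psd_space) \<and>
    (AE \<omega> in M. cadlag (\<lambda>t. Y t \<omega>) \<and>
      (let Y_left = left_lim (\<lambda>u. Y u \<omega>) in
       \<forall>t\<ge>0. \<exists>J.
         has_matrix_LS_integral
           (\<lambda>s. A ** psd_sqrt (C + Y_left s))
           (qv_disc (\<lambda>u. L u \<omega>))
           (\<lambda>s. psd_sqrt (C + Y_left s) ** transpose A) t J \<and>
         Y t \<omega> = Y 0 \<omega> + (LINT s:{0..t}|lborel. B ** Y_left s + Y_left s ** transpose B) + J))"

section \<open>Irreducibility and aperiodicity\<close>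

text \<open>In this section \<open>X\<close> is the state space and \<open>P t x\<close> is the law at time \<open>t\<close> of the process
  started in \<open>x\<close>.\<close>

definition irreducible_wrt ::
  "'a measure \<Rightarrow> (real \<Rightarrow> 'a \<Rightarrow> 'a measure) \<Rightarrow> 'a measure \<Rightarrow> bool"
where
  "irreducible_wrt X P \<mu> \<longleftrightarrow>
    sets \<mu> = sets X \<and> sigma_finite_measure \<mu> \<and>
    (\<forall>x\<in>space X. \<forall>D\<in>sets X. 0 < emeasure \<mu> D \<longrightarrow>
       0 < (\<integral>\<^sup>+t\<in>{0..}. emeasure (P t x) D \<partial>lborel))"

definition maximal_irreducibility_measure ::
  "'a measure \<Rightarrow> (real \<Rightarrow> 'a \<Rightarrow> 'a measure) \<Rightarrow> 'a measure \<Rightarrow> bool"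
where
  "maximal_irreducibility_measure X P \<psi> \<longleftrightarrow>
    irreducible_wrt X P \<psi> \<and> (\<forall>\<phi>. irreducible_wrt X P \<phi> \<longrightarrow> absolutely_continuous \<psi> \<phi>)"

definition small_set ::
  "'a measure \<Rightarrow> (real \<Rightarrow> 'a \<Rightarrow> 'a measure) \<Rightarrow> 'a set \<Rightarrow> bool"
where
  "small_set X P D \<longleftrightarrow>
    D \<in> sets X \<and> D \<noteq> {} \<and>
    (\<exists>m>0. \<exists>\<nu>. sets \<nu> = sets X \<and> emeasure \<nu> (space X) \<noteq> 0 \<and>
       (\<forall>x\<in>D. \<forall>E\<in>sets X. emeasure \<nu> E \<le> emeasure (P m x) E))"

text \<open>The choice of \<open>\<psi>\<close> is immaterial, since any two maximal irreducibility measures have the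
  same null sets.\<close>

definition aperiodic :: "'a measure \<Rightarrow> (real \<Rightarrow> 'a \<Rightarrow> 'a measure) \<Rightarrow> bool" where
  "aperiodic X P \<longleftrightarrow>
    (\<exists>\<psi>. maximal_irreducibility_measure X P \<psi> \<and>
      (\<exists>D. small_set X P D \<and> 0 < emeasure \<psi> D \<and>
        (\<exists>T\<ge>0. \<forall>t\<ge>T. \<forall>x\<in>D. 0 < emeasure (P t x) D)))"

end

theory Submission
  imports Defs "HOL-Computational_Algebra.Fundamental_Theorem_Algebra"
begin

text \<open>Between jumps \<open>Y\<close> follows the linear flow \<open>x \<mapsto> e\<^sup>t\<^sup>B x (e\<^sup>t\<^sup>B)\<^sup>T\<close>, and a jump of \<open>L\<close> adds a rank one
  matrix \<open>v v\<^sup>T\<close>. With positive probability \<open>L\<close> has exactly one jump in each of \<open>d\<close> consecutive intervals. On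
  this event \<open>Y\<close> ends at \<open>y + V\<^sup>T V\<close>, where \<open>y\<close> is the start carried along by the flow and the law of the
  matrix \<open>V\<close> has a minorant with positive density near 0. The Gram map \<open>V \<mapsto> V\<^sup>T V\<close> turns this into a positive
  density on the positive definite matrices near 0. Since \<open>e\<^sup>t\<^sup>B \<longlongrightarrow> 0\<close>, a long period without jumps makes \<open>y\<close>
  small, uniformly on bounded sets of starting points. Hence a set of positive Lebesgue measure near 0 is charged
  at all large times, which gives irreducibility and reduces aperiodicity to a small set of positive
  measure near 0.

  The densities are only measurable, so no small set comes from continuity. Two such blocks give a
  transition kernel minorized by \<open>\<integral> u(x, s) w(y, s) ds\<close>. Up to a small error the sections of a
  measurable function take countably many values, so this integral is bounded below by a positive constant
  on a product of two sets of positive measure.\<close>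

section \<open>Positive semidefinite matrices\<close>

text \<open>The law of V becomes tractable once the counting path is frozen: for fixed offsets of
  the jumps inside a block, the passage from jump sizes to the rows of V is triangular, since the
  matrix applied to a jump depends only on the jumps before it. The density estimates hold for every
  choice of offsets and are integrated over the counting path at the end. Independent blocks come
  from splitting one i.i.d. sequence of jump sizes. The obstacle is the Gram map, which lowers the
  dimension from d^2 to d(d+1)/2. Both sides are enlarged by auxiliary coordinates until the
  dimensions agree: a symmetric matrix is lifted to the matrices with that image under
  \<open>symz\<close>, and a second matrix W remembers the rest of V. In suitable coordinates the
  lifted map is polynomial, so null sets can be carried across it, and the Radon-Nikodym theorem
  turns this into a density that is positive almost everywhere. From y a block reaches S only if S -
  y is a Gram matrix, so S has to dominate y as a quadratic form; hence the starting point must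
  first shrink towards 0.\<close>

lemma sym_inner:
  fixes S :: "real^'n^'n"
  assumes "transpose S = S"
  shows "(S *v x) \<bullet> y = x \<bullet> (S *v y)"
  by (metis assms dot_lmul_matrix transpose_matrix_vector)

lemma psdD: "S \<in> psd \<Longrightarrow> transpose S = S" "S \<in> psd \<Longrightarrow> 0 \<le> x \<bullet> (S *v x)"
  by (auto simp: psd_def)

lemma pd_psd: "S \<in> pd \<Longrightarrow> S \<in> psd"
  unfolding pd_def psd_def by (auto, metis inner_zero_left order.order_iff_strict)

text \<open>The first-order condition at a minimum: near t = 0 the linear term dominates, so for b
  different from 0 a small t of opposite sign gives a negative value. The witness is t = -e b with e
  |c| < 1.\<close>

lemma linear_coeff_zero:
  fixes b c :: real
  assumes "\<And>t. 0 \<le> 2 * t * b + t\<^sup>2 * c"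
  shows "b = 0"
proof (rule ccontr)
  assume "b \<noteq> 0"
  define e where "e = 1 / (1 + \<bar>c\<bar>)"
  have e: "e > 0" "e * \<bar>c\<bar> < 1" unfolding e_def by (auto simp: field_simps)
  have "0 \<le> 2 * (- e * b) * b + (- e * b)\<^sup>2 * c" by (rule assms)
  also have "\<dots> = e * b\<^sup>2 * (e * c - 2)" by (simp add: power2_eq_square algebra_simps)
  also have "\<dots> < 0"
  proof (rule mult_pos_neg)
    show "0 < e * b\<^sup>2" using e \<open>b \<noteq> 0\<close> by simp
    show "e * c - 2 < 0" using e by (smt (verit) mult_left_mono)
  qed
  finally show False by simp
qed

text \<open>The maximum of the quadratic form on the unit sphere is attained at an eigenvector.\<close>

lemma sym_eigenvector_exists:
  fixes S :: "real^'n^'n"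
  assumes S: "transpose S = S" and W: "subspace W" and inv: "\<And>w. w \<in> W \<Longrightarrow> S *v w \<in> W"
    and ne: "w0 \<in> W" "w0 \<noteq> 0"
  shows "\<exists>v l. v \<in> W \<and> norm v = 1 \<and> S *v v = l *\<^sub>R v"
proof -
  let ?K = "W \<inter> sphere 0 1"
  have cK: "compact ?K"
    using closed_subspace[OF W] by (auto intro: closed_Int_compact)
  have "w0 /\<^sub>R norm w0 \<in> ?K"
    using ne W by (auto simp: subspace_scale)
  then have Kne: "?K \<noteq> {}" by blast
  have "continuous_on ?K (\<lambda>x. x \<bullet> (S *v x))"
    by (intro continuous_intros matrix_vector_mult_linear_continuous_on)
  from continuous_attains_sup[OF cK Kne this]
  obtain v where v: "v \<in> ?K" "\<And>y. y \<in> ?K \<Longrightarrow> y \<bullet> (S *v y) \<le> v \<bullet> (S *v v)" by blast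
  define l where "l = v \<bullet> (S *v v)"
  have vn: "v \<bullet> v = 1" using v(1) by (simp add: dot_square_norm)
  have le: "w \<bullet> (S *v w) \<le> l * (w \<bullet> w)" if "w \<in> W" for w
  proof (cases "w = 0")
    case False
    have "w /\<^sub>R norm w \<in> ?K" using False that W by (auto simp: subspace_scale)
    from v(2)[OF this] have "(w \<bullet> (S *v w)) / (norm w)\<^sup>2 \<le> l"
      by (simp add: l_def matrix_vector_mult_scaleR field_simps power2_eq_square)
    then show ?thesis using False by (simp add: field_simps dot_square_norm)
  qed simp
  \<comment> \<open>Maximality of the form at \<open>v\<close>, tested on v + t w, is a quadratic
    inequality in t whose linear coefficient must vanish. Below, w is taken to be l v - S v itself,
    which lies in W by invariance.\<close>
  have orth: "w \<bullet> (l *\<^sub>R v - S *v v) = 0" if w: "w \<in> W" for w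
  proof (rule linear_coeff_zero[where c = "l * (w \<bullet> w) - w \<bullet> (S *v w)"])
    fix t :: real
    have "v + t *\<^sub>R w \<in> W" using v(1) w W by (simp add: subspace_add subspace_scale)
    from le[OF this]
    show "0 \<le> 2 * t * (w \<bullet> (l *\<^sub>R v - S *v v)) + t\<^sup>2 * (l * (w \<bullet> w) - w \<bullet> (S *v w))"
      using sym_inner[OF S, of v w] vn
      by (simp add: matrix_vector_right_distrib matrix_vector_mult_scaleR inner_add inner_diff_right
           l_def[symmetric] power2_eq_square algebra_simps inner_commute)
  qed
  have "l *\<^sub>R v - S *v v \<in> W" using v(1) inv W by (simp add: subspace_diff subspace_scale)
  from orth[OF this] have "S *v v = l *\<^sub>R v" by simp
  then show ?thesis using v(1) by auto
qed

text \<open>The spectral theorem. An orthonormal set of eigenvectors of maximal cardinality is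
  complete: its orthogonal complement is invariant under \<open>S\<close>, so a nonzero complement
  would contain one more eigenvector.\<close>

lemma sym_eigenbasis:
  fixes S :: "real^'n^'n"
  assumes S: "transpose S = S"
  shows "\<exists>B l. finite B \<and> (\<forall>b\<in>B. S *v b = l b *\<^sub>R b \<and> norm b = 1) \<and> pairwise orthogonal B \<and>
    (\<forall>x. x = (\<Sum>b\<in>B. (b \<bullet> x) *\<^sub>R b))"
proof -
  define P where "P B \<longleftrightarrow> finite B \<and> (\<forall>b\<in>B. (\<exists>l. S *v b = l *\<^sub>R b) \<and> norm b = 1) \<and> pairwise orthogonal B"
    for B :: "(real^'n) set"
  have "P {}" by (simp add: P_def)
  moreover have "card B < Suc DIM(real^'n)" if "P B" for B
  proof -
    have "0 \<notin> B" using that by (auto simp: P_def)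
    then have "independent B" using that pairwise_orthogonal_independent by (auto simp: P_def)
    then show ?thesis using independent_bound[of B] by simp
  qed
  ultimately obtain B where B: "P B" "\<And>B'. P B' \<Longrightarrow> card B' \<le> card B"
    using ex_has_greatest_nat[of P "{}" card "Suc DIM(real^'n)"] by (metis less_imp_le)
  obtain l where l: "\<And>b. b \<in> B \<Longrightarrow> S *v b = l b *\<^sub>R b"
    using B(1) unfolding P_def by metis
  define W where "W = {w. \<forall>b\<in>B. b \<bullet> w = 0}"
  have "subspace W" unfolding W_def subspace_def by (auto simp: inner_add_right)
  have W0: "w = 0" if w: "w \<in> W" for w
  proof (rule ccontr)
    assume "w \<noteq> 0"
    have inv: "S *v w \<in> W" if "w \<in> W" for w
      using that unfolding W_def by (auto simp: sym_inner[OF S, symmetric] l)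
    obtain v m where v: "v \<in> W" "norm v = 1" "S *v v = m *\<^sub>R v"
      using sym_eigenvector_exists[OF S \<open>subspace W\<close> inv w \<open>w \<noteq> 0\<close>] by blast
    have "v \<notin> B" using v unfolding W_def by (metis (mono_tags) inner_eq_zero_iff mem_Collect_eq norm_zero zero_neq_one)
    moreover have "P (insert v B)"
      using B(1) v unfolding P_def W_def
      by (auto simp: pairwise_insert orthogonal_def inner_commute)
    ultimately show False using B(2)[of "insert v B"] B(1) by (simp add: P_def)
  qed
  have "x = (\<Sum>b\<in>B. (b \<bullet> x) *\<^sub>R b)" for x
  proof -
    have "x - (\<Sum>b\<in>B. (b \<bullet> x) *\<^sub>R b) \<in> W"
      unfolding W_def
    proof safe
      fix c assume c: "c \<in> B"
      have "c \<bullet> (\<Sum>b\<in>B. (b \<bullet> x) *\<^sub>R b) = (\<Sum>b\<in>B. if b = c then c \<bullet> x else 0)"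
        unfolding inner_sum_right
      proof (rule sum.cong)
        fix b assume "b \<in> B"
        then show "c \<bullet> ((b \<bullet> x) *\<^sub>R b) = (if b = c then c \<bullet> x else 0)"
          using B(1) c unfolding P_def
          by (auto simp: pairwise_def orthogonal_def dot_square_norm)
      qed simp
      then show "c \<bullet> (x - (\<Sum>b\<in>B. (b \<bullet> x) *\<^sub>R b)) = 0"
        using c B(1) by (simp add: inner_diff_right P_def)
    qed
    then show ?thesis using W0 by fastforce
  qed
  then show ?thesis using B(1) l unfolding P_def by blast
qed

lemma outer_mult: "outer b *v x = (b \<bullet> x) *\<^sub>R b"
  by (auto simp: outer_def matrix_vector_mult_def vec_eq_iff inner_vec_def sum_distrib_left sum_distrib_right mult_ac)

lemma outer_sym [simp]: "transpose (outer b) = outer b"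
  by (auto simp: outer_def transpose_def mult_ac)

lemma transpose_add: "transpose (A + B) = transpose A + transpose (B :: real^'n^'n)"
  by (auto simp: transpose_def vec_eq_iff)

lemma transpose_sub: "transpose (A - B) = transpose A - transpose (B :: real^'n^'n)"
  by (auto simp: transpose_def vec_eq_iff)

lemma transpose_scaleR: "transpose (c *\<^sub>R A) = c *\<^sub>R transpose (A :: real^'n^'n)"
  by (auto simp: transpose_def vec_eq_iff)

lemma matrix_sum_vector_mult: "(\<Sum>i\<in>I. f i) *v x = (\<Sum>i\<in>I. (f i :: real^'n^'n) *v x)"
  by (induction I rule: infinite_finite_induct) (auto simp: matrix_vector_mult_add_rdistrib)

lemma transpose_sum: "transpose (\<Sum>i\<in>I. f i) = (\<Sum>i\<in>I. transpose (f i :: real^'n^'n))"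
  by (induction I rule: infinite_finite_induct) (auto simp: transpose_add, auto simp: transpose_def vec_eq_iff)

lemma scaleR_matrix_vector: "(c *\<^sub>R A) *v x = c *\<^sub>R ((A :: real^'n^'n) *v x)"
  by (auto simp: matrix_vector_mult_def vec_eq_iff sum_distrib_left mult_ac)

text \<open>The root has the same eigenvectors, with the roots of the eigenvalues.\<close>

lemma psd_sqrt_exists:
  fixes S :: "real^'n^'n"
  assumes S: "S \<in> psd"
  shows "\<exists>R\<in>psd. R ** R = S"
proof -
  obtain B l where B: "finite B" "\<And>b. b \<in> B \<Longrightarrow> S *v b = l b *\<^sub>R b \<and> norm b = 1" "pairwise orthogonal B"
    "\<And>x. x = (\<Sum>b\<in>B. (b \<bullet> x) *\<^sub>R b)"
    using sym_eigenbasis[OF psdD(1)[OF S]] by blast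
  have l0: "0 \<le> l b" if "b \<in> B" for b
    using psdD(2)[OF S, of b] B(2)[OF that] by (simp add: dot_square_norm)
  define R where "R = (\<Sum>b\<in>B. sqrt (l b) *\<^sub>R outer b)"
  have Rx: "R *v x = (\<Sum>b\<in>B. (sqrt (l b) * (b \<bullet> x)) *\<^sub>R b)" for x
    unfolding R_def by (simp add: matrix_sum_vector_mult outer_mult scaleR_matrix_vector)
  have Rb: "R *v c = sqrt (l c) *\<^sub>R c" if c: "c \<in> B" for c
  proof -
    have "(\<Sum>b\<in>B. (sqrt (l b) * (b \<bullet> c)) *\<^sub>R b) = (\<Sum>b\<in>B. if b = c then sqrt (l c) *\<^sub>R c else 0)"
    proof (rule sum.cong)
      fix b assume "b \<in> B"
      then show "(sqrt (l b) * (b \<bullet> c)) *\<^sub>R b = (if b = c then sqrt (l c) *\<^sub>R c else 0)"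
        using B(2,3) c by (auto simp: pairwise_def orthogonal_def dot_square_norm)
    qed simp
    then show ?thesis using c B(1) Rx by simp
  qed
  have lin: "A *v x = (\<Sum>b\<in>B. (b \<bullet> x) *\<^sub>R (A *v b))" for A :: "real^'n^'n" and x
    by (subst B(4)[of x]) (simp add: linear_sum[OF matrix_vector_mul_linear] matrix_vector_mult_scaleR)
  have "R ** R = S"
  proof (subst matrix_eq, safe)
    fix x
    have "(R ** R) *v x = (\<Sum>b\<in>B. (b \<bullet> x) *\<^sub>R (R ** R *v b))" by (rule lin)
    also have "\<dots> = (\<Sum>b\<in>B. (b \<bullet> x) *\<^sub>R (S *v b))"
      using B(2) Rb l0 by (auto intro!: sum.cong simp: matrix_vector_mul_assoc[symmetric] matrix_vector_mult_scaleR)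
    also have "\<dots> = S *v x" by (rule lin[symmetric])
    finally show "(R ** R) *v x = S *v x" .
  qed
  moreover have "R \<in> psd"
    unfolding psd_def
  proof safe
    show "transpose R = R" unfolding R_def by (simp add: transpose_sum transpose_scaleR)
    fix x show "0 \<le> x \<bullet> (R *v x)"
      unfolding Rx inner_sum_right
      using l0 by (auto intro!: sum_nonneg simp: inner_commute mult.assoc)
  qed
  ultimately show ?thesis by blast
qed

text \<open>For a symmetric root R of \<open>S\<close> the form at v is |R v|^2, so R v and then S v
  = R (R v) vanish.\<close>

lemma psd_quad_zero:
  fixes S :: "real^'n^'n"
  assumes S: "S \<in> psd" and "v \<bullet> (S *v v) = 0"
  shows "S *v v = 0"
proof -
  obtain R where R: "R \<in> psd" "R ** R = S" using psd_sqrt_exists[OF S] by blast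
  have "(R *v v) \<bullet> (R *v v) = v \<bullet> (S *v v)"
    using R by (metis matrix_vector_mul_assoc psdD(1) sym_inner)
  then have "R *v v = 0" using assms(2) by simp
  then show ?thesis using R(2) by (metis matrix_vector_mul_assoc matrix_vector_mult_0_right)
qed

text \<open>The difference of two roots is symmetric, so it is enough to show that it annihilates
  each of its eigenvectors.\<close>

lemma psd_sqrt_unique:
  fixes R Q :: "real^'n^'n"
  assumes R: "R \<in> psd" and Q: "Q \<in> psd" and eq: "R ** R = Q ** Q"
  shows "R = Q"
proof -
  let ?D = "R - Q"
  have D: "transpose ?D = ?D" using R Q by (simp add: transpose_sub psdD)
  obtain B l where B: "finite B" "\<And>b. b \<in> B \<Longrightarrow> ?D *v b = l b *\<^sub>R b \<and> norm b = 1"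
    "\<And>x. x = (\<Sum>b\<in>B. (b \<bullet> x) *\<^sub>R b)"
    using sym_eigenbasis[OF D] by blast
  have z: "?D *v b = 0" if b: "b \<in> B" for b
  proof (cases "l b = 0")
    case True then show ?thesis using B(2)[OF b] by simp
  next
    case False
    have *: "R *v b = Q *v b + l b *\<^sub>R b" using B(2)[OF b]
      by (simp add: matrix_vector_mult_diff_rdistrib algebra_simps)
    have "(R *v b) \<bullet> (R *v b) = b \<bullet> ((R ** R) *v b)"
      using sym_inner[OF psdD(1)[OF R]] by (simp add: matrix_vector_mul_assoc[symmetric])
    also have "\<dots> = (Q *v b) \<bullet> (Q *v b)"
      unfolding eq using sym_inner[OF psdD(1)[OF Q]] by (simp add: matrix_vector_mul_assoc[symmetric])
    finally have "(R *v b) \<bullet> (R *v b) = (Q *v b) \<bullet> (Q *v b)" .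
    \<comment> \<open>|R b|^2 - |Q b|^2 is the inner product of R b - Q b with R b + Q b, and the
      first factor is \<open>l b\<close> times b. Both forms are nonnegative, so each
      vanishes.\<close>
    then have "l b * (b \<bullet> (R *v b) + b \<bullet> (Q *v b)) = 0"
      unfolding * by (simp add: inner_add inner_commute algebra_simps)
    then have "b \<bullet> (R *v b) = 0" "b \<bullet> (Q *v b) = 0"
      using False psdD(2)[OF R, of b] psdD(2)[OF Q, of b] by auto
    then have "R *v b = 0" "Q *v b = 0" using psd_quad_zero[OF R, of b] psd_quad_zero[OF Q, of b] by auto
    then show ?thesis by (simp add: matrix_vector_mult_diff_rdistrib)
  qed
  have "?D *v x = 0" for x
    by (subst B(3)[of x]) (simp add: linear_sum[OF matrix_vector_mul_linear] matrix_vector_mult_scaleR z)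
  then have "?D = 0" by (simp add: matrix_eq)
  then show ?thesis by simp
qed

lemma psd_sqrt:
  assumes "S \<in> psd"
  shows psd_sqrt_psd: "psd_sqrt S \<in> psd" and psd_sqrt_square: "psd_sqrt S ** psd_sqrt S = S"
proof -
  have "\<exists>!R. R \<in> psd \<and> R ** R = S"
    using psd_sqrt_exists[OF assms] psd_sqrt_unique by blast
  from theI'[OF this] show "psd_sqrt S \<in> psd" "psd_sqrt S ** psd_sqrt S = S"
    unfolding psd_sqrt_def by auto
qed

lemma psd_sqrt_eqI: "R \<in> psd \<Longrightarrow> R ** R = S \<Longrightarrow> psd_sqrt S = R"
  unfolding psd_sqrt_def using psd_sqrt_unique by blast

lemma outer_psd [simp]: "outer v \<in> psd"
  by (auto simp: psd_def outer_mult inner_commute)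

lemma psd_zero [simp]: "0 \<in> psd" by (auto simp: psd_def transpose_def vec_eq_iff)

lemma psd_add: "S \<in> psd \<Longrightarrow> S' \<in> psd \<Longrightarrow> S + S' \<in> psd"
  by (auto simp: psd_def transpose_add matrix_vector_mult_add_rdistrib inner_add_right)

lemma pd_add: "S \<in> pd \<Longrightarrow> S' \<in> psd \<Longrightarrow> S + S' \<in> pd"
  by (auto simp: psd_def pd_def transpose_add matrix_vector_mult_add_rdistrib inner_add_right intro: add_pos_nonneg)

lemma psd_sum: "(\<And>i. i \<in> I \<Longrightarrow> f i \<in> psd) \<Longrightarrow> (\<Sum>i\<in>I. f i) \<in> psd"
  by (induction I rule: infinite_finite_induct) (auto intro: psd_add)

lemma matrix_vector_transpose_inner: "x \<bullet> ((G :: real^'n^'n) *v y) = (transpose G *v x) \<bullet> y"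
  by (simp add: dot_lmul_matrix transpose_matrix_vector)

lemma psd_congruence:
  fixes G :: "real^'n^'n"
  assumes "S \<in> psd" shows "G ** S ** transpose G \<in> psd"
  using assms unfolding psd_def
  by (auto simp: matrix_transpose_mul matrix_mul_assoc matrix_vector_mul_assoc[symmetric] matrix_vector_transpose_inner[of _ G])

lemma outer_matrix: fixes G :: "real^'n^'n" shows "outer (G *v x) = G ** outer x ** transpose G"
proof (subst matrix_eq, safe)
  fix v
  have "x \<bullet> (transpose G *v v) = (G *v x) \<bullet> v"
    by (subst matrix_vector_transpose_inner) (simp only: transpose_transpose)
  then show "outer (G *v x) *v v = (G ** outer x ** transpose G) *v v"
    by (simp only: matrix_vector_mul_assoc[symmetric] outer_mult matrix_vector_mult_scaleR)
qed

section \<open>Continuity of matrix operations and closedness of the cone\<close>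

lemma continuous_matrix_mult [continuous_intros]:
  fixes f :: "'a::t2_space \<Rightarrow> real^'n^'n" and g :: "'a \<Rightarrow> real^'n^'n"
  assumes "continuous_on S f" "continuous_on S g"
  shows "continuous_on S (\<lambda>x. f x ** g x)"
  unfolding matrix_matrix_mult_def
  by (intro continuous_intros continuous_on_vec_lambda continuous_on_sum continuous_on_mult continuous_on_component assms)

lemma continuous_transpose [continuous_intros]:
  fixes f :: "'a::t2_space \<Rightarrow> real^'n^'n"
  assumes "continuous_on S f"
  shows "continuous_on S (\<lambda>x. transpose (f x))"
  unfolding transpose_def
  by (intro continuous_on_vec_lambda continuous_on_component assms)

lemma continuous_matrix_vector [continuous_intros]:
  fixes f :: "'a::t2_space \<Rightarrow> real^'n^'n" and g :: "'a \<Rightarrow> real^'n"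
  assumes "continuous_on S f" "continuous_on S g"
  shows "continuous_on S (\<lambda>x. f x *v g x)"
  unfolding matrix_vector_mult_def
  by (intro continuous_intros continuous_on_vec_lambda continuous_on_sum continuous_on_mult continuous_on_component assms)

lemma closed_psd: "closed (psd :: (real^'n^'n) set)"
proof -
  have "psd = {S :: real^'n^'n. transpose S = S} \<inter> (\<Inter>x. {S. 0 \<le> x \<bullet> (S *v x)})"
    by (auto simp: psd_def)
  moreover have "closed {S :: real^'n^'n. transpose S = S}"
    by (intro closed_Collect_eq continuous_intros)
  moreover have "closed {S :: real^'n^'n. 0 \<le> x \<bullet> (S *v x)}" for x
    by (intro closed_Collect_le continuous_intros)
  ultimately show ?thesis by (metis (no_types, lifting) closed_INT closed_Int)
qed

lemma psd_borel [measurable]: "psd \<in> sets borel"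
  by (rule borel_closed[OF closed_psd])

lemma convex_psd: "convex psd"
  unfolding convex_def psd_def
  by (auto simp: transpose_add transpose_scaleR matrix_vector_mult_add_rdistrib scaleR_matrix_vector inner_add_right)

section \<open>Estimates in the Frobenius norm\<close>

lemma norm_matrix_vector_le: "norm ((A :: real^'n^'m) *v x) \<le> norm A * norm x"
proof -
  have "norm (A *v x) \<le> L2_set (\<lambda>i. norm (A $ i) * norm x) UNIV"
    unfolding norm_vec_def[of "A *v x"]
  proof (rule L2_set_mono)
    fix i
    have "(A *v x) $ i = A $ i \<bullet> x" by (simp add: matrix_vector_mult_def inner_vec_def)
    then show "norm ((A *v x) $ i) \<le> norm (A $ i) * norm x"
      using Cauchy_Schwarz_ineq2[of "A $ i" x] by simp
  qed simp
  also have "\<dots> = norm A * norm x"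
    by (simp add: L2_set_left_distrib[symmetric] norm_vec_def[of A])
  finally show ?thesis .
qed

lemma norm_transpose [simp]: "norm (transpose (A :: real^'n^'n)) = norm A"
proof -
  have "(norm (transpose A))\<^sup>2 = (norm A)\<^sup>2"
    unfolding dot_square_norm[symmetric] inner_vec_def by (subst sum.swap) (simp add: transpose_def)
  then show ?thesis by simp
qed

lemma norm_matrix_mult_le: "norm ((A :: real^'n^'n) ** (B :: real^'n^'n)) \<le> norm A * norm B"
proof -
  have "norm (A ** B) \<le> L2_set (\<lambda>i. norm (A $ i) * norm B) UNIV"
    unfolding norm_vec_def[of "A ** B"]
  proof (rule L2_set_mono)
    fix i
    have "(A ** B) $ i = transpose B *v (A $ i)"
      by (auto simp: matrix_matrix_mult_def matrix_vector_mult_def transpose_def vec_eq_iff mult_ac)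
    then show "norm ((A ** B) $ i) \<le> norm (A $ i) * norm B"
      using norm_matrix_vector_le[of "transpose B" "A $ i"] norm_transpose[of B] by (simp add: mult_ac)
  qed simp
  also have "\<dots> = norm A * norm B"
    by (simp add: L2_set_left_distrib[symmetric] norm_vec_def[of A])
  finally show ?thesis .
qed

lemma quad_norm_bound: "\<bar>x \<bullet> ((S :: real^'n^'n) *v x)\<bar> \<le> norm S * (norm x)\<^sup>2"
proof -
  have "norm (S *v x) \<le> norm S * norm x"
    by (rule norm_matrix_vector_le)
  then have "norm x * norm (S *v x) \<le> norm x * (norm S * norm x)" by (intro mult_left_mono) auto
  then show ?thesis using Cauchy_Schwarz_ineq2[of x "S *v x"] by (simp add: power2_eq_square mult_ac)
qed

section \<open>Measurability of the square root and bounds for positive definite matrices\<close>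

lemma psd_mult_self: "R \<in> psd \<Longrightarrow> R ** R \<in> psd"
proof -
  assume R: "R \<in> psd"
  have "mat 1 \<in> psd" by (simp add: psd_def)
  from psd_congruence[OF this, of R] show "R ** R \<in> psd"
    using psdD(1)[OF R] by simp
qed

text \<open>Squaring is continuous and injective on a compact set of psd matrices, so its inverse is
  continuous on the compact image.\<close>

lemma continuous_on_sqrt_ball:
  fixes n :: nat
  defines "K \<equiv> psd \<inter> cball 0 (real n) :: (real^'n^'n) set"
  shows "compact ((\<lambda>R. R ** R) ` K)" "continuous_on ((\<lambda>R. R ** R) ` K) psd_sqrt"
proof -
  have K: "compact K" unfolding K_def using closed_psd by (auto intro: closed_Int_compact)
  have c: "continuous_on K (\<lambda>R. R ** R)" by (intro continuous_intros)
  show "compact ((\<lambda>R. R ** R) ` K)" using compact_continuous_image[OF c K] .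
  show "continuous_on ((\<lambda>R. R ** R) ` K) psd_sqrt"
    by (rule continuous_on_inv[OF c K]) (auto simp: K_def intro: psd_sqrt_eqI)
qed

text \<open>\<open>psd_sqrt\<close> is unspecified outside \<open>psd\<close>; with a value fixed there the square root is Borel.\<close>

definition msqrt :: "real^'n^'n \<Rightarrow> real^'n^'n" where
  "msqrt S = (if S \<in> psd then psd_sqrt S else 0)"

lemma msqrt_psd [simp]: "msqrt S \<in> psd"
  by (simp add: msqrt_def psd_sqrt_psd)

lemma msqrt_square: "S \<in> psd \<Longrightarrow> msqrt S ** msqrt S = S"
  by (simp add: msqrt_def psd_sqrt_square)

text \<open>The squares of the psd matrices in balls of integer radius are compact sets that cover
  \<open>psd\<close>, and the root is continuous on each. Together with the complement of
  \<open>psd\<close> they form a countable Borel cover.\<close>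

lemma msqrt_measurable [measurable]: "(msqrt :: real^'n^'n \<Rightarrow> _) \<in> borel_measurable borel"
proof -
  define Q where "Q n = (\<lambda>R. R ** R) ` (psd \<inter> cball 0 (real n) :: (real^'n^'n) set)" for n
  have Qpsd: "Q n \<subseteq> psd" for n
    unfolding Q_def using psd_mult_self by auto
  show ?thesis
  proof (rule measurable_piecewise_restrict[where C = "insert (- psd) (range Q)"])
    show "countable (insert (- psd) (range Q))" by simp
    show "O' \<inter> space borel \<in> sets borel" if "O' \<in> insert (- psd) (range Q)" for O'
      using that continuous_on_sqrt_ball(1) closed_psd unfolding Q_def
      by (auto intro: borel_compact borel_comp)
    show "space borel \<subseteq> \<Union> (insert (- psd) (range Q))"
    proof
      fix S :: "real^'n^'n"
      show "S \<in> \<Union> (insert (- psd) (range Q))"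
      proof (cases "S \<in> psd")
        case True
        obtain n where "norm (psd_sqrt S) \<le> real n" using real_arch_simple by blast
        then have "S \<in> Q n" unfolding Q_def
          using psd_sqrt_psd[OF True] psd_sqrt_square[OF True] by (auto intro!: image_eqI[of _ _ "psd_sqrt S"])
        then show ?thesis by auto
      qed auto
    qed
    show "msqrt \<in> borel_measurable (restrict_space borel O')" if mem: "O' \<in> insert (- psd) (range Q)" for O'
    proof (cases "O' = - psd")
      case True
      have "msqrt \<in> borel_measurable (restrict_space borel O') \<longleftrightarrow> (\<lambda>_. 0 :: real^'n^'n) \<in> borel_measurable (restrict_space borel O')"
        by (rule measurable_cong) (auto simp: True msqrt_def space_restrict_space)
      then show ?thesis by simp
    next
      case False
      then obtain n where n: "O' = Q n" using mem by blast
      have "continuous_on (Q n) psd_sqrt" using continuous_on_sqrt_ball(2) unfolding Q_def .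
      then have "continuous_on (Q n) msqrt"
        by (rule continuous_on_eq) (use Qpsd in \<open>auto simp: msqrt_def\<close>)
      then show ?thesis unfolding n by (rule borel_measurable_continuous_on_restrict)
    qed
  qed
qed

text \<open>The constant is the minimum of the form on the compact unit sphere.\<close>

lemma pd_lower_bound:
  fixes S :: "real^'n^'n"
  assumes "S \<in> pd"
  shows "\<exists>c>0. \<forall>x. c * (norm x)\<^sup>2 \<le> x \<bullet> (S *v x)"
proof -
  have "continuous_on (sphere 0 1 :: (real^'n) set) (\<lambda>x. x \<bullet> (S *v x))"
    by (intro continuous_intros)
  moreover have "(sphere 0 1 :: (real^'n) set) \<noteq> {}" by simp
  ultimately obtain v :: "real^'n" where v: "norm v = 1" "\<And>y. norm y = 1 \<Longrightarrow> v \<bullet> (S *v v) \<le> y \<bullet> (S *v y)"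
    using continuous_attains_inf[of "sphere 0 1 :: (real^'n) set" "\<lambda>x. x \<bullet> (S *v x)"] by (auto simp: dist_norm)
  let ?c = "v \<bullet> (S *v v)"
  have "?c > 0" using assms v(1) unfolding pd_def by (auto, metis norm_zero zero_neq_one)
  moreover have "?c * (norm x)\<^sup>2 \<le> x \<bullet> (S *v x)" for x
  proof (cases "x = 0")
    case False
    then have "?c \<le> (x /\<^sub>R norm x) \<bullet> (S *v (x /\<^sub>R norm x))" by (intro v(2)) simp
    also have "\<dots> = (x \<bullet> (S *v x)) / (norm x)\<^sup>2"
      by (simp add: matrix_vector_mult_scaleR field_simps power2_eq_square)
    finally show ?thesis using False by (simp add: field_simps)
  qed simp
  ultimately show ?thesis by blast
qed

lemma pd_invertible:
  fixes S :: "real^'n^'n"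
  assumes "S \<in> pd" shows "invertible S"
proof -
  have "\<forall>x. S *v x = 0 \<longrightarrow> x = 0" using assms unfolding pd_def by (metis (mono_tags, lifting) inner_zero_right less_irrefl mem_Collect_eq)
  then show ?thesis by (simp add: matrix_left_invertible_ker invertible_left_inverse)
qed

lemma invertible_mult_left_inverse: "invertible (S :: real^'n^'n) \<Longrightarrow> matrix_inv S ** S = mat 1"
  and invertible_mult_right_inverse: "invertible (S :: real^'n^'n) \<Longrightarrow> S ** matrix_inv S = mat 1"
  using someI_ex[of "\<lambda>A'. S ** A' = mat 1 \<and> A' ** S = mat 1"]
  unfolding invertible_def matrix_inv_def by auto

lemma msqrt_pd:
  fixes S :: "real^'n^'n"
  assumes "S \<in> pd" shows "msqrt S \<in> pd" "invertible (msqrt S)"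
proof -
  let ?R = "msqrt S"
  have RR: "?R ** ?R = S" using assms by (simp add: msqrt_square pd_psd)
  have "0 < x \<bullet> (?R *v x)" if "x \<noteq> 0" for x
  proof -
    have "0 \<le> x \<bullet> (?R *v x)" using psdD(2)[OF msqrt_psd] .
    moreover have "x \<bullet> (?R *v x) \<noteq> 0"
    proof
      assume "x \<bullet> (?R *v x) = 0"
      then have "?R *v x = 0" by (rule psd_quad_zero[OF msqrt_psd])
      then have "S *v x = 0" using RR by (metis matrix_vector_mul_assoc matrix_vector_mult_0_right)
      then show False using assms that unfolding pd_def by force
    qed
    ultimately show ?thesis by simp
  qed
  then show "?R \<in> pd" using psdD(1)[OF msqrt_psd] by (auto simp: pd_def)
  then show "invertible ?R" by (rule pd_invertible)
qed

lemma norm_msqrt_mult: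
  assumes "S \<in> psd"
  shows "(norm (msqrt S *v x))\<^sup>2 = x \<bullet> (S *v x)"
  using sym_inner[OF psdD(1)[OF msqrt_psd], of S x "msqrt S *v x"] msqrt_square[OF assms]
  by (simp add: dot_square_norm matrix_vector_mul_assoc)

section \<open>Measurability of matrix operations\<close>

lemma borel_measurable_vecI:
  fixes f :: "'a \<Rightarrow> 'b::euclidean_space^'n"
  assumes "\<And>i. (\<lambda>x. f x $ i) \<in> borel_measurable M"
  shows "f \<in> borel_measurable M"
  unfolding borel_measurable_euclidean_space[of f]
  using assms by (auto simp: Basis_vec_def inner_axis)

lemma borel_measurable_vec_nth' [measurable (raw)]:
  fixes f :: "'a \<Rightarrow> 'b::euclidean_space^'n"
  assumes "f \<in> borel_measurable M"
  shows "(\<lambda>x. f x $ i) \<in> borel_measurable M"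
  by (rule measurable_compose[OF assms]) (intro borel_measurable_continuous_onI continuous_intros continuous_on_component)

lemma borel_measurable_mmult [measurable (raw)]:
  fixes f g :: "'a \<Rightarrow> real^'n^'n"
  assumes [measurable]: "f \<in> borel_measurable M" "g \<in> borel_measurable M"
  shows "(\<lambda>x. f x ** g x) \<in> borel_measurable M"
  by (intro borel_measurable_vecI) (simp add: matrix_matrix_mult_def)

lemma borel_measurable_mvmult [measurable (raw)]:
  fixes f :: "'a \<Rightarrow> real^'n^'n"
  assumes [measurable]: "f \<in> borel_measurable M" "g \<in> borel_measurable M"
  shows "(\<lambda>x. f x *v g x) \<in> borel_measurable M"
  by (intro borel_measurable_vecI) (simp add: matrix_vector_mult_def)

lemma borel_measurable_transpose [measurable (raw)]:
  fixes f :: "'a \<Rightarrow> real^'n^'n"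
  assumes [measurable]: "f \<in> borel_measurable M"
  shows "(\<lambda>x. transpose (f x)) \<in> borel_measurable M"
  by (intro borel_measurable_vecI) (simp add: transpose_def)

lemma borel_measurable_outer [measurable (raw)]:
  assumes [measurable]: "f \<in> borel_measurable M"
  shows "(\<lambda>x. outer (f x)) \<in> borel_measurable M"
  by (intro borel_measurable_vecI) (simp add: outer_def)

lemma borel_measurable_det [measurable (raw)]:
  fixes f :: "'a \<Rightarrow> real^'n^'n"
  assumes [measurable]: "f \<in> borel_measurable M"
  shows "(\<lambda>x. det (f x)) \<in> borel_measurable M"
  unfolding det_def by measurable

text \<open>Cramer's rule expresses the inverse through determinants. For a singular matrix
  \<open>matrix_inv\<close> chooses from an empty predicate, so its value is the same for all
  singular matrices and this piece is constant.\<close>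

lemma borel_measurable_matrix_inv [measurable (raw)]:
  fixes f :: "'a \<Rightarrow> real^'n^'n"
  assumes [measurable]: "f \<in> borel_measurable M"
  shows "(\<lambda>x. matrix_inv (f x)) \<in> borel_measurable M"
proof -
  define g :: "real^'n^'n \<Rightarrow> real^'n^'n" where
    "g S = (if det S = 0 then matrix_inv S else (\<chi> k l. det (\<chi> i j. if j = k then (axis l 1 :: real^'n) $ i else S $ i $ j) / det S))" for S
  have inv_g: "matrix_inv S = g S" for S
  proof (cases "det S = 0")
    case False
    have "(matrix_inv S *v axis l 1) = (\<chi> k. det (\<chi> i j. if j = k then (axis l 1 :: real^'n) $ i else S $ i $ j) / det S)" for l
      using invertible_mult_right_inverse[of S] False
      by (subst cramer[symmetric, OF False]) (simp add: invertible_det_nz matrix_vector_mul_assoc)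
    moreover have "matrix_inv S $ k $ l = (matrix_inv S *v axis l 1) $ k" for k l
      by (simp add: matrix_vector_mult_basis column_def)
    ultimately show ?thesis using False by (simp add: g_def vec_eq_iff)
  qed (simp add: g_def)
  have inv_0: "matrix_inv S = (SOME A'. False)" if "det S = 0" for S :: "real^'n^'n"
    using that invertible_det_nz[of S] unfolding matrix_inv_def invertible_def by (simp add: ) meson
  have eq: "matrix_inv = (\<lambda>S. if det S = 0 then (SOME A'. False) else (\<chi> k l. det (\<chi> i j. if j = k then (axis l 1 :: real^'n) $ i else S $ i $ j) / det S))"
  proof
    fix S :: "real^'n^'n"
    show "matrix_inv S = (if det S = 0 then (SOME A'. False) else (\<chi> k l. det (\<chi> i j. if j = k then (axis l 1 :: real^'n) $ i else S $ i $ j) / det S))"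
      using inv_g[of S] inv_0[of S] unfolding g_def by (cases "det S = 0") auto
  qed
  have "(\<lambda>x. (\<chi> k l. det (\<chi> i j. if j = k then (axis l 1 :: real^'n) $ i else f x $ i $ j) / det (f x)) :: real^'n^'n) \<in> borel_measurable M"
    (is "?h \<in> _")
  proof (intro borel_measurable_vecI)
    fix k l
    have "(\<lambda>x. (\<chi> i j. if j = k then (axis l 1 :: real^'n) $ i else f x $ i $ j)) \<in> borel_measurable M"
      by (intro borel_measurable_vecI) simp
    then show "(\<lambda>x. ?h x $ k $ l) \<in> borel_measurable M" by simp
  qed
  then show ?thesis unfolding eq by (intro measurable_If) auto
qed

section \<open>The matrix exponential\<close>

primrec mpow :: "real^'n^'n \<Rightarrow> nat \<Rightarrow> real^'n^'n" where
  "mpow B 0 = mat 1"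
| "mpow B (Suc k) = B ** mpow B k"

lemma mpow_commute: "mpow B k ** B = B ** mpow B k"
  by (induction k) (auto simp: matrix_mul_assoc[symmetric])

lemma mpow_bound: fixes B :: "real^'n^'n" shows "\<bar>mpow B k $ i $ j\<bar> \<le> norm (mat 1 :: real^'n^'n) * norm (B :: real^'n^'n) ^ k"
proof -
  have "norm (mpow B k) \<le> norm (mat 1 :: real^'n^'n) * norm B ^ k"
  proof (induction k)
    case (Suc k)
    have "norm (mpow B (Suc k)) \<le> norm B * norm (mpow B k)" by (simp add: norm_matrix_mult_le)
    also have "\<dots> \<le> norm B * (norm (mat 1 :: real^'n^'n) * norm B ^ k)" by (intro mult_left_mono Suc) auto
    finally show ?case by (simp add: mult_ac)
  qed simp
  moreover have "\<bar>mpow B k $ i $ j\<bar> \<le> norm (mpow B k)"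
    using component_le_norm_cart[of "mpow B k $ i" j] Finite_Cartesian_Product.norm_nth_le[of "mpow B k" i] by linarith
  ultimately show ?thesis by linarith
qed

text \<open>The series of exp(t B), taken entrywise so that real power series in t can be summed and
  differentiated.\<close>

definition mexp :: "real^'n^'n \<Rightarrow> real \<Rightarrow> real^'n^'n" where
  "mexp B t = (\<chi> i j. \<Sum>k. mpow B k $ i $ j / fact k * t ^ k)"

lemma mexp_summable: fixes B :: "real^'n^'n" shows "summable (\<lambda>k. mpow B k $ i $ j / fact k * t ^ k)"
proof (rule summable_comparison_test)
  let ?c = "norm (mat 1 :: real^'n^'n)"
  let ?g = "\<lambda>k. ?c * (inverse (fact k) * (norm B * \<bar>t\<bar>) ^ k)"
  show "\<exists>N. \<forall>k\<ge>N. norm (mpow B k $ i $ j / fact k * t ^ k) \<le> ?c * (inverse (fact k) * (norm B * \<bar>t\<bar>) ^ k)"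
  proof (intro exI allI impI)
    fix k
    have "norm (mpow B k $ i $ j / fact k * t ^ k) = \<bar>mpow B k $ i $ j\<bar> * (\<bar>t\<bar> ^ k / fact k)"
      by (simp add: abs_mult power_abs)
    also have "\<dots> \<le> (?c * norm B ^ k) * (\<bar>t\<bar> ^ k / fact k)"
      by (intro mult_right_mono mpow_bound) auto
    finally show "norm (mpow B k $ i $ j / fact k * t ^ k) \<le> ?c * (inverse (fact k) * (norm B * \<bar>t\<bar>) ^ k)"
      by (simp add: power_mult_distrib field_simps)
  qed
  show "summable (\<lambda>k. ?c * (inverse (fact k) * (norm B * \<bar>t\<bar>) ^ k))"
    by (intro summable_mult summable_exp)
qed

lemma mexp_sum_mult:
  "(\<Sum>l\<in>UNIV. c l * (\<Sum>k. mpow B k $ l $ j / fact k * t ^ k)) = (\<Sum>k. \<Sum>l\<in>UNIV. c l * (mpow B k $ l $ j / fact k * t ^ k))"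
proof -
  have "(\<Sum>l\<in>UNIV. c l * (\<Sum>k. mpow B k $ l $ j / fact k * t ^ k)) = (\<Sum>l\<in>UNIV. \<Sum>k. c l * (mpow B k $ l $ j / fact k * t ^ k))"
    by (intro sum.cong refl suminf_mult[symmetric] mexp_summable)
  also have "\<dots> = (\<Sum>k. \<Sum>l\<in>UNIV. c l * (mpow B k $ l $ j / fact k * t ^ k))"
    by (rule suminf_sum[symmetric]) (intro summable_mult mexp_summable)
  finally show ?thesis .
qed

lemma mexp_0 [simp]: "mexp B 0 = mat 1"
proof -
  have "(\<Sum>k. mpow B k $ i $ j / fact k * 0 ^ k) = mpow B 0 $ i $ j" for i j
    using powser_zero[of "\<lambda>k. mpow B k $ i $ j / fact k"] by simp
  then show ?thesis by (simp add: mexp_def vec_eq_iff)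
qed

lemma mexp_entry_deriv: "((\<lambda>t. mexp B t $ i $ j) has_real_derivative (B ** mexp B t) $ i $ j) (at t)"
proof -
  let ?c = "\<lambda>i j k. mpow B k $ i $ j / fact k"
  have "((\<lambda>t. \<Sum>k. ?c i j k * t ^ k) has_real_derivative (\<Sum>k. diffs (?c i j) k * t ^ k)) (at t)"
    by (rule termdiffs_strong_converges_everywhere) (rule mexp_summable)
  moreover have "diffs (?c i j) k = (\<Sum>l\<in>UNIV. B $ i $ l * ?c l j k)" for k
    by (simp add: diffs_def matrix_matrix_mult_def sum_divide_distrib sum_distrib_left field_simps del: of_nat_Suc)
  moreover have "(\<Sum>k. (\<Sum>l\<in>UNIV. B $ i $ l * ?c l j k) * t ^ k) = (\<Sum>l\<in>UNIV. B $ i $ l * (\<Sum>k. ?c l j k * t ^ k))"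
    by (simp only: mexp_sum_mult) (simp add: sum_distrib_right sum_distrib_left mult_ac)
  ultimately show ?thesis by (simp add: mexp_def matrix_matrix_mult_def)
qed

lemma has_vector_derivative_vecI:
  fixes f :: "real \<Rightarrow> 'b::euclidean_space^'n"
  assumes "\<And>i. ((\<lambda>t. f t $ i) has_vector_derivative d $ i) (at t within S)"
  shows "(f has_vector_derivative d) (at t within S)"
  unfolding has_vector_derivative_def
proof (subst has_derivative_componentwise_within, safe)
  fix b :: "'b^'n" assume "b \<in> Basis"
  then obtain i u where b: "b = axis i u" unfolding Basis_vec_def by auto
  have "((\<lambda>t. f t $ i \<bullet> u) has_vector_derivative d $ i \<bullet> u) (at t within S)"
    using bounded_linear.has_vector_derivative[OF bounded_linear_inner_left assms] .
  then show "((\<lambda>x. f x \<bullet> b) has_derivative (\<lambda>x. x *\<^sub>R d \<bullet> b)) (at t within S)"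
    unfolding b by (simp add: inner_axis has_vector_derivative_def)
qed

lemma mexp_deriv: "(mexp B has_vector_derivative B ** mexp B t) (at t within S)"
  by (intro has_vector_derivative_vecI)
     (metis mexp_entry_deriv has_real_derivative_iff_has_vector_derivative has_vector_derivative_at_within)

lemma bounded_bilinear_mmult: "bounded_bilinear ((**) :: real^'n^'n \<Rightarrow> real^'n^'n \<Rightarrow> real^'n^'n)"
proof
  show "\<exists>K. \<forall>(a :: real^'n^'n) (b :: real^'n^'n). norm (a ** b) \<le> norm a * norm b * K"
    by (intro exI[of _ 1]) (simp add: norm_matrix_mult_le)
qed (auto simp: matrix_matrix_mult_def vec_eq_iff sum_distrib_left sum.distrib algebra_simps)

lemma bounded_linear_mmult_left: "bounded_linear (\<lambda>X :: real^'n^'n. (B :: real^'n^'n) ** X)"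
  by (rule bounded_bilinear.bounded_linear_right[OF bounded_bilinear_mmult])

lemma has_vector_derivative_mmult:
  fixes f g :: "real \<Rightarrow> real^'n^'n"
  assumes "(f has_vector_derivative f') (at t within S)" "(g has_vector_derivative g') (at t within S)"
  shows "((\<lambda>t. f t ** g t) has_vector_derivative (f t ** g' + f' ** g t)) (at t within S)"
  by (rule bounded_bilinear.has_vector_derivative[OF bounded_bilinear_mmult assms])

lemma mexp_commute: "mexp B t ** B = B ** mexp B t"
proof -
  have "(\<Sum>l\<in>UNIV. (\<Sum>k. mpow B k $ i $ l / fact k * t ^ k) * B $ l $ j) = (\<Sum>k. (\<Sum>l\<in>UNIV. mpow B k $ i $ l * B $ l $ j) / fact k * t ^ k)" for i j
  proof -
    have "(\<Sum>l\<in>UNIV. (\<Sum>k. mpow B k $ i $ l / fact k * t ^ k) * B $ l $ j) = (\<Sum>l\<in>UNIV. \<Sum>k. mpow B k $ i $ l / fact k * t ^ k * B $ l $ j)"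
      by (intro sum.cong refl suminf_mult2 mexp_summable)
    also have "\<dots> = (\<Sum>k. \<Sum>l\<in>UNIV. mpow B k $ i $ l / fact k * t ^ k * B $ l $ j)"
      by (rule suminf_sum[symmetric]) (intro summable_mult2 mexp_summable)
    finally show ?thesis by (simp add: sum_divide_distrib sum_distrib_right sum_distrib_left mult_ac)
  qed
  moreover have "(\<Sum>l\<in>UNIV. B $ i $ l * (\<Sum>k. mpow B k $ l $ j / fact k * t ^ k)) = (\<Sum>k. (\<Sum>l\<in>UNIV. B $ i $ l * mpow B k $ l $ j) / fact k * t ^ k)" for i j
    unfolding mexp_sum_mult
    by (rule suminf_cong) (auto simp: sum_divide_distrib sum_distrib_right sum_distrib_left intro!: sum.cong)
  moreover have "(\<Sum>l\<in>UNIV. mpow B k $ i $ l * B $ l $ j) = (\<Sum>l\<in>UNIV. B $ i $ l * mpow B k $ l $ j)" for i j k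
    using arg_cong[OF mpow_commute, of "\<lambda>M. M $ i $ j" B k] by (simp add: matrix_matrix_mult_def)
  ultimately show ?thesis
    by (simp add: mexp_def matrix_matrix_mult_def vec_eq_iff)
qed

lemma mexp_minus_deriv: "((\<lambda>t. mexp B (c - t)) has_vector_derivative - (B ** mexp B (c - t))) (at t within S)"
proof -
  have "((\<lambda>t. c - t) has_vector_derivative -1) (at t within S)"
    by (auto intro!: derivative_eq_intros)
  then have "((mexp B \<circ> (\<lambda>t. c - t)) has_vector_derivative (-1) *\<^sub>R (B ** mexp B (c - t))) (at t within S)"
    by (rule vector_diff_chain_within) (rule mexp_deriv)
  then show ?thesis by (simp add: o_def)
qed

lemma matrix_mul_minus: "(- A) ** B = - (A ** (B :: real^'n^'n))" "A ** (- B) = - (A ** (B :: real^'n^'n))"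
  by (auto simp: matrix_matrix_mult_def vec_eq_iff sum_negf)

text \<open>The product of exp((s + t - u) B) and exp(u B) has derivative 0 in u; compare u = 0 with
  u = t.\<close>

lemma mexp_add: "mexp B (s + t) = mexp B s ** mexp B t"
proof -
  let ?f = "\<lambda>u. mexp B (s + t - u) ** mexp B u"
  obtain c where "\<And>u. u \<in> UNIV \<Longrightarrow> ?f u = c"
  proof (rule has_vector_derivative_zero_constant[of UNIV ?f])
    fix u :: real
    show "(?f has_vector_derivative 0) (at u within UNIV)"
      by (rule has_vector_derivative_eq_rhs[OF has_vector_derivative_mmult[OF mexp_minus_deriv mexp_deriv]])
         (simp add: matrix_mul_assoc mexp_commute matrix_mul_minus)
  qed (auto intro: that)
  from this[of 0] this[of t] show ?thesis by simp
qed

lemma mexp_inverse: "mexp B t ** mexp B (- t) = mat 1" "mexp B (- t) ** mexp B t = mat 1"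
  using mexp_add[of B t "-t"] mexp_add[of B "-t" t] by auto

lemma mexp_invertible: "invertible (mexp B t)"
  using mexp_inverse unfolding invertible_def by blast

lemma continuous_on_mexp [continuous_intros]:
  assumes "continuous_on S f" shows "continuous_on S (\<lambda>x. mexp B (f x))"
proof -
  have "continuous_on UNIV (mexp B)"
    by (intro continuous_at_imp_continuous_on ballI has_vector_derivative_continuous[OF mexp_deriv])
  then show ?thesis using continuous_on_compose2[OF _ assms] by blast
qed

lemma borel_measurable_mexp [measurable (raw)]:
  assumes "f \<in> borel_measurable M" shows "(\<lambda>x. mexp B (f x)) \<in> borel_measurable M"
  by (rule measurable_compose[OF assms]) (intro borel_measurable_continuous_onI continuous_intros)

section \<open>Stability of the matrix exponential\<close>

text \<open>Stability is proved by induction on the degree of a polynomial \<open>p\<close> annihilating a vector \<open>w\<close>: a root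
  of \<open>p\<close> which is not an eigenvalue can be cancelled, and for an eigenvalue variation of constants
  reduces the decay of \<open>e\<^sup>t\<^sup>B w\<close> to that of \<open>e\<^sup>t\<^sup>B (B - \<mu>) w\<close>.\<close>

definition pact :: "complex^'n^'n \<Rightarrow> complex^'n \<Rightarrow> complex poly \<Rightarrow> complex^'n" where
  "pact B w p = fold_coeffs (\<lambda>a r. a *s w + B *v r) p 0"

lemma pact_0 [simp]: "pact B w 0 = 0"
  by (simp add: pact_def)

lemma pact_pCons: "pact B w (pCons a p) = a *s w + B *v pact B w p"
  by (cases "p = 0 \<and> a = 0") (auto simp: pact_def)

lemma pact_add: "pact B w (p + q) = pact B w p + pact B w q"
  by (induction p q rule: poly_induct2)
     (simp_all add: pact_pCons matrix_vector_right_distrib vec.scale_left_distrib algebra_simps)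

lemma mv_smult: "(B :: complex^'n^'n) *v (c *s w) = c *s (B *v w)"
  by (auto simp: matrix_vector_mult_def vec_eq_iff sum_distrib_left mult_ac)

lemma pact_smult: "pact B w (smult c p) = c *s pact B w p"
  by (induction p) (simp_all add: pact_pCons mv_smult vector_add_ldistrib)

lemma pact_apply: "pact B (B *v w) p = B *v pact B w p"
  by (induction p) (simp_all add: pact_pCons mv_smult matrix_vector_right_distrib)

lemma pact_vec_add: "pact B (v + w) p = pact B v p + pact B w p"
  by (induction p) (simp_all add: pact_pCons matrix_vector_right_distrib vector_add_ldistrib)

lemma pact_vec_smult: "pact B (c *s w) p = c *s pact B w p"
  by (induction p) (simp_all add: pact_pCons mv_smult vector_add_ldistrib vector_smult_assoc mult.commute)

text \<open>\<open>pact B w p\<close> is p(B) w, evaluated by Horner's scheme. Splitting off the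
  factor x - m moves B - m from the polynomial to the vector, which drives the induction on the
  degree.\<close>

lemma pact_root: "pact B w ([:-m, 1:] * q) = pact B (B *v w + (- m) *s w) q"
proof -
  have "[:-m, 1:] * q = smult (- m) q + pCons 0 q" by simp
  then show ?thesis by (simp only: pact_add pact_smult pact_pCons pact_vec_add pact_vec_smult pact_apply) (simp add: vec_eq_iff)
qed

lemma pact_monom: "pact B w (monom c i) = c *s (((*v) B ^^ i) w)"
  by (induction i) (simp_all add: monom_0 monom_Suc pact_pCons mv_smult)

lemma pact_sum: "pact B w (\<Sum>i\<in>I. f i) = (\<Sum>i\<in>I. pact B w (f i))"
  by (induction I rule: infinite_finite_induct) (simp_all add: pact_add)

text \<open>The vectors w, B w, B^2 w, ... up to exponent N are N + 1 vectors in a space of real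
  dimension N. Linear dependence is a property of sets, so a coincidence of two of them is treated
  apart.\<close>

lemma exists_annihilating_poly:
  fixes w :: "complex^'n"
  shows "\<exists>p. p \<noteq> 0 \<and> pact B w p = 0"
proof -
  define f where "f i = ((*v) B ^^ i) w" for i
  let ?N = "DIM(complex^'n)"
  show ?thesis
  proof (cases "inj_on f {..?N}")
    case False
    then obtain i j where ij: "i \<noteq> j" "f i = f j" unfolding inj_on_def by auto
    let ?p = "monom 1 i + monom (-1) j :: complex poly"
    have "coeff ?p i \<noteq> 0" using ij by simp
    then have "?p \<noteq> 0" by (metis coeff_0)
    moreover have "pact B w ?p = 0" using ij by (simp add: pact_add pact_monom f_def)
    ultimately show ?thesis by blast
  next
    case True
    then have "card (f ` {..?N}) = Suc ?N" by (simp add: card_image)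
    then have "dependent (f ` {..?N})"
      using independent_bound[of "f ` {..?N}"] by (metis Suc_n_not_le_n)
    then obtain u i where u: "i \<le> ?N" "u (f i) \<noteq> 0" "(\<Sum>v\<in>f ` {..?N}. u v *\<^sub>R v) = 0"
      by (auto simp: dependent_finite)
    let ?p = "\<Sum>i\<le>?N. monom (complex_of_real (u (f i))) i"
    have "coeff ?p i = (\<Sum>j\<le>?N. if j = i then complex_of_real (u (f i)) else 0)"
      unfolding coeff_sum by (intro sum.cong) auto
    then have "coeff ?p i \<noteq> 0" using u by simp
    then have "?p \<noteq> 0" by (metis coeff_0)
    moreover have "pact B w ?p = (\<Sum>i\<le>?N. u (f i) *\<^sub>R f i)"
      by (simp add: pact_sum pact_monom f_def vec_eq_iff) (simp add: scaleR_conv_of_real)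
    then have "pact B w ?p = 0" using u(3) sum.reindex[OF True, of "\<lambda>v. u v *\<^sub>R v"] by (simp add: o_def)
    ultimately show ?thesis by blast
  qed
qed

lemma norm_smult_vec: "norm (c *s (w :: complex^'n)) = cmod c * norm w"
  unfolding norm_vec_def by (simp add: norm_mult L2_set_right_distrib)

abbreviation cmat :: "real^'n^'n \<Rightarrow> complex^'n^'n" where
  "cmat \<equiv> map_matrix complex_of_real"

lemma cmat_mult: "cmat (A ** B) = cmat A ** cmat B"
  by (simp add: map_matrix_def matrix_matrix_mult_def vec_eq_iff)

lemma cmexp_deriv:
  "((\<lambda>t. cmat (mexp B t) *v w) has_vector_derivative cmat B *v (cmat (mexp B t) *v w)) (at t)"
proof (rule has_vector_derivative_vecI)
  fix i
  have "((\<lambda>t. \<Sum>j\<in>UNIV. complex_of_real (mexp B t $ i $ j) * w $ j) has_vector_derivative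
      (\<Sum>j\<in>UNIV. complex_of_real ((B ** mexp B t) $ i $ j) * w $ j)) (at t)"
    by (intro has_vector_derivative_sum has_vector_derivative_mult_left has_vector_derivative_of_real mexp_entry_deriv)
  then show "((\<lambda>t. (cmat (mexp B t) *v w) $ i) has_vector_derivative (cmat B *v (cmat (mexp B t) *v w)) $ i) (at t)"
    unfolding matrix_vector_mul_assoc cmat_mult[symmetric]
    by (simp add: matrix_vector_mult_def map_matrix_def)
qed

text \<open>The function z(t) = exp(-m t) exp(t B) w has derivative exp(-m t) exp(t B) u, where u =
  (B - m) w. Integrating the decay of exp(t B) u bounds z, and dividing by exp(-m t) gives the decay
  of exp(t B) w.\<close>

lemma variation_of_constants_decay:
  fixes w :: "complex^'n" and m :: complex and B :: "real^'n^'n"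
  defines "u \<equiv> cmat B *v w + (- m) *s w"
  assumes m: "Re m < 0" and a: "a > 0" and K: "\<And>t. t \<ge> 0 \<Longrightarrow> norm (cmat (mexp B t) *v u) \<le> K * exp (- a * t)"
  shows "\<exists>K a. a > 0 \<and> (\<forall>t\<ge>0. norm (cmat (mexp B t) *v w) \<le> K * exp (- a * t))"
proof -
  define b where "b = - Re m"
  \<comment> \<open>Strictly below \<open>b\<close>, so that the majorant K exp((b - c) t) has a
    positive exponent and its antiderivative is of the same form; the rate \<open>a\<close> itself
    may equal or exceed \<open>b\<close>.\<close>
  define c where "c = min a (b / 2)"
  have c: "c > 0" "c \<le> a" "c < b" using m a by (auto simp: c_def b_def)
  have K0: "K \<ge> 0" using order_trans[OF norm_ge_zero K[of 0]] by simp
  define z where "z t = exp (- m * complex_of_real t) *s (cmat (mexp B t) *v w)" for t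
  have z': "(z has_vector_derivative exp (- m * complex_of_real t) *s (cmat (mexp B t) *v u)) (at t)" for t
  proof (rule has_vector_derivative_vecI)
    fix i
    let ?y = "\<lambda>t. (cmat (mexp B t) *v w) $ i"
    have y: "(?y has_vector_derivative (cmat B *v (cmat (mexp B t) *v w)) $ i) (at t)"
      using bounded_linear.has_vector_derivative[OF bounded_linear_vec_nth cmexp_deriv] .
    have e: "((\<lambda>t. exp (- m * complex_of_real t)) has_vector_derivative (- m) * exp (- m * complex_of_real t)) (at t)"
      by (rule has_vector_derivative_real_field) (auto intro!: derivative_eq_intros)
    have comm: "cmat B *v (cmat (mexp B t) *v w) = cmat (mexp B t) *v (cmat B *v w)"
      by (simp add: matrix_vector_mul_assoc cmat_mult[symmetric] mexp_commute)
    have "cmat (mexp B t) *v u = cmat (mexp B t) *v (cmat B *v w) + (- m) *s (cmat (mexp B t) *v w)"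
      unfolding u_def by (simp only: matrix_vector_right_distrib mv_smult)
    then have "(cmat (mexp B t) *v u) $ i = (cmat (mexp B t) *v (cmat B *v w)) $ i + (- m) * ?y t" by simp
    then have "(exp (- m * complex_of_real t) *s (cmat (mexp B t) *v u)) $ i =
        exp (- m * complex_of_real t) * (cmat B *v (cmat (mexp B t) *v w)) $ i + (- m) * exp (- m * complex_of_real t) * ?y t"
      unfolding comm vector_smult_component by (simp only: distrib_left mult_ac)
    then show "((\<lambda>t. z t $ i) has_vector_derivative (exp (- m * complex_of_real t) *s (cmat (mexp B t) *v u)) $ i) (at t)"
      unfolding z_def using has_vector_derivative_mult[OF e y] by simp
  qed
  have ne: "cmod (exp (- m * complex_of_real t)) = exp (b * t)" for t by (simp add: b_def)
  define C where "C = norm w + K / (b - c)"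
  have "norm (cmat (mexp B t) *v w) \<le> C * exp (- c * t)" if t: "t \<ge> 0" for t
  proof -
    have z0: "z 0 = w" by (simp add: z_def map_matrix_def mat_def vec_eq_iff matrix_vector_mult_def if_distrib if_distribR sum.delta cong: if_cong)
    have "norm (z t - z 0) \<le> K / (b - c) * exp ((b - c) * t) - K / (b - c) * exp ((b - c) * 0)"
    proof (cases "t = 0")
      case False
      show ?thesis
      proof (rule differentiable_bound_general[where f' = "\<lambda>t. exp (- m * complex_of_real t) *s (cmat (mexp B t) *v u)" and \<phi>' = "\<lambda>s. K * exp ((b - c) * s)"])
        show "0 < t" using t False by simp
        show "continuous_on {0..t} z"
          by (intro continuous_at_imp_continuous_on ballI has_vector_derivative_continuous[OF z'])
        show "continuous_on {0..t} (\<lambda>x. K / (b - c) * exp ((b - c) * x))"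
          by (intro continuous_intros)
        show "((\<lambda>x. K / (b - c) * exp ((b - c) * x)) has_vector_derivative K * exp ((b - c) * x)) (at x)" for x
          using c unfolding has_real_derivative_iff_has_vector_derivative[symmetric]
          by (auto intro!: derivative_eq_intros)
        fix x assume x: "0 < x" "x < t"
        have "norm (exp (- m * complex_of_real x) *s (cmat (mexp B x) *v u)) \<le> exp (b * x) * (K * exp (- a * x))"
          unfolding norm_smult_vec ne using K x by (intro mult_left_mono) auto
        also have "\<dots> = K * exp ((b - a) * x)" by (simp add: mult_exp_exp algebra_simps)
        also have "\<dots> \<le> K * exp ((b - c) * x)" using c x K0 by (intro mult_left_mono) (auto intro: mult_right_mono)
        finally show "norm (exp (- m * complex_of_real x) *s (cmat (mexp B x) *v u)) \<le> K * exp ((b - c) * x)" .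
      qed (rule z')
    qed simp
    then have "norm (z t) \<le> norm w + K / (b - c) * exp ((b - c) * t)"
      unfolding z0 using norm_triangle_sub[of "z t" w] c K0 by (smt (verit) divide_nonneg_pos exp_zero mult_zero_right mult_cancel_left1)
    also have "\<dots> \<le> norm w * exp ((b - c) * t) + K / (b - c) * exp ((b - c) * t)"
      using c t by (auto intro!: add_mono simp: mult_le_cancel_left1)
    also have "\<dots> = C * exp ((b - c) * t)" by (simp add: C_def algebra_simps)
    finally have "exp (b * t) * norm (cmat (mexp B t) *v w) \<le> C * exp ((b - c) * t)"
      unfolding z_def norm_smult_vec ne .
    then have "exp (- b * t) * (exp (b * t) * norm (cmat (mexp B t) *v w)) \<le> exp (- b * t) * (C * exp ((b - c) * t))"
      by (rule mult_left_mono) simp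
    then show ?thesis by (simp add: mult.assoc[symmetric] mult_exp_exp) (simp add: mult.commute mult.assoc mult_exp_exp algebra_simps)
  qed
  then show ?thesis using c(1) by blast
qed

lemma mexp_vector_decay:
  assumes B: "\<And>z. eigenvalue B z \<Longrightarrow> Re z < 0"
  shows "p \<noteq> 0 \<Longrightarrow> pact (cmat B) w p = 0 \<Longrightarrow> \<exists>K a. a > 0 \<and> (\<forall>t\<ge>0. norm (cmat (mexp B t) *v w) \<le> K * exp (- a * t))"
proof (induction "degree p" arbitrary: p w)
  case 0
  then obtain c where p: "p = [:c:]" by (metis degree_0_id)
  then have "w = 0" using 0 by (auto simp: pact_pCons vec_eq_iff)
  then show ?case by (intro exI[of _ 0] exI[of _ 1]) simp
next
  case (Suc n)
  have "\<not> constant (poly p)" using Suc(2) by (simp add: constant_degree)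
  then obtain m where "poly p m = 0" using fundamental_theorem_of_algebra by blast
  then obtain q where p: "p = [:-m, 1:] * q" by (auto simp: poly_eq_0_iff_dvd)
  then have q0: "q \<noteq> 0" using Suc.prems by auto
  have dq: "n = degree q" using Suc(2) q0 unfolding p by (subst (asm) degree_mult_eq) auto
  let ?u = "cmat B *v w + (- m) *s w"
  have u: "pact (cmat B) ?u q = 0" using Suc.prems(2) unfolding p pact_root .
  show ?case
  proof (cases "eigenvalue B m")
    case True
    obtain K a where "a > 0" "\<And>t. t \<ge> 0 \<Longrightarrow> norm (cmat (mexp B t) *v ?u) \<le> K * exp (- a * t)"
      using Suc.hyps(1)[OF dq q0 u] by blast
    then show ?thesis by (rule variation_of_constants_decay[OF B[OF True]])
  next
    case False
    \<comment> \<open>The vector q(B) w is in the kernel of B - m, which is trivial when m is no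
      eigenvalue. So q already annihilates w.\<close>
    let ?v = "pact (cmat B) w q"
    have "cmat B *v ?v + (- m) *s ?v = 0" using u by (simp only: pact_vec_add pact_vec_smult pact_apply)
    then have "cmat B *v ?v = m *s ?v" by (simp add: vec_eq_iff)
    then have "?v = 0" using False unfolding eigenvalue_def by blast
    from Suc.hyps(1)[OF dq q0 this] show ?thesis .
  qed
qed

lemma mexp_tendsto_0:
  assumes B: "\<And>z. eigenvalue B z \<Longrightarrow> Re z < 0"
  shows "(mexp B \<longlongrightarrow> 0) at_top"
proof (intro vec_tendstoI)
  fix i j
  obtain p where p: "p \<noteq> 0" "pact (cmat B) (axis j 1) p = 0" using exists_annihilating_poly by blast
  from mexp_vector_decay[OF B this] obtain K a where
    a: "a > 0" and K: "\<And>t. t \<ge> 0 \<Longrightarrow> norm (cmat (mexp B t) *v axis j 1) \<le> K * exp (- a * t)"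
    by blast
  have lim: "((\<lambda>t. K * exp (- a * t)) \<longlongrightarrow> 0) at_top"
  proof -
    have "((\<lambda>t. exp (- (a * t))) \<longlongrightarrow> 0) at_top"
      using a by (intro filterlim_compose[OF exp_at_bot] filterlim_compose[OF filterlim_uminus_at_bot_at_top]
         filterlim_tendsto_pos_mult_at_top[OF tendsto_const] filterlim_ident)
    from tendsto_mult_right_zero[OF this, of K] show ?thesis by simp
  qed
  show "((\<lambda>t. mexp B t $ i $ j) \<longlongrightarrow> 0 $ i $ j) at_top"
    unfolding zero_index
  proof (rule Lim_null_comparison[OF _ lim])
    show "\<forall>\<^sub>F t in at_top. norm (mexp B t $ i $ j) \<le> K * exp (- a * t)"
      using eventually_ge_at_top[of 0]
    proof eventually_elim
      case (elim t)
      have "norm (mexp B t $ i $ j) = norm ((cmat (mexp B t) *v axis j 1) $ i)"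
      proof -
        have "(cmat (mexp B t) *v axis j 1) $ i = complex_of_real (mexp B t $ i $ j)"
          by (simp add: matrix_vector_mult_def axis_def map_matrix_def if_distrib cong: if_cong)
        then show ?thesis by simp
      qed
      also have "\<dots> \<le> norm (cmat (mexp B t) *v axis j 1)" by (rule Finite_Cartesian_Product.norm_nth_le)
      finally show ?case using K[OF elim] by linarith
    qed
  qed
qed

section \<open>Paths of the volatility process\<close>

text \<open>The measures \<open>p\<close> and \<open>n\<close> are an arbitrary decomposition of dV,
  so only their difference is known. At a point of \<open>T\<close> it is the jump of V; away from
  \<open>T\<close> the function V is constant, so \<open>p\<close> and \<open>n\<close> agree there
  and their contributions to the integral cancel.\<close>

lemma has_LS_integral_step:
  assumes int: "has_LS_integral g V t I" and t: "0 \<le> t" and T: "finite T" "T \<subseteq> {0<..t}"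
    and V: "\<And>s. 0 \<le> s \<Longrightarrow> s \<le> t \<Longrightarrow> V s = (\<Sum>u\<in>T. if u \<le> s then c u else 0)"
  shows "I = (\<Sum>u\<in>T. c u * g u)"
proof -
  from int obtain p n where sets [measurable_cong]: "sets p = sets borel" "sets n = sets borel"
    and fin: "finite_measure p" "finite_measure n"
    and pn: "\<And>a b. 0 \<le> a \<Longrightarrow> a \<le> b \<Longrightarrow> b \<le> t \<Longrightarrow> V b - V a = measure p {a<..b} - measure n {a<..b}"
    and gi: "set_integrable p {0<..t} g" "set_integrable n {0<..t} g"
    and I: "I = (LINT s:{0<..t}|p. g s) - (LINT s:{0<..t}|n. g s)"
    unfolding has_LS_integral_def by blast
  interpret p: finite_measure p by (rule fin)
  interpret n: finite_measure n by (rule fin)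
  have spc [simp]: "space p = UNIV" "space n = UNIV" using sets_eq_imp_space_eq[OF sets(1)] sets_eq_imp_space_eq[OF sets(2)] by auto
  have Tb: "X \<in> sets borel" if "X \<subseteq> T" for X using that T(1) by (meson finite_subset finite_imp_closed borel_closed)
  have point: "measure p {u} - measure n {u} = c u" if u: "u \<in> T" for u
  proof -
    have u0: "0 < u" "u \<le> t" using u T(2) by auto
    \<comment> \<open>The last jump before \<open>u\<close>, or 0 if there is none. V is constant on
      [a0, u), and the intervals from \<open>a m\<close> to \<open>u\<close> shrink to the point
      \<open>u\<close>.\<close>
    define a0 where "a0 = Max (insert 0 {v\<in>T. v < u})"
    have a0: "0 \<le> a0" "a0 < u" "\<And>v. v \<in> T \<Longrightarrow> v < u \<Longrightarrow> v \<le> a0"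
      using u0 T(1) unfolding a0_def by auto
    define a where "a m = u - (u - a0) / real (Suc m)" for m
    have a: "a0 \<le> a m" "a m < u" for m
    proof -
      have "(u - a0) / real (Suc m) \<le> (u - a0) / 1" using a0(2) by (intro divide_left_mono) auto
      then show "a0 \<le> a m" "a m < u" using a0(2) unfolding a_def by auto
    qed
    have Va: "V u - V (a m) = c u" for m
    proof -
      have "V u - V (a m) = (\<Sum>v\<in>T. if v \<le> u then c v else 0) - (\<Sum>v\<in>T. if v \<le> a m then c v else 0)"
        using V[of u] V[of "a m"] u0 a[of m] a0 by simp
      also have "\<dots> = (\<Sum>v\<in>T. if v = u then c u else 0)"
        unfolding sum_subtractf[symmetric]
      proof (intro sum.cong refl)
        fix v assume v: "v \<in> T"
        show "(if v \<le> u then c v else 0) - (if v \<le> a m then c v else 0) = (if v = u then c u else 0)"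
          using a0(3)[OF v] a[of m] by (cases "v < u") auto
      qed
      also have "\<dots> = c u" using u T(1) by simp
      finally show ?thesis .
    qed
    have dec: "decseq (\<lambda>m. {a m<..u})"
    proof (rule decseq_SucI)
      fix m
      have "(u - a0) / real (Suc (Suc m)) \<le> (u - a0) / real (Suc m)" using a0(2) by (intro divide_left_mono) auto
      then show "{a (Suc m)<..u} \<le> {a m<..u}" unfolding a_def by auto
    qed
    have Int: "(\<Inter>m. {a m<..u}) = {u}"
    proof -
      have "x = u" if x: "\<And>m. a m < x" "x \<le> u" for x
      proof (rule ccontr)
        assume "x \<noteq> u" then have "0 < u - x" using x by simp
        moreover have "0 < u - a0" using a0 by simp
        ultimately obtain m where "inverse (real (Suc m)) < (u - x) / (u - a0)" using reals_Archimedean[of "(u - x) / (u - a0)"] by auto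
        then have "a m > x" using \<open>0 < u - a0\<close> unfolding a_def by (simp add: field_simps)
        then show False using x(1)[of m] by simp
      qed
      then show ?thesis using a by auto
    qed
    have "(\<lambda>m. measure p {a m<..u} - measure n {a m<..u}) \<longlonglongrightarrow> measure p {u} - measure n {u}"
      unfolding Int[symmetric]
      by (intro tendsto_diff p.finite_Lim_measure_decseq n.finite_Lim_measure_decseq dec) auto
    moreover have "measure p {a m<..u} - measure n {a m<..u} = c u" for m
      using pn[of "a m" u] a[of m] a0 u0 Va[of m] by simp
    ultimately show ?thesis by (simp add: LIMSEQ_const_iff)
  qed
  have meas_T: "measure p X = (\<Sum>u\<in>X. measure p {u})" "measure n X = (\<Sum>u\<in>X. measure n {u})" if "X \<subseteq> T" for X
    using that T(1) finite_subset[OF that T(1)]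
    by (auto intro!: p.finite_measure_eq_sum_singleton n.finite_measure_eq_sum_singleton)
  have intv: "measure p ({a<..b} - T) = measure n ({a<..b} - T)" if ab: "0 \<le> a" "a \<le> b" "b \<le> t" for a b
  proof -
    have Xb: "{a<..b} \<inter> T \<in> sets borel" by (rule Tb) auto
    have "measure p {a<..b} - measure n {a<..b} = V b - V a" using pn[OF ab] by simp
    also have "\<dots> = (\<Sum>v\<in>T. if v \<le> b then c v else 0) - (\<Sum>v\<in>T. if v \<le> a then c v else 0)"
      using V[of a] V[of b] ab by simp
    also have "\<dots> = (\<Sum>v\<in>T. if v \<in> {a<..b} then c v else 0)"
      unfolding sum_subtractf[symmetric] using ab by (intro sum.cong refl) auto
    also have "\<dots> = (\<Sum>v\<in>{a<..b} \<inter> T. c v)" using T(1) by (subst Int_commute) (simp only: sum.inter_restrict)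
    also have "\<dots> = measure p ({a<..b} \<inter> T) - measure n ({a<..b} \<inter> T)"
      using meas_T[of "{a<..b} \<inter> T"] point by (simp add: sum_subtractf[symmetric])
    finally have "measure p {a<..b} - measure p ({a<..b} \<inter> T) = measure n {a<..b} - measure n ({a<..b} \<inter> T)" by simp
    moreover have "{a<..b} - T = {a<..b} - ({a<..b} \<inter> T)" by auto
    ultimately show ?thesis
      using Xb by (simp add: p.finite_measure_Diff n.finite_measure_Diff sets)
  qed
  define D where "D = {0<..t} - T"
  have Db [measurable]: "D \<in> sets borel" unfolding D_def using Tb[of T] by auto
  \<comment> \<open>Both measures are finite and agree on half-open intervals, which generate the
    Borel sets and are stable under intersection.\<close>
  have eq: "density p (indicator D) = density n (indicator D)"
  proof (rule measure_eqI_generator_eq[where E = "range (\<lambda>(a, b). {a<..b::real})" and \<Omega> = UNIV and A = "\<lambda>i. {- real i<..real i}"])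
    show "Int_stable (range (\<lambda>(a, b). {a<..b::real}))"
      by (auto simp: Int_stable_def)
    show "sets (density p (indicator D)) = sigma_sets UNIV (range (\<lambda>(a, b). {a<..b::real}))"
      "sets (density n (indicator D)) = sigma_sets UNIV (range (\<lambda>(a, b). {a<..b::real}))"
      using sets by (auto simp: borel_sigma_sets_Ioc)
    show "(\<Union>i. {- real i<..real i}) = UNIV"
    proof (safe; simp)
      fix x :: real obtain k where "\<bar>x\<bar> < real k" using reals_Archimedean2 by blast
      then show "\<exists>i. - real i < x \<and> x \<le> real i" by (intro exI[of _ k]) auto
    qed
    have den: "emeasure (density p (indicator D)) X = ennreal (measure p (D \<inter> X))"
      "emeasure (density n (indicator D)) X = ennreal (measure n (D \<inter> X))" if "X \<in> sets borel" for X
    proof -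
      have e: "emeasure (density q (indicator D)) X = emeasure q (D \<inter> X)" if "sets q = sets borel" for q
        using that \<open>X \<in> sets borel\<close>
        by (subst emeasure_density) (auto simp: indicator_inter_arith[symmetric] measurable_cong_sets[OF that refl])
      show "emeasure (density p (indicator D)) X = ennreal (measure p (D \<inter> X))"
        "emeasure (density n (indicator D)) X = ennreal (measure n (D \<inter> X))"
        by (simp_all add: e sets p.emeasure_eq_measure n.emeasure_eq_measure)
    qed
    show "emeasure (density p (indicator D)) {- real i<..real i} \<noteq> \<infinity>" for i
      by (subst den) auto
    fix X assume "X \<in> range (\<lambda>(a, b). {a<..b::real})"
    then obtain a b where X: "X = {a<..b}" by auto
    have "measure p (D \<inter> X) = measure n (D \<inter> X)"
    proof (cases "max 0 a \<le> min t b")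
      case True
      have "D \<inter> X = {max 0 a<..min t b} - T" unfolding D_def X by auto
      then show ?thesis using intv[OF _ True] by simp
    next
      case False
      then have "D \<inter> X = {}" unfolding D_def X by auto
      then show ?thesis by simp
    qed
    then show "emeasure (density p (indicator D)) X = emeasure (density n (indicator D)) X"
      by (simp add: den X)
  qed auto
  have part: "(LINT s:{0<..t}|q. g s) = integral\<^sup>L (density q (indicator D)) (\<lambda>s. indicator {0<..t} s * g s) + (\<Sum>u\<in>T. g u * measure q {u})"
    if q: "finite_measure q" "sets q = sets borel" "set_integrable q {0<..t} g" for q
  proof -
    interpret q: finite_measure q by (rule q)
    note [measurable_cong] = q(2)
    let ?h = "\<lambda>s. indicator {0<..t} s * g s"
    have h: "integrable q ?h" using q(3) unfolding set_integrable_def by simp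
    then have [measurable]: "?h \<in> borel_measurable q" by simp
    have Tq: "T \<in> sets q" using Tb[of T] q(2) by auto
    have "(LINT s:{0<..t}|q. g s) = (LINT s|q. indicator D s * ?h s + (\<Sum>u\<in>T. indicator {u} s * g u))"
      unfolding set_lebesgue_integral_def
    proof (intro Bochner_Integration.integral_cong refl)
      fix s
      have "(\<Sum>u\<in>T. indicator {u} s * g u) = indicator T s * g s"
      proof -
        have "(\<Sum>u\<in>T. indicator {u} s * g u) = (\<Sum>u\<in>T. if u = s then g s else 0)"
          by (intro sum.cong) (auto simp: indicator_def)
        then show ?thesis using T(1) by (simp add: indicator_def)
      qed
      then show "indicator {0<..t} s *\<^sub>R g s = indicator D s * ?h s + (\<Sum>u\<in>T. indicator {u} s * g u)"
        using T(2) by (auto simp: D_def indicator_def)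
    qed
    also have "\<dots> = (LINT s|q. indicator D s * ?h s) + (LINT s|q. (\<Sum>u\<in>T. indicator {u} s * g u))"
    proof (rule Bochner_Integration.integral_add)
      show "integrable q (\<lambda>s. indicator D s * ?h s)"
      proof (rule Bochner_Integration.integrable_bound[OF h])
        show "(\<lambda>s. indicator D s * ?h s) \<in> borel_measurable q" by measurable
      qed (auto simp: indicator_def)
      show "integrable q (\<lambda>s. \<Sum>u\<in>T. indicator {u} s * g u)"
        using q(2) by (intro Bochner_Integration.integrable_sum integrable_mult_left) (auto simp: q.emeasure_eq_measure)
    qed
    also have "(LINT s|q. (\<Sum>u\<in>T. indicator {u} s * g u)) = (\<Sum>u\<in>T. g u * measure q {u})"
      using q(2) by (subst Bochner_Integration.integral_sum) (auto simp: q.emeasure_eq_measure mult.commute intro!: integrable_mult_left)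
    also have "(LINT s|q. indicator D s * ?h s) = integral\<^sup>L (density q (indicator D)) ?h"
    proof -
      have "(indicator D :: real \<Rightarrow> ennreal) = (\<lambda>x. ennreal (indicator D x))" by (auto simp: indicator_def)
      then show ?thesis by (simp add: integral_density)
    qed
    finally show ?thesis .
  qed
  have "I = (\<Sum>u\<in>T. g u * measure p {u}) - (\<Sum>u\<in>T. g u * measure n {u})"
    unfolding I part[OF fin(1) sets(1) gi(1)] part[OF fin(2) sets(2) gi(2)] eq by simp
  also have "\<dots> = (\<Sum>u\<in>T. c u * g u)"
    unfolding sum_subtractf[symmetric] right_diff_distrib[symmetric] using point by (intro sum.cong) (auto simp: mult.commute)
  finally show ?thesis .
qed

section \<open>Cadlag paths and their left limits\<close>

lemma cadlag_left_lim:
  assumes "cadlag f" "0 < t" shows "(f \<longlongrightarrow> left_lim f t) (at_left t)"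
proof -
  obtain l where l: "(f \<longlongrightarrow> l) (at_left t)" using assms unfolding cadlag_def by blast
  then have "left_lim f t = l" unfolding left_lim_def by (intro tendsto_Lim) auto
  then show ?thesis using l by simp
qed

lemma left_lim_eqI: "(f \<longlongrightarrow> l) (at_left t) \<Longrightarrow> left_lim f t = l" for t :: real
  unfolding left_lim_def by (intro tendsto_Lim) auto

lemma cadlag_right: "cadlag f \<Longrightarrow> 0 \<le> t \<Longrightarrow> (f \<longlongrightarrow> f t) (at_right t)"
  unfolding cadlag_def by blast

text \<open>One-sided limits bound the path near each point, and finitely many such neighborhoods
  cover [0, t].\<close>

lemma cadlag_bounded:
  fixes f :: "real \<Rightarrow> 'a::real_normed_vector"
  assumes f: "cadlag f"
  shows "\<exists>K. \<forall>s\<in>{0..t}. norm (f s) \<le> K"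
proof -
  have loc: "\<exists>e K. e > 0 \<and> (\<forall>x\<in>ball s e \<inter> {0..t}. norm (f x) \<le> K)" if s: "s \<in> {0..t}" for s
  proof -
    have "\<forall>\<^sub>F x in at_right s. dist (f x) (f s) < 1" using cadlag_right[OF f] s by (auto simp: tendsto_iff)
    then obtain b where b: "b > s" "\<And>x. s < x \<Longrightarrow> x < b \<Longrightarrow> dist (f x) (f s) < 1"
      unfolding eventually_at_right_field by blast
    have "\<exists>a<s. \<exists>l. \<forall>x. a < x \<longrightarrow> x < s \<longrightarrow> 0 \<le> x \<longrightarrow> dist (f x) l < 1"
    proof (cases "s = 0")
      \<comment> \<open>No left limit is available at 0, but there is no nonnegative x to the left
        of it, so the claim is vacuous.\<close>
      case True then show ?thesis by (intro exI[of _ "-1"]) auto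
    next
      case False
      then have "\<forall>\<^sub>F x in at_left s. dist (f x) (left_lim f s) < 1" using cadlag_left_lim[OF f] s by (auto simp: tendsto_iff)
      then show ?thesis unfolding eventually_at_left_field by blast
    qed
    then obtain a l where a: "a < s" "\<And>x. a < x \<Longrightarrow> x < s \<Longrightarrow> 0 \<le> x \<Longrightarrow> dist (f x) l < 1" by blast
    let ?e = "min (b - s) (s - a)"
    have "norm (f x) \<le> max (norm (f s)) (norm l) + 1" if x: "x \<in> ball s ?e \<inter> {0..t}" for x
    proof -
      have x': "a < x" "x < b" "0 \<le> x" using x by (auto simp: dist_real_def)
      consider "x < s" | "x = s" | "x > s" by linarith
      then show ?thesis
      proof cases
        case 1
        have "dist (f x) l < 1" using a(2)[OF x'(1) 1 x'(3)] .
        then show ?thesis using norm_triangle_sub[of "f x" l] by (simp add: dist_norm)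
      next
        case 3
        have "dist (f x) (f s) < 1" using b(2)[OF 3 x'(2)] .
        then show ?thesis using norm_triangle_sub[of "f x" "f s"] by (simp add: dist_norm)
      qed simp
    qed
    moreover have "?e > 0" using a b by simp
    ultimately show ?thesis by blast
  qed
  then obtain e K where eK: "\<And>s. s \<in> {0..t} \<Longrightarrow> e s > 0 \<and> (\<forall>x\<in>ball s (e s) \<inter> {0..t}. norm (f x) \<le> K s)" by metis
  have "{0..t} \<subseteq> (\<Union>s\<in>{0..t}. ball s (e s))" using eK by fastforce
  then obtain S where S: "S \<subseteq> {0..t}" "finite S" "{0..t} \<subseteq> (\<Union>s\<in>S. ball s (e s))"
    by (rule compactE_image[OF compact_Icc, rotated]) (auto intro: that)
  have "norm (f x) \<le> (\<Sum>s\<in>S. \<bar>K s\<bar>)" if x: "x \<in> {0..t}" for x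
  proof -
    obtain s where s: "s \<in> S" "x \<in> ball s (e s)" using S(3) x by blast
    then have "norm (f x) \<le> \<bar>K s\<bar>" using eK[of s] S(1) x by (meson IntI abs_ge_self order_trans subset_eq)
    also have "\<dots> \<le> (\<Sum>s\<in>S. \<bar>K s\<bar>)" using s(1) S(2) by (intro member_le_sum) auto
    finally show ?thesis .
  qed
  then show ?thesis by blast
qed

text \<open>The next point strictly to the right of s on the grid of mesh 1/(m + 1). Strictness
  (floor plus one, and ceiling minus one for \<open>grid_left\<close>) lets the one-sided limits of
  a path be taken along these points.\<close>

definition grid_right :: "nat \<Rightarrow> real \<Rightarrow> real" where
  "grid_right m s = (of_int \<lfloor>real (Suc m) * s\<rfloor> + 1) / real (Suc m)"

definition grid_left :: "nat \<Rightarrow> real \<Rightarrow> real" where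
  "grid_left m s = (of_int \<lceil>real (Suc m) * s\<rceil> - 1) / real (Suc m)"

lemma grid_right_bounds: "s < grid_right m s" "grid_right m s \<le> s + 1 / real (Suc m)"
proof -
  have "real (Suc m) * s < of_int \<lfloor>real (Suc m) * s\<rfloor> + 1" by linarith
  then show "s < grid_right m s" unfolding grid_right_def by (simp add: field_simps del: of_nat_Suc)
  have "of_int \<lfloor>real (Suc m) * s\<rfloor> \<le> real (Suc m) * s" by linarith
  then show "grid_right m s \<le> s + 1 / real (Suc m)" unfolding grid_right_def by (simp add: field_simps del: of_nat_Suc)
qed

lemma grid_left_bounds: "grid_left m s < s" "s - 1 / real (Suc m) \<le> grid_left m s"
proof -
  have "real (Suc m) * s > of_int \<lceil>real (Suc m) * s\<rceil> - 1" by linarith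
  then show "grid_left m s < s" unfolding grid_left_def by (simp add: field_simps del: of_nat_Suc)
  have "of_int \<lceil>real (Suc m) * s\<rceil> \<ge> real (Suc m) * s" by linarith
  then show "s - 1 / real (Suc m) \<le> grid_left m s" unfolding grid_left_def by (simp add: field_simps del: of_nat_Suc)
qed

lemma grid_right_tendsto: "filterlim (\<lambda>m. grid_right m s) (at_right s) sequentially"
proof -
  have u: "(\<lambda>m. s + 1 / real (Suc m)) \<longlonglongrightarrow> s"
    using tendsto_add[OF tendsto_const LIMSEQ_inverse_real_of_nat, of s] by (simp add: inverse_eq_divide)
  have "(\<lambda>m. grid_right m s) \<longlonglongrightarrow> s"
    by (rule tendsto_sandwich[OF _ _ tendsto_const u])
      (auto intro!: always_eventually less_imp_le grid_right_bounds(1) grid_right_bounds(2) simp del: of_nat_Suc)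
  then show ?thesis
    by (rule tendsto_imp_filterlim_at_right) (auto intro!: always_eventually grid_right_bounds)
qed

lemma grid_left_tendsto: "filterlim (\<lambda>m. grid_left m s) (at_left s) sequentially"
proof -
  have u: "(\<lambda>m. s - 1 / real (Suc m)) \<longlonglongrightarrow> s"
    using tendsto_diff[OF tendsto_const LIMSEQ_inverse_real_of_nat, of s] by (simp add: inverse_eq_divide)
  have "(\<lambda>m. grid_left m s) \<longlonglongrightarrow> s"
    by (rule tendsto_sandwich[OF _ _ u tendsto_const])
      (auto intro!: always_eventually less_imp_le grid_left_bounds(1) grid_left_bounds(2) simp del: of_nat_Suc)
  then show ?thesis
    by (rule tendsto_imp_filterlim_at_left) (auto intro!: always_eventually grid_left_bounds)
qed

text \<open>Left limits are limits of the path sampled at the grid points to the left, and each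
  sampled path factors through an integer. The indicator removes the times at which a cadlag path
  need not have a left limit.\<close>

lemma cadlag_left_lim_measurable:
  fixes f :: "real \<Rightarrow> 'a::{real_normed_vector, second_countable_topology}"
  assumes f: "cadlag f"
  shows "(\<lambda>s. indicator {0<..} s *\<^sub>R left_lim f s) \<in> borel_measurable borel"
proof (rule borel_measurable_LIMSEQ_metric)
  fix m
  have "(\<lambda>s :: real. f ((of_int \<lceil>real (Suc m) * s\<rceil> - 1) / real (Suc m))) \<in> borel_measurable borel"
    by (rule measurable_compose[of _ borel "count_space UNIV" "\<lambda>k :: int. f ((of_int k - 1) / real (Suc m))"]) measurable
  then show "(\<lambda>s. indicator {0<..} s *\<^sub>R f (grid_left m s)) \<in> borel_measurable borel"
    unfolding grid_left_def by measurable
next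
  fix s :: real
  show "(\<lambda>m. indicator {0<..} s *\<^sub>R f (grid_left m s)) \<longlonglongrightarrow> indicator {0<..} s *\<^sub>R left_lim f s"
  proof (cases "0 < s")
    case True
    then show ?thesis using filterlim_compose[OF cadlag_left_lim[OF f True] grid_left_tendsto] by simp
  qed simp
qed

section \<open>The linear flow between jumps\<close>

definition flow :: "real^'n^'n \<Rightarrow> real \<Rightarrow> real^'n^'n \<Rightarrow> real^'n^'n" where
  "flow B t x = mexp B t ** x ** transpose (mexp B t)"

lemma flow_0 [simp]: "flow B 0 x = x"
  by (simp add: flow_def)

lemma flow_add: "flow B (s + t) x = flow B s (flow B t x)"
  by (simp add: flow_def mexp_add matrix_transpose_mul matrix_mul_assoc)

lemma flow_psd: "x \<in> psd \<Longrightarrow> flow B t x \<in> psd"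
  unfolding flow_def by (rule psd_congruence)

lemma flow_plus: "flow B t (x + y) = flow B t x + flow B t y"
  by (simp add: flow_def matrix_add_ldistrib bounded_bilinear.add_left[OF bounded_bilinear_mmult])

lemma flow_outer: "flow B t (outer v) = outer (mexp B t *v v)"
  by (simp add: flow_def outer_matrix)

lemma has_vector_derivative_transpose:
  fixes f :: "real \<Rightarrow> real^'n^'n"
  assumes "(f has_vector_derivative d) (at t within S)"
  shows "((\<lambda>t. transpose (f t)) has_vector_derivative transpose d) (at t within S)"
proof (intro has_vector_derivative_vecI)
  fix i j
  have "((\<lambda>t. f t $ j $ i) has_vector_derivative d $ j $ i) (at t within S)"
    by (intro bounded_linear.has_vector_derivative[OF bounded_linear_vec_nth] assms)
  then show "((\<lambda>t. transpose (f t) $ i $ j) has_vector_derivative transpose d $ i $ j) (at t within S)"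
    by (simp add: transpose_def)
qed

lemma transpose_minus: "transpose (- A) = - transpose (A :: real^'n^'n)"
  by (auto simp: transpose_def vec_eq_iff)

text \<open>Uniqueness for the linear equation: pulling \<open>z\<close> back to time
  \<open>s\<close> by the inverse flow gives a function with derivative 0.\<close>

lemma linear_ode_flow:
  fixes z :: "real \<Rightarrow> real^'n^'n"
  assumes z: "\<And>t. t \<in> {s..e} \<Longrightarrow> (z has_vector_derivative B ** z t + z t ** transpose B) (at t within {s..e})"
    and "s \<le> e"
  shows "z e = flow B (e - s) (z s)"
proof -
  let ?w = "\<lambda>t. mexp B (s - t) ** z t ** transpose (mexp B (s - t))"
  obtain c where c: "\<And>t. t \<in> {s..e} \<Longrightarrow> ?w t = c"
  proof (rule has_vector_derivative_zero_constant[of "{s..e}" ?w])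
    fix t assume t: "t \<in> {s..e}"
    have "(?w has_vector_derivative
        mexp B (s - t) ** z t ** transpose (- (B ** mexp B (s - t))) +
        (mexp B (s - t) ** (B ** z t + z t ** transpose B) + - (B ** mexp B (s - t)) ** z t) ** transpose (mexp B (s - t))) (at t within {s..e})"
      by (intro has_vector_derivative_mmult has_vector_derivative_transpose mexp_minus_deriv z t)
    moreover have "transpose (- (B ** mexp B (s - t))) = - (transpose B ** transpose (mexp B (s - t)))"
      by (simp only: mexp_commute[symmetric] matrix_transpose_mul transpose_minus)
    moreover have "mexp B (s - t) ** (B ** z t) = B ** mexp B (s - t) ** z t"
      by (simp only: matrix_mul_assoc mexp_commute)
    ultimately show "(?w has_vector_derivative 0) (at t within {s..e})"
      by (simp add: matrix_mul_assoc matrix_mul_minus matrix_add_ldistrib bounded_bilinear.add_left[OF bounded_bilinear_mmult])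
  qed (auto intro: that)
  have "?w e = ?w s" using c[of e] c[of s] \<open>s \<le> e\<close> by simp
  then have "mexp B (e - s) ** ?w e ** transpose (mexp B (e - s)) = flow B (e - s) (z s)"
    by (simp add: flow_def)
  moreover have "mexp B (e - s) ** ?w e ** transpose (mexp B (e - s)) = flow B (e - s) (flow B (s - e) (z e))"
    by (simp add: flow_def)
  ultimately show ?thesis by (simp add: flow_add[symmetric])
qed

text \<open>The integrand contains left limits, and the equation holds only before \<open>e\<close>,
  where the next jump may occur. Its right-hand side \<open>z\<close> is continuous up to
  \<open>e\<close> and equals the left limits on (s, e], so it solves the differential
  equation.\<close>

lemma continuous_path_flow:
  fixes y :: "real \<Rightarrow> real^'n^'n" and B :: "real^'n^'n"
  defines "h \<equiv> \<lambda>s. B ** left_lim y s + left_lim y s ** transpose B"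
  assumes y: "cadlag y" and s: "0 \<le> s" "s < e"
    and eq: "\<And>t. s \<le> t \<Longrightarrow> t < e \<Longrightarrow> y t = y s + integral {s..t} h"
    and int: "h integrable_on {s..e}"
  shows "left_lim y e = flow B (e - s) (y s)" "y s + integral {s..e} h = left_lim y e"
proof -
  define z where "z t = y s + integral {s..t} h" for t
  have cz: "continuous_on {s..e} z"
    unfolding z_def by (intro continuous_intros indefinite_integral_continuous_1 int)
  have left: "left_lim y t = z t" if t: "s < t" "t \<le> e" for t
  proof (rule left_lim_eqI)
    have "(z \<longlongrightarrow> z t) (at t within {s..t})"
      using continuous_on_subset[OF cz, of "{s..t}"] t by (auto simp: continuous_on_def)
    then have "(z \<longlongrightarrow> z t) (at_left t)"
      using t by (simp add: at_within_Icc_at_left)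
    moreover have "\<forall>\<^sub>F x in at_left t. z x = y x"
      unfolding eventually_at_left_field z_def
      by (intro exI[of _ s] conjI allI impI eq[symmetric]) (use t in auto)
    ultimately show "(y \<longlongrightarrow> z t) (at_left t)" by (rule Lim_transform_eventually)
  qed
  let ?g = "\<lambda>t. B ** z t + z t ** transpose B"
  \<comment> \<open>At \<open>s\<close> itself the path may have jumped, so the left limit there may
    differ from \<open>z s\<close>; a single point does not affect the integral.\<close>
  have z2: "z t = y s + integral {s..t} ?g" if t: "t \<in> {s..e}" for t
    unfolding z_def[of t]
  proof (rule arg_cong[where f = "\<lambda>x. y s + x"], rule integral_spike)
    show "negligible {s}" by simp
    show "?g x = h x" if "x \<in> {s..t} - {s}" for x
      unfolding h_def using left[of x] that t by simp
  qed
  have cg: "continuous_on {s..e} ?g" by (intro continuous_intros cz)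
  have "(z has_vector_derivative ?g t) (at t within {s..e})" if t: "t \<in> {s..e}" for t
  proof -
    have "((\<lambda>t. y s + integral {s..t} ?g) has_vector_derivative ?g t) (at t within {s..e})"
      using has_vector_derivative_add[OF has_vector_derivative_const integral_has_vector_derivative[OF cg t]] by simp
    then show ?thesis
      by (rule has_vector_derivative_transform[rotated 2]) (use t z2 in auto)
  qed
  then have "z e = flow B (e - s) (z s)" by (rule linear_ode_flow) (use s in auto)
  then show "left_lim y e = flow B (e - s) (y s)" "y s + integral {s..e} h = left_lim y e"
    using left[of e] s by (auto simp: z_def)
qed

lemma integrable_left_lim:
  fixes y :: "real \<Rightarrow> real^'n^'n"
  assumes y: "cadlag y"
  shows "set_integrable lborel {0..t} (\<lambda>s. B ** left_lim y s + left_lim y s ** transpose B)" (is "set_integrable _ _ ?h")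
proof -
  have [measurable]: "(\<lambda>s. indicator {0<..} s *\<^sub>R left_lim y s) \<in> borel_measurable borel"
    by (rule cadlag_left_lim_measurable[OF y])
  let ?l = "\<lambda>s. indicator {0<..} s *\<^sub>R left_lim y s"
  \<comment> \<open>The value \<open>left_lim y 0\<close> depends on negative times and is
    unspecified, so the point 0 is treated separately here and in the bound
    \<open>K'\<close>.\<close>
  have m: "(\<lambda>s. indicator {0..t} s *\<^sub>R ?h s) \<in> borel_measurable borel"
  proof -
    have "(\<lambda>s. if s = 0 then indicator {0..t} 0 *\<^sub>R ?h 0 else indicator {0..t} s *\<^sub>R (B ** ?l s + ?l s ** transpose B)) \<in> borel_measurable borel"
      by measurable
    also have "(\<lambda>s. if s = 0 then indicator {0..t} 0 *\<^sub>R ?h 0 else indicator {0..t} s *\<^sub>R (B ** ?l s + ?l s ** transpose B)) = (\<lambda>s. indicator {0..t} s *\<^sub>R ?h s)"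
      by (auto simp: fun_eq_iff indicator_def)
    finally show ?thesis .
  qed
  obtain K where K: "\<And>s. s \<in> {0..t} \<Longrightarrow> norm (y s) \<le> K" using cadlag_bounded[OF y, of t] by blast
  have Kl: "norm (left_lim y s) \<le> K" if s: "0 < s" "s \<le> t" for s
  proof (rule tendsto_upperbound[OF tendsto_norm[OF cadlag_left_lim[OF y s(1)]]])
    show "\<forall>\<^sub>F x in at_left s. norm (y x) \<le> K"
      unfolding eventually_at_left_field using s K by (intro exI[of _ 0]) auto
  qed simp
  define K' where "K' = max (2 * norm B * K) (norm (?h 0))"
  have Kh: "norm (?h s) \<le> K'" if s: "s \<in> {0..t}" for s
  proof (cases "s = 0")
    case False
    then have l: "norm (left_lim y s) \<le> K" using Kl s by auto
    have "norm (?h s) \<le> norm B * norm (left_lim y s) + norm (left_lim y s) * norm B"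
      using norm_triangle_ineq[of "B ** left_lim y s" "left_lim y s ** transpose B"]
        norm_matrix_mult_le[of B "left_lim y s"] norm_matrix_mult_le[of "left_lim y s" "transpose B"]
      unfolding norm_transpose[of B] by linarith
    also have "\<dots> \<le> 2 * norm B * K" using mult_left_mono[OF l norm_ge_zero[of B]] by (simp add: mult.commute)
    finally show ?thesis by (simp add: K'_def)
  qed (simp add: K'_def)
  show ?thesis
    unfolding set_integrable_def
  proof (rule Bochner_Integration.integrable_bound)
    show "integrable lborel (\<lambda>s. indicator {0..t} s * K')"
      by (rule integrable_mult_left) (auto intro!: integrable_real_indicator simp: emeasure_lborel_Icc_eq)
    show "AE s in lborel. norm (indicator {0..t} s *\<^sub>R ?h s) \<le> norm (indicator {0..t} s * K')"
      using Kh by (auto simp: indicator_def intro: order_trans[OF _ abs_ge_self])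
  qed (use m in simp)
qed

section \<open>Single paths driven by finitely many jumps\<close>

lemma outer_0 [simp]: "outer 0 = 0"
  by (simp add: outer_def vec_eq_iff)

text \<open>Deterministic facts about one path. The counter may grow by more than one at a time and
  a jump size may be 0, so the jump times of \<open>l\<close> are only some of those of
  \<open>n\<close>.\<close>

locale counting_path =
  fixes n :: "real \<Rightarrow> nat" and x :: "nat \<Rightarrow> real^'n" and l :: "real \<Rightarrow> real^'n"
  assumes n_mono: "mono_on {0..} n"
    and n_right: "\<And>t. 0 \<le> t \<Longrightarrow> (n \<longlongrightarrow> n t) (at_right t)"
    and l: "\<And>t. 0 \<le> t \<Longrightarrow> l t = (\<Sum>i<n t. x i)"
begin

lemma n_le: "0 \<le> s \<Longrightarrow> s \<le> t \<Longrightarrow> n s \<le> n t"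
  using n_mono by (auto simp: mono_on_def)

lemma jump_eq:
  assumes "0 \<le> s" "s < u" "\<And>v. s \<le> v \<Longrightarrow> v < u \<Longrightarrow> n v = k"
  shows "jump l u = (\<Sum>i\<in>{k..<n u}. x i)"
proof -
  have "((\<lambda>_. \<Sum>i<k. x i) \<longlongrightarrow> (\<Sum>i<k. x i)) (at_left u)" by simp
  moreover have "\<forall>\<^sub>F v in at_left u. (\<Sum>i<k. x i) = l v"
    unfolding eventually_at_left_field using assms l by (intro exI[of _ s]) auto
  ultimately have "(l \<longlongrightarrow> (\<Sum>i<k. x i)) (at_left u)" by (rule Lim_transform_eventually)
  then have "left_lim l u = (\<Sum>i<k. x i)" by (rule left_lim_eqI)
  moreover have "k \<le> n u" using assms(3)[of s] assms(1,2) n_le[of s u] by auto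
  then have "{..<n u} = {..<k} \<union> {k..<n u}" "{..<k} \<inter> {k..<n u} = {}" by auto
  then have "(\<Sum>i<n u. x i) = (\<Sum>i<k. x i) + (\<Sum>i\<in>{k..<n u}. x i)" by (simp add: sum.union_disjoint)
  ultimately show ?thesis unfolding jump_def using l assms(1,2) by simp
qed

lemma no_jump:
  assumes "0 \<le> s" "s < u" "n s = n u"
  shows "jump l u = 0"
proof -
  have "n v = n u" if "s \<le> v" "v < u" for v using n_le[of s v] n_le[of v u] that assms by auto
  from jump_eq[OF assms(1,2) this] show ?thesis by simp
qed

definition J :: "real \<Rightarrow> real set" where
  "J e = {u\<in>{0<..e}. jump l u \<noteq> 0}"

text \<open>The counter strictly increases from one jump time of \<open>l\<close> to the next, so it
  is injective on them, with values at most \<open>n e\<close>.\<close>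

lemma finite_J: "finite (J e)"
proof (rule inj_on_finite[of n _ "{..n e}"])
  have "n u < n v" if "u \<in> J e" "v \<in> J e" "u < v" for u v
    using that no_jump[of u v] n_le[of u v] unfolding J_def by (auto simp: le_less)
  then show "inj_on n (J e)" by (intro inj_onI) (metis less_irrefl linorder_neqE)
  show "n ` J e \<subseteq> {..n e}" unfolding J_def using n_le by auto
qed simp

lemma qv_disc_eq: "qv_disc l t = (\<Sum>u\<in>J t. outer (jump l u))"
proof -
  have "qv_disc l t = (\<Sum>\<^sub>\<infinity>u\<in>J t. outer (jump l u))"
    unfolding qv_disc_def by (rule infsum_cong_neutral) (auto simp: J_def outer_def vec_eq_iff)
  then show ?thesis using finite_J by simp
qed

lemma qv_disc_step:
  assumes "s \<le> t"
  shows "qv_disc l s $ i $ j = (\<Sum>u\<in>J t. if u \<le> s then outer (jump l u) $ i $ j else 0)"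
proof -
  have "J s = J t \<inter> {u. u \<le> s}" using assms by (auto simp: J_def)
  then have "(\<Sum>u\<in>J s. outer (jump l u) $ i $ j) = (\<Sum>u\<in>J t. if u \<le> s then outer (jump l u) $ i $ j else 0)"
    using finite_J[of t] by (simp add: sum.inter_restrict)
  then show ?thesis by (simp add: qv_disc_eq)
qed

lemma matrix_LS_eq:
  assumes J: "has_matrix_LS_integral H (qv_disc l) K t I" and t: "0 \<le> t"
  shows "I = (\<Sum>u\<in>J t. H u ** outer (jump l u) ** K u)"
proof -
  obtain I' where I': "\<And>i j k m. has_LS_integral (\<lambda>s. H s $ i $ k * K s $ m $ j) (\<lambda>s. qv_disc l s $ k $ m) t (I' i j k m)"
    and I: "I = (\<chi> i j. \<Sum>k\<in>UNIV. \<Sum>m\<in>UNIV. I' i j k m)"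
    using J unfolding has_matrix_LS_integral_def by blast
  have e: "I' i j k m = (\<Sum>u\<in>J t. outer (jump l u) $ k $ m * (H u $ i $ k * K u $ m $ j))" for i j k m
    by (rule has_LS_integral_step[OF I' t finite_J _ qv_disc_step]) (auto simp: J_def)
  show ?thesis
  proof (simp only: vec_eq_iff, intro allI)
    fix i j
    have "I $ i $ j = (\<Sum>u\<in>J t. \<Sum>k\<in>UNIV. \<Sum>m\<in>UNIV. outer (jump l u) $ k $ m * (H u $ i $ k * K u $ m $ j))"
      unfolding I e by (simp add: sum.swap[of _ "J t"])
    also have "\<dots> = (\<Sum>u\<in>J t. (H u ** outer (jump l u) ** K u) $ i $ j)"
    proof (intro sum.cong refl)
      fix u
      have "(H u ** outer (jump l u) ** K u) $ i $ j = (\<Sum>m\<in>UNIV. \<Sum>k\<in>UNIV. outer (jump l u) $ k $ m * (H u $ i $ k * K u $ m $ j))"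
        unfolding matrix_matrix_mult_def by (simp add: sum_distrib_right sum_distrib_left mult_ac)
      then show "(\<Sum>k\<in>UNIV. \<Sum>m\<in>UNIV. outer (jump l u) $ k $ m * (H u $ i $ k * K u $ m $ j)) = (H u ** outer (jump l u) ** K u) $ i $ j"
        by (subst sum.swap) simp
    qed
    finally show "I $ i $ j = (\<Sum>u\<in>J t. H u ** outer (jump l u) ** K u) $ i $ j" by simp
  qed
qed

end

locale volatility_path = counting_path n x l
  for n :: "real \<Rightarrow> nat" and x :: "nat \<Rightarrow> real^'n" and l :: "real \<Rightarrow> real^'n" +
  fixes A B C :: "real^'n^'n" and y :: "real \<Rightarrow> real^'n^'n"
  assumes C: "C \<in> pd" and y_psd: "\<And>t. 0 \<le> t \<Longrightarrow> y t \<in> psd" and y: "cadlag y"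
    and y_eq: "\<And>t. 0 \<le> t \<Longrightarrow> \<exists>J. has_matrix_LS_integral (\<lambda>s. A ** psd_sqrt (C + left_lim y s)) (qv_disc l)
       (\<lambda>s. psd_sqrt (C + left_lim y s) ** transpose A) t J \<and>
       y t = y 0 + (LINT s:{0..t}|lborel. B ** left_lim y s + left_lim y s ** transpose B) + J"
begin

abbreviation "h \<equiv> \<lambda>s. B ** left_lim y s + left_lim y s ** transpose B"

text \<open>The jump of \<open>y\<close> at \<open>u\<close>: for a symmetric root R, the matrix A R
  (x x^T) R A^T is the outer square of the vector A R x.\<close>

definition jterm :: "real \<Rightarrow> real^'n^'n" where
  "jterm u = outer (A *v (msqrt (C + left_lim y u) *v jump l u))"

lemma left_psd: "0 < u \<Longrightarrow> left_lim y u \<in> psd"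
  by (rule Lim_in_closed_set[OF closed_psd _ _ cadlag_left_lim[OF y]])
     (auto simp: eventually_at_left_field intro!: exI[of _ 0] y_psd)

lemma y_sum:
  assumes t: "0 \<le> t"
  shows "y t = y 0 + integral {0..t} h + (\<Sum>u\<in>J t. jterm u)"
proof -
  obtain I where I: "has_matrix_LS_integral (\<lambda>s. A ** psd_sqrt (C + left_lim y s)) (qv_disc l)
       (\<lambda>s. psd_sqrt (C + left_lim y s) ** transpose A) t I"
     and eq: "y t = y 0 + (LINT s:{0..t}|lborel. h s) + I"
    using y_eq[OF t] by blast
  have "I = (\<Sum>u\<in>J t. jterm u)"
    unfolding matrix_LS_eq[OF I t]
  proof (intro sum.cong refl)
    fix u assume "u \<in> J t"
    then have "C + left_lim y u \<in> psd" using C left_psd by (auto simp: J_def intro: psd_add pd_psd)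
    then have ps: "psd_sqrt (C + left_lim y u) = msqrt (C + left_lim y u)" by (simp add: msqrt_def)
    have "transpose (msqrt (C + left_lim y u)) = msqrt (C + left_lim y u)" by (rule psdD(1)) simp
    then show "A ** psd_sqrt (C + left_lim y u) ** outer (jump l u) ** (psd_sqrt (C + left_lim y u) ** transpose A) = jterm u"
      unfolding ps jterm_def outer_matrix by (simp add: matrix_mul_assoc)
  qed
  moreover have "(LINT s:{0..t}|lborel. h s) = integral {0..t} h"
    by (rule set_borel_integral_eq_integral(2)[OF integrable_left_lim[OF y]])
  ultimately show ?thesis using eq by simp
qed

lemma y_increment:
  assumes s: "0 \<le> s" "s \<le> t"
  shows "y t = y s + integral {s..t} h + (\<Sum>u\<in>J t - J s. jterm u)"
proof -
  have int: "h integrable_on {0..t}"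
    by (rule set_borel_integral_eq_integral(1)[OF integrable_left_lim[OF y]])
  have "J s \<subseteq> J t" using s by (auto simp: J_def)
  then have "(\<Sum>u\<in>J t. jterm u) = (\<Sum>u\<in>J s. jterm u) + (\<Sum>u\<in>J t - J s. jterm u)"
    using finite_J by (metis add.commute sum.subset_diff)
  moreover have "integral {0..t} h = integral {0..s} h + integral {s..t} h"
    using Henstock_Kurzweil_Integration.integral_combine[OF s int] by simp
  ultimately show ?thesis using y_sum[of s] y_sum[of t] s by (simp add: algebra_simps)
qed

lemma path_between:
  assumes s: "0 \<le> s" "s < e" and n: "\<And>t. s \<le> t \<Longrightarrow> t < e \<Longrightarrow> n t = n s"
  shows "left_lim y e = flow B (e - s) (y s)"
    and "y e = flow B (e - s) (y s) + outer (A *v (msqrt (C + flow B (e - s) (y s)) *v jump l e))"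
proof -
  have J: "J t = J s" if "s \<le> t" "t < e" for t
  proof -
    have "u \<le> s" if u: "u \<in> J t" for u
    proof (rule ccontr)
      assume "\<not> u \<le> s"
      then have "jump l u = 0" using no_jump[of s u] n[of u] u s \<open>t < e\<close> by (auto simp: J_def)
      then show False using u by (simp add: J_def)
    qed
    then show ?thesis using that(1) by (auto simp: J_def)
  qed
  have int: "h integrable_on {s..e}"
    by (rule integrable_on_subinterval[OF set_borel_integral_eq_integral(1)[OF integrable_left_lim[OF y]]]) (use s in auto)
  have "y t = y s + integral {s..t} h" if "s \<le> t" "t < e" for t
    using y_increment[OF s(1) that(1)] J[OF that] by simp
  note f = continuous_path_flow[OF y s this int]
  show left: "left_lim y e = flow B (e - s) (y s)" by (rule f(1))
  have Je: "J e - J s = (if jump l e = 0 then {} else {e})"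
  proof -
    have "u \<in> J s" if "u \<in> J e" "u \<noteq> e" for u
    proof -
      have "u \<in> J (max s u)" "max s u < e" using that s by (auto simp: J_def)
      then show ?thesis using J[of "max s u"] by auto
    qed
    then show ?thesis using s by (auto simp: J_def)
  qed
  have "(\<Sum>u\<in>J e - J s. jterm u) = jterm e"
    unfolding Je by (simp add: jterm_def)
  then show "y e = flow B (e - s) (y s) + outer (A *v (msqrt (C + flow B (e - s) (y s)) *v jump l e))"
    using y_increment[OF s(1) less_imp_le[OF s(2)]] f(2) unfolding left jterm_def by (simp only:)
qed

lemma path_no_jump:
  assumes s: "0 \<le> s" "s < e" and n: "n e = n s"
  shows "y e = flow B (e - s) (y s)"
proof -
  have c: "n t = n s" if "s \<le> t" "t < e" for t using n_le[of s t] n_le[of t e] that s n by auto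
  have "jump l e = 0" by (rule no_jump[OF s n[symmetric]])
  then show ?thesis using path_between(2)[OF s c] by (simp only: matrix_vector_mult_0_right outer_0 add_0_right)
qed

text \<open>The jump time is the infimum of the times at which the counter exceeds its initial
  value. Right-continuity at \<open>s\<close> puts it after \<open>s\<close>, and right-continuity
  at the infimum shows that the counter has already increased there.\<close>

lemma path_one_jump:
  assumes s: "0 \<le> s" "s < e" and n: "n e = Suc (n s)"
  defines "\<tau> \<equiv> Inf {u\<in>{s..e}. n s < n u}"
  shows "s < \<tau>" "\<tau> \<le> e"
    "y e = flow B (e - \<tau>) (flow B (\<tau> - s) (y s) + outer (A *v (msqrt (C + flow B (\<tau> - s) (y s)) *v x (n s))))"
proof -
  let ?S = "{u\<in>{s..e}. n s < n u}"
  have e: "e \<in> ?S" using s n by auto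
  have bdd: "bdd_below ?S" by (auto intro: bdd_belowI)
  show te: "\<tau> \<le> e" unfolding \<tau>_def by (rule cInf_lower[OF e bdd])
  have ev: "\<exists>b>t. \<forall>v. t < v \<longrightarrow> v < b \<longrightarrow> n v = n t" if "0 \<le> t" for t
    using n_right[OF that] by (auto simp: tendsto_discrete eventually_at_right_field)
  obtain b where b: "b > s" "\<And>v. s < v \<Longrightarrow> v < b \<Longrightarrow> n v = n s" using ev[OF s(1)] by blast
  have "min b e \<le> \<tau>" unfolding \<tau>_def
  proof (rule cInf_greatest)
    fix u assume "u \<in> ?S" then show "min b e \<le> u" using b by (metis (no_types, lifting) CollectD atLeastAtMost_iff less_irrefl linorder_not_less min.coboundedI1 order_le_imp_less_or_eq)
  qed (use e in blast)
  then show st: "s < \<tau>" using b s by auto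
  have before: "n v = n s" if v: "s \<le> v" "v < \<tau>" for v
  proof -
    have "v \<notin> ?S" using cInf_lower[OF _ bdd, of v] v unfolding \<tau>_def by auto
    then have "\<not> n s < n v" using v te by auto
    then show ?thesis using n_le[of s v] s v by auto
  qed
  have at: "n \<tau> = Suc (n s)"
  proof -
    have "n \<tau> \<le> Suc (n s)" using n_le[of \<tau> e] te st s n by auto
    moreover have "n \<tau> \<noteq> n s"
    proof
      assume eq: "n \<tau> = n s"
      obtain c where c: "c > \<tau>" "\<And>v. \<tau> < v \<Longrightarrow> v < c \<Longrightarrow> n v = n \<tau>" using ev[of \<tau>] st s by auto
      have "c \<le> \<tau>" unfolding \<tau>_def
      proof (rule cInf_greatest)
        fix u assume u: "u \<in> ?S"
        show "c \<le> u"
        proof (rule ccontr)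
          assume "\<not> c \<le> u"
          moreover have "\<tau> \<le> u" unfolding \<tau>_def by (rule cInf_lower[OF u bdd])
          ultimately have "n u = n s" using c(2)[of u] eq by (cases "u = \<tau>") auto
          then show False using u by auto
        qed
      qed (use e in blast)
      then show False using c by simp
    qed
    moreover have "n s \<le> n \<tau>" using n_le[of s \<tau>] st s by auto
    ultimately show ?thesis by auto
  qed
  have j: "jump l \<tau> = x (n s)" using jump_eq[OF s(1) st before] unfolding at by simp
  have y1: "y \<tau> = flow B (\<tau> - s) (y s) + outer (A *v (msqrt (C + flow B (\<tau> - s) (y s)) *v x (n s)))"
    using path_between(2)[OF s(1) st before] unfolding j .
  have "y e = flow B (e - \<tau>) (y \<tau>)"
  proof (cases "\<tau> = e")
    case False
    show ?thesis by (rule path_no_jump) (use False st te s at n in auto)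
  qed simp
  then show "y e = flow B (e - \<tau>) (flow B (\<tau> - s) (y s) + outer (A *v (msqrt (C + flow B (\<tau> - s) (y s)) *v x (n s))))"
    unfolding y1 .
qed

end

section \<open>Measurable versions and maximal irreducibility measures\<close>

lemma grid_right_nat: "0 \<le> t \<Longrightarrow> grid_right m t = (real (nat \<lfloor>real (Suc m) * t\<rfloor>) + 1) / real (Suc m)"
  by (simp add: grid_right_def del: of_nat_Suc)

text \<open>Time integrals of transition probabilities require joint measurability in time and
  chance. The limit of right grid samples has it, and equals \<open>Y\<close> off the null set
  \<open>N\<close> that contains all outcomes whose path is not cadlag.\<close>

lemma cadlag_measurable_version:
  fixes Y :: "real \<Rightarrow> 'w \<Rightarrow> real^'n^'n"
  assumes meas: "\<And>t. 0 \<le> t \<Longrightarrow> Y t \<in> measurable M psd_space"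
    and cad: "AE \<omega> in M. cadlag (\<lambda>t. Y t \<omega>)"
  obtains Y' where "Y' \<in> measurable (borel \<Otimes>\<^sub>M M) psd_space" "\<And>t. 0 \<le> t \<Longrightarrow> AE \<omega> in M. Y t \<omega> = Y' (t, \<omega>)"
proof -
  from cad obtain N where N: "{\<omega>\<in>space M. \<not> cadlag (\<lambda>t. Y t \<omega>)} \<subseteq> N" "emeasure M N = 0" "N \<in> sets M"
    by (rule AE_E)
  note [measurable] = N(3)
  \<comment> \<open>Only nonnegative times are constrained, so time is cut off at 0. Since the grid
    index is a natural number, each \<open>Z m\<close> combines countably many measurable
    functions.\<close>
  define Z where "Z m = (\<lambda>(t, \<omega>). Y ((real (nat \<lfloor>real (Suc m) * max t 0\<rfloor>) + 1) / real (Suc m)) \<omega>)" for m :: nat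
  have Ym: "Y t \<in> borel_measurable M" if "0 \<le> t" for t
    using meas[OF that] by (simp add: measurable_restrict_space2_iff)
  have Zm [measurable]: "Z m \<in> borel_measurable (borel \<Otimes>\<^sub>M M)" for m
  proof -
    have "(\<lambda>p. (\<lambda>k p. Y ((real k + 1) / real (Suc m)) (snd p)) (nat \<lfloor>real (Suc m) * max (fst p) 0\<rfloor>) p) \<in> borel_measurable (borel \<Otimes>\<^sub>M M)"
    proof (rule measurable_compose_countable[where f = "\<lambda>k p. Y ((real k + 1) / real (Suc m)) (snd p)"])
      fix k :: nat
      have [measurable]: "Y ((real k + 1) / real (Suc m)) \<in> borel_measurable M" by (rule Ym) simp
      show "(\<lambda>p. Y ((real k + 1) / real (Suc m)) (snd p)) \<in> borel_measurable (borel \<Otimes>\<^sub>M M)" by measurable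
    qed measurable
    then show ?thesis unfolding Z_def by (simp add: case_prod_unfold)
  qed
  have Zlim: "(\<lambda>m. Z m (t, \<omega>)) \<longlonglongrightarrow> Y (max t 0) \<omega>" if "\<omega> \<in> space M - N" for t \<omega>
  proof -
    have "cadlag (\<lambda>t. Y t \<omega>)" using N(1) that by auto
    from filterlim_compose[OF cadlag_right[OF this, of "max t 0"] grid_right_tendsto]
    show ?thesis unfolding Z_def by (simp add: grid_right_nat)
  qed
  define Y' where "Y' = (\<lambda>p. if snd p \<in> N then 0 else lim (\<lambda>m. Z m p))"
  have "Y' \<in> borel_measurable (borel \<Otimes>\<^sub>M M)"
    unfolding Y'_def by measurable
  moreover have "Y' \<in> space (borel \<Otimes>\<^sub>M M) \<rightarrow> psd"
  proof
    fix p :: "real \<times> 'w" assume p: "p \<in> space (borel \<Otimes>\<^sub>M M)"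
    show "Y' p \<in> psd"
    proof (cases "snd p \<in> N")
      case False
      then have s: "snd p \<in> space M - N" using p by (auto simp: space_pair_measure)
      have "Y' p = Y (max (fst p) 0) (snd p)"
        using limI[OF Zlim[OF s, of "fst p"]] False by (simp add: Y'_def)
      also have "\<dots> \<in> psd" using measurable_space[OF meas, of "max (fst p) 0" "snd p"] s by (simp add: space_restrict_space)
      finally show ?thesis .
    qed (simp add: Y'_def)
  qed
  ultimately have "Y' \<in> measurable (borel \<Otimes>\<^sub>M M) psd_space" by (intro measurable_restrict_space2)
  moreover have "AE \<omega> in M. Y t \<omega> = Y' (t, \<omega>)" if "0 \<le> t" for t
  proof (rule AE_I[OF _ N(2,3)], rule subsetI, rule ccontr)
    fix \<omega> assume w: "\<omega> \<in> {\<omega> \<in> space M. Y t \<omega> \<noteq> Y' (t, \<omega>)}" "\<omega> \<notin> N"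
    then have "Y' (t, \<omega>) = Y t \<omega>" using limI[OF Zlim[of \<omega> t]] that by (simp add: Y'_def max_def)
    then show False using w by simp
  qed
  ultimately show ?thesis by (rule that)
qed

lemma emeasure_distr_version:
  assumes "Z \<in> measurable M S" "Y' \<in> measurable (borel \<Otimes>\<^sub>M M) S" "AE \<omega> in M. Z \<omega> = Y' (t, \<omega>)" "D \<in> sets S"
  shows "emeasure (distr M S Z) D = emeasure M (Pair t -` (Y' -` D \<inter> space (borel \<Otimes>\<^sub>M M)))"
proof -
  note [measurable] = assms(1,2,4)
  have "emeasure (distr M S Z) D = emeasure M (Z -` D \<inter> space M)"
    by (rule emeasure_distr) measurable
  also have "\<dots> = emeasure M ((\<lambda>\<omega>. Y' (t, \<omega>)) -` D \<inter> space M)"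
    using assms(3) by (intro emeasure_eq_AE) (auto intro!: measurable_sets[OF _ assms(4)])
  also have "(\<lambda>\<omega>. Y' (t, \<omega>)) -` D \<inter> space M = Pair t -` (Y' -` D \<inter> space (borel \<Otimes>\<^sub>M M))"
    by (auto simp: space_pair_measure)
  finally show ?thesis .
qed

lemma transition_measurable:
  fixes Y :: "real \<Rightarrow> 'w \<Rightarrow> real^'n^'n"
  assumes "prob_space M"
    and meas: "\<And>t. 0 \<le> t \<Longrightarrow> Y t \<in> measurable M psd_space"
    and cad: "AE \<omega> in M. cadlag (\<lambda>t. Y t \<omega>)"
    and D: "D \<in> sets psd_space"
  shows "\<exists>g. g \<in> borel_measurable borel \<and> (\<forall>t\<ge>0. emeasure (distr M psd_space (Y t)) D = g t)"
proof -
  interpret prob_space M by fact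
  obtain Y' where Y': "Y' \<in> measurable (borel \<Otimes>\<^sub>M M) psd_space" "\<And>t. 0 \<le> t \<Longrightarrow> AE \<omega> in M. Y t \<omega> = Y' (t, \<omega>)"
    using cadlag_measurable_version[OF meas cad] by blast
  have "(\<lambda>t. emeasure M (Pair t -` (Y' -` D \<inter> space (borel \<Otimes>\<^sub>M M)))) \<in> borel_measurable borel"
    by (rule measurable_emeasure_Pair) (rule measurable_sets[OF Y'(1) D])
  moreover have "emeasure (distr M psd_space (Y t)) D = emeasure M (Pair t -` (Y' -` D \<inter> space (borel \<Otimes>\<^sub>M M)))" if "0 \<le> t" for t
    by (rule emeasure_distr_version[OF meas[OF that] Y'(1) Y'(2)[OF that] D])
  ultimately show ?thesis by blast
qed

text \<open>\<open>r\<close> is the law of the process at an independent exponential time. The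
  exponential density is positive at all nonnegative times, so an r-null set is charged at almost no
  time.\<close>

lemma dominating_measure:
  fixes Y :: "real \<Rightarrow> 'w \<Rightarrow> real^'n^'n"
  assumes "prob_space M"
    and meas: "\<And>t. 0 \<le> t \<Longrightarrow> Y t \<in> measurable M psd_space"
    and cad: "AE \<omega> in M. cadlag (\<lambda>t. Y t \<omega>)"
  shows "\<exists>r. finite_measure r \<and> sets r = sets psd_space \<and>
    (\<forall>D\<in>sets psd_space. emeasure r D = 0 \<longrightarrow> (\<integral>\<^sup>+t\<in>{0..}. emeasure (distr M psd_space (Y t)) D \<partial>lborel) = 0)"
proof -
  interpret prob_space M by fact
  obtain Y' where Y' [measurable]: "Y' \<in> measurable (borel \<Otimes>\<^sub>M M) psd_space" and eq: "\<And>t. 0 \<le> t \<Longrightarrow> AE \<omega> in M. Y t \<omega> = Y' (t, \<omega>)"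
    using cadlag_measurable_version[OF meas cad] by blast
  let ?e = "density lborel (exponential_density 1)"
  interpret e: prob_space ?e by (rule prob_space_exponential_density) simp
  interpret pe: pair_prob_space ?e M ..
  define r where "r = distr (?e \<Otimes>\<^sub>M M) psd_space Y'"
  have Y'm [measurable]: "Y' \<in> measurable (?e \<Otimes>\<^sub>M M) psd_space"
    using Y' by (simp cong: measurable_cong_sets)
  have "prob_space r" unfolding r_def by (rule pe.prob_space_distr) measurable
  then have "finite_measure r" by (simp add: prob_space.finite_measure)
  moreover have "(\<integral>\<^sup>+t\<in>{0..}. emeasure (distr M psd_space (Y t)) D \<partial>lborel) = 0" if D: "D \<in> sets psd_space" "emeasure r D = 0" for D
  proof -
    let ?g = "\<lambda>t. emeasure M (Pair t -` (Y' -` D \<inter> space (borel \<Otimes>\<^sub>M M)))"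
    have YD: "Y' -` D \<inter> space (borel \<Otimes>\<^sub>M M) \<in> sets (borel \<Otimes>\<^sub>M M)" by (rule measurable_sets[OF Y' D(1)])
    have g [measurable]: "?g \<in> borel_measurable borel"
      by (rule measurable_emeasure_Pair[OF YD])
    have sp: "space (?e \<Otimes>\<^sub>M M) = space (borel \<Otimes>\<^sub>M M)" by (simp add: space_pair_measure)
    have st: "sets (?e \<Otimes>\<^sub>M M) = sets (borel \<Otimes>\<^sub>M M)" by (intro sets_pair_measure_cong) auto
    have "emeasure r D = emeasure (?e \<Otimes>\<^sub>M M) (Y' -` D \<inter> space (borel \<Otimes>\<^sub>M M))"
      unfolding r_def using D(1) by (subst emeasure_distr) (auto simp: sp)
    also have "\<dots> = (\<integral>\<^sup>+t. ?g t \<partial>?e)"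
      by (rule emeasure_pair_measure_alt) (use YD st in simp)
    also have "\<dots> = (\<integral>\<^sup>+t. ennreal (exponential_density 1 t) * ?g t \<partial>lborel)"
      by (rule nn_integral_density) (use g in simp_all)
    finally have "AE t in lborel. ennreal (exponential_density 1 t) * ?g t = 0"
      using D(2) g by (simp add: nn_integral_0_iff_AE del: mult_eq_0_iff)
    then have "AE t in lborel. emeasure (distr M psd_space (Y t)) D * indicator {0..} t = 0"
    proof eventually_elim
      case (elim t)
      then show ?case
        using emeasure_distr_version[OF meas[of t] Y' eq[of t] D(1)]
        by (auto simp: exponential_density_def indicator_def split: if_splits)
    qed
    then have "(\<integral>\<^sup>+t\<in>{0..}. emeasure (distr M psd_space (Y t)) D \<partial>lborel) = (\<integral>\<^sup>+t. 0 \<partial>(lborel :: real measure))"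
      by (intro nn_integral_cong_AE) auto
    then show ?thesis by simp
  qed
  ultimately show ?thesis by (intro exI[of _ r]) (auto simp: r_def)
qed

text \<open>Every irreducibility measure is absolutely continuous with respect to \<open>r\<close>, so it is equivalent to the
  restriction of \<open>r\<close> to some set. A set of maximal \<open>r\<close>-measure of this kind gives the maximal measure,
  without recourse to the Markov property.\<close>

lemma maximal_irreducibility_measure_exists:
  assumes r: "finite_measure r" "sets r = sets X"
    and dom: "\<And>D. D \<in> sets X \<Longrightarrow> emeasure r D = 0 \<Longrightarrow> \<exists>x\<in>space X. (\<integral>\<^sup>+t\<in>{0..}. emeasure (P t x) D \<partial>lborel) = 0"
    and P: "\<And>t x. sets (P t x) = sets X"
  shows "\<exists>\<psi>. maximal_irreducibility_measure X P \<psi>"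
proof -
  interpret r: finite_measure r by fact
  define Rp where "Rp D \<longleftrightarrow> (\<forall>x\<in>space X. 0 < (\<integral>\<^sup>+t\<in>{0..}. emeasure (P t x) D \<partial>lborel))" for D
  have Rp_mono: "Rp D'" if "Rp D" "D \<subseteq> D'" "D' \<in> sets X" for D D'
  proof -
    have "(\<integral>\<^sup>+t\<in>{0..}. emeasure (P t x) D \<partial>lborel) \<le> (\<integral>\<^sup>+t\<in>{0..}. emeasure (P t x) D' \<partial>lborel)" for x
      using that P by (intro nn_integral_mono mult_right_mono emeasure_mono) auto
    then show ?thesis using that(1) unfolding Rp_def by (meson less_le_trans)
  qed
  \<comment> \<open>The sets to which \<open>r\<close> can be restricted to give an irreducibility
    measure.\<close>
  define CC where "CC = {A\<in>sets X. \<forall>D\<in>sets X. D \<subseteq> A \<longrightarrow> 0 < emeasure r D \<longrightarrow> Rp D}"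
  have CC_Un: "(\<Union>i. A i) \<in> CC" if A: "\<And>i::nat. A i \<in> CC" for A
    unfolding CC_def
  proof safe
    show "(\<Union>i. A i) \<in> sets X" using A by (auto simp: CC_def)
    fix D assume D: "D \<in> sets X" "D \<subseteq> (\<Union>i. A i)" "0 < emeasure r D"
    have "\<exists>i. 0 < emeasure r (D \<inter> A i)"
    proof (rule ccontr)
      assume "\<not> (\<exists>i. 0 < emeasure r (D \<inter> A i))"
      then have "emeasure r (\<Union>i. D \<inter> A i) = 0"
        using A D r by (intro emeasure_UN_eq_0) (auto simp: CC_def)
      moreover have "(\<Union>i. D \<inter> A i) = D" using D(2) by auto
      ultimately show False using D(3) by simp
    qed
    then obtain i where i: "0 < emeasure r (D \<inter> A i)" ..
    have "D \<inter> A i \<in> sets X" using A[of i] D by (auto simp: CC_def)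
    then have "Rp (D \<inter> A i)" using A[of i] i by (auto simp: CC_def)
    then show "Rp D" using Rp_mono D(1) by blast
  qed
  have "{} \<in> CC" by (auto simp: CC_def)
  let ?S = "measure r ` CC"
  have bdd: "bdd_above ?S" by (auto intro!: bdd_aboveI r.bounded_measure)
  have ne: "?S \<noteq> {}" using \<open>{} \<in> CC\<close> by blast
  have "\<exists>A\<in>CC. Sup ?S - 1 / real (Suc n) < measure r A" for n
    using less_cSupD[OF ne, of "Sup ?S - 1 / real (Suc n)"] by auto
  then obtain A where A: "\<And>n. A n \<in> CC" "\<And>n. Sup ?S - 1 / real (Suc n) < measure r (A n)" by metis
  define As where "As = (\<Union>n. A n)"
  have As: "As \<in> CC" unfolding As_def by (rule CC_Un[OF A(1)])
  then have Ass: "As \<in> sets X" "As \<in> sets r" using r by (auto simp: CC_def)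
  have As_max: "measure r As \<ge> Sup ?S"
  proof (rule field_le_epsilon)
    fix e :: real assume "e > 0"
    then obtain n where "inverse (real (Suc n)) < e" using reals_Archimedean by blast
    moreover have "measure r (A n) \<le> measure r As"
      using Ass r A(1)[of n] unfolding As_def by (intro r.finite_measure_mono) (auto simp: CC_def)
    ultimately show "Sup ?S \<le> measure r As + e" using A(2)[of n] by (simp add: inverse_eq_divide del: of_nat_Suc)
  qed
  have null: "emeasure r (B - As) = 0" if B: "B \<in> CC" for B
  proof -
    have "(\<Union>i::nat. if i = 0 then B else As) \<in> CC" by (rule CC_Un) (use B As in auto)
    moreover have "(\<Union>i::nat. if i = 0 then B else As) = B \<union> As" by auto
    ultimately have "B \<union> As \<in> CC" by simp
    then have "measure r (B \<union> As) \<le> Sup ?S" by (intro cSup_upper bdd) auto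
    moreover have "measure r (B \<union> As) = measure r As + measure r (B - As)"
      using B Ass r by (subst r.finite_measure_Union[symmetric]) (auto simp: CC_def Un_commute intro!: arg_cong[of _ _ "measure r"])
    ultimately have "measure r (B - As) = 0" using As_max measure_nonneg[of r "B - As"] by linarith
    then show ?thesis by (simp add: r.emeasure_eq_measure)
  qed
  define \<psi> where "\<psi> = density r (indicator As)"
  have psi: "emeasure \<psi> D = emeasure r (As \<inter> D)" if "D \<in> sets X" for D
    unfolding \<psi>_def using that Ass r by (subst emeasure_density) (auto simp: indicator_inter_arith[symmetric])
  have "irreducible_wrt X P \<psi>"
    unfolding irreducible_wrt_def
  proof (intro conjI ballI impI)
    show "sets \<psi> = sets X" by (simp add: \<psi>_def r)
    have "finite_measure \<psi>"
      by (rule finite_measureI) (use psi[of "space X"] r Ass sets_eq_imp_space_eq[OF r(2)] in \<open>auto simp: \<psi>_def r.emeasure_eq_measure\<close>)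
    then show "sigma_finite_measure \<psi>" by (simp add: finite_measure.axioms)
    fix x D assume x: "x \<in> space X" and D: "D \<in> sets X" "0 < emeasure \<psi> D"
    then have "Rp (As \<inter> D)" using As psi[OF D(1)] Ass by (auto simp: CC_def)
    then have "Rp D" using Rp_mono D(1) by blast
    then show "0 < (\<integral>\<^sup>+t\<in>{0..}. emeasure (P t x) D \<partial>lborel)" using x by (simp add: Rp_def)
  qed
  moreover have "absolutely_continuous \<psi> \<phi>" if \<phi>: "irreducible_wrt X P \<phi>" for \<phi>
  proof -
    have s\<phi>: "sets \<phi> = sets r" using \<phi> r by (simp add: irreducible_wrt_def)
    have \<phi>Rp: "Rp D" if "D \<in> sets X" "0 < emeasure \<phi> D" for D
      using \<phi> that unfolding irreducible_wrt_def Rp_def by blast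
    \<comment> \<open>An r-null set fails to be reached from at least one state, so an
      irreducibility measure cannot charge it.\<close>
    have "absolutely_continuous r \<phi>"
      unfolding absolutely_continuous_def
    proof
      fix D assume D: "D \<in> null_sets r"
      then have "\<not> Rp D" using dom[of D] r by (auto simp: Rp_def null_sets_def)
      then have "emeasure \<phi> D = 0" using \<phi>Rp[of D] D r by (cases "emeasure \<phi> D = 0") (auto simp: null_sets_def zero_less_iff_neq_zero)
      then show "D \<in> null_sets \<phi>" using D s\<phi> by (auto simp: null_sets_def)
    qed
    from r.Radon_Nikodym[OF this s\<phi>] obtain f where f [measurable]: "f \<in> borel_measurable r" and den: "density r f = \<phi>" by blast
    \<comment> \<open>On the set where its density is positive, \<phi> and r have the same null
      sets; so this set belongs to \<open>CC\<close>, and by maximality it lies in \<open>As\<close>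
      up to an r-null set.\<close>
    define B where "B = {x\<in>space r. 0 < f x}"
    have Bm [measurable]: "B \<in> sets r" unfolding B_def by measurable
    have "B \<in> CC"
      unfolding CC_def
    proof safe
      show "B \<in> sets X" using Bm r by simp
      fix D assume D: "D \<in> sets X" "D \<subseteq> B" "0 < emeasure r D"
      note [measurable] = D(1)[folded r(2)]
      have "emeasure \<phi> D = (\<integral>\<^sup>+x. f x * indicator D x \<partial>r)"
        unfolding den[symmetric] by (rule emeasure_density) measurable
      moreover have "(\<integral>\<^sup>+x. f x * indicator D x \<partial>r) \<noteq> 0"
      proof
        assume "(\<integral>\<^sup>+x. f x * indicator D x \<partial>r) = 0"
        then have "AE x in r. f x * indicator D x = 0" by (subst (asm) nn_integral_0_iff_AE) auto
        then have "AE x in r. x \<notin> D" by eventually_elim (use D(2) in \<open>auto simp: B_def indicator_def split: if_splits\<close>)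
        then have "emeasure r D = 0" using D(1) r AE_iff_null_sets[of D r] by (auto simp: null_sets_def)
        then show False using D(3) by simp
      qed
      ultimately have "0 < emeasure \<phi> D" by (simp add: zero_less_iff_neq_zero)
      then show "Rp D" using \<phi>Rp D(1) by blast
    qed
    note nB = null[OF this]
    show ?thesis
      unfolding absolutely_continuous_def
    proof
      fix D assume D: "D \<in> null_sets \<psi>"
      then have DX: "D \<in> sets X" "D \<in> sets r" by (auto simp: \<psi>_def r null_sets_def)
      then have "emeasure r (As \<inter> D) = 0" using D psi[of D] by (auto simp: null_sets_def)
      then have "emeasure r ((B - As) \<union> (As \<inter> D)) = 0"
        using nB DX Ass by (intro emeasure_Un_null_set[THEN trans]) (auto simp: null_sets_def)
      then have "AE x in r. x \<notin> (B - As) \<union> (As \<inter> D)"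
        using DX Ass by (subst AE_iff_null_sets[symmetric]) (auto simp: null_sets_def)
      then have "AE x in r. f x * indicator D x = 0"
        using AE_space by eventually_elim (auto simp: B_def indicator_def)
      then have "emeasure \<phi> D = 0"
        unfolding den[symmetric] using DX by (subst emeasure_density) (auto simp: nn_integral_0_iff_AE)
      then show "D \<in> null_sets \<phi>" using DX s\<phi> by (auto simp: null_sets_def)
    qed
  qed
  ultimately show ?thesis unfolding maximal_irreducibility_measure_def by blast
qed

section \<open>Lebesgue measure on the symmetric matrices\<close>

lemma prod_Basis_vec:
  fixes f :: "'b::euclidean_space^'n \<Rightarrow> 'c::comm_monoid_mult"
  shows "(\<Prod>b\<in>Basis. f b) = (\<Prod>i\<in>UNIV. \<Prod>u\<in>Basis. f (axis i u))"
proof -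
  have B: "(Basis :: ('b^'n) set) = (\<lambda>(i, u). axis i u) ` (UNIV \<times> Basis)"
    by (auto simp: Basis_vec_def)
  have inj: "inj_on (\<lambda>(i :: 'n, u :: 'b). axis i u) (UNIV \<times> Basis)"
    by (auto simp: inj_on_def axis_eq_axis nonzero_Basis)
  show ?thesis
    unfolding B prod.reindex[OF inj] by (simp add: prod.cartesian_product case_prod_unfold)
qed

lemma measurable_PiM_vec [measurable]:
  "(\<lambda>v. \<chi> i. v (g i)) \<in> borel_measurable (\<Pi>\<^sub>M i\<in>I. (lborel :: 'b::euclidean_space measure))" if "range g \<subseteq> I" for g :: "'n::finite \<Rightarrow> 'i"
proof (intro borel_measurable_vecI)
  fix i
  have "(\<lambda>v. v (g i)) \<in> borel_measurable (\<Pi>\<^sub>M i\<in>I. (lborel :: 'b measure))"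
  proof -
    have "g i \<in> I" using that by auto
    from measurable_component_singleton[OF this, of "\<lambda>_. lborel"] show ?thesis by simp
  qed
  then show "(\<lambda>v. (\<chi> i. v (g i)) $ i) \<in> borel_measurable (\<Pi>\<^sub>M i\<in>I. (lborel :: 'b measure))" by simp
qed

text \<open>The free choice of the bijection allows rows to be indexed by the order of the jumps,
  and makes permutations of coordinates a mere change of index.\<close>

lemma lborel_vec_PiM:
  fixes g :: "'n::finite \<Rightarrow> 'i"
  assumes g: "bij_betw g UNIV I"
  shows "lborel = distr (\<Pi>\<^sub>M i\<in>I. lborel) borel (\<lambda>v. (\<chi> i. v (g i)) :: 'b::euclidean_space^'n)"
proof (rule lborel_eqI)
  interpret product_sigma_finite "\<lambda>_::'i. lborel :: 'b measure" ..
  have I: "finite I" "range g = I" "inj g" using g by (auto simp: bij_betw_def)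
  have gI: "g i \<in> I" for i using I by auto
  fix l u :: "'b^'n" assume lu: "\<And>b. b \<in> Basis \<Longrightarrow> l \<bullet> b \<le> u \<bullet> b"
  have lui: "l $ i \<bullet> b \<le> u $ i \<bullet> b" if "b \<in> Basis" for i b
    using lu[of "axis i b"] that by (auto simp: inner_axis Basis_vec_def)
  have pre: "(\<lambda>v. (\<chi> i. v (g i))) -` box l u \<inter> space (\<Pi>\<^sub>M i\<in>I. lborel) = (\<Pi>\<^sub>E i\<in>I. box (l $ (inv g i)) (u $ (inv g i)))"
  proof -
    have "(\<chi> i. v (g i)) \<in> box l u \<longleftrightarrow> (\<forall>i\<in>I. v i \<in> box (l $ (inv g i)) (u $ (inv g i)))" for v
      unfolding I(2)[symmetric] by (auto simp: mem_box Basis_vec_def inner_axis I(3))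
    then show ?thesis by (auto simp: space_PiM PiE_iff)
  qed
  have "emeasure (distr (\<Pi>\<^sub>M i\<in>I. lborel) borel (\<lambda>v. \<chi> i. v (g i))) (box l u) = (\<Prod>i\<in>I. emeasure lborel (box (l $ (inv g i)) (u $ (inv g i))))"
    by (subst emeasure_distr) (auto simp: pre I intro!: emeasure_PiM measurable_PiM_vec)
  also have "\<dots> = (\<Prod>i\<in>UNIV. emeasure lborel (box (l $ i) (u $ i)))"
    by (rule prod.reindex_bij_betw[OF g, symmetric, THEN trans]) (simp add: I(3))
  also have "\<dots> = (\<Prod>i\<in>UNIV. \<Prod>b\<in>Basis. ennreal ((u $ i - l $ i) \<bullet> b))"
    using lui by (simp add: emeasure_lborel_box prod_ennreal inner_diff_left)
  also have "\<dots> = (\<Prod>b\<in>Basis. ennreal ((u - l) \<bullet> b))"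
    by (subst prod_Basis_vec) (simp add: inner_axis)
  finally show "emeasure (distr (\<Pi>\<^sub>M i\<in>I. lborel) borel (\<lambda>v. \<chi> i. v (g i))) (box l u) = ennreal (\<Prod>b\<in>Basis. (u - l) \<bullet> b)"
    using lu by (simp add: prod_ennreal inner_diff_left)
qed simp

lemma emeasure_lborel_vec_rect:
  fixes A :: "'n::finite \<Rightarrow> 'b::euclidean_space set"
  assumes A: "\<And>i. A i \<in> sets borel"
  shows "{v. \<forall>i. v $ i \<in> A i} \<in> sets borel" "emeasure lborel {v. \<forall>i. v $ i \<in> A i} = (\<Prod>i\<in>UNIV. emeasure lborel (A i))"
proof -
  interpret product_sigma_finite "\<lambda>_::'n. lborel :: 'b measure" ..
  note [measurable] = A
  have "{v \<in> space borel. \<forall>i. v $ i \<in> A i} \<in> sets borel" by measurable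
  then show s: "{v. \<forall>i. v $ i \<in> A i} \<in> sets borel" by simp
  have "emeasure lborel {v. \<forall>i. v $ i \<in> A i} = emeasure (\<Pi>\<^sub>M i\<in>UNIV. lborel) (\<Pi>\<^sub>E i\<in>UNIV. A i)"
    by (subst lborel_vec_PiM[OF bij_id], subst emeasure_distr[OF _ s])
       (auto intro!: measurable_PiM_vec arg_cong[of _ _ "emeasure _"] simp: space_PiM PiE_iff)
  also have "\<dots> = (\<Prod>i\<in>UNIV. emeasure lborel (A i))" using A by (intro emeasure_PiM) auto
  finally show "emeasure lborel {v. \<forall>i. v $ i \<in> A i} = (\<Prod>i\<in>UNIV. emeasure lborel (A i))" .
qed

text \<open>Each set \<open>{i, j}\<close> gets a representative \<open>(i, j)\<close>; \<open>symz M\<close> is the symmetric matrix formed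
  from the entries of \<open>M\<close> at the representatives. Null sets of symmetric matrices are studied through
  their preimages under \<open>symz\<close>, where the remaining entries are free.\<close>

definition doubletons :: "'n::finite set set" where
  "doubletons = {s. \<exists>i j. s = {i, j}}"

definition pair_rep :: "'n::finite set \<Rightarrow> 'n \<times> 'n" where
  "pair_rep s = (SOME p. s = {fst p, snd p})"

definition symz :: "real^'n^'n \<Rightarrow> real^'n^'n" where
  "symz M = (\<chi> i j. M $ fst (pair_rep {i, j}) $ snd (pair_rep {i, j}))"

definition reps :: "('n::finite \<times> 'n) set" where
  "reps = pair_rep ` doubletons"

lemma pair_rep: "s \<in> doubletons \<Longrightarrow> {fst (pair_rep s), snd (pair_rep s)} = s"
  unfolding doubletons_def pair_rep_def by (rule someI2_ex[where P = "\<lambda>p. s = {fst p, snd p}"]) auto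

lemma pair_rep_in: "{i, j} \<in> doubletons" by (auto simp: doubletons_def)

lemma inj_pair_rep: "inj_on pair_rep doubletons"
  by (metis inj_onI pair_rep)

lemma symz_sym [simp]: "transpose (symz M) = symz M"
  by (simp add: symz_def transpose_def vec_eq_iff insert_commute)

lemma symz_id: assumes S: "transpose S = S" shows "symz S = S"
proof -
  have s: "S $ i $ j = S $ j $ i" for i j using S by (metis transpose_def vec_lambda_beta)
  have "S $ fst (pair_rep {i, j}) $ snd (pair_rep {i, j}) = S $ i $ j" for i j
    using pair_rep[OF pair_rep_in, of i j] s by (auto simp: doubleton_eq_iff)
  then show ?thesis by (simp add: symz_def vec_eq_iff)
qed

lemma symz_add: "symz (M + M') = symz M + symz M'"
  and symz_diff: "symz (M - M') = symz M - symz M'"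
  and symz_scaleR: "symz (c *\<^sub>R M) = c *\<^sub>R symz M"
  by (simp_all add: symz_def vec_eq_iff)

lemma linear_symz: "linear symz"
  by (simp add: linear_iff symz_add symz_scaleR)

lemma continuous_on_symz [continuous_intros]:
  assumes "continuous_on S f" shows "continuous_on S (\<lambda>x. symz (f x))"
  using continuous_on_compose2[OF linear_continuous_on[OF linear_conv_bounded_linear[THEN iffD1, OF linear_symz]] assms] by blast

lemma borel_measurable_symz [measurable (raw)]:
  "f \<in> borel_measurable M \<Longrightarrow> (\<lambda>x. symz (f x)) \<in> borel_measurable M"
  by (rule measurable_compose, assumption) (intro borel_measurable_continuous_onI continuous_intros)

lemma symz_vimage_borel: "D \<in> sets borel \<Longrightarrow> symz -` D \<in> sets borel"
  using measurable_sets[of symz borel borel D] borel_measurable_symz[OF measurable_ident] by simp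

text \<open>The entries that \<open>symz\<close> ignores are confined to an interval of length one.
  They then carry total mass one, and the push-forward under \<open>symz\<close> has the right
  weight.\<close>

definition aux_cube :: "(real^'n^'n) set" where
  "aux_cube = {M. \<forall>i j. M $ i $ j \<in> (if (i, j) \<in> reps then UNIV else {0..<1})}"

lemma matrix_rect:
  fixes A :: "'n::finite \<Rightarrow> 'n \<Rightarrow> real set"
  assumes A: "\<And>i j. A i j \<in> sets borel"
  shows "{M :: real^'n^'n. \<forall>i j. M $ i $ j \<in> A i j} \<in> sets borel"
    "emeasure lborel {M :: real^'n^'n. \<forall>i j. M $ i $ j \<in> A i j} = (\<Prod>(i, j)\<in>UNIV. emeasure lborel (A i j))"
proof -
  have e: "{M :: real^'n^'n. \<forall>i j. M $ i $ j \<in> A i j} = {M. \<forall>i. M $ i \<in> {v. \<forall>j. v $ j \<in> A i j}}" by auto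
  show "{M :: real^'n^'n. \<forall>i j. M $ i $ j \<in> A i j} \<in> sets borel"
    unfolding e by (intro emeasure_lborel_vec_rect(1) A)
  show "emeasure lborel {M :: real^'n^'n. \<forall>i j. M $ i $ j \<in> A i j} = (\<Prod>(i, j)\<in>UNIV. emeasure lborel (A i j))"
    unfolding e
    by (subst emeasure_lborel_vec_rect(2)) (simp_all add: emeasure_lborel_vec_rect A prod.cartesian_product flip: UNIV_Times_UNIV)
qed

lemma aux_cube_borel [measurable]: "aux_cube \<in> sets borel"
  unfolding aux_cube_def by (rule matrix_rect(1)) auto

text \<open>Lebesgue measure on \<open>aux_cube\<close> is a product in which the ignored entries
  have mass one, so the representative entries have exactly the product law that defines
  \<open>lebesgue_sym\<close>.\<close>

lemma lebesgue_sym_eq: "(lebesgue_sym :: (real^'n^'n) measure) = distr (density lborel (indicator aux_cube)) borel symz"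
proof -
  interpret product_sigma_finite "\<lambda>_::'n set. lborel :: real measure" ..
  let ?r = "\<lambda>M :: real^'n^'n. \<lambda>s\<in>doubletons. M $ fst (pair_rep s) $ snd (pair_rep s)"
  let ?m = "density lborel (indicator aux_cube) :: (real^'n^'n) measure"
  have rm: "?r \<in> measurable ?m (\<Pi>\<^sub>M s\<in>doubletons. lborel)"
    by (rule measurable_restrict) simp
  have eq: "distr ?m (\<Pi>\<^sub>M s\<in>doubletons. lborel) ?r = (\<Pi>\<^sub>M s\<in>doubletons. lborel)"
  proof (rule PiM_eqI)
    fix A :: "'n set \<Rightarrow> real set" assume "\<And>s. s \<in> doubletons \<Longrightarrow> A s \<in> sets lborel"
    then have A: "\<And>s. s \<in> doubletons \<Longrightarrow> A s \<in> sets borel" by simp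
    define A' where "A' i j = (if (i, j) \<in> reps then A {i, j} else {0..<1})" for i j
    have A'm: "A' i j \<in> sets borel" for i j
      unfolding A'_def using A[OF pair_rep_in] by auto
    have rs: "{i, j} \<in> doubletons \<and> pair_rep {i, j} = (i, j)" if ij: "(i, j) \<in> reps" for i j
    proof -
      obtain s where s: "s \<in> doubletons" "(i, j) = pair_rep s" using ij by (auto simp: reps_def)
      then have "{i, j} = s" using pair_rep[OF s(1)] by (metis fst_conv snd_conv)
      then show ?thesis using s by simp
    qed
    have "?r -` (\<Pi>\<^sub>E s\<in>doubletons. A s) \<inter> aux_cube = {M. \<forall>i j. M $ i $ j \<in> A' i j}"
    proof (intro set_eqI iffI)
      fix M assume M: "M \<in> ?r -` (\<Pi>\<^sub>E s\<in>doubletons. A s) \<inter> aux_cube"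
      then have *: "M $ fst (pair_rep s) $ snd (pair_rep s) \<in> A s" if "s \<in> doubletons" for s
        using that by (auto simp: PiE_iff)
      show "M \<in> {M. \<forall>i j. M $ i $ j \<in> A' i j}"
      proof safe
        fix i j show "M $ i $ j \<in> A' i j"
        proof (cases "(i, j) \<in> reps")
          case True
          then show ?thesis using *[of "{i, j}"] rs[OF True] by (simp add: A'_def)
        next
          case False
          have "M $ i $ j \<in> (if (i, j) \<in> reps then UNIV else {0..<1})" using M unfolding aux_cube_def by blast
          then show ?thesis using False by (simp add: A'_def)
        qed
      qed
    next
      fix M assume M: "M \<in> {M. \<forall>i j. M $ i $ j \<in> A' i j}"
      have "M $ fst (pair_rep s) $ snd (pair_rep s) \<in> A s" if s: "s \<in> doubletons" for s
      proof -
        have "pair_rep s \<in> reps" using s by (auto simp: reps_def)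
        then have "A' (fst (pair_rep s)) (snd (pair_rep s)) = A s" using pair_rep[OF s] by (simp add: A'_def)
        then show ?thesis using M by auto
      qed
      moreover have "M \<in> aux_cube"
        unfolding aux_cube_def
      proof safe
        fix i j
        have "M $ i $ j \<in> A' i j" using M by blast
        then show "M $ i $ j \<in> (if (i, j) \<in> reps then UNIV else {0..<1})" by (simp add: A'_def split: if_splits)
      qed
      ultimately show "M \<in> ?r -` (\<Pi>\<^sub>E s\<in>doubletons. A s) \<inter> aux_cube" by auto
    qed
    note pre = this
    have rect: "(\<Pi>\<^sub>E s\<in>doubletons. A s) \<in> sets (\<Pi>\<^sub>M s\<in>doubletons. lborel)"
      using A by (intro sets_PiM_I_finite) auto
    have "emeasure (distr ?m (\<Pi>\<^sub>M s\<in>doubletons. lborel) ?r) (\<Pi>\<^sub>E s\<in>doubletons. A s) = emeasure ?m (?r -` (\<Pi>\<^sub>E s\<in>doubletons. A s) \<inter> space ?m)"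
      by (rule emeasure_distr[OF rm rect])
    also have "\<dots> = emeasure lborel (?r -` (\<Pi>\<^sub>E s\<in>doubletons. A s) \<inter> aux_cube)"
      using measurable_sets[OF rm rect]
      by (subst emeasure_density) (auto simp: indicator_inter_arith[symmetric] Int_commute)
    also have "\<dots> = (\<Prod>(i, j)\<in>UNIV. emeasure lborel (A' i j))"
      unfolding pre by (rule matrix_rect(2)[OF A'm])
    also have "\<dots> = (\<Prod>p\<in>reps. emeasure lborel (A' (fst p) (snd p)))"
      by (rule prod.mono_neutral_cong_right) (auto simp: A'_def)
    also have "\<dots> = (\<Prod>s\<in>doubletons. emeasure lborel (A s))"
      unfolding reps_def by (subst prod.reindex[OF inj_pair_rep], rule prod.cong)
        (auto simp: A'_def reps_def pair_rep)
    finally show "emeasure (distr ?m (\<Pi>\<^sub>M s\<in>doubletons. lborel) ?r) (\<Pi>\<^sub>E s\<in>doubletons. A s) = (\<Prod>s\<in>doubletons. emeasure lborel (A s))" .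
  qed auto
  have "lebesgue_sym = distr (\<Pi>\<^sub>M s\<in>doubletons. lborel) borel (\<lambda>v. (\<chi> i j. v {i, j}) :: real^'n^'n)"
    by (simp add: lebesgue_sym_def doubletons_def)
  also have "\<dots> = distr (distr ?m (\<Pi>\<^sub>M s\<in>doubletons. lborel) ?r) borel (\<lambda>v. (\<chi> i j. v {i, j}) :: real^'n^'n)"
    unfolding eq ..
  also have "\<dots> = distr ?m borel ((\<lambda>v. (\<chi> i j. v {i, j})) \<circ> ?r)"
  proof (rule distr_distr[OF _ rm])
    show "(\<lambda>v. (\<chi> i j. v {i, j}) :: real^'n^'n) \<in> borel_measurable (\<Pi>\<^sub>M s\<in>doubletons. lborel)"
    proof (intro borel_measurable_vecI)
      fix i j :: 'n
      have "(\<lambda>v. v {i, j}) \<in> measurable (\<Pi>\<^sub>M s\<in>doubletons. lborel) (lborel :: real measure)"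
        by (rule measurable_component_singleton) (rule pair_rep_in)
      then show "(\<lambda>v. ((\<chi> i j. v {i, j}) :: real^'n^'n) $ i $ j) \<in> borel_measurable (\<Pi>\<^sub>M s\<in>doubletons. lborel)" by simp
    qed
  qed
  also have "(\<lambda>v. (\<chi> i j. v {i, j})) \<circ> ?r = symz"
    by (auto simp: symz_def fun_eq_iff pair_rep_in)
  finally show ?thesis .
qed

lemma sets_lebesgue_sym [measurable_cong, simp]: "sets lebesgue_sym = sets borel"
  by (simp add: lebesgue_sym_def)

lemma space_lebesgue_sym [simp]: "space lebesgue_sym = UNIV"
  by (simp add: lebesgue_sym_def)

lemma emeasure_lebesgue_sym:
  assumes "D \<in> sets borel" shows "emeasure lebesgue_sym D = emeasure lborel (aux_cube \<inter> symz -` D)"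
  using assms symz_vimage_borel[OF assms] unfolding lebesgue_sym_eq
  by (subst emeasure_distr) (auto simp: emeasure_density indicator_inter_arith[symmetric])

text \<open>The preimage of \<open>D\<close> under \<open>symz\<close> is invariant under shifts of
  the ignored entries, so countably many integer translates of its part in \<open>aux_cube\<close>
  cover it. Null sets of symmetric matrices can thus be tested in the space of all matrices.\<close>

lemma lebesgue_sym_null_iff:
  fixes D :: "(real^'n^'n) set"
  assumes D: "D \<in> sets borel" shows "emeasure lebesgue_sym D = 0 \<longleftrightarrow> emeasure lborel (symz -` D) = 0"
proof
  assume "emeasure lborel (symz -` D) = 0"
  then show "emeasure lebesgue_sym D = 0"
    unfolding emeasure_lebesgue_sym[OF D]
    using emeasure_mono[of "aux_cube \<inter> symz -` D" "symz -` D" lborel] symz_vimage_borel[OF D] by simp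
next
  assume z: "emeasure lebesgue_sym D = 0"
  define sh where "sh f = ((\<chi> i j. if (i, j) \<in> reps then 0 else of_int (f i j)) :: real^'n^'n)" for f :: "'n \<Rightarrow> 'n \<Rightarrow> int"
  have sh0: "symz (sh f) = 0" for f
    using pair_rep_in by (auto simp: symz_def sh_def vec_eq_iff reps_def)
  have cover: "symz -` D \<subseteq> (\<Union>f. (+) (sh f) ` (aux_cube \<inter> symz -` D))"
  proof
    fix M assume M: "M \<in> symz -` D"
    define f where "f i j = \<lfloor>M $ i $ j\<rfloor>" for i j
    have "M - sh f \<in> aux_cube"
      unfolding aux_cube_def sh_def f_def by (auto, linarith)
    moreover have "symz (M - sh f) = symz M" by (simp add: symz_diff sh0)
    ultimately have "M - sh f \<in> aux_cube \<inter> symz -` D" using M by simp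
    then have "M \<in> (+) (sh f) ` (aux_cube \<inter> symz -` D)" by (intro image_eqI[of _ _ "M - sh f"]) simp_all
    then show "M \<in> (\<Union>f. (+) (sh f) ` (aux_cube \<inter> symz -` D))" by blast
  qed
  have tr: "(+) a ` X = (+) (- a) -` X" for a :: "real^'n^'n" and X
    by (auto intro!: image_eqI[of _ _ "- a + _"])
  define X where "X = aux_cube \<inter> symz -` D"
  have X: "X \<in> sets borel" using symz_vimage_borel[OF D] by (auto simp: X_def)
  have Xs: "(+) (sh f) ` (aux_cube \<inter> symz -` D) \<in> null_sets lborel" for f
  proof -
    have m: "(+) (- sh f) -` X \<in> sets borel"
      using measurable_sets[OF _ X, of "(+) (- sh f)" borel] by simp
    have "emeasure lborel X = emeasure (distr lborel borel ((+) (- sh f))) X"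
      by (simp only: lborel_distr_plus)
    also have "\<dots> = emeasure lborel ((+) (- sh f) -` X)"
      by (subst emeasure_distr) (use X in auto)
    finally show ?thesis using z m unfolding tr emeasure_lebesgue_sym[OF D] X_def[symmetric] by (simp add: null_sets_def)
  qed
  have "(\<Union>f. (+) (sh f) ` (aux_cube \<inter> symz -` D)) \<in> null_sets lborel"
    by (rule null_sets_UN') (use Xs in auto)
  from null_sets_subset[OF this _ cover] symz_vimage_borel[OF D] show "emeasure lborel (symz -` D) = 0" by auto
qed

lemma sigma_finite_lebesgue_sym: "sigma_finite_measure (lebesgue_sym :: (real^'n^'n) measure)"
proof
  let ?A = "range (\<lambda>n::nat. cball 0 (real n) :: (real^'n^'n) set)"
  have "emeasure lebesgue_sym (cball (0 :: real^'n^'n) (real n)) \<noteq> \<infinity>" for n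
  proof -
    have "aux_cube \<inter> symz -` cball 0 (real n) \<subseteq> {M :: real^'n^'n. \<forall>i j. M $ i $ j \<in> {- (real n + 1)..real n + 1}}"
    proof safe
      fix M :: "real^'n^'n" and i j assume M: "M \<in> aux_cube" "symz M \<in> cball 0 (real n)"
      show "M $ i $ j \<in> {- (real n + 1)..real n + 1}"
      proof (cases "(i, j) \<in> reps")
        case True
        then obtain s where s: "s \<in> doubletons" "(i, j) = pair_rep s" by (auto simp: reps_def)
        then have "{i, j} = s" using pair_rep[OF s(1)] by (metis fst_conv snd_conv)
        then have "M $ i $ j = symz M $ i $ j" using s(2)[symmetric] by (simp add: symz_def)
        moreover have "\<bar>symz M $ i $ j\<bar> \<le> norm (symz M)"
          using component_le_norm_cart[of "symz M $ i" j] Finite_Cartesian_Product.norm_nth_le[of "symz M" i] by linarith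
        ultimately show ?thesis using M(2) by auto
      next
        case False
        have "M $ i $ j \<in> (if (i, j) \<in> reps then UNIV else {0..<1})" using M(1) unfolding aux_cube_def by blast
        then show ?thesis using False by auto
      qed
    qed
    then have "emeasure lebesgue_sym (cball (0 :: real^'n^'n) (real n)) \<le> emeasure lborel {M :: real^'n^'n. \<forall>i j. M $ i $ j \<in> {- (real n + 1)..real n + 1}}"
      by (subst emeasure_lebesgue_sym) (auto intro!: emeasure_mono matrix_rect(1)[of "\<lambda>_ _. {- (real n + 1)..real n + 1}"] simp: )
    also have "\<dots> < \<infinity>"
      by (subst matrix_rect(2)[of "\<lambda>_ _. {- (real n + 1)..real n + 1}"]) (auto simp: power_less_top_ennreal less_top[symmetric] power_eq_top_ennreal)
    finally show ?thesis by simp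
  qed
  moreover have "\<Union>?A = UNIV" using real_arch_simple by auto
  ultimately show "\<exists>A. countable A \<and> A \<subseteq> sets (lebesgue_sym :: (real^'n^'n) measure) \<and> \<Union> A = space lebesgue_sym \<and> (\<forall>a\<in>A. emeasure lebesgue_sym a \<noteq> \<infinity>)"
    by (intro exI[of _ ?A]) auto
qed

lemma negligible_borel_null: "negligible N \<Longrightarrow> N \<in> sets borel \<Longrightarrow> N \<in> null_sets lborel"
  by (simp add: negligible_iff_null_sets null_sets_completion_iff)

lemma pd_borel [measurable]: "(pd :: (real^'n^'n) set) \<in> sets borel"
proof -
  have "(pd :: (real^'n^'n) set) = psd \<inter> {S. det S \<noteq> 0}"
  proof (intro set_eqI iffI)
    fix S :: "real^'n^'n" assume "S \<in> pd"
    then show "S \<in> psd \<inter> {S. det S \<noteq> 0}" using pd_psd pd_invertible invertible_det_nz by auto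
  next
    fix S :: "real^'n^'n" assume S: "S \<in> psd \<inter> {S. det S \<noteq> 0}"
    have "0 < v \<bullet> (S *v v)" if "v \<noteq> 0" for v
    proof -
      have "S *v v \<noteq> 0" using S that invertible_det_nz[of S] by (metis IntD2 mem_Collect_eq matrix_left_invertible_ker invertible_left_inverse)
      then show ?thesis using S psd_quad_zero[of S v] psdD(2)[of S v] by force
    qed
    then show "S \<in> pd" using S by (auto simp: pd_def psd_def)
  qed
  moreover have "{S :: real^'n^'n. det S \<noteq> 0} \<in> sets borel"
  proof -
    have "{S \<in> space borel. det (S :: real^'n^'n) \<noteq> 0} \<in> sets borel" by measurable
    then show ?thesis by (simp only: space_borel UNIV_I simp_thms)
  qed
  ultimately show ?thesis by (metis psd_borel sets.Int)
qed

text \<open>Subtracting any positive multiple of the identity takes a psd matrix that is not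
  positive definite out of \<open>psd\<close>. So the set lies in the frontier of a convex set,
  which is negligible.\<close>

lemma null_psd_diff_pd: "emeasure lborel (symz -` (psd - pd) :: (real^'n^'n) set) = 0"
proof -
  have cv: "convex (symz -` (psd :: (real^'n^'n) set))"
    by (rule convex_linear_vimage[OF linear_symz convex_psd])
  have "symz -` (psd - pd) \<subseteq> frontier (symz -` (psd :: (real^'n^'n) set))"
  proof safe
    fix M :: "real^'n^'n" assume M: "symz M \<in> psd" "symz M \<notin> pd"
    then obtain v where v: "v \<noteq> 0" "v \<bullet> (symz M *v v) \<le> 0" by (auto simp: pd_def not_less)
    have "M \<notin> interior (symz -` psd)"
    proof
      assume "M \<in> interior (symz -` psd)"
      then obtain e where e: "e > 0" "cball M e \<subseteq> symz -` psd" by (auto simp: mem_interior_cball)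
      define c where "c = e / norm (mat 1 :: real^'n^'n)"
      have m1: "norm (mat 1 :: real^'n^'n) > 0" by (simp add: mat_def vec_eq_iff)
      have "M - c *\<^sub>R mat 1 \<in> cball M e" using e m1 by (simp add: dist_norm c_def)
      then have "M - c *\<^sub>R mat 1 \<in> symz -` psd" using e(2) by blast
      then have "symz (M - c *\<^sub>R mat 1) \<in> psd" by simp
      then have "0 \<le> v \<bullet> ((symz M - c *\<^sub>R mat 1) *v v)"
        by (simp add: symz_diff symz_scaleR symz_id psdD(2))
      also have "\<dots> = v \<bullet> (symz M *v v) - c * (v \<bullet> v)"
        by (simp add: matrix_vector_mult_diff_rdistrib scaleR_matrix_vector inner_diff_right)
      also have "\<dots> < 0"
      proof -
        have "0 < c" "0 < v \<bullet> v" using v e m1 by (simp_all add: c_def)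
        then have "0 < c * (v \<bullet> v)" by simp
        then show ?thesis using v(2) by linarith
      qed
      finally show False by simp
    qed
    moreover have "M \<in> closure (symz -` psd)" using M by (intro subsetD[OF closure_subset]) auto
    ultimately show "M \<in> frontier (symz -` psd)" by (simp add: frontier_def)
  qed
  then have "negligible (symz -` (psd - pd) :: (real^'n^'n) set)"
    using negligible_convex_frontier[OF cv] negligible_subset by blast
  moreover have "symz -` (psd - pd) \<in> sets (borel :: (real^'n^'n) measure)" by (intro symz_vimage_borel) auto
  ultimately show ?thesis using negligible_borel_null by (auto simp: null_sets_def)
qed

section \<open>Disintegration of Gram matrices\<close>

definition mask :: "real^'n^'n \<Rightarrow> real^'n^'n" where
  "mask S = (\<chi> i j. if (i, j) \<in> reps then S $ i $ j else 0)"

text \<open>Overwrites the representative entries of \<open>M\<close> by those of \<open>S\<close>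
  and keeps the auxiliary ones, see \<open>put_entry\<close>. Written as a linear correction, it is
  visibly differentiable.\<close>

definition put :: "real^'n^'n \<Rightarrow> real^'n^'n \<Rightarrow> real^'n^'n" where
  "put M S = M + mask (S - M)"

lemma linear_mask: "linear mask"
  by (auto simp: linear_iff mask_def vec_eq_iff)

lemma put_entry: "put M S $ i $ j = (if (i, j) \<in> reps then S $ i $ j else M $ i $ j)"
  by (simp add: put_def mask_def)

lemma pair_rep_reps: "pair_rep {i, j} \<in> reps"
  by (simp add: reps_def pair_rep_in)

lemma symz_put: "transpose S = S \<Longrightarrow> symz (put M S) = S"
  using symz_id[of S] by (simp add: symz_def put_entry pair_rep_reps vec_eq_iff)

lemma put_put [simp]: "put (put M R) S = put M S"
  by (simp add: put_entry vec_eq_iff)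

lemma put_symz [simp]: "put M (symz M) = M"
proof -
  have "symz M $ i $ j = M $ i $ j" if "(i, j) \<in> reps" for i j
  proof -
    obtain s where s: "s \<in> doubletons" "(i, j) = pair_rep s" by (metis imageE reps_def \<open>(i, j) \<in> reps\<close>)
    then have "{i, j} = s" using pair_rep[OF s(1)] by (metis fst_conv snd_conv)
    then show ?thesis using s(2)[symmetric] by (simp add: symz_def)
  qed
  then show ?thesis by (simp add: put_entry vec_eq_iff)
qed

lemma borel_measurable_put [measurable (raw)]:
  assumes [measurable]: "f \<in> borel_measurable M" "g \<in> borel_measurable M"
  shows "(\<lambda>x. put (f x) (g x)) \<in> borel_measurable M"
proof (intro borel_measurable_vecI)
  fix i j show "(\<lambda>x. put (f x) (g x) $ i $ j) \<in> borel_measurable M" unfolding put_entry by simp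
qed

definition gram :: "real^'n^'n \<Rightarrow> real^'n^'n" where
  "gram V = transpose V ** V"

lemma gram_sym [simp]: "transpose (gram V) = gram V"
  by (simp add: gram_def matrix_transpose_mul)

lemma borel_measurable_gram [measurable (raw)]:
  "f \<in> borel_measurable M \<Longrightarrow> (\<lambda>x. gram (f x)) \<in> borel_measurable M"
  unfolding gram_def by measurable

text \<open>The squared norm of \<open>V\<close> is the trace of its Gram matrix.\<close>

lemma norm_gram_le: "(norm V)\<^sup>2 \<le> real CARD('n) * norm (gram (V :: real^'n^'n))"
proof -
  have "(norm V)\<^sup>2 = (\<Sum>k\<in>UNIV. \<Sum>i\<in>UNIV. V $ k $ i * V $ k $ i)"
    by (simp add: dot_square_norm[symmetric] inner_vec_def)
  also have "\<dots> = (\<Sum>i\<in>UNIV. \<Sum>k\<in>UNIV. V $ k $ i * V $ k $ i)" by (rule sum.swap)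
  also have "\<dots> = (\<Sum>i\<in>UNIV. gram V $ i $ i)"
    by (simp add: gram_def matrix_matrix_mult_def transpose_def)
  also have "\<dots> \<le> (\<Sum>i\<in>(UNIV :: 'n set). norm (gram V))"
  proof (rule sum_mono)
    fix i
    show "gram V $ i $ i \<le> norm (gram V)"
      using component_le_norm_cart[of "gram V $ i" i] Finite_Cartesian_Product.norm_nth_le[of "gram V" i] by linarith
  qed
  finally show ?thesis by simp
qed

lemma invertible_matrix_inv: "invertible (R :: real^'n^'n) \<Longrightarrow> invertible (matrix_inv R)"
  using invertible_mult_left_inverse invertible_mult_right_inverse unfolding invertible_def by blast

lemma transpose_inv_mult:
  assumes "invertible (W :: real^'n^'n)"
  shows "transpose W ** transpose (matrix_inv W) = mat 1" "transpose (matrix_inv W) ** transpose W = mat 1"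
  using invertible_mult_left_inverse[OF assms] invertible_mult_right_inverse[OF assms]
  by (simp_all add: matrix_transpose_mul[symmetric])

lemma borel_measurable_fst' [measurable]: "fst \<in> borel_measurable (borel :: ('a::second_countable_topology \<times> 'b::second_countable_topology) measure)"
  and borel_measurable_snd' [measurable]: "snd \<in> borel_measurable (borel :: ('a::second_countable_topology \<times> 'b::second_countable_topology) measure)"
  by (intro borel_measurable_continuous_onI continuous_intros)+

text \<open>\<open>polar (M, W) = R W\<close> for the positive definite \<open>R\<close> with \<open>W\<^sup>T R\<^sup>2 W = symz M\<close>; thus the Gram
  matrix of \<open>polar (M, W)\<close> is \<open>symz M\<close>.\<close>

definition polar :: "(real^'n^'n) \<times> (real^'n^'n) \<Rightarrow> real^'n^'n" where
  "polar = (\<lambda>(M, W). msqrt (transpose (matrix_inv W) ** symz M ** matrix_inv W) ** W)"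

lemma borel_measurable_polar [measurable]: "polar \<in> borel_measurable borel"
proof -
  have "polar \<in> borel_measurable (borel \<Otimes>\<^sub>M borel)"
    unfolding polar_def by measurable
  then show ?thesis by (simp add: borel_prod)
qed

lemma polar_facts:
  assumes W: "invertible W" and M: "symz M \<in> pd"
  defines "R \<equiv> msqrt (transpose (matrix_inv W) ** symz M ** matrix_inv W)"
  shows "R \<in> pd" "polar (M, W) = R ** W" "transpose W ** (R ** R) ** W = symz M" "gram (polar (M, W)) = symz M"
    "invertible (polar (M, W))"
proof -
  let ?Q = "transpose (matrix_inv W) ** symz M ** matrix_inv W"
  have Qpsd: "?Q \<in> psd"
    using psd_congruence[OF pd_psd[OF M], of "transpose (matrix_inv W)"] by simp
  have Qinv: "invertible ?Q"
    by (intro invertible_mult transpose_invertible invertible_matrix_inv W pd_invertible M)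
  have "?Q \<in> pd"
  proof -
    have "0 < v \<bullet> (?Q *v v)" if "v \<noteq> 0" for v
    proof -
      have "?Q *v v \<noteq> 0" using Qinv that by (metis invertible_left_inverse matrix_left_invertible_ker)
      then show ?thesis using Qpsd psd_quad_zero[of ?Q v] psdD(2)[of ?Q v] by force
    qed
    then show ?thesis using Qpsd by (auto simp: pd_def psd_def)
  qed
  then show R: "R \<in> pd" unfolding R_def by (rule msqrt_pd)
  show p: "polar (M, W) = R ** W" by (simp add: polar_def R_def)
  have RR: "R ** R = ?Q" unfolding R_def by (rule msqrt_square[OF Qpsd])
  have "transpose W ** ?Q ** W = (transpose W ** transpose (matrix_inv W)) ** symz M ** (matrix_inv W ** W)"
    by (simp add: matrix_mul_assoc)
  then show e: "transpose W ** (R ** R) ** W = symz M"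
    unfolding RR by (simp add: transpose_inv_mult[OF W] invertible_mult_left_inverse[OF W])
  have "transpose R = R" using R by (simp add: pd_def)
  then have "gram (R ** W) = transpose W ** (R ** R) ** W"
    by (simp add: gram_def matrix_transpose_mul matrix_mul_assoc)
  then show "gram (polar (M, W)) = symz M" using e p by simp
  show "invertible (polar (M, W))" unfolding p by (intro invertible_mult pd_invertible R W)
qed

text \<open>A pair (M, V) stands for R = \<open>symz M\<close>, the auxiliary entries of
  \<open>M\<close>, and V. The Gram matrix of V takes the place of R in the first component, and R
  survives in the second one as the quotient of V by R.\<close>

definition gram_map :: "(real^'n^'n) \<times> (real^'n^'n) \<Rightarrow> (real^'n^'n) \<times> (real^'n^'n)" where
  "gram_map = (\<lambda>(M, V). (put M (gram V), matrix_inv (symz M) ** V))"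

text \<open>With W = R^-1 V the Gram matrix of V is W^T R^2 W. So the matrix under the root in
  \<open>polar\<close> is R^2, its root is R, and R W = V.\<close>

lemma polar_gram_map:
  assumes M: "symz M \<in> pd" and V: "invertible V"
  shows "polar (gram_map (M, V)) = V"
proof -
  let ?R = "symz M"
  have R: "invertible ?R" by (rule pd_invertible[OF M])
  define W where "W = matrix_inv ?R ** V"
  have RW: "?R ** W = V" using invertible_mult_right_inverse[OF R] by (simp add: W_def matrix_mul_assoc)
  have W: "invertible W" unfolding W_def by (intro invertible_mult invertible_matrix_inv R V)
  have "transpose (matrix_inv W) ** gram V ** matrix_inv W
     = (transpose (matrix_inv W) ** transpose W) ** (transpose ?R ** ?R) ** (W ** matrix_inv W)"
    unfolding RW[symmetric] gram_def by (simp add: matrix_transpose_mul matrix_mul_assoc)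
  also have "\<dots> = ?R ** ?R" by (simp add: transpose_inv_mult[OF W] invertible_mult_right_inverse[OF W])
  finally have "msqrt (transpose (matrix_inv W) ** gram V ** matrix_inv W) = ?R"
    using psd_sqrt_eqI[OF pd_psd[OF M] refl] psd_mult_self[OF pd_psd[OF M]] by (simp add: msqrt_def)
  then show ?thesis unfolding gram_map_def polar_def by (simp add: symz_put W_def[symmetric] RW)
qed

section \<open>Null sets under linear and differentiable maps\<close>

lemma AE_lborel_negligible:
  assumes "negligible N" "\<And>x. x \<notin> N \<Longrightarrow> P x"
  shows "AE x in lborel. P x"
proof -
  have "AE x in lebesgue. P x"
    by (rule AE_I'[of N]) (use assms in \<open>auto simp: negligible_iff_null_sets\<close>)
  then show ?thesis by (simp add: AE_completion_iff)
qed

lemma AE_lborel_negligibleD: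
  assumes "AE x in lborel. P x"
  shows "negligible {x. \<not> P x}"
proof -
  have "AE x in lebesgue. P x" using assms by (simp add: AE_completion_iff)
  then obtain N where N: "{x. \<not> P x} \<subseteq> N" "N \<in> null_sets lebesgue" by (auto elim!: AE_E simp: null_sets_def)
  then show ?thesis using negligible_iff_null_sets negligible_subset by blast
qed

lemma bounded_linear_symz: "bounded_linear symz"
  and bounded_linear_mask: "bounded_linear mask"
  using linear_symz linear_mask linear_conv_bounded_linear by blast+

lemma bounded_linear_transpose: "bounded_linear (transpose :: real^'n^'n \<Rightarrow> real^'n^'n)"
  by (subst linear_conv_bounded_linear[symmetric]) (simp add: linear_iff transpose_add transpose_scaleR)

lemma AE_lborel_mmult:
  fixes R :: "real^'n^'n" and P :: "real^'n^'n \<Rightarrow> bool"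
  assumes R: "invertible R" and P: "AE V in lborel. P V"
  shows "AE W in lborel. P (R ** W)"
proof (rule AE_lborel_negligible)
  let ?f = "\<lambda>V. matrix_inv R ** V"
  show "negligible (?f ` {V. \<not> P V})"
  proof (rule negligible_differentiable_image_negligible[OF order_refl AE_lborel_negligibleD[OF P]])
    show "?f differentiable_on {V. \<not> P V}"
      by (intro linear_imp_differentiable_on linear_conv_bounded_linear[THEN iffD2] bounded_linear_mmult_left)
  qed
  fix W assume W: "W \<notin> ?f ` {V. \<not> P V}"
  have "W = ?f (R ** W)" using invertible_mult_left_inverse[OF R] by (simp add: matrix_mul_assoc)
  then show "P (R ** W)" using W by blast
qed

lemma differentiable_bounded_linear:
  assumes "bounded_linear L" "f differentiable F" shows "(\<lambda>x. L (f x)) differentiable F"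
  using assms unfolding differentiable_def by (blast intro: bounded_linear.has_derivative)

lemma differentiable_mmult:
  fixes f g :: "'a::real_normed_vector \<Rightarrow> real^'n^'n"
  assumes "f differentiable (at x within S)" "g differentiable (at x within S)"
  shows "(\<lambda>x. f x ** g x) differentiable (at x within S)"
  using assms unfolding differentiable_def by (blast intro: bounded_bilinear.FDERIV[OF bounded_bilinear_mmult])

text \<open>This is \<open>gram_map\<close> in the coordinates (R, W) with V = R W, see
  \<open>gram_map_mult\<close>; it inverts the passage from the lifted Gram matrix and W to R and W.
  It contains neither a root nor an inverse, so it is polynomial and maps null sets to null
  sets.\<close>

definition gram_map_inv :: "(real^'n^'n) \<times> (real^'n^'n) \<Rightarrow> (real^'n^'n) \<times> (real^'n^'n)" where
  "gram_map_inv = (\<lambda>(M, W). (put M (transpose W ** (symz M ** symz M) ** W), W))"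

lemma gram_map_inv_differentiable:
  fixes F :: "((real^'n^'n) \<times> (real^'n^'n)) set"
  shows "gram_map_inv differentiable_on F"
  unfolding differentiable_on_def
proof
  fix p :: "(real^'n^'n) \<times> (real^'n^'n)" assume "p \<in> F"
  let ?F = "at p within F"
  have 1: "fst differentiable ?F" and 2: "snd differentiable ?F"
    by (auto intro: bounded_linear_imp_differentiable bounded_linear_fst bounded_linear_snd)
  have s: "(\<lambda>p. symz (fst p)) differentiable ?F"
    by (rule differentiable_bounded_linear[OF bounded_linear_symz 1])
  have t: "(\<lambda>p. transpose (snd p)) differentiable ?F"
    by (rule differentiable_bounded_linear[OF bounded_linear_transpose 2])
  have Q: "(\<lambda>p. transpose (snd p) ** (symz (fst p) ** symz (fst p)) ** snd p) differentiable ?F"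
    by (rule differentiable_mmult[OF differentiable_mmult[OF t differentiable_mmult[OF s s]] 2])
  have "(\<lambda>p. mask (transpose (snd p) ** (symz (fst p) ** symz (fst p)) ** snd p - fst p)) differentiable ?F"
    by (rule differentiable_bounded_linear[OF bounded_linear_mask differentiable_diff[OF Q 1]])
  from differentiable_Pair[OF differentiable_add[OF 1 this] 2]
  show "gram_map_inv differentiable ?F"
    unfolding gram_map_inv_def case_prod_unfold put_def .
qed

text \<open>The image under \<open>gram_map\<close> of the pairs with positive definite R and
  invertible V in the open unit ball.\<close>

definition polar_dom :: "((real^'n^'n) \<times> (real^'n^'n)) set" where
  "polar_dom = {(M, W). det W \<noteq> 0 \<and> symz M \<in> pd \<and> norm (polar (M, W)) < 1}"

lemma polar_dom_borel [measurable]: "(polar_dom :: ((real^'n^'n) \<times> (real^'n^'n)) set) \<in> sets borel"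
proof -
  have "{p \<in> space (borel :: ((real^'n^'n) \<times> (real^'n^'n)) measure). det (snd p) \<noteq> 0 \<and> symz (fst p) \<in> pd \<and> norm (polar p) < 1} \<in> sets borel"
    by measurable
  then show ?thesis by (simp add: polar_dom_def case_prod_unfold)
qed

text \<open>The preimage has the root R of \<open>polar_facts\<close> in place of the Gram matrix,
  with the same auxiliary entries and the same W.\<close>

lemma gram_map_inv_onto:
  assumes "p \<in> polar_dom"
  shows "\<exists>M W. p = gram_map_inv (M, W) \<and> symz M \<in> pd \<and> det W \<noteq> 0 \<and> norm (symz M ** W) < 1"
proof -
  obtain M W where p: "p = (M, W)" by (cases p)
  have W: "invertible W" and M: "symz M \<in> pd" and n: "norm (polar (M, W)) < 1"
    using assms by (auto simp: p polar_dom_def invertible_det_nz)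
  define R where "R = msqrt (transpose (matrix_inv W) ** symz M ** matrix_inv W)"
  note R = polar_facts[OF W M, folded R_def]
  have RS: "symz (put M R) = R" using R(1) by (intro symz_put) (simp add: pd_def)
  have "gram_map_inv (put M R, W) = p"
    unfolding gram_map_inv_def p by (simp add: RS R(3))
  then show ?thesis using RS R(1,2) n W by (intro exI[of _ "put M R"] exI[of _ W]) (auto simp: invertible_det_nz)
qed

lemma gram_map_mult:
  assumes "symz M \<in> pd"
  shows "gram_map (M, symz M ** W) = gram_map_inv (M, W)"
proof -
  have "matrix_inv (symz M) ** (symz M ** W) = W"
    using invertible_mult_left_inverse[OF pd_invertible[OF assms]] by (simp add: matrix_mul_assoc)
  then show ?thesis by (simp add: gram_map_def gram_map_inv_def gram_def matrix_transpose_mul matrix_mul_assoc)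
qed

lemma borel_measurable_gram_map [measurable]: "gram_map \<in> borel_measurable borel"
  and borel_measurable_gram_map_inv [measurable]: "gram_map_inv \<in> borel_measurable borel"
  unfolding gram_map_def gram_map_inv_def case_prod_unfold by measurable

text \<open>A matrix \<open>V\<close> in the unit ball is mapped to a lift of its Gram matrix, together with the auxiliary
  coordinate \<open>W = R\<^sup>-\<^sup>1 V\<close> for an independent positive definite \<open>R\<close>. For fixed \<open>R\<close> this is linear in \<open>V\<close>, and
  the inverse map is polynomial in \<open>(R, W)\<close>; so the image measure dominates Lebesgue measure, and
  \<open>j\<close> is obtained from the Radon-Nikodym density.\<close>

lemma gram_disintegration:
  obtains j :: "(real^'n^'n) \<times> (real^'n^'n) \<Rightarrow> ennreal" where
    "j \<in> borel_measurable borel"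
    "\<And>h. h \<in> borel_measurable borel \<Longrightarrow> (\<integral>\<^sup>+p. h (polar p) * j p \<partial>lborel) \<le> (\<integral>\<^sup>+V. h V \<partial>lborel)"
    "AE p in lborel. p \<in> polar_dom \<longrightarrow> 0 < j p"
    "\<And>N :: (real^'n^'n) set. N \<in> null_sets lborel \<Longrightarrow> AE p in lborel. p \<in> polar_dom \<longrightarrow> polar p \<notin> N"
    "\<And>p. p \<notin> polar_dom \<Longrightarrow> j p = 0"
proof -
  obtain k0 :: "real^'n^'n \<Rightarrow> real" where k0 [measurable]: "k0 \<in> borel_measurable lborel" "\<And>M. 0 < k0 M" "integrable lborel k0"
    by (metis sigma_finite_measure.obtain_positive_integrable_function[OF sigma_finite_lborel])
  define c where "c = integral\<^sup>L lborel k0"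
  have c0: "0 \<le> c" unfolding c_def by (intro Bochner_Integration.integral_nonneg) (use k0(2) less_imp_le in auto)
  \<comment> \<open>A strictly positive weight for the auxiliary matrix with total mass at most 1;
    the denominator 1 + c is positive whatever c is.\<close>
  define k where "k M = ennreal (k0 M / (1 + c))" for M
  have k [measurable]: "k \<in> borel_measurable borel" unfolding k_def using k0(1) by measurable
  have kpos: "0 < k M" for M unfolding k_def using k0(2) c0 by simp
  have kint: "(\<integral>\<^sup>+M. k M \<partial>lborel) \<le> 1"
  proof -
    have "(\<integral>\<^sup>+M. k M \<partial>lborel) = ennreal (integral\<^sup>L lborel (\<lambda>M. k0 M / (1 + c)))"
      unfolding k_def by (intro nn_integral_eq_integral) (use k0(3) c0 less_imp_le[OF k0(2)] in auto)
    also have "\<dots> = ennreal (c / (1 + c))" by (simp add: c_def)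
    also have "\<dots> \<le> ennreal 1" using c0 by (intro ennreal_leI) simp
    finally show ?thesis by simp
  qed
  define good where "good = {p :: (real^'n^'n) \<times> (real^'n^'n). symz (fst p) \<in> pd \<and> det (snd p) \<noteq> 0 \<and> norm (snd p) < 1}"
  have good [measurable]: "good \<in> sets borel"
  proof -
    have "{p \<in> space (borel :: ((real^'n^'n) \<times> (real^'n^'n)) measure). symz (fst p) \<in> pd \<and> det (snd p) \<noteq> 0 \<and> norm (snd p) < 1} \<in> sets borel"
      by measurable
    then show ?thesis by (simp add: good_def)
  qed
  define G where "G p = k (fst p) * indicator good p" for p :: "(real^'n^'n) \<times> (real^'n^'n)"
  have G [measurable]: "G \<in> borel_measurable borel" unfolding G_def by measurable
  define \<Theta> where "\<Theta> = distr (density lborel G) borel (gram_map :: (real^'n^'n) \<times> (real^'n^'n) \<Rightarrow> _)"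
  have sT [measurable_cong]: "sets \<Theta> = sets borel" by (simp add: \<Theta>_def)
  have intT: "(\<integral>\<^sup>+p. u p \<partial>\<Theta>) = (\<integral>\<^sup>+p. G p * u (gram_map p) \<partial>lborel)" if [measurable]: "u \<in> borel_measurable borel" for u
    unfolding \<Theta>_def by (simp add: nn_integral_distr nn_integral_density)
  have Gfub: "(\<integral>\<^sup>+p. G p * h (snd p) \<partial>lborel) \<le> (\<integral>\<^sup>+V\<in>ball 0 1. h V \<partial>lborel)" if [measurable]: "h \<in> borel_measurable borel" for h
  proof -
    have "(\<integral>\<^sup>+p. G p * h (snd p) \<partial>lborel) \<le> (\<integral>\<^sup>+p. k (fst p) * (h (snd p) * indicator (ball 0 1) (snd p)) \<partial>lborel)"
      by (intro nn_integral_mono) (auto simp: G_def good_def indicator_def)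
    also have "\<dots> = (\<integral>\<^sup>+p. k (fst p) * (h (snd p) * indicator (ball 0 1) (snd p)) \<partial>(lborel \<Otimes>\<^sub>M lborel))"
      by (simp add: lborel_prod)
    also have "\<dots> = (\<integral>\<^sup>+M. \<integral>\<^sup>+V. k M * (h V * indicator (ball 0 1) V) \<partial>lborel \<partial>lborel)"
    proof (subst lborel.nn_integral_fst[symmetric])
      have [measurable]: "ball (0 :: real^'n^'n) 1 \<in> sets borel" by simp
      have "(\<lambda>V. h V * indicator (ball 0 1) V) \<in> borel_measurable borel" by measurable
      from borel_measurable_times_ennreal[OF measurable_compose[OF borel_measurable_fst' k] measurable_compose[OF borel_measurable_snd' this]]
      have "(\<lambda>p. k (fst p) * (h (snd p) * indicator (ball 0 1) (snd p))) \<in> borel_measurable borel" .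
      then show "(\<lambda>p. k (fst p) * (h (snd p) * indicator (ball 0 1) (snd p))) \<in> borel_measurable (lborel \<Otimes>\<^sub>M lborel)"
        by (simp add: lborel_prod)
    qed simp
    also have "\<dots> = (\<integral>\<^sup>+M. k M \<partial>lborel) * (\<integral>\<^sup>+V\<in>ball 0 1. h V \<partial>lborel)"
    proof -
      have [measurable]: "ball (0 :: real^'n^'n) 1 \<in> sets borel" by simp
      show ?thesis by (simp add: nn_integral_cmult nn_integral_multc)
    qed
    also have "\<dots> \<le> 1 * (\<integral>\<^sup>+V\<in>ball 0 1. h V \<partial>lborel)" by (intro mult_right_mono kint) auto
    finally show ?thesis by simp
  qed
  have fin: "finite_measure \<Theta>"
  proof (rule finite_measureI)
    have "emeasure \<Theta> (space \<Theta>) = (\<integral>\<^sup>+p. 1 \<partial>\<Theta>)" by simp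
    also have "\<dots> = (\<integral>\<^sup>+p. G p * 1 \<partial>lborel)" by (rule intT) simp
    also have "\<dots> \<le> (\<integral>\<^sup>+V\<in>ball 0 1. 1 \<partial>(lborel :: (real^'n^'n) measure))" by (rule Gfub) simp
    also have "\<dots> = emeasure lborel (ball (0 :: real^'n^'n) 1)" by simp
    also have "\<dots> < \<infinity>" using emeasure_lborel_ball_finite by blast
    finally show "emeasure \<Theta> (space \<Theta>) \<noteq> \<infinity>" by simp
  qed
  interpret T: finite_measure \<Theta> by (rule fin)
  have polarT: "(\<integral>\<^sup>+p. h (polar p) \<partial>\<Theta>) \<le> (\<integral>\<^sup>+V. h V \<partial>lborel)" if [measurable]: "h \<in> borel_measurable borel" for h
  proof -
    have "(\<integral>\<^sup>+p. h (polar p) \<partial>\<Theta>) = (\<integral>\<^sup>+p. G p * h (polar (gram_map p)) \<partial>lborel)" by (rule intT) measurable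
    also have "\<dots> = (\<integral>\<^sup>+p. G p * h (snd p) \<partial>lborel)"
    proof (rule nn_integral_cong)
      fix p :: "(real^'n^'n) \<times> (real^'n^'n)"
      show "G p * h (polar (gram_map p)) = G p * h (snd p)"
      proof (cases "p \<in> good")
        case True
        then show ?thesis using polar_gram_map[of "fst p" "snd p"] by (simp add: good_def invertible_det_nz)
      qed (simp add: G_def)
    qed
    also have "\<dots> \<le> (\<integral>\<^sup>+V\<in>ball 0 1. h V \<partial>lborel)" by (rule Gfub) measurable
    also have "\<dots> \<le> (\<integral>\<^sup>+V. h V \<partial>lborel)" by (intro nn_integral_mono) (auto simp: indicator_def)
    finally show ?thesis .
  qed
  define N where "N = density lborel (indicator (polar_dom :: ((real^'n^'n) \<times> (real^'n^'n)) set))"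
  have sN: "sets N = sets \<Theta>" by (simp add: N_def sT)
  \<comment> \<open>If \<Theta> does not charge \<open>E\<close>, almost no good pair (M, V) is
    mapped into \<open>E\<close>. For fixed M the substitution V = R W carries this over to pairs
    (M, W), and the polynomial \<open>gram_map_inv\<close> maps the exceptional null set onto a set
    containing the part of \<open>E\<close> in \<open>polar_dom\<close>.\<close>
  have ac: "absolutely_continuous \<Theta> N"
    unfolding absolutely_continuous_def
  proof
    fix E assume E: "E \<in> null_sets \<Theta>"
    then have Eb [measurable]: "E \<in> sets borel" by (auto simp: sT null_sets_def)
    have "(\<integral>\<^sup>+p. G p * indicator E (gram_map p) \<partial>lborel) = 0"
      using E intT[of "indicator E"] by (simp add: null_sets_def)
    then have "AE p in lborel. G p * indicator E (gram_map p) = 0"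
      by (subst (asm) nn_integral_0_iff_AE) auto
    then have "AE p in (lborel \<Otimes>\<^sub>M lborel). \<not> (p \<in> good \<and> gram_map p \<in> E)"
      unfolding lborel_prod
    proof eventually_elim
      case (elim p) then show ?case using kpos[of "fst p"] by (auto simp: G_def)
    qed
    then have "AE M in lborel. AE V in lborel. \<not> ((M, V) \<in> good \<and> gram_map (M, V) \<in> E)"
      by (rule lborel_pair.AE_pair)
    then have ae: "AE M in lborel. AE W in lborel. \<not> (symz M \<in> pd \<and> det W \<noteq> 0 \<and> norm (symz M ** W) < 1 \<and> gram_map_inv (M, W) \<in> E)"
    proof eventually_elim
      case (elim M)
      show ?case
      proof (cases "symz M \<in> pd")
        case True
        have inv: "invertible (symz M)" by (rule pd_invertible[OF True])
        have "AE W in lborel. \<not> ((M, symz M ** W) \<in> good \<and> gram_map (M, symz M ** W) \<in> E)"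
          by (rule AE_lborel_mmult[OF inv elim])
        then show ?thesis
          by eventually_elim (use True inv in \<open>auto simp: good_def gram_map_mult det_mul invertible_det_nz\<close>)
      qed simp
    qed
    define F where "F = {p. symz (fst p) \<in> pd \<and> det (snd p) \<noteq> 0 \<and> norm (symz (fst p) ** snd p) < 1 \<and> gram_map_inv p \<in> E}"
    have Fm: "{p \<in> space (lborel \<Otimes>\<^sub>M lborel). \<not> p \<in> F} \<in> sets (lborel \<Otimes>\<^sub>M lborel)"
    proof -
      have "{p \<in> space (borel :: ((real^'n^'n) \<times> (real^'n^'n)) measure). \<not> (symz (fst p) \<in> pd \<and> det (snd p) \<noteq> 0 \<and> norm (symz (fst p) ** snd p) < 1 \<and> gram_map_inv p \<in> E)} \<in> sets borel"
        by measurable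
      then show ?thesis unfolding lborel_prod F_def by simp
    qed
    have "AE p in (lborel \<Otimes>\<^sub>M lborel). \<not> p \<in> F"
      by (rule lborel_pair.AE_pair_measure[OF Fm]) (use ae in \<open>simp add: F_def\<close>)
    then have "negligible F" using AE_lborel_negligibleD[of "\<lambda>p. \<not> p \<in> F"] unfolding lborel_prod by simp
    then have "negligible (gram_map_inv ` F)"
      by (rule negligible_differentiable_image_negligible[OF order_refl _ gram_map_inv_differentiable])
    moreover have "p \<in> gram_map_inv ` F" if p: "p \<in> polar_dom \<inter> E" for p
    proof -
      obtain M W where "p = gram_map_inv (M, W)" "symz M \<in> pd" "det W \<noteq> 0" "norm (symz M ** W) < 1"
        using gram_map_inv_onto[of p] p by blast
      then show ?thesis using p unfolding F_def by (intro image_eqI[of _ _ "(M, W)"]) auto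
    qed
    then have "polar_dom \<inter> E \<subseteq> gram_map_inv ` F" by blast
    ultimately have "negligible (polar_dom \<inter> E)" by (rule negligible_subset)
    then have "polar_dom \<inter> E \<in> null_sets lborel" by (rule negligible_borel_null) (rule sets.Int[OF polar_dom_borel Eb])
    then have "emeasure N E = 0"
      unfolding N_def by (subst emeasure_density) (auto simp: indicator_inter_arith[symmetric] null_sets_def)
    then show "E \<in> null_sets N" by (simp add: null_sets_def N_def)
  qed
  from T.Radon_Nikodym[OF ac sN] obtain f where f [measurable]: "f \<in> borel_measurable \<Theta>" and fN: "density \<Theta> f = N" by blast
  have fb [measurable]: "f \<in> borel_measurable borel" using f sT by simp
  have AE_N: "AE p in lborel. p \<in> polar_dom \<longrightarrow> Q p" if "AE p in \<Theta>. Q p" for Q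
  proof -
    have "AE p in N. Q p" by (rule absolutely_continuous_AE[OF sN ac that])
    then show ?thesis unfolding N_def by (subst (asm) AE_density) (auto simp: indicator_def)
  qed
  \<comment> \<open>\<open>f\<close> is the density of Lebesgue measure on \<open>polar_dom\<close>
    with respect to \<Theta>, so its reciprocal is a lower density of \<Theta> with respect to
    Lebesgue measure. It is positive where \<open>f\<close> is finite, that is \<Theta>-almost
    everywhere.\<close>
  define j where "j p = indicator polar_dom p * inverse (f p)" for p
  show ?thesis
  proof (rule that[of j])
    show j [measurable]: "j \<in> borel_measurable borel" unfolding j_def by measurable
    show "j p = 0" if "p \<notin> polar_dom" for p using that by (simp add: j_def)
    fix h :: "real^'n^'n \<Rightarrow> ennreal" assume h [measurable]: "h \<in> borel_measurable borel"
    have "(\<integral>\<^sup>+p. h (polar p) * j p \<partial>lborel) = (\<integral>\<^sup>+p. h (polar p) * inverse (f p) \<partial>N)"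
      unfolding N_def by (subst nn_integral_density) (auto simp: j_def mult_ac intro!: nn_integral_cong)
    also have "\<dots> = (\<integral>\<^sup>+p. f p * (h (polar p) * inverse (f p)) \<partial>\<Theta>)"
      unfolding fN[symmetric] by (rule nn_integral_density) measurable
    also have "\<dots> \<le> (\<integral>\<^sup>+p. h (polar p) \<partial>\<Theta>)"
    proof (rule nn_integral_mono)
      fix p
      have "f p * inverse (f p) \<le> 1"
        by (cases "f p = 0 \<or> f p = \<infinity>") (auto simp: ennreal_inverse_mult divide_ennreal_def[symmetric] ennreal_divide_self top.not_eq_extremum)
      then have "h (polar p) * (f p * inverse (f p)) \<le> h (polar p) * 1" by (intro mult_left_mono) auto
      then show "f p * (h (polar p) * inverse (f p)) \<le> h (polar p)" by (simp add: mult_ac)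
    qed
    also have "\<dots> \<le> (\<integral>\<^sup>+V. h V \<partial>lborel)" by (rule polarT[OF h])
    finally show "(\<integral>\<^sup>+p. h (polar p) * j p \<partial>lborel) \<le> (\<integral>\<^sup>+V. h V \<partial>lborel)" .
  next
    have "sigma_finite_measure N"
      unfolding N_def by (subst sigma_finite_measure.sigma_finite_iff_density_finite[OF sigma_finite_lborel]) (auto simp: indicator_def)
    then have "AE p in \<Theta>. f p \<noteq> \<infinity>"
      unfolding fN[symmetric] by (subst (asm) T.sigma_finite_iff_density_finite) auto
    from AE_N[OF this] show "AE p in lborel. p \<in> polar_dom \<longrightarrow> 0 < j p"
      by eventually_elim (auto simp: j_def zero_less_iff_neq_zero ennreal_inverse_eq_0_iff)
  next
    fix N0 :: "(real^'n^'n) set" assume N0: "N0 \<in> null_sets lborel"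
    then have [measurable]: "N0 \<in> sets borel" by (auto simp: null_sets_def)
    have "(\<integral>\<^sup>+p. indicator N0 (polar p) \<partial>\<Theta>) \<le> (\<integral>\<^sup>+V. indicator N0 V \<partial>lborel)" by (rule polarT) measurable
    also have "\<dots> = 0" using N0 by (simp add: null_sets_def)
    finally have "AE p in \<Theta>. indicator N0 (polar p) = (0 :: ennreal)"
      by (subst nn_integral_0_iff_AE[symmetric]) auto
    then have "AE p in \<Theta>. polar p \<notin> N0" by eventually_elim (auto simp: indicator_def split: if_splits)
    from AE_N[OF this] show "AE p in lborel. p \<in> polar_dom \<longrightarrow> polar p \<notin> N0" .
  qed
qed

lemma gram_rows:
  "gram V = (\<Sum>i\<in>UNIV. outer (V $ i))"
  by (simp add: gram_def outer_def matrix_matrix_mult_def transpose_def vec_eq_iff)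

section \<open>Densities for a prescribed number of jumps\<close>

lemma nn_integral_lborel_translate:
  fixes a :: "'b::euclidean_space"
  assumes [measurable]: "g \<in> borel_measurable borel"
  shows "(\<integral>\<^sup>+x. g (a + x) \<partial>lborel) = (\<integral>\<^sup>+x. g x \<partial>lborel)"
proof -
  have "(\<integral>\<^sup>+x. g x \<partial>lborel) = (\<integral>\<^sup>+x. g x \<partial>distr lborel borel ((+) a))"
    by (simp add: lborel_distr_plus)
  also have "\<dots> = (\<integral>\<^sup>+x. g (a + x) \<partial>lborel)" by (subst nn_integral_distr) auto
  finally show ?thesis by simp
qed

lemma nn_integral_lborel_vec:
  fixes g :: "'n::finite \<Rightarrow> 'i"
  assumes g: "bij_betw g UNIV I" and [measurable]: "h \<in> borel_measurable borel"
  shows "(\<integral>\<^sup>+x. h x \<partial>lborel) = (\<integral>\<^sup>+v. h ((\<chi> i. v (g i)) :: 'b::euclidean_space^'n) \<partial>(\<Pi>\<^sub>M i\<in>I. lborel))"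
  using g measurable_PiM_vec[of g I] by (subst lborel_vec_PiM[OF g], subst nn_integral_distr) (auto simp: bij_betw_def)

lemma nn_integral_lborel_diagonal:
  fixes A :: "real^'n^'n"
  assumes A: "\<And>i j. i \<noteq> j \<Longrightarrow> A $ i $ j = 0" and d: "det A \<noteq> 0" and [measurable]: "g \<in> borel_measurable borel"
  shows "(\<integral>\<^sup>+v. g v \<partial>lborel) = ennreal \<bar>det A\<bar> * (\<integral>\<^sup>+x. g (A *v x) \<partial>lborel)"
proof -
  define c :: "real^'n \<Rightarrow> real" where "c b = b \<bullet> (A *v b)" for b
  have det: "det A = (\<Prod>i\<in>UNIV. A $ i $ i)" by (rule det_diagonal) (rule A)
  have nz: "A $ i $ i \<noteq> 0" for i using d unfolding det by auto
  have Ax: "A *v x = (\<chi> i. A $ i $ i * x $ i)" for x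
  proof -
    have "(\<Sum>j\<in>UNIV. A $ i $ j * x $ j) = (\<Sum>j\<in>UNIV. if j = i then A $ i $ i * x $ i else 0)" for i
      by (intro sum.cong) (auto simp: A)
    then show ?thesis by (simp add: matrix_vector_mult_def)
  qed
  have cb: "c (axis i 1) = A $ i $ i" for i
    unfolding c_def Ax by (simp add: inner_axis')
  have Bas: "(Basis :: (real^'n) set) = range (\<lambda>i. axis i 1)" by (auto simp: Basis_vec_def)
  have inj: "inj (\<lambda>i. axis i 1 :: real^'n)" by (auto simp: inj_def axis_eq_axis)
  have T: "(0 + (\<Sum>j\<in>Basis. (c j * (x \<bullet> j)) *\<^sub>R j)) = A *v x" for x
  proof -
    have "(\<Sum>j\<in>Basis. (c j * (x \<bullet> j)) *\<^sub>R j) = (\<Sum>i\<in>UNIV. (A $ i $ i * x $ i) *\<^sub>R axis i 1)"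
      unfolding Bas sum.reindex[OF inj] by (simp add: cb inner_axis)
    also have "\<dots> = A *v x"
      unfolding Ax by (simp add: vec_eq_iff axis_def if_distrib cong: if_cong)
    finally show ?thesis by simp
  qed
  have "(\<Prod>j\<in>Basis. \<bar>c j\<bar>) = \<bar>det A\<bar>"
    unfolding Bas prod.reindex[OF inj] det abs_prod by (simp add: cb)
  then have "lborel = density (distr lborel borel (\<lambda>x. A *v x)) (\<lambda>_. ennreal \<bar>det A\<bar>)"
    using lborel_affine_euclidean[of c 0] nz unfolding T by (simp add: Bas cb image_iff) (metis cb)
  then have "(\<integral>\<^sup>+v. g v \<partial>lborel) = (\<integral>\<^sup>+v. g v \<partial>density (distr lborel borel (\<lambda>x. A *v x)) (\<lambda>_. ennreal \<bar>det A\<bar>))" by simp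
  also have "\<dots> = ennreal \<bar>det A\<bar> * (\<integral>\<^sup>+x. g (A *v x) \<partial>lborel)"
    by (simp add: nn_integral_density nn_integral_distr nn_integral_cmult)
  finally show ?thesis .
qed

text \<open>By Fubini: with the other coordinates fixed, the shear translates the coordinate
  \<open>m\<close>.\<close>

lemma nn_integral_lborel_shear:
  fixes g :: "real^'n \<Rightarrow> ennreal"
  assumes mn: "m \<noteq> n" and [measurable]: "g \<in> borel_measurable borel"
  shows "(\<integral>\<^sup>+x. g (\<chi> i. if i = m then x $ m + x $ n else x $ i) \<partial>lborel) = (\<integral>\<^sup>+x. g x \<partial>lborel)"
proof -
  interpret product_sigma_finite "\<lambda>_::'n. lborel :: real measure" ..
  let ?P = "\<Pi>\<^sub>M i\<in>UNIV - {m}. (lborel :: real measure)"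
  have ins: "(UNIV :: 'n set) = insert m (UNIV - {m})" by auto
  have vm: "(\<lambda>v. \<chi> i. v i) \<in> borel_measurable (\<Pi>\<^sub>M i\<in>UNIV. (lborel :: real measure))"
    by (rule measurable_PiM_vec) auto
  have split: "(\<integral>\<^sup>+x. h x \<partial>lborel) = (\<integral>\<^sup>+v. \<integral>\<^sup>+y. h (\<chi> i. (v(m := y)) i) \<partial>lborel \<partial>?P)" if h: "h \<in> borel_measurable borel" for h :: "real^'n \<Rightarrow> ennreal"
  proof -
    have "(\<integral>\<^sup>+x. h x \<partial>lborel) = (\<integral>\<^sup>+v. h (\<chi> i. v i) \<partial>(\<Pi>\<^sub>M i\<in>UNIV. lborel))"
      using nn_integral_lborel_vec[OF bij_id h] by simp
    also have "\<dots> = (\<integral>\<^sup>+v. \<integral>\<^sup>+y. h (\<chi> i. (v(m := y)) i) \<partial>lborel \<partial>?P)"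
      by (subst ins, rule product_nn_integral_insert) (use measurable_compose[OF vm h] in auto)
    finally show ?thesis .
  qed
  let ?s = "\<lambda>x :: real^'n. \<chi> i. if i = m then x $ m + x $ n else x $ i"
  have s: "?s \<in> borel_measurable borel" by (intro borel_measurable_vecI) simp
  have "(\<integral>\<^sup>+x. g (?s x) \<partial>lborel) = (\<integral>\<^sup>+v. \<integral>\<^sup>+y. g (?s (\<chi> i. (v(m := y)) i)) \<partial>lborel \<partial>?P)"
    by (rule split) (rule measurable_compose[OF s], simp)
  also have "\<dots> = (\<integral>\<^sup>+v. \<integral>\<^sup>+y. g (\<chi> i. (v(m := v n + y)) i) \<partial>lborel \<partial>?P)"
    using mn by (intro nn_integral_cong arg_cong[of _ _ g]) (auto simp: vec_eq_iff)
  also have "\<dots> = (\<integral>\<^sup>+v. \<integral>\<^sup>+y. g (\<chi> i. (v(m := y)) i) \<partial>lborel \<partial>?P)"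
  proof (rule nn_integral_cong)
    fix v :: "'n \<Rightarrow> real"
    have "(\<lambda>y. \<chi> i. (v(m := y)) i) \<in> borel_measurable borel"
      by (intro borel_measurable_vecI) (simp add: fun_upd_def)
    then have "(\<lambda>y. g (\<chi> i. (v(m := y)) i)) \<in> borel_measurable borel" by measurable
    from nn_integral_lborel_translate[OF this]
    show "(\<integral>\<^sup>+y. g (\<chi> i. (v(m := v n + y)) i) \<partial>lborel) = (\<integral>\<^sup>+y. g (\<chi> i. (v(m := y)) i) \<partial>lborel)" .
  qed
  also have "\<dots> = (\<integral>\<^sup>+x. g x \<partial>lborel)" by (rule split[symmetric]) simp
  finally show ?thesis .
qed

text \<open>The matrix is a product of diagonal matrices, transpositions of coordinates and shears;
  the determinant is multiplicative.\<close>

lemma nn_integral_lborel_mvmult: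
  fixes H :: "real^'n^'n"
  assumes "invertible H" and "g \<in> borel_measurable borel"
  shows "(\<integral>\<^sup>+v. g v \<partial>lborel) = ennreal \<bar>det H\<bar> * (\<integral>\<^sup>+x. g (H *v x) \<partial>lborel)"
proof -
  \<comment> \<open>The induction has to quantify over g, because for a product A B the claim for B
    is applied to g composed with A. The premise on the determinant disposes of matrices with a zero
    row.\<close>
  have "\<forall>g\<in>borel_measurable borel. det H \<noteq> 0 \<longrightarrow> (\<integral>\<^sup>+v. g v \<partial>lborel) = ennreal \<bar>det H\<bar> * (\<integral>\<^sup>+x. g (H *v x) \<partial>lborel)"
  proof (induction H rule: induct_matrix_elementary_alt)
    case (1 A B)
    show ?case
    proof (intro ballI impI)
      fix g :: "real^'n \<Rightarrow> ennreal" assume g [measurable]: "g \<in> borel_measurable borel" and "det (A ** B) \<noteq> 0"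
      then have d: "det A \<noteq> 0" "det B \<noteq> 0" by (auto simp: det_mul)
      have m: "(\<lambda>x. g (A *v x)) \<in> borel_measurable borel" by measurable
      have "(\<integral>\<^sup>+v. g v \<partial>lborel) = ennreal \<bar>det A\<bar> * (\<integral>\<^sup>+x. g (A *v x) \<partial>lborel)" using 1(1) g d by blast
      also have "(\<integral>\<^sup>+x. g (A *v x) \<partial>lborel) = ennreal \<bar>det B\<bar> * (\<integral>\<^sup>+x. g (A *v (B *v x)) \<partial>lborel)" using 1(2) m d by blast
      finally show "(\<integral>\<^sup>+v. g v \<partial>lborel) = ennreal \<bar>det (A ** B)\<bar> * (\<integral>\<^sup>+x. g ((A ** B) *v x) \<partial>lborel)"
        by (simp add: det_mul abs_mult ennreal_mult mult.assoc matrix_vector_mul_assoc)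
    qed
  next
    case (2 A i)
    then have "det A = 0" by (rule det_zero_row(2))
    then show ?case by simp
  next
    case (3 A)
    then show ?case using nn_integral_lborel_diagonal by blast
  next
    case (4 m n)
    let ?p = "Transposition.transpose m n"
    let ?M = "(\<chi> i j. mat 1 $ i $ ?p j) :: real^'n^'n"
    have det: "\<bar>det ?M\<bar> = 1"
      by (subst det_permute_columns) (auto simp: permutes_swap_id sign_swap_id abs_mult)
    have Mx: "?M *v x = (\<chi> i. x $ ?p i)" for x
    proof -
      have "(\<Sum>j\<in>UNIV. (if i = ?p j then 1 else 0) * x $ j) = (\<Sum>j\<in>UNIV. if j = ?p i then x $ j else 0)" for i
        by (intro sum.cong) auto
      then show ?thesis by (simp add: matrix_vector_mult_def mat_def)
    qed
    have bij: "bij_betw ?p UNIV UNIV" by simp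
    show ?case
    proof (intro ballI impI)
      fix g :: "real^'n \<Rightarrow> ennreal" assume g [measurable]: "g \<in> borel_measurable borel"
      have sm: "(\<lambda>x :: real^'n. \<chi> i. x $ ?p i) \<in> borel_measurable borel" by (intro borel_measurable_vecI) simp
      have "(\<integral>\<^sup>+x. g (\<chi> i. x $ ?p i) \<partial>lborel) = (\<integral>\<^sup>+v. g (\<chi> i. v (?p i)) \<partial>(\<Pi>\<^sub>M i\<in>UNIV. lborel))"
        using nn_integral_lborel_vec[OF bij_id measurable_compose[OF sm g]] by simp
      also have "\<dots> = (\<integral>\<^sup>+x. g x \<partial>lborel)" by (rule nn_integral_lborel_vec[OF bij g, symmetric])
      finally show "(\<integral>\<^sup>+v. g v \<partial>lborel) = ennreal \<bar>det ?M\<bar> * (\<integral>\<^sup>+x. g (?M *v x) \<partial>lborel)"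
        unfolding Mx det by simp
    qed
  next
    case (5 m n)
    let ?M = "(\<chi> i j. of_bool (i = m \<and> j = n \<or> i = j)) :: real^'n^'n"
    have "?M = (\<chi> k. if k = m then row m (mat 1) + 1 *s row n (mat 1) else row k (mat 1))"
      using 5 by (auto simp: vec_eq_iff row_def mat_def)
    then have det: "det ?M = 1" using det_row_operation[OF 5, of "mat 1 :: real^'n^'n" 1] by simp
    have Mx: "?M *v x = (\<chi> i. if i = m then x $ m + x $ n else x $ i)" for x
    proof -
      have "(\<Sum>j\<in>UNIV. of_bool (i = m \<and> j = n \<or> i = j) * x $ j) = (\<Sum>j\<in>UNIV. (if j = i then x $ i else 0) + (if j = n then if i = m then x $ n else 0 else 0))" for i
        using 5 by (intro sum.cong) auto
      then show ?thesis by (auto simp: matrix_vector_mult_def sum.distrib vec_eq_iff)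
    qed
    show ?case unfolding Mx det using nn_integral_lborel_shear[OF 5] by simp
  qed
  then show ?thesis using assms invertible_det_nz by blast
qed

lemma invertible_lower_bound:
  assumes "invertible (A :: real^'n^'n)"
  shows "\<exists>a>0. \<forall>x. a * norm x \<le> norm (A *v x)"
proof -
  have "norm x \<le> norm (matrix_inv A) * norm (A *v x)" for x
    using norm_matrix_vector_le[of "matrix_inv A" "A *v x"] invertible_mult_left_inverse[OF assms]
    by (simp add: matrix_vector_mul_assoc)
  moreover have "norm (matrix_inv A) * norm (A *v x) \<le> (1 + norm (matrix_inv A)) * norm (A *v x)" for x
    by (intro mult_right_mono) auto
  ultimately have "norm x \<le> (1 + norm (matrix_inv A)) * norm (A *v x)" for x by (meson order_trans)
  then show ?thesis
    by (intro exI[of _ "1 / (1 + norm (matrix_inv A))"]) (simp add: field_simps add_pos_nonneg)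
qed

section \<open>Increments within one block\<close>

locale jump_density =
  fixes A B C :: "real^'n^'n" and F :: "(real^'n) measure" and f :: "real^'n \<Rightarrow> ennreal" and V :: "(real^'n) set"
  assumes A: "invertible A" and C: "C \<in> pd"
    and F: "prob_space F" "sets F = sets borel"
    and f [measurable]: "f \<in> borel_measurable borel"
    and f_le: "\<And>h. h \<in> borel_measurable borel \<Longrightarrow> (\<integral>\<^sup>+x. h x * f x \<partial>lborel) \<le> (\<integral>\<^sup>+x. h x \<partial>F)"
    and V: "open V" "0 \<in> V" and f_pos: "AE x in lborel. x \<in> V \<longrightarrow> 0 < f x"
begin

declare F(2) [measurable_cong]

text \<open>A block of unit length is seen from its right end point: a jump \<open>x\<close> at offset \<open>1 - r\<close>, carried to
  the end of the block by the linear flow, contributes \<open>v v\<^sup>T\<close> with \<open>v = stepmat r y x\<close>. So the position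
  after a block is \<open>y\<close> plus a Gram matrix.\<close>

definition stepmat :: "real \<Rightarrow> real^'n^'n \<Rightarrow> real^'n^'n" where
  "stepmat r y = mexp B r ** A ** msqrt (C + flow B (- r) y)"

lemma borel_measurable_flow [measurable (raw)]:
  assumes [measurable]: "g \<in> borel_measurable M" "h \<in> borel_measurable M"
  shows "(\<lambda>x. flow B (g x) (h x)) \<in> borel_measurable M"
  unfolding flow_def by measurable

lemma borel_measurable_stepmat [measurable (raw)]:
  assumes [measurable]: "g \<in> borel_measurable M" "h \<in> borel_measurable M"
  shows "(\<lambda>x. stepmat (g x) (h x)) \<in> borel_measurable M"
  unfolding stepmat_def by measurable

lemma stepmat_pd: "y \<in> psd \<Longrightarrow> C + flow B (- r) y \<in> pd"
  by (intro pd_add C flow_psd)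

lemma stepmat_invertible: "y \<in> psd \<Longrightarrow> invertible (stepmat r y)"
  unfolding stepmat_def by (intro invertible_mult mexp_invertible A msqrt_pd stepmat_pd)

text \<open>Adding a psd matrix to \<open>C\<close> only increases the form, so \<open>C\<close>
  alone bounds the root from below, uniformly in y; compactness of [0, 1] gives uniformity in r. The
  constant determines how small a vector v must be in order to come from a jump in the neighborhood
  \<open>V\<close>.\<close>

lemma stepmat_lower_bound: "\<exists>c>0. \<forall>r\<in>{0..1}. \<forall>y\<in>psd. \<forall>x. c * norm x \<le> norm (stepmat r y *v x)"
proof -
  obtain a where a: "a > 0" "\<And>x. a * norm x \<le> norm (A *v x)" using invertible_lower_bound[OF A] by blast
  obtain c where c: "c > 0" "\<And>x. c * (norm x)\<^sup>2 \<le> x \<bullet> (C *v x)" using pd_lower_bound[OF C] by blast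
  have "compact ((\<lambda>r. mexp B (- r)) ` {0..1})"
    by (intro compact_continuous_image continuous_intros) auto
  then have "bounded ((\<lambda>r. mexp B (- r)) ` {0..1})" by (rule compact_imp_bounded)
  then obtain e where e: "e > 0" "\<And>r. r \<in> {0..1} \<Longrightarrow> norm (mexp B (- r)) \<le> e"
    unfolding bounded_pos by auto
  have "sqrt c * a / e * norm x \<le> norm (stepmat r y *v x)" if r: "r \<in> {0..1}" and y: "y \<in> psd" for r y x
  proof -
    let ?R = "msqrt (C + flow B (- r) y)"
    have "c * (norm x)\<^sup>2 \<le> x \<bullet> (C *v x) + x \<bullet> (flow B (- r) y *v x)"
      using c(2)[of x] psdD(2)[OF flow_psd[OF y], of x B "- r"] by simp
    also have "\<dots> = (norm (?R *v x))\<^sup>2"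
      by (simp add: norm_msqrt_mult[OF pd_psd[OF stepmat_pd[OF y]]] matrix_vector_mult_add_rdistrib inner_add_right)
    finally have "sqrt (c * (norm x)\<^sup>2) \<le> norm (?R *v x)" by (simp add: real_le_lsqrt)
    then have 1: "sqrt c * norm x \<le> norm (?R *v x)" by (simp add: real_sqrt_mult)
    have 2: "norm z \<le> e * norm (mexp B r *v z)" for z
    proof -
      have "norm z = norm (mexp B (- r) *v (mexp B r *v z))" by (simp add: matrix_vector_mul_assoc mexp_inverse)
      also have "\<dots> \<le> norm (mexp B (- r)) * norm (mexp B r *v z)" by (rule norm_matrix_vector_le)
      also have "\<dots> \<le> e * norm (mexp B r *v z)" by (intro mult_right_mono e r) auto
      finally show ?thesis .
    qed
    have "a * (sqrt c * norm x) \<le> a * norm (?R *v x)" using 1 a by (intro mult_left_mono) auto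
    also have "\<dots> \<le> norm (A *v (?R *v x))" by (rule a)
    also have "\<dots> \<le> e * norm (stepmat r y *v x)"
      using 2[of "A *v (?R *v x)"] by (simp add: stepmat_def matrix_vector_mul_assoc matrix_mul_assoc)
    finally show ?thesis using e by (simp add: field_simps)
  qed
  then show ?thesis using a c e by (intro exI[of _ "sqrt c * a / e"]) auto
qed

text \<open>The position after k jumps, carried to the end of the block by the flow alone;
  \<open>y\<close> is the start of the block carried along in the same way. The time left after jump
  k is 1 - \<tau> k.\<close>

primrec run :: "real^'n^'n \<Rightarrow> (nat \<Rightarrow> real) \<Rightarrow> (nat \<Rightarrow> real^'n) \<Rightarrow> nat \<Rightarrow> real^'n^'n" where
  "run y \<tau> X 0 = y"
| "run y \<tau> X (Suc k) = run y \<tau> X k + outer (stepmat (1 - \<tau> k) (run y \<tau> X k) *v X k)"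

text \<open>The same position in terms of the increments v instead of the jump sizes;
  \<open>vjump\<close> translates one into the other.\<close>

definition acc :: "real^'n^'n \<Rightarrow> (nat \<Rightarrow> real^'n) \<Rightarrow> nat \<Rightarrow> real^'n^'n" where
  "acc y v k = y + (\<Sum>i<k. outer (v i))"

definition vjump :: "real^'n^'n \<Rightarrow> (nat \<Rightarrow> real) \<Rightarrow> (nat \<Rightarrow> real^'n) \<Rightarrow> nat \<Rightarrow> real^'n" where
  "vjump y \<tau> X k = stepmat (1 - \<tau> k) (run y \<tau> X k) *v X k"

lemma run_acc: "run y \<tau> X k = acc y (vjump y \<tau> X) k"
  by (induction k) (simp_all add: acc_def vjump_def)

lemma run_psd: "y \<in> psd \<Longrightarrow> run y \<tau> X k \<in> psd"
  by (induction k) (auto intro: psd_add)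

lemma acc_psd: "y \<in> psd \<Longrightarrow> acc y v k \<in> psd"
  unfolding acc_def by (intro psd_add psd_sum) auto

lemma run_cong: "(\<And>i. i < k \<Longrightarrow> X i = X' i) \<Longrightarrow> run y \<tau> X k = run y \<tau> X' k"
  by (induction k) auto

lemma acc_cong: "(\<And>i. i < k \<Longrightarrow> v i = v' i) \<Longrightarrow> acc y v k = acc y v' k"
  by (auto simp: acc_def intro!: sum.cong)

lemma borel_measurable_run [measurable (raw)]:
  assumes "y \<in> borel_measurable M" "\<And>i. i < k \<Longrightarrow> (\<lambda>p. \<tau> p i) \<in> borel_measurable M" "\<And>i. i < k \<Longrightarrow> (\<lambda>p. X p i) \<in> borel_measurable M"
  shows "(\<lambda>p. run (y p) (\<tau> p) (X p) k) \<in> borel_measurable M"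
  using assms
proof (induction k)
  case (Suc k)
  have [measurable]: "(\<lambda>p. run (y p) (\<tau> p) (X p) k) \<in> borel_measurable M" using Suc by auto
  have [measurable]: "(\<lambda>p. \<tau> p k) \<in> borel_measurable M" "(\<lambda>p. X p k) \<in> borel_measurable M" using Suc by auto
  show ?case by simp
qed simp

lemma borel_measurable_acc [measurable (raw)]:
  assumes [measurable]: "y \<in> borel_measurable M" and v: "\<And>i. i < k \<Longrightarrow> (\<lambda>p. v p i) \<in> borel_measurable M"
  shows "(\<lambda>p. acc (y p) (v p) k) \<in> borel_measurable M"
  unfolding acc_def by (intro borel_measurable_add borel_measurable_sum borel_measurable_outer v) auto

text \<open>A minorant of the conditional density of the k-th increment given the earlier ones, on
  which the matrix depends through \<open>acc\<close>. Their product \<open>qden\<close> is a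
  minorant of the joint density.\<close>

definition vden :: "real^'n^'n \<Rightarrow> (nat \<Rightarrow> real) \<Rightarrow> (nat \<Rightarrow> real^'n) \<Rightarrow> nat \<Rightarrow> ennreal" where
  "vden y \<tau> v k = f (matrix_inv (stepmat (1 - \<tau> k) (acc y v k)) *v v k) * ennreal (1 / \<bar>det (stepmat (1 - \<tau> k) (acc y v k))\<bar>)"

definition qden :: "real^'n^'n \<Rightarrow> (nat \<Rightarrow> real) \<Rightarrow> (nat \<Rightarrow> real^'n) \<Rightarrow> nat \<Rightarrow> ennreal" where
  "qden y \<tau> v K = (\<Prod>k<K. vden y \<tau> v k)"

lemma borel_measurable_vden:
  assumes [measurable]: "y \<in> borel_measurable M" "(\<lambda>p. \<tau> p k) \<in> borel_measurable M" and v: "\<And>i. i \<le> k \<Longrightarrow> (\<lambda>p. v p i) \<in> borel_measurable M"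
  shows "(\<lambda>p. vden (y p) (\<tau> p) (v p) k) \<in> borel_measurable M"
proof -
  have [measurable]: "(\<lambda>p. acc (y p) (v p) k) \<in> borel_measurable M" by (intro borel_measurable_acc v) auto
  have [measurable]: "(\<lambda>p. v p k) \<in> borel_measurable M" by (rule v) simp
  have [measurable]: "(\<lambda>p. matrix_inv (stepmat (1 - \<tau> p k) (acc (y p) (v p) k)) *v v p k) \<in> borel_measurable M" by measurable
  show ?thesis unfolding vden_def by measurable
qed

lemma borel_measurable_qden:
  assumes "y \<in> borel_measurable M" "\<And>i. i < K \<Longrightarrow> (\<lambda>p. \<tau> p i) \<in> borel_measurable M" "\<And>i. i < K \<Longrightarrow> (\<lambda>p. v p i) \<in> borel_measurable M"
  shows "(\<lambda>p. qden (y p) (\<tau> p) (v p) K) \<in> borel_measurable M"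
  unfolding qden_def by (intro borel_measurable_prod_ennreal borel_measurable_vden) (use assms in auto)

lemma qden_Suc: "qden y \<tau> v (Suc K) = qden y \<tau> v K * vden y \<tau> v K"
  by (simp add: qden_def)

lemma vden_cong: "(\<And>i. i \<le> k \<Longrightarrow> v i = v' i) \<Longrightarrow> vden y \<tau> v k = vden y \<tau> v' k"
  using acc_cong[of k v v' y] by (simp add: vden_def)

lemma qden_cong: "(\<And>i. i < K \<Longrightarrow> v i = v' i) \<Longrightarrow> qden y \<tau> v K = qden y \<tau> v' K"
  unfolding qden_def by (intro prod.cong vden_cong) auto

lemma one_jump_bound:
  assumes y: "y \<in> psd" and [measurable]: "h \<in> borel_measurable borel"
  shows "(\<integral>\<^sup>+w. h w * (f (matrix_inv (stepmat r y) *v w) * ennreal (1 / \<bar>det (stepmat r y)\<bar>)) \<partial>lborel) \<le> (\<integral>\<^sup>+x. h (stepmat r y *v x) \<partial>F)"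
proof -
  let ?H = "stepmat r y"
  have H: "invertible ?H" by (rule stepmat_invertible[OF y])
  have d: "det ?H \<noteq> 0" using H invertible_det_nz by blast
  have "(\<integral>\<^sup>+w. h w * (f (matrix_inv ?H *v w) * ennreal (1 / \<bar>det ?H\<bar>)) \<partial>lborel) = ennreal (1 / \<bar>det ?H\<bar>) * (\<integral>\<^sup>+w. h w * f (matrix_inv ?H *v w) \<partial>lborel)"
    by (subst nn_integral_cmult[symmetric]) (auto simp: mult_ac)
  also have "(\<integral>\<^sup>+w. h w * f (matrix_inv ?H *v w) \<partial>lborel) = ennreal \<bar>det ?H\<bar> * (\<integral>\<^sup>+x. h (?H *v x) * f (matrix_inv ?H *v (?H *v x)) \<partial>lborel)"
    by (rule nn_integral_lborel_mvmult[OF H]) measurable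
  also have "\<dots> = ennreal \<bar>det ?H\<bar> * (\<integral>\<^sup>+x. h (?H *v x) * f x \<partial>lborel)"
    by (simp add: matrix_vector_mul_assoc invertible_mult_left_inverse[OF H])
  also have "ennreal (1 / \<bar>det ?H\<bar>) * (ennreal \<bar>det ?H\<bar> * (\<integral>\<^sup>+x. h (?H *v x) * f x \<partial>lborel)) = (\<integral>\<^sup>+x. h (?H *v x) * f x \<partial>lborel)"
    using d by (simp add: mult.assoc[symmetric] ennreal_mult[symmetric])
  also have "\<dots> \<le> (\<integral>\<^sup>+x. h (?H *v x) \<partial>F)"
    by (rule f_le) measurable
  finally show ?thesis .
qed

end

lemma AE_lborel_translate:
  fixes a :: "'b::euclidean_space"
  assumes "AE x in lborel. P x" shows "AE x in lborel. P (a + x)"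
proof (rule AE_lborel_negligible)
  show "negligible ((+) (- a) ` {x. \<not> P x})"
    by (rule negligible_translation[OF AE_lborel_negligibleD[OF assms]])
  fix x assume "x \<notin> (+) (- a) ` {x. \<not> P x}"
  moreover have "x = - a + (a + x)" by simp
  ultimately show "P (a + x)" by blast
qed

context jump_density
begin

lemma sets_PiM_lborel: "sets (\<Pi>\<^sub>M k\<in>I. (lborel :: (real^'n) measure)) = sets (\<Pi>\<^sub>M k\<in>I. borel)"
  by (rule sets_PiM_cong) simp_all

lemma sets_PiM_F: "sets (\<Pi>\<^sub>M k\<in>I. F) = sets (\<Pi>\<^sub>M k\<in>I. borel)"
  by (rule sets_PiM_cong) (simp_all add: F(2))

text \<open>The map from jump sizes to increments is triangular. Integrating out the last increment
  leaves a function \<open>h'\<close> of the others, to which the induction hypothesis applies; then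
  \<open>one_jump_bound\<close> turns the last increment into a jump size.\<close>

lemma jump_chain_bound:
  assumes y: "y \<in> psd" and h: "h \<in> borel_measurable (\<Pi>\<^sub>M k\<in>{..<K}. borel)"
  shows "(\<integral>\<^sup>+v. h v * qden y \<tau> v K \<partial>(\<Pi>\<^sub>M k\<in>{..<K}. lborel)) \<le> (\<integral>\<^sup>+X. h (\<lambda>k\<in>{..<K}. vjump y \<tau> X k) \<partial>(\<Pi>\<^sub>M k\<in>{..<K}. F))"
  using h
proof (induction K arbitrary: h)
  case 0
  show ?case by (simp add: PiM_empty nn_integral_count_space_finite qden_def restrict_def)
next
  case (Suc K)
  interpret L: product_sigma_finite "\<lambda>_::nat. lborel :: (real^'n) measure" ..
  interpret F0: prob_space F by (rule F)
  interpret PF: product_sigma_finite "\<lambda>_::nat. F" ..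
  let ?b = "\<Pi>\<^sub>M k\<in>{..<K}. (borel :: (real^'n) measure)"
  have ins: "{..<Suc K} = insert K {..<K}" by auto
  note h [measurable] = Suc.prems
  have comp: "(\<lambda>v. v k) \<in> borel_measurable (\<Pi>\<^sub>M k\<in>{..<K'}. (borel :: (real^'n) measure))" if "k < K'" for k K'
    by (rule measurable_component_singleton) (use that in simp)
  have upd: "(\<lambda>p. (fst p)(K := snd p)) \<in> measurable (?b \<Otimes>\<^sub>M borel) (\<Pi>\<^sub>M k\<in>{..<Suc K}. borel)"
    using measurable_add_dim[of K "{..<K}" "\<lambda>_. borel"] unfolding ins case_prod_unfold .
  have vdm: "(\<lambda>v. vden y \<tau> v K) \<in> borel_measurable (\<Pi>\<^sub>M k\<in>{..<Suc K}. borel)"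
    by (intro borel_measurable_vden comp) auto
  define h' where "h' v = (\<integral>\<^sup>+w. h (v(K := w)) * vden y \<tau> (v(K := w)) K \<partial>lborel)" for v
  have h'm: "h' \<in> borel_measurable ?b"
  proof -
    have "(\<lambda>p. h ((fst p)(K := snd p)) * vden y \<tau> ((fst p)(K := snd p)) K) \<in> borel_measurable (?b \<Otimes>\<^sub>M borel)"
      by (intro borel_measurable_times_ennreal measurable_compose[OF upd h] measurable_compose[OF upd vdm])
    then have "(\<lambda>(v, w). h (v(K := w)) * vden y \<tau> (v(K := w)) K) \<in> borel_measurable (?b \<Otimes>\<^sub>M lborel)"
      by (simp add: case_prod_unfold cong: measurable_cong_sets sets_pair_measure_cong)
    then show ?thesis unfolding h'_def by (rule lborel.borel_measurable_nn_integral)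
  qed
  have qm: "(\<lambda>v. qden y \<tau> v (Suc K)) \<in> borel_measurable (\<Pi>\<^sub>M k\<in>{..<Suc K}. borel)"
    by (intro borel_measurable_qden comp) auto
  have "(\<integral>\<^sup>+v. h v * qden y \<tau> v (Suc K) \<partial>(\<Pi>\<^sub>M k\<in>{..<Suc K}. lborel))
      = (\<integral>\<^sup>+v. \<integral>\<^sup>+w. h (v(K := w)) * qden y \<tau> (v(K := w)) (Suc K) \<partial>lborel \<partial>(\<Pi>\<^sub>M k\<in>{..<K}. lborel))"
    unfolding ins
  proof (rule L.product_nn_integral_insert)
    show "(\<lambda>v. h v * qden y \<tau> v (Suc K)) \<in> borel_measurable (\<Pi>\<^sub>M k\<in>insert K {..<K}. lborel)"
      using borel_measurable_times_ennreal[OF h qm] unfolding ins measurable_cong_sets[OF sets_PiM_lborel refl] .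
  qed auto
  also have "\<dots> = (\<integral>\<^sup>+v. h' v * qden y \<tau> v K \<partial>(\<Pi>\<^sub>M k\<in>{..<K}. lborel))"
  proof (rule nn_integral_cong)
    fix v assume v: "v \<in> space (\<Pi>\<^sub>M k\<in>{..<K}. (lborel :: (real^'n) measure))"
    have q: "qden y \<tau> (v(K := w)) K = qden y \<tau> v K" for w by (rule qden_cong) simp
    have m: "(\<lambda>w. v(K := w)) \<in> measurable borel (\<Pi>\<^sub>M k\<in>{..<Suc K}. (borel :: (real^'n) measure))"
      unfolding ins by (rule measurable_fun_upd[where J = "{..<K}"]) (use v in \<open>auto simp: space_PiM\<close>)
    have "(\<integral>\<^sup>+w. h (v(K := w)) * qden y \<tau> (v(K := w)) (Suc K) \<partial>lborel) = (\<integral>\<^sup>+w. h (v(K := w)) * vden y \<tau> (v(K := w)) K * qden y \<tau> v K \<partial>lborel)"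
      by (intro nn_integral_cong) (simp add: qden_Suc q mult_ac)
    also have "\<dots> = h' v * qden y \<tau> v K"
      unfolding h'_def
      by (rule nn_integral_multc)
         (use borel_measurable_times_ennreal[OF measurable_compose[OF m h] measurable_compose[OF m vdm]] in \<open>simp only: measurable_lborel2\<close>)
    finally show "(\<integral>\<^sup>+w. h (v(K := w)) * qden y \<tau> (v(K := w)) (Suc K) \<partial>lborel) = h' v * qden y \<tau> v K" .
  qed
  also have "\<dots> \<le> (\<integral>\<^sup>+X. h' (\<lambda>k\<in>{..<K}. vjump y \<tau> X k) \<partial>(\<Pi>\<^sub>M k\<in>{..<K}. F))"
    by (rule Suc.IH[OF h'm])
  also have "\<dots> \<le> (\<integral>\<^sup>+X. \<integral>\<^sup>+x. h (\<lambda>k\<in>{..<Suc K}. vjump y \<tau> (X(K := x)) k) \<partial>F \<partial>(\<Pi>\<^sub>M k\<in>{..<K}. F))"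
  proof (rule nn_integral_mono)
    fix X :: "nat \<Rightarrow> real^'n"
    let ?v = "\<lambda>k\<in>{..<K}. vjump y \<tau> X k"
    have r: "run y \<tau> X K = acc y ?v K" unfolding run_acc by (rule acc_cong) simp
    have m: "(\<lambda>w. ?v(K := w)) \<in> measurable borel (\<Pi>\<^sub>M k\<in>{..<Suc K}. (borel :: (real^'n) measure))"
      unfolding ins by (rule measurable_fun_upd[where J = "{..<K}"]) (auto simp: space_PiM)
    have ac: "acc y (?v(K := w)) K = acc y ?v K" for w by (rule acc_cong) simp
    have "h' ?v = (\<integral>\<^sup>+w. h (?v(K := w)) * (f (matrix_inv (stepmat (1 - \<tau> K) (acc y ?v K)) *v w) * ennreal (1 / \<bar>det (stepmat (1 - \<tau> K) (acc y ?v K))\<bar>)) \<partial>lborel)"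
      unfolding h'_def vden_def ac by simp
    also have "\<dots> \<le> (\<integral>\<^sup>+x. h (?v(K := stepmat (1 - \<tau> K) (acc y ?v K) *v x)) \<partial>F)"
      by (rule one_jump_bound[OF acc_psd[OF y] measurable_compose[OF m h]])
    also have "\<dots> = (\<integral>\<^sup>+x. h (\<lambda>k\<in>{..<Suc K}. vjump y \<tau> (X(K := x)) k) \<partial>F)"
    proof (intro nn_integral_cong arg_cong[of _ _ h] ext)
      fix x k
      have "run y \<tau> (X(K := x)) k' = run y \<tau> X k'" if "k' \<le> K" for k' by (rule run_cong) (use that in auto)
      then show "(?v(K := stepmat (1 - \<tau> K) (acc y ?v K) *v x)) k = (\<lambda>k\<in>{..<Suc K}. vjump y \<tau> (X(K := x)) k) k"
        using r by (auto simp: vjump_def less_Suc_eq)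
    qed
    finally show "h' ?v \<le> (\<integral>\<^sup>+x. h (\<lambda>k\<in>{..<Suc K}. vjump y \<tau> (X(K := x)) k) \<partial>F)" .
  qed
  also have "\<dots> = (\<integral>\<^sup>+X. h (\<lambda>k\<in>{..<Suc K}. vjump y \<tau> X k) \<partial>(\<Pi>\<^sub>M k\<in>{..<Suc K}. F))"
    unfolding ins
  proof (rule PF.product_nn_integral_insert[symmetric])
    have "(\<lambda>X. \<lambda>k\<in>{..<Suc K}. vjump y \<tau> X k) \<in> measurable (\<Pi>\<^sub>M k\<in>{..<Suc K}. borel) (\<Pi>\<^sub>M k\<in>{..<Suc K}. borel)"
      by (intro measurable_restrict) (auto simp: vjump_def intro!: borel_measurable_mvmult borel_measurable_stepmat borel_measurable_run comp)
    from measurable_compose[OF this h]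
    show "(\<lambda>X. h (\<lambda>k\<in>insert K {..<K}. vjump y \<tau> X k)) \<in> borel_measurable (\<Pi>\<^sub>M k\<in>insert K {..<K}. F)"
      unfolding ins measurable_cong_sets[OF sets_PiM_F refl] .
  qed auto
  finally show ?case .
qed

lemma one_jump_positive:
  assumes c: "c > 0" "\<And>x. c * norm x \<le> norm (stepmat r y *v x)" and y: "y \<in> psd" and \<rho>: "ball 0 \<rho> \<subseteq> V"
  shows "AE w in lborel. norm w < c * \<rho> \<longrightarrow> 0 < f (matrix_inv (stepmat r y) *v w)"
proof (rule AE_lborel_negligible)
  let ?H = "stepmat r y"
  have H: "invertible ?H" by (rule stepmat_invertible[OF y])
  show "negligible ((\<lambda>x. ?H *v x) ` {x. \<not> (x \<in> V \<longrightarrow> 0 < f x)})"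
    by (rule negligible_differentiable_image_negligible[OF order_refl AE_lborel_negligibleD[OF f_pos]])
       (simp add: linear_imp_differentiable_on)
  fix w assume w: "w \<notin> (\<lambda>x. ?H *v x) ` {x. \<not> (x \<in> V \<longrightarrow> 0 < f x)}"
  let ?x = "matrix_inv ?H *v w"
  have wx: "w = ?H *v ?x" using invertible_mult_right_inverse[OF H] by (simp add: matrix_vector_mul_assoc)
  then have "?x \<in> V \<longrightarrow> 0 < f ?x" using w by blast
  moreover have "?x \<in> V" if "norm w < c * \<rho>"
  proof -
    have "c * norm ?x < c * \<rho>" using c(2)[of ?x] wx that by simp
    then show ?thesis using c(1) \<rho> by auto
  qed
  ultimately show "norm w < c * \<rho> \<longrightarrow> 0 < f ?x" by blast
qed

text \<open>By Fubini, one coordinate at a time: the earlier increments fix the matrix, and the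
  exceptional set for the last one is the linear image of a null set.\<close>

lemma jump_chain_positive:
  assumes c: "c > 0" "\<And>r y x. r \<in> {0..1} \<Longrightarrow> y \<in> psd \<Longrightarrow> c * norm x \<le> norm (stepmat r y *v x)"
    and y: "y \<in> psd" and \<rho>: "ball 0 \<rho> \<subseteq> V" and \<tau>: "\<And>k. k < K \<Longrightarrow> \<tau> k \<in> {0..1}"
  shows "AE v in (\<Pi>\<^sub>M k\<in>{..<K}. lborel). \<forall>k<K. norm (v k) < c * \<rho> \<longrightarrow> 0 < vden y \<tau> v k"
  using \<tau>
proof (induction K)
  case (Suc K)
  interpret L: product_sigma_finite "\<lambda>_::nat. lborel :: (real^'n) measure" ..
  have ins: "{..<Suc K} = insert K {..<K}" by auto
  define ok where "ok K v \<longleftrightarrow> (\<forall>k<K. norm (v k) < c * \<rho> \<longrightarrow> 0 < vden y \<tau> v k)" for K v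
  have comp: "(\<lambda>v. v k) \<in> borel_measurable (\<Pi>\<^sub>M k\<in>{..<Suc K}. (lborel :: (real^'n) measure))" if "k < Suc K" for k
    using measurable_component_singleton[of k "{..<Suc K}" "\<lambda>_. lborel :: (real^'n) measure"] that by simp
  have okm: "{v \<in> space (\<Pi>\<^sub>M k\<in>{..<Suc K}. lborel). \<not> ok (Suc K) v} \<in> sets (\<Pi>\<^sub>M k\<in>{..<Suc K}. lborel)"
  proof -
    have [measurable]: "(\<lambda>v. vden y \<tau> v k) \<in> borel_measurable (\<Pi>\<^sub>M k\<in>{..<Suc K}. lborel)" if "k < Suc K" for k
      by (intro borel_measurable_vden comp) (use that in auto)
    have "{v \<in> space (\<Pi>\<^sub>M k\<in>{..<Suc K}. lborel). \<forall>k\<in>{..<Suc K}. norm (v k) < c * \<rho> \<longrightarrow> 0 < vden y \<tau> v k} \<in> sets (\<Pi>\<^sub>M k\<in>{..<Suc K}. lborel)"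
    proof (rule sets.sets_Collect_finite_All')
      fix k assume k: "k \<in> {..<Suc K}"
      have [measurable]: "(\<lambda>v. v k) \<in> borel_measurable (\<Pi>\<^sub>M k\<in>{..<Suc K}. (lborel :: (real^'n) measure))"
        "(\<lambda>v. vden y \<tau> v k) \<in> borel_measurable (\<Pi>\<^sub>M k\<in>{..<Suc K}. lborel)"
        using k comp by (auto intro!: borel_measurable_vden)
      show "{v \<in> space (\<Pi>\<^sub>M k\<in>{..<Suc K}. lborel). norm (v k) < c * \<rho> \<longrightarrow> 0 < vden y \<tau> v k} \<in> sets (\<Pi>\<^sub>M k\<in>{..<Suc K}. lborel)"
        by measurable
    qed auto
    then have "{v \<in> space (\<Pi>\<^sub>M k\<in>{..<Suc K}. lborel). ok (Suc K) v} \<in> sets (\<Pi>\<^sub>M k\<in>{..<Suc K}. lborel)"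
      by (simp add: ok_def)
    then show ?thesis by (rule sets.sets_Collect_neg)
  qed
  let ?bad = "{v \<in> space (\<Pi>\<^sub>M k\<in>{..<Suc K}. lborel). \<not> ok (Suc K) v}"
  have "emeasure (\<Pi>\<^sub>M k\<in>{..<Suc K}. lborel) ?bad = (\<integral>\<^sup>+v. indicator ?bad v \<partial>(\<Pi>\<^sub>M k\<in>{..<Suc K}. lborel))"
    using okm by simp
  also have "\<dots> = (\<integral>\<^sup>+v. \<integral>\<^sup>+w. indicator ?bad (v(K := w)) \<partial>lborel \<partial>(\<Pi>\<^sub>M k\<in>{..<K}. lborel))"
    using okm unfolding ins by (intro L.product_nn_integral_insert) auto
  also have "\<dots> = (\<integral>\<^sup>+v. 0 \<partial>(\<Pi>\<^sub>M k\<in>{..<K}. (lborel :: (real^'n) measure)))"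
  proof (rule nn_integral_cong_AE)
    have "AE v in (\<Pi>\<^sub>M k\<in>{..<K}. lborel). ok K v" unfolding ok_def using Suc by auto
    then show "AE v in (\<Pi>\<^sub>M k\<in>{..<K}. lborel). (\<integral>\<^sup>+w. indicator ?bad (v(K := w)) \<partial>lborel) = 0"
    proof eventually_elim
      case (elim v)
      let ?H = "stepmat (1 - \<tau> K) (acc y v K)"
      have rK: "1 - \<tau> K \<in> {0..1}" using Suc.prems[of K] by auto
      have d: "det ?H \<noteq> 0" using stepmat_invertible[OF acc_psd[OF y]] invertible_det_nz by blast
      have "AE w in lborel. norm w < c * \<rho> \<longrightarrow> 0 < f (matrix_inv ?H *v w)"
        by (rule one_jump_positive[OF c(1) c(2)[OF rK acc_psd[OF y]] acc_psd[OF y] \<rho>])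
      then have "AE w in lborel. indicator ?bad (v(K := w)) = (0 :: ennreal)"
      proof eventually_elim
        case (elim w)
        have "vden y \<tau> (v(K := w)) k = vden y \<tau> v k" if "k < K" for k by (rule vden_cong) (use that in auto)
        then have "ok K (v(K := w))" using \<open>ok K v\<close> by (simp add: ok_def)
        moreover have "acc y (v(K := w)) K = acc y v K" by (rule acc_cong) simp
        then have "norm w < c * \<rho> \<longrightarrow> 0 < vden y \<tau> (v(K := w)) K"
          using elim d by (simp add: vden_def ennreal_zero_less_mult_iff)
        ultimately have "ok (Suc K) (v(K := w))" by (auto simp: ok_def less_Suc_eq)
        then show ?case by simp
      qed
      then have "(\<integral>\<^sup>+w. indicator ?bad (v(K := w)) \<partial>lborel) = (\<integral>\<^sup>+w. 0 \<partial>(lborel :: (real^'n) measure))"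
        by (rule nn_integral_cong_AE)
      then show ?case by simp
    qed
  qed
  finally have "emeasure (\<Pi>\<^sub>M k\<in>{..<Suc K}. lborel) ?bad = 0" by simp
  then have "AE v in (\<Pi>\<^sub>M k\<in>{..<Suc K}. lborel). ok (Suc K) v"
    using okm by (intro AE_I'[of ?bad]) (auto simp: null_sets_def)
  then show ?case by (simp only: ok_def)
qed simp

end

section \<open>Density minorant for a block of d jumps\<close>

locale gram_density = jump_density A B C F f V
  for A B C :: "real^'n^'n" and F :: "(real^'n) measure" and f :: "real^'n \<Rightarrow> ennreal" and V :: "(real^'n) set" +
  fixes j :: "(real^'n^'n) \<times> (real^'n^'n) \<Rightarrow> ennreal"
  assumes j [measurable]: "j \<in> borel_measurable borel"
    and j_le: "\<And>h. h \<in> borel_measurable borel \<Longrightarrow> (\<integral>\<^sup>+p. h (polar p) * j p \<partial>lborel) \<le> (\<integral>\<^sup>+V. h V \<partial>lborel)"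
    and j_pos: "AE p in lborel. p \<in> polar_dom \<longrightarrow> 0 < j p"
    and j_null: "\<And>N :: (real^'n^'n) set. N \<in> null_sets lborel \<Longrightarrow> AE p in lborel. p \<in> polar_dom \<longrightarrow> polar p \<notin> N"
    and j_dom: "\<And>p. p \<notin> polar_dom \<Longrightarrow> j p = 0"
begin

text \<open>An arbitrary numbering of the rows: row i of the matrix V is the increment of the jump
  with number \<open>idx i\<close>.\<close>

definition idx :: "'n \<Rightarrow> nat" where
  "idx = (SOME g. bij_betw g UNIV {..<CARD('n)})"

lemma idx: "bij_betw idx UNIV {..<CARD('n)}"
proof -
  obtain g :: "'n \<Rightarrow> nat" where "bij_betw g UNIV {0..<CARD('n)}" using ex_bij_betw_finite_nat[of "UNIV :: 'n set"] by auto
  then have "\<exists>g :: 'n \<Rightarrow> nat. bij_betw g UNIV {..<CARD('n)}" by (auto simp: atLeast0LessThan)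
  then show ?thesis unfolding idx_def by (rule someI_ex)
qed

definition rws :: "real^'n^'n \<Rightarrow> nat \<Rightarrow> real^'n" where
  "rws W k = W $ inv idx k"

lemma rws_vec: "k < CARD('n) \<Longrightarrow> rws (\<chi> i. v (idx i)) k = v k"
  using idx by (auto simp: rws_def bij_betw_def f_inv_into_f)

lemma borel_measurable_rws [measurable (raw)]:
  "g \<in> borel_measurable M \<Longrightarrow> (\<lambda>x. rws (g x) k) \<in> borel_measurable M"
  unfolding rws_def by measurable

lemma gram_acc: "y + gram (\<chi> i. v (idx i)) = acc y v CARD('n)"
proof -
  have "gram (\<chi> i. v (idx i)) = (\<Sum>i\<in>UNIV. outer (v (idx i)))" by (simp add: gram_rows)
  also have "\<dots> = (\<Sum>k<CARD('n). outer (v k))" by (rule sum.reindex_bij_betw[OF idx])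
  finally show ?thesis by (simp add: acc_def)
qed

text \<open>Density minorant for the position after a block with \<open>d\<close> jumps at offsets \<open>\<tau>\<close>. The position is
  \<open>symz (fst p)\<close>, while the other coordinates of \<open>p\<close> are auxiliary.\<close>

definition u :: "real^'n^'n \<Rightarrow> (nat \<Rightarrow> real) \<Rightarrow> (real^'n^'n) \<times> (real^'n^'n) \<Rightarrow> ennreal" where
  "u y \<tau> p = qden y \<tau> (rws (polar (fst p - y, snd p))) CARD('n) * j (fst p - y, snd p)"

lemma borel_measurable_u:
  assumes y [measurable]: "y \<in> borel_measurable M" and \<tau>: "\<And>k. k < CARD('n) \<Longrightarrow> (\<lambda>x. \<tau> x k) \<in> borel_measurable M"
    and [measurable]: "p \<in> borel_measurable M"
  shows "(\<lambda>x. u (y x) (\<tau> x) (p x)) \<in> borel_measurable M"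
proof -
  have f: "(\<lambda>x. fst (p x)) \<in> borel_measurable M" "(\<lambda>x. snd (p x)) \<in> borel_measurable M"
    by (auto intro: measurable_compose[OF _ borel_measurable_fst'] measurable_compose[OF _ borel_measurable_snd'])
  note [measurable] = f
  have s: "(\<lambda>x. (fst (p x) - y x, snd (p x))) \<in> borel_measurable M"
    unfolding borel_prod[symmetric] by measurable
  have "(\<lambda>x. rws (polar (fst (p x) - y x, snd (p x))) k) \<in> borel_measurable M" for k
    by (intro borel_measurable_rws measurable_compose[OF s borel_measurable_polar])
  then show ?thesis
    unfolding u_def by (intro borel_measurable_times_ennreal borel_measurable_qden y \<tau> measurable_compose[OF s j]) auto
qed

lemma nn_integral_PiM_F_restrict:
  assumes h: "h \<in> borel_measurable (\<Pi>\<^sub>M k\<in>{..<K}. borel)"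
  shows "(\<integral>\<^sup>+X. h X \<partial>(\<Pi>\<^sub>M k\<in>{..<K::nat}. F)) = (\<integral>\<^sup>+X. h (restrict X {..<K}) \<partial>(\<Pi>\<^sub>M k\<in>UNIV. F))"
proof -
  interpret F0: prob_space F by (rule F)
  interpret PF: product_prob_space "\<lambda>_::nat. F" UNIV ..
  have e: "(\<Pi>\<^sub>M k\<in>{..<K}. F) = distr (\<Pi>\<^sub>M k\<in>UNIV. F) (\<Pi>\<^sub>M k\<in>{..<K}. F) (\<lambda>X. restrict X {..<K})"
    by (rule PF.distr_PiM_restrict_finite[symmetric]) auto
  show ?thesis
    by (subst e, subst nn_integral_distr) (auto intro!: measurable_restrict_subset simp: measurable_cong_sets[OF sets_PiM_F refl] h)
qed

text \<open>The sense in which \<open>u\<close> is a density minorant. After translation by y the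
  first component is a lift of the Gram matrix of some V; \<open>j_le\<close> passes to Lebesgue
  measure in V, whose rows are the increments, and \<open>jump_chain_bound\<close> passes to the
  jump sizes.\<close>

lemma stage_bound:
  assumes y: "y \<in> psd" and h [measurable]: "h \<in> borel_measurable borel"
  shows "(\<integral>\<^sup>+p. h (symz (fst p)) * u y \<tau> p \<partial>lborel) \<le> (\<integral>\<^sup>+X. h (run y \<tau> X CARD('n)) \<partial>(\<Pi>\<^sub>M k\<in>UNIV. F))"
proof -
  have um: "u y \<tau> \<in> borel_measurable borel" by (rule borel_measurable_u) auto
  have "(\<lambda>p :: (real^'n^'n) \<times> (real^'n^'n). h (symz (fst p))) \<in> borel_measurable borel"
    by (rule measurable_compose[OF borel_measurable_fst']) measurable
  then have hum: "(\<lambda>p. h (symz (fst p)) * u y \<tau> p) \<in> borel_measurable borel"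
    using um by (rule borel_measurable_times_ennreal)
  have ym: "symz y = y" by (rule symz_id) (rule psdD(1)[OF y])
  define \<phi> where "\<phi> W = h (y + gram W) * qden y \<tau> (rws W) CARD('n)" for W
  have \<phi>m [measurable]: "\<phi> \<in> borel_measurable borel"
    unfolding \<phi>_def by (intro borel_measurable_times_ennreal borel_measurable_qden) measurable
  have "(\<integral>\<^sup>+p. h (symz (fst p)) * u y \<tau> p \<partial>lborel) = (\<integral>\<^sup>+p. h (symz (fst ((y, 0) + p))) * u y \<tau> ((y, 0) + p) \<partial>lborel)"
    by (rule nn_integral_lborel_translate[OF hum, symmetric])
  also have "\<dots> = (\<integral>\<^sup>+p. \<phi> (polar p) * j p \<partial>lborel)"
  proof (rule nn_integral_cong)
    fix p :: "(real^'n^'n) \<times> (real^'n^'n)"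
    show "h (symz (fst ((y, 0) + p))) * u y \<tau> ((y, 0) + p) = \<phi> (polar p) * j p"
    proof (cases "p \<in> polar_dom")
      case True
      then have "gram (polar p) = symz (fst p)"
        using polar_facts(4)[of "snd p" "fst p"] by (auto simp: polar_dom_def invertible_det_nz case_prod_unfold)
      then show ?thesis by (simp add: u_def \<phi>_def symz_add ym mult.assoc)
    qed (simp add: u_def j_dom)
  qed
  also have "\<dots> \<le> (\<integral>\<^sup>+V. \<phi> V \<partial>lborel)" by (rule j_le) measurable
  also have "\<dots> = (\<integral>\<^sup>+v. \<phi> (\<chi> i. v (idx i)) \<partial>(\<Pi>\<^sub>M k\<in>{..<CARD('n)}. lborel))"
    by (rule nn_integral_lborel_vec[OF idx]) measurable
  also have "\<dots> = (\<integral>\<^sup>+v. h (acc y v CARD('n)) * qden y \<tau> v CARD('n) \<partial>(\<Pi>\<^sub>M k\<in>{..<CARD('n)}. lborel))"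
  proof (rule nn_integral_cong)
    fix v
    have "qden y \<tau> (rws (\<chi> i. v (idx i))) CARD('n) = qden y \<tau> v CARD('n)" by (rule qden_cong) (rule rws_vec)
    then show "\<phi> (\<chi> i. v (idx i)) = h (acc y v CARD('n)) * qden y \<tau> v CARD('n)" by (simp add: \<phi>_def gram_acc)
  qed
  also have "\<dots> \<le> (\<integral>\<^sup>+X. h (acc y (\<lambda>k\<in>{..<CARD('n)}. vjump y \<tau> X k) CARD('n)) \<partial>(\<Pi>\<^sub>M k\<in>{..<CARD('n)}. F))"
  proof (rule jump_chain_bound[OF y])
    have "(\<lambda>v. v k) \<in> borel_measurable (\<Pi>\<^sub>M k\<in>{..<CARD('n)}. (borel :: (real^'n) measure))" if "k < CARD('n)" for k
      by (rule measurable_component_singleton) (use that in simp)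
    then have [measurable]: "(\<lambda>v. acc y v CARD('n)) \<in> borel_measurable (\<Pi>\<^sub>M k\<in>{..<CARD('n)}. (borel :: (real^'n) measure))"
      by (intro borel_measurable_acc) auto
    show "(\<lambda>v. h (acc y v CARD('n))) \<in> borel_measurable (\<Pi>\<^sub>M k\<in>{..<CARD('n)}. borel)" by measurable
  qed
  also have "\<dots> = (\<integral>\<^sup>+X. h (run y \<tau> X CARD('n)) \<partial>(\<Pi>\<^sub>M k\<in>{..<CARD('n)}. F))"
  proof (rule nn_integral_cong)
    fix X
    have "acc y (\<lambda>k\<in>{..<CARD('n)}. vjump y \<tau> X k) CARD('n) = run y \<tau> X CARD('n)" unfolding run_acc by (rule acc_cong) simp
    then show "h (acc y (\<lambda>k\<in>{..<CARD('n)}. vjump y \<tau> X k) CARD('n)) = h (run y \<tau> X CARD('n))" by simp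
  qed
  also have "\<dots> = (\<integral>\<^sup>+X. h (run y \<tau> (restrict X {..<CARD('n)}) CARD('n)) \<partial>(\<Pi>\<^sub>M k\<in>UNIV. F))"
  proof (rule nn_integral_PiM_F_restrict)
    have c: "(\<lambda>v. v k) \<in> borel_measurable (\<Pi>\<^sub>M k\<in>{..<CARD('n)}. (borel :: (real^'n) measure))" if "k < CARD('n)" for k
      by (rule measurable_component_singleton) (use that in simp)
    have [measurable]: "(\<lambda>X. run y \<tau> X CARD('n)) \<in> borel_measurable (\<Pi>\<^sub>M k\<in>{..<CARD('n)}. (borel :: (real^'n) measure))"
      by (rule borel_measurable_run) (auto intro: c)
    show "(\<lambda>X. h (run y \<tau> X CARD('n))) \<in> borel_measurable (\<Pi>\<^sub>M k\<in>{..<CARD('n)}. borel)" by measurable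
  qed
  also have "\<dots> = (\<integral>\<^sup>+X. h (run y \<tau> X CARD('n)) \<partial>(\<Pi>\<^sub>M k\<in>UNIV. F))"
    by (intro nn_integral_cong arg_cong[of _ _ h] run_cong) simp
  finally show ?thesis .
qed

text \<open>The radius is uniform in y and in the offsets. If the Gram matrix S - y is small, so are
  all rows of V, and almost all small rows have positive density. The null set excluded here is a
  set of matrices V, and \<open>j_null\<close> pulls it back to a null set of pairs.\<close>

lemma stage_positive:
  "\<exists>r>0. \<forall>y\<in>psd. \<forall>\<tau>. (\<forall>k<CARD('n). \<tau> k \<in> {0..1}) \<longrightarrow>
    (AE p in lborel. det (snd p) \<noteq> 0 \<and> symz (fst p) - y \<in> pd \<and> norm (symz (fst p) - y) < r \<longrightarrow> 0 < u y \<tau> p)"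
proof -
  obtain c where c: "c > 0" "\<And>r y x. r \<in> {0..1} \<Longrightarrow> y \<in> psd \<Longrightarrow> c * norm x \<le> norm (stepmat r y *v x)"
    using stepmat_lower_bound by blast
  obtain \<rho> where \<rho>: "\<rho> > 0" "ball 0 \<rho> \<subseteq> V" using V open_contains_ball by blast
  \<comment> \<open>The bound 1 keeps V in the unit ball required by \<open>polar_dom\<close>; the
    bound c \<rho> makes every row the image of a jump in \<open>V\<close>.\<close>
  define m where "m = min 1 (c * \<rho>)"
  have m: "m > 0" "m \<le> 1" "m \<le> c * \<rho>" using c \<rho> by (auto simp: m_def)
  \<comment> \<open>By the trace estimate \<open>norm_gram_le\<close>, a Gram matrix of norm below
    m^2 / d belongs to a matrix of norm below m.\<close>
  define r where "r = m\<^sup>2 / real CARD('n)"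
  have d0: "real CARD('n) > 0" by simp
  have r: "r > 0" using m d0 by (simp add: r_def)
  have "AE p in lborel. det (snd p) \<noteq> 0 \<and> symz (fst p) - y \<in> pd \<and> norm (symz (fst p) - y) < r \<longrightarrow> 0 < u y \<tau> p"
    if y: "y \<in> psd" and \<tau>: "\<forall>k<CARD('n). \<tau> k \<in> {0..1}" for y \<tau>
  proof -
    have chain: "AE v in (\<Pi>\<^sub>M k\<in>{..<CARD('n)}. lborel). \<forall>k<CARD('n). norm (v k) < c * \<rho> \<longrightarrow> 0 < vden y \<tau> v k"
      by (rule jump_chain_positive[OF c y \<rho>(2)]) (use \<tau> in auto)
    define Nb where "Nb = {V :: real^'n^'n. norm V < m \<and> qden y \<tau> (rws V) CARD('n) = 0}"
    have qm [measurable]: "(\<lambda>V. qden y \<tau> (rws V) CARD('n)) \<in> borel_measurable borel"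
      by (rule borel_measurable_qden) auto
    have Nbm: "Nb \<in> sets borel"
    proof -
      have "{V \<in> space borel. norm (V :: real^'n^'n) < m \<and> qden y \<tau> (rws V) CARD('n) = 0} \<in> sets borel" by measurable
      then show ?thesis by (simp add: Nb_def)
    qed
    have "AE v in (\<Pi>\<^sub>M k\<in>{..<CARD('n)}. lborel). (\<chi> i. v (idx i)) \<notin> Nb"
      using chain
    proof eventually_elim
      case (elim v)
      have "0 < qden y \<tau> v CARD('n)" if n: "norm (\<chi> i. v (idx i)) < m"
      proof -
        have "norm (v k) < c * \<rho>" if k: "k < CARD('n)" for k
        proof -
          obtain i where i: "idx i = k" using idx k by (metis bij_betw_def imageE lessThan_iff)
          have "norm (v k) \<le> norm (\<chi> i. v (idx i))"
            using Finite_Cartesian_Product.norm_nth_le[of "\<chi> i. v (idx i)" i] i by simp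
          then show ?thesis using n m by simp
        qed
        then have "\<forall>k<CARD('n). vden y \<tau> v k \<noteq> 0" using elim by (metis less_irrefl)
        then have "qden y \<tau> v CARD('n) \<noteq> 0" by (simp add: qden_def)
        then show ?thesis by (simp add: zero_less_iff_neq_zero)
      qed
      moreover have "qden y \<tau> (rws (\<chi> i. v (idx i))) CARD('n) = qden y \<tau> v CARD('n)" by (rule qden_cong) (rule rws_vec)
      ultimately show ?case by (auto simp: Nb_def)
    qed
    then have "AE V in lborel. V \<notin> Nb"
      using measurable_PiM_vec[of idx "{..<CARD('n)}"] idx Nbm
      by (subst lborel_vec_PiM[OF idx], subst AE_distr_iff) (auto simp: bij_betw_def)
    then have "Nb \<in> null_sets lborel" using Nbm AE_iff_null_sets[of Nb lborel] by simp
    from j_null[OF this] have "AE p in lborel. p \<in> polar_dom \<longrightarrow> polar p \<notin> Nb \<and> 0 < j p"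
      using j_pos by eventually_elim auto
    from AE_lborel_translate[OF this, of "(- y, 0)"]
    show ?thesis
    proof eventually_elim
      case (elim p)
      show ?case
      proof
        assume a: "det (snd p) \<noteq> 0 \<and> symz (fst p) - y \<in> pd \<and> norm (symz (fst p) - y) < r"
        let ?p = "(fst p - y, snd p)"
        have ym: "symz y = y" by (rule symz_id) (rule psdD(1)[OF y])
        have s: "symz (fst p - y) = symz (fst p) - y" by (simp add: symz_diff ym)
        have g: "gram (polar ?p) = symz (fst p) - y"
          using polar_facts(4)[of "snd p" "fst p - y"] a s by (simp add: invertible_det_nz)
        have "(norm (polar ?p))\<^sup>2 \<le> real CARD('n) * norm (symz (fst p) - y)" using norm_gram_le[of "polar ?p"] g by simp
        also have "\<dots> < real CARD('n) * r" using a d0 by (intro mult_strict_left_mono) auto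
        also have "\<dots> = m\<^sup>2" by (simp add: r_def)
        finally have n: "norm (polar ?p) < m" using m by (simp add: power_less_imp_less_base)
        then have "?p \<in> polar_dom" using a s m by (simp add: polar_dom_def)
        moreover have "(- y, 0) + p = ?p" by (simp add: prod_eq_iff)
        ultimately have "polar ?p \<notin> Nb" "0 < j ?p" using elim by auto
        then show "0 < u y \<tau> p" using n by (simp add: Nb_def u_def ennreal_zero_less_mult_iff zero_less_iff_neq_zero)
      qed
    qed
  qed
  then show ?thesis using r by blast
qed

end

section \<open>Small sets\<close>

text \<open>The sections \<open>A\<^sub>x\<close> of a measurable set form a separable subset of the measure algebra of \<open>S\<close>:
  up to \<open>\<eta>\<close> they depend only on a measurable label of \<open>x\<close> with countably many values.\<close>

lemma countable_sections:
  assumes S: "finite_measure S" and A: "A \<in> sets (X \<Otimes>\<^sub>M S)"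
  shows "\<And>\<eta>::real. \<eta> > 0 \<Longrightarrow> \<exists>c :: 'a \<Rightarrow> nat. c \<in> measurable X (count_space UNIV) \<and>
    (\<forall>x\<in>space X. \<forall>x'\<in>space X. c x = c x' \<longrightarrow> measure S (Pair x -` A - Pair x' -` A) \<le> \<eta>)"
proof -
  interpret S: finite_measure S by fact
  have sec: "Pair x -` D \<in> sets S" if "D \<in> sets (X \<Otimes>\<^sub>M S)" for x D
    using that by (rule sets_Pair1)
  have "A \<in> sigma_sets (space X \<times> space S) {a \<times> b | a b. a \<in> sets X \<and> b \<in> sets S}"
    using A by (simp add: sets_pair_measure)
  then show "\<And>\<eta>::real. \<eta> > 0 \<Longrightarrow> \<exists>c :: 'a \<Rightarrow> nat. c \<in> measurable X (count_space UNIV) \<and>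
    (\<forall>x\<in>space X. \<forall>x'\<in>space X. c x = c x' \<longrightarrow> measure S (Pair x -` A - Pair x' -` A) \<le> \<eta>)"
  proof (induction A rule: sigma_sets.induct)
    case (Basic R)
    then obtain a b where R: "R = a \<times> b" "a \<in> sets X" by blast
    show ?case
    proof (intro exI[of _ "\<lambda>x. if x \<in> a then 1 else 0"] conjI ballI impI)
      show "(\<lambda>x. if x \<in> a then 1 else 0) \<in> measurable X (count_space UNIV)" using R(2) by measurable
      fix x x' assume "(if x \<in> a then 1 else 0 :: nat) = (if x' \<in> a then 1 else 0)"
      then have e: "Pair x -` R - Pair x' -` R = {}" by (auto simp: R split: if_splits)
      show "measure S (Pair x -` R - Pair x' -` R) \<le> \<eta>" unfolding e using Basic by simp
    qed
  next
    case Empty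
    then show ?case by (intro exI[of _ "\<lambda>_. 0"]) auto
  next
    case (Compl D)
    from Compl.IH[OF Compl.prems] obtain c :: "'a \<Rightarrow> nat" where c0: "c \<in> measurable X (count_space UNIV) \<and>
      (\<forall>x\<in>space X. \<forall>x'\<in>space X. c x = c x' \<longrightarrow> measure S (Pair x -` D - Pair x' -` D) \<le> \<eta>)" by (rule exE)
    then have c: "c \<in> measurable X (count_space UNIV)"
      "\<And>x x'. x \<in> space X \<Longrightarrow> x' \<in> space X \<Longrightarrow> c x = c x' \<Longrightarrow> measure S (Pair x -` D - Pair x' -` D) \<le> \<eta>" by simp_all
    have Ds: "D \<in> sets (X \<Otimes>\<^sub>M S)" using Compl(1) by (simp add: sets_pair_measure)
    have "measure S (Pair x -` (space X \<times> space S - D) - Pair x' -` (space X \<times> space S - D)) \<le> \<eta>"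
      if x: "x \<in> space X" "x' \<in> space X" "c x = c x'" for x x'
    proof -
      have "Pair x -` (space X \<times> space S - D) - Pair x' -` (space X \<times> space S - D) \<subseteq> Pair x' -` D - Pair x -` D"
        using x by auto
      then have "measure S (Pair x -` (space X \<times> space S - D) - Pair x' -` (space X \<times> space S - D)) \<le> measure S (Pair x' -` D - Pair x -` D)"
        by (rule S.finite_measure_mono) (use sec[OF Ds] in auto)
      also have "\<dots> \<le> \<eta>" using c(2)[of x' x] x by simp
      finally show ?thesis .
    qed
    then show ?case using c(1) by (intro exI[of _ c]) simp
  next
    case (Union D)
    have Ds: "D i \<in> sets (X \<Otimes>\<^sub>M S)" for i using Union(1) by (simp add: sets_pair_measure)
    let ?U = "\<lambda>n. \<Union>i\<le>n. D i"
    have Us: "?U n \<in> sets (X \<Otimes>\<^sub>M S)" "(\<Union>i. D i) \<in> sets (X \<Otimes>\<^sub>M S)" for n using Ds by auto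
    define tail where "tail x n = measure S (Pair x -` (\<Union>i. D i) - Pair x -` ?U n)" for x n
    have tail_lim: "(\<lambda>n. tail x n) \<longlonglongrightarrow> 0" for x
    proof -
      have "(\<lambda>n. measure S (Pair x -` (\<Union>i. D i) - Pair x -` ?U n)) \<longlonglongrightarrow> measure S (\<Inter>n. Pair x -` (\<Union>i. D i) - Pair x -` ?U n)"
        by (rule S.finite_Lim_measure_decseq) (use sec[OF Us(1)] sec[OF Us(2)] in \<open>auto simp: decseq_def\<close>)
      moreover have e: "(\<Inter>n. Pair x -` (\<Union>i. D i) - Pair x -` ?U n) = {}" by auto
      ultimately show ?thesis unfolding e tail_def by simp
    qed
    have tail_m [measurable]: "(\<lambda>x. tail x n) \<in> borel_measurable X" for n
    proof -
      have "(\<lambda>x. measure S (Pair x -` ((\<Union>i. D i) - ?U n))) \<in> borel_measurable X"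
        unfolding measure_def
        by (intro borel_measurable_enn2real S.measurable_emeasure_Pair sets.Diff Us)
      then show ?thesis by (simp add: tail_def vimage_Diff)
    qed
    \<comment> \<open>How many of the sets are needed to exhaust the section up to \<eta> / 2
      depends on x, so this number becomes part of the label.\<close>
    define n where "n x = (LEAST k. tail x k < \<eta> / 2)" for x
    have nm: "n \<in> measurable X (count_space UNIV)"
      unfolding n_def by measurable
    have nx: "tail x (n x) < \<eta> / 2" for x
    proof -
      have "\<forall>\<^sub>F k in sequentially. tail x k < \<eta> / 2"
        using order_tendstoD(2)[OF tail_lim, of "\<eta> / 2"] Union.prems by simp
      then obtain k where "tail x k < \<eta> / 2" by (auto simp: eventually_sequentially)
      then show ?thesis unfolding n_def by (rule LeastI)
    qed
    have "\<forall>i m. \<exists>c :: 'a \<Rightarrow> nat. c \<in> measurable X (count_space UNIV) \<and>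
      (\<forall>x\<in>space X. \<forall>x'\<in>space X. c x = c x' \<longrightarrow> measure S (Pair x -` D i - Pair x' -` D i) \<le> \<eta> / (2 * real (Suc m)))"
      using Union.IH Union.prems by auto
    then obtain c where cm: "\<And>i m. c i m \<in> measurable X (count_space (UNIV :: nat set))"
      and c: "\<And>i m x x'. x \<in> space X \<Longrightarrow> x' \<in> space X \<Longrightarrow> c i m x = c i m x' \<Longrightarrow> measure S (Pair x -` D i - Pair x' -` D i) \<le> \<eta> / (2 * real (Suc m))"
      by metis
    \<comment> \<open>The label encodes that number together with the labels of x for the individual
      sets. Their precision \<eta> / (2 (n + 1)) makes the n + 1 errors add up to \<eta> / 2, and
      the tail accounts for the other half.\<close>
    define e where "e x = to_nat (n x, map (\<lambda>i. c i (n x) x) [0..<Suc (n x)])" for x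
    have em: "e \<in> measurable X (count_space UNIV)"
    proof -
      have listm: "(\<lambda>x. map (\<lambda>i. c i k x) is) \<in> measurable X (count_space UNIV)" for k "is"
      proof (induction "is")
        case (Cons a l)
        have "(\<lambda>x. (\<lambda>z x. z # map (\<lambda>i. c i k x) l) (c a k x) x) \<in> measurable X (count_space UNIV)"
          by (rule measurable_compose_countable[OF _ cm]) (rule measurable_compose[OF Cons measurable_count_space])
        then show ?case by simp
      qed simp
      have "(\<lambda>x. (\<lambda>k x. to_nat (k, map (\<lambda>i. c i k x) [0..<Suc k])) (n x) x) \<in> measurable X (count_space UNIV)"
        by (rule measurable_compose_countable[OF _ nm]) (rule measurable_compose[OF listm measurable_count_space])
      then show ?thesis unfolding e_def .
    qed
    have "measure S (Pair x -` (\<Union>i. D i) - Pair x' -` (\<Union>i. D i)) \<le> \<eta>" if x: "x \<in> space X" "x' \<in> space X" "e x = e x'" for x x'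
    proof -
      have nn: "n x = n x'" and "map (\<lambda>i. c i (n x) x) [0..<Suc (n x)] = map (\<lambda>i. c i (n x') x') [0..<Suc (n x')]"
        using x(3) by (auto simp: e_def)
      then have cc: "c i (n x) x = c i (n x) x'" if "i \<le> n x" for i
        using that by (auto simp: map_eq_conv simp del: upt_Suc)
      let ?tl = "Pair x -` (\<Union>i. D i) - Pair x -` ?U (n x)"
      let ?fin = "\<Union>i\<le>n x. Pair x -` D i - Pair x' -` D i"
      have mt: "?tl \<in> sets S" by (intro sets.Diff sec Us)
      have mf: "?fin \<in> sets S" by (intro sets.finite_UN sets.Diff sec Ds) auto
      have "measure S (Pair x -` (\<Union>i. D i) - Pair x' -` (\<Union>i. D i)) \<le> measure S (?tl \<union> ?fin)"
        by (rule S.finite_measure_mono[OF _ sets.Un[OF mt mf]]) auto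
      also have "\<dots> \<le> measure S ?tl + measure S ?fin"
        by (rule measure_Un_le[OF mt mf])
      also have "measure S ?fin \<le> (\<Sum>i\<le>n x. measure S (Pair x -` D i - Pair x' -` D i))"
        by (rule S.finite_measure_subadditive_finite) (use sec[OF Ds] in auto)
      also have "\<dots> \<le> (\<Sum>i\<le>n x. \<eta> / (2 * real (Suc (n x))))"
        by (intro sum_mono c x cc) auto
      also have "\<dots> = \<eta> / 2" by (simp add: field_simps)
      also have "measure S ?tl \<le> \<eta> / 2" using nx[of x] by (simp add: tail_def)
      finally show ?thesis by simp
    qed
    then show ?case using em by (intro exI[of _ e]) simp
  qed
qed

text \<open>On superlevel sets of u and w the claim becomes a lower bound for the measure of the
  intersection of two sections. This measure exceeds some \<delta> on a set of positive measure,
  which therefore meets one of the countably many label cells D x E in positive measure. Within a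
  cell the intersection loses at most a fixed part of \<delta>.\<close>

lemma uniform_minorization:
  fixes u :: "'a \<times> 's \<Rightarrow> ennreal" and w :: "'b \<times> 's \<Rightarrow> ennreal"
  assumes S: "finite_measure S" and X: "sigma_finite_measure X" and Y: "sigma_finite_measure Y"
    and u [measurable]: "u \<in> borel_measurable (X \<Otimes>\<^sub>M S)" and w [measurable]: "w \<in> borel_measurable (Y \<Otimes>\<^sub>M S)"
    and pos: "(\<integral>\<^sup>+x. \<integral>\<^sup>+y. \<integral>\<^sup>+s. u (x, s) * w (y, s) \<partial>S \<partial>Y \<partial>X) \<noteq> 0"
  shows "\<exists>D\<in>sets X. \<exists>E\<in>sets Y. \<exists>\<delta>>0. emeasure X D \<noteq> 0 \<and> emeasure Y E \<noteq> 0 \<and>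
    (\<forall>x\<in>D. \<forall>y\<in>E. \<delta> \<le> (\<integral>\<^sup>+s. u (x, s) * w (y, s) \<partial>S))"
proof -
  interpret S: finite_measure S by fact
  interpret X: sigma_finite_measure X by fact
  interpret Y: sigma_finite_measure Y by fact
  interpret XY: pair_sigma_finite X Y ..
  define e where "e n = ennreal (1 / real (Suc n))" for n
  have e0: "0 < e n" for n by (simp add: e_def)
  have e_ex: "\<exists>n. e n < a" if "0 < a" for a :: ennreal
  proof (cases a)
    case (real r)
    then have "r > 0" using that by simp
    then obtain n where "inverse (real (Suc n)) < r" using reals_Archimedean by blast
    then show ?thesis unfolding real(2) e_def by (intro exI[of _ n]) (simp add: inverse_eq_divide ennreal_lessI \<open>r > 0\<close> del: of_nat_Suc)
  next
    case top then show ?thesis by (auto simp: e_def)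
  qed
  have e_mono: "e m \<le> e n" if "n \<le> m" for n m
    unfolding e_def using that by (intro ennreal_leI) (simp add: frac_le)
  define A where "A n = {p \<in> space (X \<Otimes>\<^sub>M S). e n < u p}" for n
  define A' where "A' n = {p \<in> space (Y \<Otimes>\<^sub>M S). e n < w p}" for n
  have As: "A n \<in> sets (X \<Otimes>\<^sub>M S)" and A's: "A' n \<in> sets (Y \<Otimes>\<^sub>M S)" for n
    unfolding A_def A'_def by measurable
  note sec = sets_Pair1[OF As] sets_Pair1[OF A's]
  define G where "G n p = emeasure S (Pair (fst p) -` A n \<inter> Pair (snd p) -` A' n)" for n p
  have Gm [measurable]: "G n \<in> borel_measurable (X \<Otimes>\<^sub>M Y)" for n
  proof -
    let ?Q = "{q \<in> space ((X \<Otimes>\<^sub>M Y) \<Otimes>\<^sub>M S). e n < u (fst (fst q), snd q) \<and> e n < w (snd (fst q), snd q)}"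
    have Q: "?Q \<in> sets ((X \<Otimes>\<^sub>M Y) \<Otimes>\<^sub>M S)" by measurable
    have "(\<lambda>p. emeasure S (Pair p -` ?Q)) \<in> borel_measurable (X \<Otimes>\<^sub>M Y)"
      by (rule S.measurable_emeasure_Pair[OF Q])
    moreover have "emeasure S (Pair p -` ?Q) = G n p" if "p \<in> space (X \<Otimes>\<^sub>M Y)" for p
      using that by (auto simp: G_def A_def A'_def space_pair_measure intro!: arg_cong[of _ _ "emeasure S"])
    ultimately show ?thesis by (simp cong: measurable_cong)
  qed
  have "\<exists>n. (\<integral>\<^sup>+p. G n p \<partial>(X \<Otimes>\<^sub>M Y)) \<noteq> 0"
  proof (rule ccontr)
    assume "\<not> (\<exists>n. (\<integral>\<^sup>+p. G n p \<partial>(X \<Otimes>\<^sub>M Y)) \<noteq> 0)"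
    then have "\<And>n. AE p in X \<Otimes>\<^sub>M Y. G n p = 0" by (simp add: nn_integral_0_iff_AE)
    then have "AE p in X \<Otimes>\<^sub>M Y. \<forall>n. G n p = 0" by (simp add: AE_all_countable)
    then have "AE x in X. AE y in Y. \<forall>n. G n (x, y) = 0" by (rule XY.AE_pair)
    then have "AE x in X. (\<integral>\<^sup>+y. \<integral>\<^sup>+s. u (x, s) * w (y, s) \<partial>S \<partial>Y) = 0"
      using AE_space
    proof eventually_elim
      case (elim x)
      note x = \<open>x \<in> space X\<close>
      have "AE y in Y. (\<integral>\<^sup>+s. u (x, s) * w (y, s) \<partial>S) = 0"
        using elim(1) AE_space
      proof eventually_elim
        case (elim y)
        have "AE s in S. s \<notin> Pair x -` A n \<inter> Pair y -` A' n" for n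
        proof -
          have "Pair x -` A n \<inter> Pair y -` A' n \<in> sets S" using sec by auto
          then show ?thesis using elim(1) AE_iff_null_sets[of "Pair x -` A n \<inter> Pair y -` A' n" S]
            by (auto simp: G_def null_sets_def)
        qed
        then have "AE s in S. \<forall>n. s \<notin> Pair x -` A n \<inter> Pair y -` A' n" by (simp add: AE_all_countable)
        then have "AE s in S. u (x, s) * w (y, s) = 0"
          using AE_space
        proof eventually_elim
          case (elim s)
          show ?case
          proof (rule ccontr)
            assume "u (x, s) * w (y, s) \<noteq> 0"
            then have "0 < u (x, s)" "0 < w (y, s)" by (auto simp: zero_less_iff_neq_zero)
            then obtain n m where "e n < u (x, s)" "e m < w (y, s)" using e_ex by blast
            then have "e (max n m) < u (x, s)" "e (max n m) < w (y, s)"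
              using e_mono[of n "max n m"] e_mono[of m "max n m"] by (auto intro: le_less_trans)
            then have "s \<in> Pair x -` A (max n m) \<inter> Pair y -` A' (max n m)"
              using x \<open>y \<in> space Y\<close> \<open>s \<in> space S\<close> by (auto simp: A_def A'_def space_pair_measure)
            then show False using elim by blast
          qed
        qed
        then have "(\<integral>\<^sup>+s. u (x, s) * w (y, s) \<partial>S) = (\<integral>\<^sup>+s. 0 \<partial>S)" by (rule nn_integral_cong_AE)
        then show ?case by simp
      qed
      then have "(\<integral>\<^sup>+y. \<integral>\<^sup>+s. u (x, s) * w (y, s) \<partial>S \<partial>Y) = (\<integral>\<^sup>+y. 0 \<partial>Y)" by (rule nn_integral_cong_AE)
      then show ?case by simp
    qed
    then have "(\<integral>\<^sup>+x. \<integral>\<^sup>+y. \<integral>\<^sup>+s. u (x, s) * w (y, s) \<partial>S \<partial>Y \<partial>X) = (\<integral>\<^sup>+x. 0 \<partial>X)" by (rule nn_integral_cong_AE)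
    then show False using pos by simp
  qed
  then obtain n where n: "(\<integral>\<^sup>+p. G n p \<partial>(X \<Otimes>\<^sub>M Y)) \<noteq> 0" ..
  define H where "H m = {p \<in> space (X \<Otimes>\<^sub>M Y). e m < G n p}" for m
  have Hm: "H m \<in> sets (X \<Otimes>\<^sub>M Y)" for m unfolding H_def by measurable
  have "\<exists>m. emeasure (X \<Otimes>\<^sub>M Y) (H m) \<noteq> 0"
  proof (rule ccontr)
    assume "\<not> (\<exists>m. emeasure (X \<Otimes>\<^sub>M Y) (H m) \<noteq> 0)"
    then have "AE p in X \<Otimes>\<^sub>M Y. p \<notin> H m" for m using Hm AE_iff_null_sets[OF Hm[of m]] by (auto simp: null_sets_def)
    then have "AE p in X \<Otimes>\<^sub>M Y. \<forall>m. p \<notin> H m" by (simp add: AE_all_countable)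
    then have "AE p in X \<Otimes>\<^sub>M Y. G n p = 0"
      using AE_space by eventually_elim (use e_ex in \<open>auto simp: H_def zero_less_iff_neq_zero\<close>)
    then show False using n by (simp add: nn_integral_0_iff_AE)
  qed
  then obtain m where m: "emeasure (X \<Otimes>\<^sub>M Y) (H m) \<noteq> 0" ..
  \<comment> \<open>Sections are taken up to \<delta> / 4 in each of the two variables, so moving
    from (x0, y0) to another point of the cell leaves at least \<delta> / 2.\<close>
  define \<delta> where "\<delta> = 1 / real (Suc m)"
  have \<delta>: "\<delta> > 0" by (simp add: \<delta>_def)
  obtain c :: "'a \<Rightarrow> nat" where c [measurable]: "c \<in> measurable X (count_space UNIV)"
    and cA: "\<And>x x'. x \<in> space X \<Longrightarrow> x' \<in> space X \<Longrightarrow> c x = c x' \<Longrightarrow> measure S (Pair x -` A n - Pair x' -` A n) \<le> \<delta> / 4"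
    using countable_sections[OF S As[of n], of "\<delta> / 4"] \<delta> by auto
  obtain c' :: "'b \<Rightarrow> nat" where c' [measurable]: "c' \<in> measurable Y (count_space UNIV)"
    and cA': "\<And>x x'. x \<in> space Y \<Longrightarrow> x' \<in> space Y \<Longrightarrow> c' x = c' x' \<Longrightarrow> measure S (Pair x -` A' n - Pair x' -` A' n) \<le> \<delta> / 4"
    using countable_sections[OF S A's[of n], of "\<delta> / 4"] \<delta> by auto
  define D where "D i = {x\<in>space X. c x = i}" for i
  define E where "E k = {y\<in>space Y. c' y = k}" for k
  have Dm: "D i \<in> sets X" and Em: "E i \<in> sets Y" for i unfolding D_def E_def by measurable
  have "\<exists>q. emeasure (X \<Otimes>\<^sub>M Y) (H m \<inter> (D (fst q) \<times> E (snd q))) \<noteq> 0"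
  proof (rule ccontr)
    assume "\<not> ?thesis"
    then have "H m \<inter> (D (fst q) \<times> E (snd q)) \<in> null_sets (X \<Otimes>\<^sub>M Y)" for q
      using Hm Dm Em by (auto simp: null_sets_def)
    then have "(\<Union>q. H m \<inter> (D (fst q) \<times> E (snd q))) \<in> null_sets (X \<Otimes>\<^sub>M Y)" by (intro null_sets_UN') auto
    moreover have "(\<Union>q. H m \<inter> (D (fst q) \<times> E (snd q))) = H m"
    proof -
      have "p \<in> D (fst (c (fst p), c' (snd p))) \<times> E (snd (c (fst p), c' (snd p)))" if "p \<in> H m" for p
        using that by (cases p) (auto simp: H_def D_def E_def space_pair_measure)
      then show ?thesis by blast
    qed
    ultimately show False using m by (auto simp: null_sets_def)
  qed
  then obtain q where q: "emeasure (X \<Otimes>\<^sub>M Y) (H m \<inter> (D (fst q) \<times> E (snd q))) \<noteq> 0" ..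
  have DE: "emeasure X (D (fst q)) * emeasure Y (E (snd q)) \<noteq> 0"
  proof -
    have "emeasure (X \<Otimes>\<^sub>M Y) (H m \<inter> (D (fst q) \<times> E (snd q))) \<le> emeasure (X \<Otimes>\<^sub>M Y) (D (fst q) \<times> E (snd q))"
      by (intro emeasure_mono) (use Dm Em in auto)
    also have "\<dots> = emeasure X (D (fst q)) * emeasure Y (E (snd q))" by (rule Y.emeasure_pair_measure_Times[OF Dm Em])
    finally show ?thesis using q by auto
  qed
  have "H m \<inter> (D (fst q) \<times> E (snd q)) \<noteq> {}" using q by (metis emeasure_empty)
  then obtain x0 y0 where xy0: "(x0, y0) \<in> H m" "x0 \<in> D (fst q)" "y0 \<in> E (snd q)" by auto
  have g0: "\<delta> < measure S (Pair x0 -` A n \<inter> Pair y0 -` A' n)"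
    using xy0(1) by (simp add: H_def G_def e_def \<delta>_def S.emeasure_eq_measure ennreal_less_iff)
  have "e n * e n * ennreal (\<delta> / 2) \<le> (\<integral>\<^sup>+s. u (x, s) * w (y, s) \<partial>S)" if xy: "x \<in> D (fst q)" "y \<in> E (snd q)" for x y
  proof -
    have sp: "x \<in> space X" "x0 \<in> space X" "y \<in> space Y" "y0 \<in> space Y" "c x0 = c x" "c' y0 = c' y"
      using xy xy0 by (auto simp: D_def E_def)
    let ?g = "Pair x -` A n \<inter> Pair y -` A' n"
    have "measure S (Pair x0 -` A n \<inter> Pair y0 -` A' n) \<le> measure S (?g \<union> (Pair x0 -` A n - Pair x -` A n) \<union> (Pair y0 -` A' n - Pair y -` A' n))"
      by (rule S.finite_measure_mono) (use sec in auto)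
    also have "\<dots> \<le> measure S ?g + measure S (Pair x0 -` A n - Pair x -` A n) + measure S (Pair y0 -` A' n - Pair y -` A' n)"
      using sec by (intro order_trans[OF measure_Un_le] add_mono measure_Un_le) auto
    also have "\<dots> \<le> measure S ?g + \<delta> / 4 + \<delta> / 4" by (intro add_mono cA cA' sp order_refl)
    finally have "\<delta> / 2 \<le> measure S ?g" using g0 by simp
    then have "e n * e n * ennreal (\<delta> / 2) \<le> e n * e n * emeasure S ?g"
      by (intro mult_left_mono) (auto simp: S.emeasure_eq_measure ennreal_leI)
    also have "\<dots> = (\<integral>\<^sup>+s. e n * e n * indicator ?g s \<partial>S)"
      using sec by (subst nn_integral_cmult_indicator) auto
    also have "\<dots> \<le> (\<integral>\<^sup>+s. u (x, s) * w (y, s) \<partial>S)"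
      by (intro nn_integral_mono) (auto simp: A_def A'_def indicator_def intro!: mult_mono)
    finally show ?thesis .
  qed
  moreover have "0 < e n * e n * ennreal (\<delta> / 2)" using e0 \<delta> by (simp add: ennreal_zero_less_mult_iff)
  ultimately show ?thesis using DE Dm Em by (intro bexI[of _ "D (fst q)"] bexI[of _ "E (snd q)"] exI[of _ "e n * e n * ennreal (\<delta> / 2)"]) auto
qed

section \<open>The law of the volatility process\<close>

text \<open>The countable infimum makes the jump time in \<open>(s, e]\<close> a measurable function of the path.\<close>

definition jump_time :: "real \<Rightarrow> real \<Rightarrow> (real \<Rightarrow> nat) \<Rightarrow> real" where
  "jump_time s e n = (INF q\<in>(\<rat> \<inter> {s<..<e}) \<union> {e}. if n s < n q then q else e)"

text \<open>If the counter has increased at u < e, then by monotonicity it has increased at all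
  rational times shortly after u, so these give the same infimum. The additional point
  \<open>e\<close> covers a first increase at \<open>e\<close> itself.\<close>

lemma jump_time_eq:
  assumes n: "mono_on {0..} n" and s: "0 \<le> s" "s < e" and ne: "n s < n e"
  shows "jump_time s e n = Inf {u\<in>{s..e}. n s < n u}"
proof -
  let ?S = "{u\<in>{s..e}. n s < n u}"
  let ?Q = "(\<rat> \<inter> {s<..<e}) \<union> {e}"
  let ?g = "\<lambda>q. if n s < n q then q else e"
  have bS: "bdd_below ?S" by (auto intro: bdd_belowI)
  have eS: "e \<in> ?S" using s ne by auto
  have gS: "?g q \<in> ?S" if "q \<in> ?Q" for q using that eS s by auto
  have bQ: "bdd_below (?g ` ?Q)"
  proof (rule bdd_belowI[of _ s])
    fix v assume "v \<in> ?g ` ?Q"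
    then obtain q where "q \<in> ?Q" "v = ?g q" by (rule imageE)
    then show "s \<le> v" using gS[of q] by simp
  qed
  show ?thesis
  proof (rule antisym)
    show "Inf ?S \<le> jump_time s e n"
      unfolding jump_time_def
    proof (rule cINF_greatest)
      show "Inf ?S \<le> ?g q" if "q \<in> ?Q" for q by (rule cInf_lower[OF gS[OF that] bS])
    qed simp
    show "jump_time s e n \<le> Inf ?S"
    proof (rule cInf_greatest)
      show "?S \<noteq> {}" using eS by blast
      fix u assume u: "u \<in> ?S"
      show "jump_time s e n \<le> u"
      proof (rule field_le_epsilon)
        fix \<epsilon> :: real assume \<epsilon>: "\<epsilon> > 0"
        have "jump_time s e n \<le> e"
          unfolding jump_time_def using cINF_lower[OF bQ, of e] by simp
        moreover have "jump_time s e n \<le> u + \<epsilon>" if ue: "u < e"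
        proof -
          obtain q where q: "q \<in> \<rat>" "u < q" "q < min e (u + \<epsilon>)"
            using Rats_dense_in_real[of u "min e (u + \<epsilon>)"] ue \<epsilon> by auto
          have su: "s < u" using u by (cases "u = s") auto
          then have qQ: "q \<in> ?Q" using q by auto
          have "n u \<le> n q" using n q su s by (auto simp: mono_on_def)
          then have "?g q = q" using u by auto
          then have "jump_time s e n \<le> q" unfolding jump_time_def using cINF_lower[OF bQ qQ] by simp
          then show ?thesis using q by simp
        qed
        ultimately show "jump_time s e n \<le> u + \<epsilon>" using u \<epsilon> by (cases "u < e") auto
      qed
    qed
  qed
qed

abbreviation path_space :: "(real \<Rightarrow> nat) measure" where
  "path_space \<equiv> \<Pi>\<^sub>M t\<in>{0..}. count_space UNIV"

lemma jump_time_measurable: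
  assumes "0 \<le> s" "s < e"
  shows "jump_time s e \<in> borel_measurable path_space"
proof -
  have c: "(\<lambda>n. n t) \<in> measurable path_space (count_space UNIV)" if "0 \<le> t" for t
    by (rule measurable_component_singleton) (use that in simp)
  have "(\<lambda>n. INF q\<in>(\<rat> \<inter> {s<..<e}) \<union> {e}. if n s < n q then q else e) \<in> borel_measurable path_space"
  proof (rule borel_measurable_cINF)
    show "countable ((\<rat> \<inter> {s<..<e}) \<union> {e})" by (simp add: countable_rat countable_Int1)
    show "bdd_below ((\<lambda>q. if n s < n q then q else e) ` ((\<rat> \<inter> {s<..<e}) \<union> {e}))" for n :: "real \<Rightarrow> nat"
      using assms by (auto intro!: bdd_belowI[of _ s])
    fix q assume q: "q \<in> (\<rat> \<inter> {s<..<e}) \<union> {e}"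
    have r: "(\<lambda>n. real (n t)) \<in> borel_measurable path_space" if "0 \<le> t" for t
      by (rule measurable_compose[OF c[OF that]]) simp
    have [measurable]: "(\<lambda>n. real (n s)) \<in> borel_measurable path_space" "(\<lambda>n. real (n q)) \<in> borel_measurable path_space"
      using r assms q by auto
    have "(\<lambda>n. if real (n s) < real (n q) then q else e) \<in> borel_measurable path_space" by measurable
    then show "(\<lambda>n. if n s < n q then q else e) \<in> borel_measurable path_space" by simp
  qed
  then show ?thesis unfolding jump_time_def[abs_def] .
qed

context gram_density
begin

definition tick :: "nat \<Rightarrow> real" where
  "tick k = real k / real CARD('n)"

lemma tick: "tick 0 = 0" "tick CARD('n) = 1" "tick k < tick (Suc k)" "0 \<le> tick k"
  by (simp_all add: tick_def divide_strict_right_mono)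

lemma tick_mono: "k \<le> m \<Longrightarrow> tick k \<le> tick m"
  by (simp add: tick_def divide_right_mono)

text \<open>The jump times are measured from the start \<open>s\<close> of the block, not from the
  start of the k-th interval, as \<open>run\<close> expects.\<close>

definition offs :: "real \<Rightarrow> (real \<Rightarrow> nat) \<Rightarrow> nat \<Rightarrow> real" where
  "offs s n k = jump_time (s + tick k) (s + tick (Suc k)) n - s"

lemma offs_measurable: "0 \<le> s \<Longrightarrow> (\<lambda>n. offs s n k) \<in> borel_measurable path_space"
  unfolding offs_def using tick(3)[of k] tick(4)[of k]
  by (intro borel_measurable_diff jump_time_measurable) auto

lemma path_stage:
  assumes path: "volatility_path n x l A B C y" and s: "0 \<le> s"
    and n: "\<And>k. k < CARD('n) \<Longrightarrow> n (s + tick (Suc k)) = Suc (n (s + tick k))"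
  shows "y (s + 1) = run (flow B 1 (y s)) (offs s n) (\<lambda>k. x (n s + k)) CARD('n)"
    and "\<And>k. k < CARD('n) \<Longrightarrow> offs s n k \<in> {0..1}"
proof -
  interpret volatility_path n x l A B C y by (rule path)
  have nk: "n (s + tick k) = n s + k" if "k \<le> CARD('n)" for k
    using that by (induction k) (auto simp: n tick)
  \<comment> \<open>The invariant: the position at the k-th tick, carried to the end of the block by
    the flow, is \<open>run\<close> after k jumps.\<close>
  have "flow B (1 - tick k) (y (s + tick k)) = run (flow B 1 (y s)) (offs s n) (\<lambda>k. x (n s + k)) k \<and> (\<forall>i<k. offs s n i \<in> {0..1})"
    if "k \<le> CARD('n)" for k
    using that
  proof (induction k)
    case (Suc k)
    let ?a = "s + tick k" and ?b = "s + tick (Suc k)"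
    have ab: "0 \<le> ?a" "?a < ?b" using s tick by (auto intro: add_nonneg_nonneg)
    have nab: "n ?b = Suc (n ?a)" using n Suc.prems by auto
    define T where "T = jump_time ?a ?b n"
    have Teq: "T = Inf {u\<in>{?a..?b}. n ?a < n u}"
      unfolding T_def by (rule jump_time_eq[OF n_mono ab]) (simp add: nab)
    note pj = path_one_jump[OF ab nab, folded Teq]
    define r where "r = s + 1 - T"
    have offs: "offs s n k = T - s" by (simp add: offs_def T_def)
    then have r1: "1 - offs s n k = r" by (simp add: r_def)
    define Z where "Z = run (flow B 1 (y s)) (offs s n) (\<lambda>k. x (n s + k)) k"
    have Z: "flow B (1 - tick k) (y ?a) = Z" using Suc by (simp add: Z_def)
    let ?m = "flow B (T - ?a) (y ?a)"
    have m1: "flow B r ?m = Z" unfolding Z[symmetric] flow_add[symmetric] by (simp add: r_def)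
    \<comment> \<open>The backward flow inside \<open>stepmat\<close> recovers the position just
      before the jump, on which the factor under the root depends.\<close>
    have m2: "flow B (- r) Z = ?m" unfolding m1[symmetric] flow_add[symmetric] by simp
    have "flow B (1 - tick (Suc k)) (y ?b) = flow B r (?m + outer (A *v (msqrt (C + ?m) *v x (n ?a))))"
    proof -
      have "1 - tick (Suc k) + (?b - T) = r" by (simp add: r_def)
      then show ?thesis unfolding pj(3) flow_add[symmetric] by (simp only:)
    qed
    also have "\<dots> = Z + outer (mexp B r *v (A *v (msqrt (C + ?m) *v x (n ?a))))"
      by (simp add: flow_plus m1 flow_outer)
    also have "\<dots> = Z + outer (stepmat r Z *v x (n s + k))"
      using nk[of k] Suc.prems by (simp add: stepmat_def m2 matrix_vector_mul_assoc matrix_mul_assoc)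
    finally have "flow B (1 - tick (Suc k)) (y ?b) = run (flow B 1 (y s)) (offs s n) (\<lambda>k. x (n s + k)) (Suc k)"
      by (simp add: Z_def[symmetric] r1)
    moreover have "offs s n k \<in> {0..1}"
      using pj(1,2) tick(4)[of k] tick_mono[of "Suc k" "CARD('n)"] tick(2) Suc.prems unfolding offs by auto
    ultimately show ?case using Suc by (auto simp: less_Suc_eq)
  qed (simp add: tick)
  from this[of "CARD('n)"]
  show "y (s + 1) = run (flow B 1 (y s)) (offs s n) (\<lambda>k. x (n s + k)) CARD('n)"
    and "\<And>k. k < CARD('n) \<Longrightarrow> offs s n k \<in> {0..1}" by (simp_all add: tick)
qed

end

section \<open>The law of the process given the counting path\<close>

locale mucogarch_process = gram_density A B C F f V j
  for A B C :: "real^'n^'n" and F :: "(real^'n) measure" and f :: "real^'n \<Rightarrow> ennreal" and V :: "(real^'n) set"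
    and j :: "(real^'n^'n) \<times> (real^'n^'n) \<Rightarrow> ennreal" +
  fixes M :: "'w measure" and rate :: real and N :: "real \<Rightarrow> 'w \<Rightarrow> nat" and X :: "nat \<Rightarrow> 'w \<Rightarrow> real^'n"
    and L :: "real \<Rightarrow> 'w \<Rightarrow> real^'n" and Y :: "real^'n^'n \<Rightarrow> real \<Rightarrow> 'w \<Rightarrow> real^'n^'n"
  assumes pois: "poisson_process M rate N"
    and indX: "prob_space.indep_vars M (\<lambda>_. borel) X UNIV"
    and lawX: "\<And>i. distr M borel (X i) = F"
    and indNX: "prob_space.indep_set M
         (sets (vimage_algebra (space M) (\<lambda>\<omega> i. X i \<omega>) (\<Pi>\<^sub>M i\<in>UNIV. borel)))
         (sets (vimage_algebra (space M) (\<lambda>\<omega>. \<lambda>t\<in>{0..}. N t \<omega>) path_space))"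
    and L: "\<And>t \<omega>. 0 \<le> t \<Longrightarrow> \<omega> \<in> space M \<Longrightarrow> L t \<omega> = (\<Sum>i<N t \<omega>. X i \<omega>)"
    and Y: "\<And>x. x \<in> psd \<Longrightarrow> mucogarch_volatility M L A B C (Y x) \<and> (AE \<omega> in M. Y x 0 \<omega> = x)"
begin

sublocale M: prob_space M using pois by (simp add: poisson_process_def)

definition Nf :: "'w \<Rightarrow> real \<Rightarrow> nat" where "Nf \<omega> = (\<lambda>t\<in>{0..}. N t \<omega>)"
definition Xf :: "'w \<Rightarrow> nat \<Rightarrow> real^'n" where "Xf \<omega> = (\<lambda>i. X i \<omega>)"

lemma N_measurable: "0 \<le> t \<Longrightarrow> N t \<in> measurable M (count_space UNIV)"
  using pois by (simp add: poisson_process_def)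

lemma X_measurable: "X i \<in> borel_measurable M"
  using indX unfolding M.indep_vars_def by blast

lemma Nf_measurable: "Nf \<in> measurable M path_space"
  unfolding Nf_def[abs_def] by (rule measurable_restrict) (simp add: N_measurable)

lemma Xf_measurable: "Xf \<in> measurable M (\<Pi>\<^sub>M i\<in>UNIV. borel)"
proof -
  have "(\<lambda>\<omega>. \<lambda>i\<in>UNIV. X i \<omega>) \<in> measurable M (\<Pi>\<^sub>M i\<in>UNIV. borel)"
    by (rule measurable_restrict) (rule X_measurable)
  then show ?thesis by (simp add: Xf_def[abs_def] restrict_def)
qed

abbreviation PN :: "(real \<Rightarrow> nat) measure" where "PN \<equiv> distr M path_space Nf"
abbreviation PX :: "(nat \<Rightarrow> real^'n) measure" where "PX \<equiv> \<Pi>\<^sub>M k\<in>UNIV. F"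

lemma distr_Xf: "distr M (\<Pi>\<^sub>M i\<in>UNIV. borel) Xf = PX"
  using M.indep_vars_iff_distr_eq_PiM'[where I = "UNIV :: nat set" and M' = "\<lambda>_. borel" and X = X] indX X_measurable
  by (simp add: lawX Xf_def[abs_def] restrict_def)

lemma joint_law: "distr M ((\<Pi>\<^sub>M i\<in>UNIV. borel) \<Otimes>\<^sub>M path_space) (\<lambda>\<omega>. (Xf \<omega>, Nf \<omega>)) = PX \<Otimes>\<^sub>M PN"
proof -
  interpret PN: prob_space PN by (rule M.prob_space_distr[OF Nf_measurable])
  interpret PX: prob_space "distr M (\<Pi>\<^sub>M i\<in>UNIV. borel) Xf" by (rule M.prob_space_distr[OF Xf_measurable])
  let ?XN = "(\<Pi>\<^sub>M i\<in>UNIV. (borel :: (real^'n) measure)) \<Otimes>\<^sub>M path_space"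
  have XNm: "(\<lambda>\<omega>. (Xf \<omega>, Nf \<omega>)) \<in> measurable M ?XN" by (rule measurable_Pair[OF Xf_measurable Nf_measurable])
  have "distr M (\<Pi>\<^sub>M i\<in>UNIV. borel) Xf \<Otimes>\<^sub>M PN = distr M ?XN (\<lambda>\<omega>. (Xf \<omega>, Nf \<omega>))"
  proof (rule pair_measure_eqI)
    show "sigma_finite_measure (distr M (\<Pi>\<^sub>M i\<in>UNIV. borel) Xf)" "sigma_finite_measure PN" ..
    show "sets (distr M (\<Pi>\<^sub>M i\<in>UNIV. borel) Xf \<Otimes>\<^sub>M PN) = sets (distr M ?XN (\<lambda>\<omega>. (Xf \<omega>, Nf \<omega>)))"
      by (simp cong: sets_pair_measure_cong)
    fix D E assume "D \<in> sets (distr M (\<Pi>\<^sub>M i\<in>UNIV. borel) Xf)" "E \<in> sets PN"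
    then have DE: "D \<in> sets (\<Pi>\<^sub>M i\<in>UNIV. borel)" "E \<in> sets path_space" by auto
    have "emeasure (distr M ?XN (\<lambda>\<omega>. (Xf \<omega>, Nf \<omega>))) (D \<times> E) = emeasure M ((\<lambda>\<omega>. (Xf \<omega>, Nf \<omega>)) -` (D \<times> E) \<inter> space M)"
      by (rule emeasure_distr[OF XNm]) (use DE in auto)
    also have "(\<lambda>\<omega>. (Xf \<omega>, Nf \<omega>)) -` (D \<times> E) \<inter> space M = (Xf -` D \<inter> space M) \<inter> (Nf -` E \<inter> space M)" by auto
    also have "emeasure M \<dots> = ennreal (M.prob (Xf -` D \<inter> space M) * M.prob (Nf -` E \<inter> space M))"
    proof -
      have "Xf -` D \<inter> space M \<in> sets (vimage_algebra (space M) (\<lambda>\<omega> i. X i \<omega>) (\<Pi>\<^sub>M i\<in>UNIV. borel))"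
        using in_vimage_algebra[OF DE(1), of Xf "space M"] by (simp add: Xf_def[abs_def])
      moreover have "Nf -` E \<inter> space M \<in> sets (vimage_algebra (space M) (\<lambda>\<omega>. \<lambda>t\<in>{0..}. N t \<omega>) path_space)"
        using in_vimage_algebra[OF DE(2), of Nf "space M"] by (simp add: Nf_def[abs_def])
      ultimately show ?thesis using M.indep_setD[OF indNX] by (simp add: M.emeasure_eq_measure)
    qed
    also have "\<dots> = emeasure (distr M (\<Pi>\<^sub>M i\<in>UNIV. borel) Xf) D * emeasure PN E"
      by (simp add: emeasure_distr[OF Xf_measurable DE(1)] emeasure_distr[OF Nf_measurable DE(2)] M.emeasure_eq_measure ennreal_mult)
    finally show "emeasure (distr M (\<Pi>\<^sub>M i\<in>UNIV. borel) Xf) D * emeasure PN E = emeasure (distr M ?XN (\<lambda>\<omega>. (Xf \<omega>, Nf \<omega>))) (D \<times> E)" by simp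
  qed
  then show ?thesis by (simp add: distr_Xf)
qed

lemma volatility_path_AE:
  assumes x: "x \<in> psd"
  shows "AE \<omega> in M. volatility_path (\<lambda>t. Nf \<omega> t) (Xf \<omega>) (\<lambda>t. L t \<omega>) A B C (\<lambda>t. Y x t \<omega>) \<and> Y x 0 \<omega> = x \<and> Nf \<omega> 0 = 0"
proof -
  have v: "mucogarch_volatility M L A B C (Y x)" and Y0: "AE \<omega> in M. Y x 0 \<omega> = x" using Y[OF x] by auto
  have Ym: "Y x t \<in> measurable M psd_space" if "0 \<le> t" for t using v that by (simp add: mucogarch_volatility_def)
  have N: "AE \<omega> in M. N 0 \<omega> = 0 \<and> mono_on {0..} (\<lambda>t. N t \<omega>) \<and> (\<forall>t\<ge>0. ((\<lambda>s. N s \<omega>) \<longlongrightarrow> N t \<omega>) (at_right t))"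
    using pois by (simp add: poisson_process_def)
  have E: "AE \<omega> in M. cadlag (\<lambda>t. Y x t \<omega>) \<and>
      (\<forall>t\<ge>0. \<exists>J. has_matrix_LS_integral (\<lambda>s. A ** psd_sqrt (C + left_lim (\<lambda>u. Y x u \<omega>) s)) (qv_disc (\<lambda>u. L u \<omega>))
           (\<lambda>s. psd_sqrt (C + left_lim (\<lambda>u. Y x u \<omega>) s) ** transpose A) t J \<and>
         Y x t \<omega> = Y x 0 \<omega> + (LINT s:{0..t}|lborel. B ** left_lim (\<lambda>u. Y x u \<omega>) s + left_lim (\<lambda>u. Y x u \<omega>) s ** transpose B) + J)"
    using v unfolding mucogarch_volatility_def Let_def by blast
  show ?thesis
    using N E Y0 AE_space
  proof eventually_elim
    case (elim \<omega>)
    have "counting_path (\<lambda>t. Nf \<omega> t) (Xf \<omega>) (\<lambda>t. L t \<omega>)"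
    proof
      show "mono_on {0..} (Nf \<omega>)" using elim(1) by (auto simp: mono_on_def Nf_def)
      show "L t \<omega> = (\<Sum>i<Nf \<omega> t. Xf \<omega> i)" if "0 \<le> t" for t using L[OF that elim(4)] that by (simp add: Nf_def Xf_def)
      show "(Nf \<omega> \<longlongrightarrow> Nf \<omega> t) (at_right t)" if t: "0 \<le> t" for t
      proof -
        have "((\<lambda>s. N s \<omega>) \<longlongrightarrow> N t \<omega>) (at_right t)" using elim(1) t by blast
        moreover have "\<forall>\<^sub>F s in at_right t. N s \<omega> = Nf \<omega> s"
          using t by (auto simp: eventually_at_right_field Nf_def intro!: exI[of _ "t + 1"])
        ultimately have "(Nf \<omega> \<longlongrightarrow> N t \<omega>) (at_right t)" by (rule Lim_transform_eventually)
        then show ?thesis using t by (simp add: Nf_def)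
      qed
    qed
    moreover have "Y x t \<omega> \<in> psd" if "0 \<le> t" for t
      using measurable_space[OF Ym[OF that] elim(4)] by (simp add: space_restrict_space)
    ultimately have "volatility_path (\<lambda>t. Nf \<omega> t) (Xf \<omega>) (\<lambda>t. L t \<omega>) A B C (\<lambda>t. Y x t \<omega>)"
      using elim(2) C by (simp add: volatility_path_def volatility_path_axioms_def)
    then show ?case using elim(1,3) by (simp add: Nf_def)
  qed
qed

text \<open>Conditioning on the counting path, carried out by Fubini for the product law
  \<open>joint_law\<close>. On the event \<open>G\<close> the position is an explicit function
  \<Phi> of jump sizes and counting path; discarding the other paths gives a lower bound.\<close>

lemma law_lower_bound:
  assumes x: "x \<in> psd" and t: "0 \<le> t" and G: "G \<in> sets path_space"
    and \<Phi>: "\<Phi> \<in> borel_measurable ((\<Pi>\<^sub>M i\<in>UNIV. borel) \<Otimes>\<^sub>M path_space)"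
    and eq: "AE \<omega> in M. Nf \<omega> \<in> G \<longrightarrow> Y x t \<omega> = \<Phi> (Xf \<omega>, Nf \<omega>)"
    and E: "E \<in> sets psd_space"
  shows "(\<integral>\<^sup>+n. indicator G n * (\<integral>\<^sup>+X. indicator E (\<Phi> (X, n)) \<partial>PX) \<partial>PN) \<le> emeasure (distr M psd_space (Y x t)) E"
proof -
  let ?XN = "(\<Pi>\<^sub>M i\<in>UNIV. (borel :: (real^'n) measure)) \<Otimes>\<^sub>M path_space"
  interpret PN: prob_space PN by (rule M.prob_space_distr[OF Nf_measurable])
  interpret F0: prob_space F by (rule F)
  interpret PX0: product_prob_space "\<lambda>_::nat. F" UNIV ..
  interpret XN: pair_sigma_finite PX PN ..
  have Eb: "E \<in> sets borel" "E \<subseteq> psd" using E by (auto simp: sets_restrict_space_iff)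
  have XNm: "(\<lambda>\<omega>. (Xf \<omega>, Nf \<omega>)) \<in> measurable M ?XN" by (rule measurable_Pair[OF Xf_measurable Nf_measurable])
  have sXN: "sets (PX \<Otimes>\<^sub>M PN) = sets ?XN" by (rule sets_pair_measure_cong) (simp_all add: sets_PiM_F)
  define h :: "(nat \<Rightarrow> real^'n) \<times> (real \<Rightarrow> nat) \<Rightarrow> ennreal" where "h p = indicator G (snd p) * indicator E (\<Phi> p)" for p
  have Ei: "(\<lambda>p. indicator E (\<Phi> p) :: ennreal) \<in> borel_measurable ?XN"
    using Eb by (intro measurable_compose[OF \<Phi>]) auto
  have hm: "h \<in> borel_measurable ?XN"
    unfolding h_def[abs_def] using G by (intro borel_measurable_times_ennreal Ei measurable_compose[OF measurable_snd]) auto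
  have "(\<integral>\<^sup>+n. indicator G n * (\<integral>\<^sup>+X. indicator E (\<Phi> (X, n)) \<partial>PX) \<partial>PN) = (\<integral>\<^sup>+n. \<integral>\<^sup>+X. h (X, n) \<partial>PX \<partial>PN)"
  proof (rule nn_integral_cong)
    fix n assume n: "n \<in> space PN"
    have "(\<lambda>X. indicator E (\<Phi> (X, n)) :: ennreal) \<in> borel_measurable (\<Pi>\<^sub>M i\<in>UNIV. borel)"
      by (rule measurable_compose[OF measurable_Pair2' Ei]) (use n in simp)
    then have "(\<lambda>X. indicator E (\<Phi> (X, n)) :: ennreal) \<in> borel_measurable PX"
      by (simp only: measurable_cong_sets[OF sets_PiM_F refl])
    then show "indicator G n * (\<integral>\<^sup>+X. indicator E (\<Phi> (X, n)) \<partial>PX) = (\<integral>\<^sup>+X. h (X, n) \<partial>PX)"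
      unfolding h_def by (simp add: nn_integral_cmult)
  qed
  also have "\<dots> = (\<integral>\<^sup>+p. h p \<partial>(PX \<Otimes>\<^sub>M PN))"
    by (rule XN.nn_integral_snd) (simp add: hm measurable_cong_sets[OF sXN refl])
  also have "\<dots> = (\<integral>\<^sup>+\<omega>. h (Xf \<omega>, Nf \<omega>) \<partial>M)"
    unfolding joint_law[symmetric] by (rule nn_integral_distr[OF XNm]) (simp add: hm)
  also have "\<dots> \<le> (\<integral>\<^sup>+\<omega>. indicator (Y x t -` E \<inter> space M) \<omega> \<partial>M)"
  proof (rule nn_integral_mono_AE)
    show "AE \<omega> in M. h (Xf \<omega>, Nf \<omega>) \<le> indicator (Y x t -` E \<inter> space M) \<omega>"
      using eq AE_space by eventually_elim (auto simp: h_def indicator_def)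
  qed
  also have "\<dots> = emeasure M (Y x t -` E \<inter> space M)"
    using Y[OF x] t E by (intro nn_integral_indicator measurable_sets[OF _ E]) (auto simp: mucogarch_volatility_def)
  also have "\<dots> = emeasure (distr M psd_space (Y x t)) E"
    using Y[OF x] t E by (intro emeasure_distr[symmetric]) (auto simp: mucogarch_volatility_def)
  finally show ?thesis .
qed

text \<open>The ticks continue beyond 1, so K = 2d describes two consecutive blocks.\<close>

definition jump_pattern :: "real \<Rightarrow> nat \<Rightarrow> (real \<Rightarrow> nat) set" where
  "jump_pattern a K = {n \<in> space path_space. n a = n 0 \<and> (\<forall>k<K. n (a + tick (Suc k)) = Suc (n (a + tick k)))}"

lemma path_component: "0 \<le> t \<Longrightarrow> (\<lambda>n. n t) \<in> measurable path_space (count_space UNIV)"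
  by (rule measurable_component_singleton) simp

lemma jump_pattern_sets: "0 \<le> a \<Longrightarrow> jump_pattern a K \<in> sets path_space"
proof -
  assume a: "0 \<le> a"
  have [measurable]: "(\<lambda>n. n a) \<in> measurable path_space (count_space UNIV)" "(\<lambda>n. n 0) \<in> measurable path_space (count_space UNIV)"
    "(\<lambda>n. n (a + tick k)) \<in> measurable path_space (count_space UNIV)" for k
    using a tick(4)[of k] by (auto intro!: path_component)
  show ?thesis unfolding jump_pattern_def by measurable
qed

lemma jump_pattern_pos:
  assumes a: "0 < a"
  shows "emeasure PN (jump_pattern a K) \<noteq> 0"
proof -
  \<comment> \<open>The waiting interval from 0 to \<open>a\<close> takes index 0, so the ticks are
    shifted by one. Accordingly the prescribed increments \<open>c\<close> are 0 first and 1 from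
    then on.\<close>
  define \<tau> where "\<tau> i = (if i = 0 then 0 else a + tick (i - 1))" for i
  have tau_less: "\<tau> i < \<tau> (Suc i)" for i
  proof (cases i)
    case (Suc m) then show ?thesis using tick(3)[of m] by (simp add: \<tau>_def)
  qed (use a in \<open>simp add: \<tau>_def tick\<close>)
  have tau0: "0 \<le> \<tau> i" for i using a tick(4) by (auto simp: \<tau>_def intro: add_nonneg_nonneg)
  have mono: "mono \<tau>" using tau_less by (simp add: mono_iff_le_Suc less_imp_le)
  define c where "c i = (if i = 0 then 0 else 1 :: nat)" for i :: nat
  let ?Z = "\<lambda>i \<omega>. N (\<tau> (Suc i)) \<omega> - N (\<tau> i) \<omega>"
  have ind: "M.indep_vars (\<lambda>_. count_space UNIV) ?Z {..<Suc K}"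
    using pois mono tau0[of 0] unfolding poisson_process_def by blast
  have pr: "M.prob (?Z i -` {c i} \<inter> space M) > 0" for i
  proof -
    have "N (\<tau> (Suc i)) \<in> measurable M (count_space UNIV)" "N (\<tau> i) \<in> measurable M (count_space UNIV)"
      using N_measurable tau0 by auto
    then have Zm: "?Z i \<in> measurable M (count_space UNIV)" by measurable
    have "distr M (count_space UNIV) (?Z i) = measure_pmf (poisson_pmf (rate * (\<tau> (Suc i) - \<tau> i)))"
      using pois tau0[of i] tau_less[of i] unfolding poisson_process_def by blast
    then have "M.prob (?Z i -` {c i} \<inter> space M) = pmf (poisson_pmf (rate * (\<tau> (Suc i) - \<tau> i))) (c i)"
      using measure_distr[OF Zm, of "{c i}"] by (simp add: pmf.rep_eq)
    moreover have "rate * (\<tau> (Suc i) - \<tau> i) > 0" using pois tau_less[of i] by (simp add: poisson_process_def)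
    ultimately show ?thesis by (simp add: pmf_poisson)
  qed
  have "M.prob (\<Inter>i\<in>{..<Suc K}. ?Z i -` {c i} \<inter> space M) = (\<Prod>i\<in>{..<Suc K}. M.prob (?Z i -` {c i} \<inter> space M))"
    by (rule M.indep_varsD[OF ind]) auto
  also have "\<dots> > 0" by (intro prod_pos ballI pr)
  finally have p: "M.prob (\<Inter>i\<in>{..<Suc K}. ?Z i -` {c i} \<inter> space M) > 0" .
  \<comment> \<open>The increments are truncated differences of natural numbers. They determine the
    values of the counter only on monotone paths, hence the inclusion almost everywhere.\<close>
  have AEm: "AE \<omega> in M. \<omega> \<in> (\<Inter>i\<in>{..<Suc K}. ?Z i -` {c i} \<inter> space M) \<longrightarrow> \<omega> \<in> Nf -` jump_pattern a K \<inter> space M"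
  proof -
    have "AE \<omega> in M. mono_on {0..} (\<lambda>t. N t \<omega>)" using pois by (auto simp: poisson_process_def)
    then show ?thesis
    proof eventually_elim
      case (elim \<omega>)
      have le: "N (\<tau> i) \<omega> \<le> N (\<tau> (Suc i)) \<omega>" for i
        using elim tau0 tau_less[of i] by (auto simp: mono_on_def)
      show ?case
      proof
        assume w: "\<omega> \<in> (\<Inter>i\<in>{..<Suc K}. ?Z i -` {c i} \<inter> space M)"
        have eq: "N (\<tau> (Suc i)) \<omega> = N (\<tau> i) \<omega> + c i" if "i \<le> K" for i
        proof -
          have "\<omega> \<in> ?Z i -` {c i} \<inter> space M" by (rule INT_D[OF w]) (use that in simp)
          then show ?thesis using le[of i] by auto
        qed
        have "Nf \<omega> a = Nf \<omega> 0" using eq[of 0] a by (simp add: \<tau>_def c_def Nf_def tick)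
        moreover have "Nf \<omega> (a + tick (Suc k)) = Suc (Nf \<omega> (a + tick k))" if "k < K" for k
          using eq[of "Suc k"] that a tick(4)[of k] tick(4)[of "Suc k"] by (simp add: \<tau>_def c_def Nf_def)
        moreover have "Nf \<omega> \<in> space path_space" "\<omega> \<in> space M"
          using INT_D[OF w, of 0] measurable_space[OF Nf_measurable] by auto
        ultimately show "\<omega> \<in> Nf -` jump_pattern a K \<inter> space M" by (simp add: jump_pattern_def)
      qed
    qed
  qed
  have m: "Nf -` jump_pattern a K \<inter> space M \<in> sets M" by (rule measurable_sets[OF Nf_measurable jump_pattern_sets]) (use a in simp)
  have "M.prob (\<Inter>i\<in>{..<Suc K}. ?Z i -` {c i} \<inter> space M) \<le> M.prob (Nf -` jump_pattern a K \<inter> space M)"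
    by (rule M.finite_measure_mono_AE[OF AEm m])
  then have "M.prob (Nf -` jump_pattern a K \<inter> space M) > 0" using p by simp
  then show ?thesis
    using a by (subst emeasure_distr[OF Nf_measurable jump_pattern_sets]) (auto simp: M.emeasure_eq_measure)
qed

end

section \<open>Positivity at all large times and irreducibility\<close>

lemma nn_integral_pos:
  assumes f: "f \<in> borel_measurable M" and A: "A \<in> sets M" "emeasure M A \<noteq> 0" and pos: "AE x in M. x \<in> A \<longrightarrow> 0 < f x"
  shows "0 < (\<integral>\<^sup>+x. f x \<partial>M)"
proof (rule ccontr)
  assume "\<not> 0 < (\<integral>\<^sup>+x. f x \<partial>M)"
  then have "AE x in M. f x = 0" using f by (simp add: nn_integral_0_iff_AE)
  then have "AE x in M. x \<notin> A" using pos by eventually_elim auto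
  then show False using A AE_iff_null_sets[of A M] by (auto simp: null_sets_def)
qed

lemma open_emeasure_pos:
  fixes S :: "'a::euclidean_space set"
  assumes "open S" "S \<noteq> {}"
  shows "emeasure lborel S \<noteq> 0"
proof
  assume "emeasure lborel S = 0"
  then have "AE x in lborel. x \<notin> S" using assms(1) AE_iff_null_sets[of S lborel] by (auto simp: null_sets_def)
  then have "negligible S" using AE_lborel_negligibleD[of "\<lambda>x. x \<notin> S"] by simp
  then show False using open_not_negligible assms by blast
qed

lemma open_invertible: "open {W :: real^'n^'n. det W \<noteq> 0}"
proof -
  have "continuous_on UNIV (det :: real^'n^'n \<Rightarrow> real)"
    unfolding det_def by (intro continuous_intros continuous_on_component)
  then have "open (det -` (- {0}) :: (real^'n^'n) set)" by (intro open_vimage) auto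
  moreover have "det -` (- {0}) = {W :: real^'n^'n. det W \<noteq> 0}" by auto
  ultimately show ?thesis by simp
qed

lemma norm_flow_le: "norm (flow B t x) \<le> (norm (mexp B t))\<^sup>2 * norm x"
proof -
  have "norm (flow B t x) \<le> norm (mexp B t ** x) * norm (mexp B t)"
    using norm_matrix_mult_le[of "mexp B t ** x" "transpose (mexp B t)"] unfolding flow_def norm_transpose .
  also have "\<dots> \<le> (norm (mexp B t) * norm x) * norm (mexp B t)" by (intro mult_right_mono norm_matrix_mult_le) auto
  finally show ?thesis by (simp add: power2_eq_square mult_ac)
qed

lemma pd_diff:
  assumes S: "transpose S = S" "\<And>v. e * (norm v)\<^sup>2 \<le> v \<bullet> (S *v v)" and y: "y \<in> psd" "norm y < e"
  shows "S - y \<in> pd"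
proof -
  have b: "(e - norm y) * (norm v)\<^sup>2 \<le> v \<bullet> ((S - y) *v v)" for v
    using S(2)[of v] quad_norm_bound[of v y] by (simp add: matrix_vector_mult_diff_rdistrib inner_diff_right algebra_simps)
  have "0 < v \<bullet> ((S - y) *v v)" if "v \<noteq> 0" for v
  proof -
    have "0 < (e - norm y) * (norm v)\<^sup>2" using y that by simp
    then show ?thesis using b[of v] by linarith
  qed
  then show ?thesis using S(1) psdD(1)[OF y(1)] by (simp add: pd_def transpose_sub)
qed

lemma psd_diff_mat:
  "S - e *\<^sub>R mat 1 \<in> psd \<longleftrightarrow> transpose S = S \<and> (\<forall>v. e * (norm v)\<^sup>2 \<le> v \<bullet> (S *v v))" for S :: "real^'n^'n"
proof -
  have "transpose (S - e *\<^sub>R mat 1) = S - e *\<^sub>R mat 1 \<longleftrightarrow> transpose S = S"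
    by (simp add: transpose_sub transpose_scaleR)
  moreover have "v \<bullet> ((S - e *\<^sub>R mat 1) *v v) = v \<bullet> (S *v v) - e * (norm v)\<^sup>2" for v
    by (simp add: matrix_vector_mult_diff_rdistrib scaleR_matrix_vector inner_diff_right dot_square_norm)
  ultimately show ?thesis by (simp add: psd_def)
qed

lemma jump_time_bounds:
  assumes "s < e" shows "s \<le> jump_time s e n" "jump_time s e n \<le> e"
proof -
  let ?Q = "(\<rat> \<inter> {s<..<e}) \<union> {e}"
  have g: "s \<le> (if n s < n q then q else e)" if "q \<in> ?Q" for q using that assms by auto
  show "s \<le> jump_time s e n"
    unfolding jump_time_def by (rule cINF_greatest) (use g in auto)
  have "bdd_below ((\<lambda>q. if n s < n q then q else e) ` ?Q)"
  proof (rule bdd_belowI[of _ s])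
    fix v assume "v \<in> (\<lambda>q. if n s < n q then q else e) ` ?Q"
    then show "s \<le> v" using g by blast
  qed
  from cINF_lower[OF this, of e] show "jump_time s e n \<le> e" by (simp add: jump_time_def)
qed

lemma (in gram_density) offs_bounds: "k < CARD('n) \<Longrightarrow> offs s n k \<in> {0..1}"
  using jump_time_bounds[of "s + tick k" "s + tick (Suc k)" n] tick(3,4)[of k] tick_mono[of "Suc k" "CARD('n)"] tick(2)
  by (simp add: offs_def)

definition (in gram_density) good_radius :: "real \<Rightarrow> bool" where
  "good_radius r \<longleftrightarrow> 0 < r \<and> (\<forall>y\<in>psd. \<forall>\<tau>. (\<forall>k<CARD('n). \<tau> k \<in> {0..1}) \<longrightarrow>
    (AE p in lborel. det (snd p) \<noteq> 0 \<and> symz (fst p) - y \<in> pd \<and> norm (symz (fst p) - y) < r \<longrightarrow> 0 < u y \<tau> p))"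

lemma (in gram_density) good_radius_exists: "\<exists>r. good_radius r"
  using stage_positive by (auto simp: good_radius_def)

context mucogarch_process
begin

abbreviation P :: "real \<Rightarrow> real^'n^'n \<Rightarrow> (real^'n^'n) measure" where
  "P t x \<equiv> distr M psd_space (Y x t)"

abbreviation seq_space :: "(nat \<Rightarrow> real^'n) measure" where "seq_space \<equiv> \<Pi>\<^sub>M i\<in>UNIV. borel"

lemma run_joint_measurable:
  assumes y: "(\<lambda>p. y p) \<in> borel_measurable (seq_space \<Otimes>\<^sub>M path_space)" and s: "0 \<le> s"
  shows "(\<lambda>p. run (y p) (offs s (snd p)) (\<lambda>k. fst p (c + k)) CARD('n)) \<in> borel_measurable (seq_space \<Otimes>\<^sub>M path_space)"
proof (rule borel_measurable_run[OF y])
  fix i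
  show "(\<lambda>p. offs s (snd p) i) \<in> borel_measurable (seq_space \<Otimes>\<^sub>M path_space)"
    by (rule measurable_compose[OF measurable_snd offs_measurable[OF s]])
  show "(\<lambda>p. fst p (c + i)) \<in> borel_measurable (seq_space \<Otimes>\<^sub>M path_space)"
    by (rule measurable_compose[OF measurable_fst]) (rule measurable_component_singleton, simp)
qed

lemma section_measurable:
  assumes \<Phi>: "\<Phi> \<in> borel_measurable (seq_space \<Otimes>\<^sub>M path_space)" and E: "E \<in> sets psd_space"
  shows "(\<lambda>n. \<integral>\<^sup>+X. indicator E (\<Phi> (X, n)) \<partial>PX) \<in> borel_measurable path_space"
proof -
  have sf: "sigma_finite_measure PX" by (rule prob_space_imp_sigma_finite) (rule prob_space_PiM, rule F)
  have Eb: "E \<in> sets borel" using E by (auto simp: sets_restrict_space_iff)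
  have "(\<lambda>p. indicator E (\<Phi> p) :: ennreal) \<in> borel_measurable (seq_space \<Otimes>\<^sub>M path_space)"
    using Eb by (intro measurable_compose[OF \<Phi>]) auto
  from measurable_compose[OF measurable_pair_swap' this]
  have "(\<lambda>(n, X). indicator E (\<Phi> (X, n)) :: ennreal) \<in> borel_measurable (path_space \<Otimes>\<^sub>M seq_space)"
    by (simp add: case_prod_unfold)
  then have "(\<lambda>(n, X). indicator E (\<Phi> (X, n)) :: ennreal) \<in> borel_measurable (path_space \<Otimes>\<^sub>M PX)"
    by (simp only: measurable_cong_sets[OF sets_pair_measure_cong[OF refl sets_PiM_F] refl])
  then show ?thesis by (rule sigma_finite_measure.borel_measurable_nn_integral[OF sf])
qed

lemma start_flow:
  assumes path: "volatility_path n x l A B C y" and a: "0 < a" and n: "n a = n 0"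
  shows "y a = flow B a (y 0)"
proof -
  interpret volatility_path n x l A B C y by (rule path)
  show ?thesis using path_no_jump[of 0 a] a n by simp
qed

lemma one_stage_law:
  assumes x: "x \<in> psd" and a: "0 < a" and E: "E \<in> sets psd_space"
  shows "(\<integral>\<^sup>+n. indicator (jump_pattern a CARD('n)) n * (\<integral>\<^sup>+X. indicator E (run (flow B (a + 1) x) (offs a n) X CARD('n)) \<partial>PX) \<partial>PN) \<le> emeasure (P (a + 1) x) E"
proof -
  define \<Phi> where "\<Phi> p = run (flow B (a + 1) x) (offs a (snd p)) (\<lambda>k. fst p (0 + k)) CARD('n)" for p
  have \<Phi>: "\<Phi> \<in> borel_measurable (seq_space \<Otimes>\<^sub>M path_space)"
    unfolding \<Phi>_def by (rule run_joint_measurable) (use a in auto)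
  have eq: "AE \<omega> in M. Nf \<omega> \<in> jump_pattern a CARD('n) \<longrightarrow> Y x (a + 1) \<omega> = \<Phi> (Xf \<omega>, Nf \<omega>)"
    using volatility_path_AE[OF x]
  proof eventually_elim
    case (elim \<omega>)
    show ?case
    proof
      assume ev: "Nf \<omega> \<in> jump_pattern a CARD('n)"
      from elim have path: "volatility_path (Nf \<omega>) (Xf \<omega>) (\<lambda>t. L t \<omega>) A B C (\<lambda>t. Y x t \<omega>)" by simp
      have "Y x a \<omega> = flow B a x" using start_flow[OF path a] ev elim by (simp add: jump_pattern_def)
      moreover have "Nf \<omega> a = 0" using ev elim by (simp add: jump_pattern_def)
      ultimately have "Y x (a + 1) \<omega> = run (flow B 1 (flow B a x)) (offs a (Nf \<omega>)) (\<lambda>k. Xf \<omega> k) CARD('n)"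
        using path_stage(1)[OF path, of a] a ev by (simp add: jump_pattern_def)
      then show "Y x (a + 1) \<omega> = \<Phi> (Xf \<omega>, Nf \<omega>)" by (simp add: \<Phi>_def flow_add[symmetric] add.commute)
    qed
  qed
  from law_lower_bound[OF x _ jump_pattern_sets \<Phi> eq E] a show ?thesis by (simp add: \<Phi>_def)
qed

text \<open>\<open>Q\<close> consists of lifts of points of \<open>E\<close> in the region where
  \<open>u\<close> is positive almost everywhere. So \<open>E\<close> is charged for each counting
  path in the pattern, and the pattern has positive probability.\<close>

lemma law_positive:
  assumes r: "good_radius r" and x: "x \<in> psd" and a: "0 < a" and E: "E \<in> sets psd_space"
    and Q: "(Q :: ((real^'n^'n) \<times> (real^'n^'n)) set) \<in> sets borel" "emeasure lborel Q \<noteq> 0"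
    and QE: "\<And>m w. (m, w) \<in> Q \<Longrightarrow> det w \<noteq> 0 \<and> symz m \<in> E \<and> symz m - flow B (a + 1) x \<in> pd \<and> norm (symz m - flow B (a + 1) x) < r"
  shows "0 < emeasure (P (a + 1) x) E"
proof -
  let ?y = "flow B (a + 1) x"
  have y: "?y \<in> psd" by (rule flow_psd[OF x])
  have Eb [measurable]: "E \<in> sets borel" using E by (auto simp: sets_restrict_space_iff)
  have inner: "0 < (\<integral>\<^sup>+X. indicator E (run ?y (offs a n) X CARD('n)) \<partial>PX)" for n
  proof -
    have "0 < (\<integral>\<^sup>+p. indicator E (symz (fst p)) * u ?y (offs a n) p \<partial>lborel)"
    proof (rule nn_integral_pos[where A = Q])
      have "(\<lambda>p :: (real^'n^'n) \<times> (real^'n^'n). indicator E (symz (fst p)) :: ennreal) \<in> borel_measurable borel"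
        by (rule measurable_compose[OF borel_measurable_fst']) measurable
      moreover have "u ?y (offs a n) \<in> borel_measurable borel" by (rule borel_measurable_u) auto
      ultimately show "(\<lambda>p. indicator E (symz (fst p)) * u ?y (offs a n) p) \<in> borel_measurable lborel"
        by (simp add: borel_measurable_times_ennreal)
      have "AE p in lborel. det (snd p) \<noteq> 0 \<and> symz (fst p) - ?y \<in> pd \<and> norm (symz (fst p) - ?y) < r \<longrightarrow> 0 < u ?y (offs a n) p"
        using r y offs_bounds unfolding good_radius_def by blast
      then show "AE p in lborel. p \<in> Q \<longrightarrow> 0 < indicator E (symz (fst p)) * u ?y (offs a n) p"
        by eventually_elim (use QE in auto)
    qed (use Q in auto)
    also have "\<dots> \<le> (\<integral>\<^sup>+X. indicator E (run ?y (offs a n) X CARD('n)) \<partial>PX)"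
      by (rule stage_bound[OF y]) measurable
    finally show ?thesis .
  qed
  have "0 < (\<integral>\<^sup>+n. indicator (jump_pattern a CARD('n)) n * (\<integral>\<^sup>+X. indicator E (run ?y (offs a n) X CARD('n)) \<partial>PX) \<partial>PN)"
  proof (rule nn_integral_pos[where A = "jump_pattern a CARD('n)"])
    have "(\<lambda>p. run ?y (offs a (snd p)) (\<lambda>k. fst p (0 + k)) CARD('n)) \<in> borel_measurable (seq_space \<Otimes>\<^sub>M path_space)"
      by (rule run_joint_measurable) (use a in auto)
    from section_measurable[OF this E] jump_pattern_sets[of a "CARD('n)"] a
    show "(\<lambda>n. indicator (jump_pattern a CARD('n)) n * (\<integral>\<^sup>+X. indicator E (run ?y (offs a n) X CARD('n)) \<partial>PX)) \<in> borel_measurable PN"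
      by (simp add: borel_measurable_times_ennreal)
    show "jump_pattern a CARD('n) \<in> sets PN" using jump_pattern_sets[of a] a by simp
    show "emeasure PN (jump_pattern a CARD('n)) \<noteq> 0" by (rule jump_pattern_pos[OF a])
  qed (use inner in auto)
  also have "\<dots> \<le> emeasure (P (a + 1) x) E" by (rule one_stage_law[OF x a E])
  finally show ?thesis .
qed

text \<open>The radius r / 2 leaves the other half for the starting point carried along by the flow:
  the difference of the two has to stay below r.\<close>

definition nbhd :: "real \<Rightarrow> (real^'n^'n) set" where
  "nbhd r = {S\<in>psd. norm S < r / 2}"

lemma nbhd_borel: "nbhd r \<in> sets borel"
proof -
  have "nbhd r = psd \<inter> ball 0 (r / 2)" by (auto simp: nbhd_def)
  then show ?thesis by auto
qed

lemma emeasure_lebesgue_psd_on: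
  assumes D: "D \<in> sets psd_space"
  shows "emeasure (lebesgue_psd_on (nbhd r)) D = emeasure lebesgue_sym (nbhd r \<inter> D)"
proof -
  have Db: "D \<in> sets borel" "D \<subseteq> psd" using D by (auto simp: sets_restrict_space_iff)
  have s: "sets (restrict_space lebesgue_sym psd) = sets (psd_space :: (real^'n^'n) measure)"
    by (rule sets_restrict_space_cong) simp
  have n: "nbhd r \<in> sets (psd_space :: (real^'n^'n) measure)" using nbhd_borel by (auto simp: sets_restrict_space_iff nbhd_def)
  have "emeasure (lebesgue_psd_on (nbhd r)) D = emeasure (restrict_space lebesgue_sym psd) (nbhd r \<inter> D)"
    unfolding lebesgue_psd_on_def using D n s by (subst emeasure_density) (auto simp: indicator_inter_arith[symmetric])
  also have "\<dots> = emeasure lebesgue_sym (nbhd r \<inter> D)"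
    using Db by (intro emeasure_restrict_space) auto
  finally show ?thesis .
qed

text \<open>Up to a null set the matrices of \<open>D\<close> near 0 are positive definite, so one
  of the pieces \<open>Dk k\<close>, where the form is at least 1/(k + 1), has positive measure.
  Once the starting point has shrunk below that bound, its difference to every matrix of the piece
  is positive definite and thus within reach of one block.\<close>

lemma eventually_positive:
  assumes stable: "\<And>z. eigenvalue B z \<Longrightarrow> Re z < 0"
    and r: "good_radius r" and D: "D \<in> sets psd_space" and pos: "emeasure (lebesgue_psd_on (nbhd r)) D \<noteq> 0"
    and R: "0 \<le> R"
  shows "\<exists>T\<ge>0. \<forall>t\<ge>T. \<forall>x\<in>psd. norm x \<le> R \<longrightarrow> 0 < emeasure (P t x) D"
proof -
  have Db: "D \<in> sets borel" "D \<subseteq> psd" using D by (auto simp: sets_restrict_space_iff)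
  have r0: "r > 0" using r by (simp add: good_radius_def)
  define D' where "D' = nbhd r \<inter> D"
  have D'b: "D' \<in> sets borel" using Db nbhd_borel by (auto simp: D'_def)
  define Dk where "Dk k = {S\<in>D'. S - (1 / real (Suc k)) *\<^sub>R mat 1 \<in> psd}" for k :: nat
  have Dkb: "Dk k \<in> sets borel" for k
  proof -
    have "{S :: real^'n^'n. S - (1 / real (Suc k)) *\<^sub>R mat 1 \<in> psd} \<in> sets borel"
      using measurable_sets[of "\<lambda>S :: real^'n^'n. S - (1 / real (Suc k)) *\<^sub>R mat 1" borel borel psd] psd_borel
      by (simp add: vimage_def)
    moreover have "Dk k = D' \<inter> {S. S - (1 / real (Suc k)) *\<^sub>R mat 1 \<in> psd}" by (auto simp: Dk_def)
    ultimately show ?thesis using D'b by auto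
  qed
  have cover: "D' \<subseteq> (psd - pd) \<union> (\<Union>k. Dk k)"
  proof
    fix S assume S: "S \<in> D'"
    show "S \<in> (psd - pd) \<union> (\<Union>k. Dk k)"
    proof (cases "S \<in> pd")
      case True
      obtain c where c: "c > 0" "\<And>v. c * (norm v)\<^sup>2 \<le> v \<bullet> (S *v v)" using pd_lower_bound[OF True] by blast
      obtain k where k: "inverse (real (Suc k)) < c" using reals_Archimedean[OF c(1)] by blast
      have "1 / real (Suc k) * (norm v)\<^sup>2 \<le> v \<bullet> (S *v v)" for v
        by (rule order_trans[OF mult_right_mono c(2)]) (use k in \<open>auto simp: inverse_eq_divide\<close>)
      then have "S \<in> Dk k" using S True psdD(1)[OF pd_psd[OF True]] by (simp add: Dk_def psd_diff_mat del: of_nat_Suc)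
      then show ?thesis by blast
    qed (use S Db in \<open>auto simp: D'_def\<close>)
  qed
  have "\<exists>k. emeasure lborel (symz -` Dk k) \<noteq> 0"
  proof (rule ccontr)
    assume "\<not> (\<exists>k. emeasure lborel (symz -` Dk k) \<noteq> 0)"
    then have "symz -` Dk k \<in> null_sets lborel" for k using symz_vimage_borel[OF Dkb[of k]] by (auto simp: null_sets_def)
    then have "(\<Union>k. symz -` Dk k) \<in> null_sets lborel" by (intro null_sets_UN) auto
    moreover have "(symz -` (psd - pd) :: (real^'n^'n) set) \<in> null_sets lborel"
      using null_psd_diff_pd symz_vimage_borel[of "psd - pd"] psd_borel pd_borel by (auto simp: null_sets_def)
    ultimately have "symz -` (psd - pd) \<union> (\<Union>k. symz -` Dk k) \<in> null_sets lborel" by (rule null_sets.Un[rotated])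
    then have "symz -` D' \<in> null_sets lborel"
      by (rule null_sets_subset) (use symz_vimage_borel[OF D'b] cover in auto)
    then have "emeasure lebesgue_sym D' = 0" using lebesgue_sym_null_iff[OF D'b] by (auto simp: null_sets_def)
    then show False using pos emeasure_lebesgue_psd_on[OF D] by (simp add: D'_def)
  qed
  then obtain k where k: "emeasure lborel (symz -` Dk k) \<noteq> 0" ..
  define e where "e = 1 / real (Suc k)"
  \<comment> \<open>The bound \<open>e\<close> keeps the difference positive definite, the bound r /
    2 keeps it within the good radius.\<close>
  define m where "m = min e (r / 2)"
  have m0: "m > 0" using r0 by (simp add: m_def e_def)
  \<comment> \<open>The flow contracts by the square of the norm of the exponential, which is at
    most \<eta> because \<eta> is at most 1. The denominator R + 1 also covers R = 0.\<close>
  define \<eta> where "\<eta> = min 1 (m / (R + 1))"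
  have \<eta>: "\<eta> > 0" "\<eta> \<le> 1" "\<eta> * R < m"
  proof -
    show "\<eta> > 0" "\<eta> \<le> 1" using m0 R by (auto simp: \<eta>_def)
    have "\<eta> * R \<le> m / (R + 1) * R" using R by (intro mult_right_mono) (auto simp: \<eta>_def)
    also have "\<dots> < m" using m0 R by (simp add: field_simps)
    finally show "\<eta> * R < m" .
  qed
  have "\<forall>\<^sub>F t in at_top. norm (mexp B t) < \<eta>"
    using tendstoD[OF mexp_tendsto_0[OF stable] \<eta>(1)] by simp
  then obtain T where T: "\<And>t. t \<ge> T \<Longrightarrow> norm (mexp B t) < \<eta>" by (auto simp: eventually_at_top_linorder)
  let ?Q = "(symz -` Dk k) \<times> {w :: real^'n^'n. det w \<noteq> 0}"
  have W: "{w :: real^'n^'n. det w \<noteq> 0} \<in> sets borel" using open_invertible by (rule borel_open)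
  have Q: "?Q \<in> sets borel"
    unfolding borel_prod[symmetric] by (rule pair_measureI[OF symz_vimage_borel[OF Dkb[of k]] W])
  have "emeasure lborel ?Q = emeasure (lborel \<Otimes>\<^sub>M lborel) ?Q" by (simp add: lborel_prod)
  also have "\<dots> = emeasure lborel (symz -` Dk k) * emeasure lborel {w :: real^'n^'n. det w \<noteq> 0}"
    by (rule lborel.emeasure_pair_measure_Times) (use symz_vimage_borel[OF Dkb[of k]] W in auto)
  also have "\<dots> \<noteq> 0"
  proof -
    have "{w :: real^'n^'n. det w \<noteq> 0} \<noteq> {}" by (auto intro: exI[of _ "mat 1"])
    then show ?thesis using k open_emeasure_pos[OF open_invertible] by auto
  qed
  finally have Q0: "emeasure lborel ?Q \<noteq> 0" .
  \<comment> \<open>The last unit of time is the block with the jumps; the bound 2 makes the waiting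
    time t - 1 positive.\<close>
  have "0 < emeasure (P t x) D" if t: "t \<ge> max T 2" and x: "x \<in> psd" "norm x \<le> R" for t x
  proof -
    let ?y = "flow B t x"
    have ypsd: "?y \<in> psd" by (rule flow_psd[OF x(1)])
    have "norm ?y \<le> (norm (mexp B t))\<^sup>2 * norm x" by (rule norm_flow_le)
    also have "\<dots> \<le> \<eta> * R"
    proof (rule mult_mono)
      have "norm (mexp B t) * norm (mexp B t) \<le> \<eta> * 1" using T[of t] t \<eta> by (intro mult_mono) auto
      then show "(norm (mexp B t))\<^sup>2 \<le> \<eta>" by (simp add: power2_eq_square)
    qed (use x \<eta> in auto)
    finally have ny: "norm ?y < m" using \<eta> by simp
    have "0 < emeasure (P (t - 1 + 1) x) D"
    proof (rule law_positive[OF r x(1) _ D Q Q0])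
      show "0 < t - 1" using t by simp
      fix mm w assume "(mm, w) \<in> ?Q"
      then have S: "symz mm \<in> Dk k" and w: "det w \<noteq> 0" by auto
      have S': "transpose (symz mm) = symz mm" "\<And>v. e * (norm v)\<^sup>2 \<le> v \<bullet> (symz mm *v v)"
        using S by (auto simp: Dk_def psd_diff_mat e_def)
      have "symz mm - ?y \<in> pd" by (rule pd_diff[OF S' ypsd]) (use ny in \<open>simp add: m_def\<close>)
      moreover have "norm (symz mm - ?y) < r"
        using norm_triangle_ineq4[of "symz mm" ?y] S ny by (auto simp: Dk_def D'_def nbhd_def m_def)
      ultimately show "det w \<noteq> 0 \<and> symz mm \<in> D \<and> symz mm - flow B (t - 1 + 1) x \<in> pd \<and> norm (symz mm - flow B (t - 1 + 1) x) < r"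
        using w S by (auto simp: Dk_def D'_def)
    qed
    then show ?thesis by simp
  qed
  then show ?thesis by (intro exI[of _ "max T 2"]) auto
qed

lemma Y_measurable: "x \<in> psd \<Longrightarrow> 0 \<le> t \<Longrightarrow> Y x t \<in> measurable M psd_space"
  using Y[of x] by (simp add: mucogarch_volatility_def)

lemma Y_cadlag: "x \<in> psd \<Longrightarrow> AE \<omega> in M. cadlag (\<lambda>t. Y x t \<omega>)"
  using Y[of x] unfolding mucogarch_volatility_def Let_def by auto

lemma irreducible_nbhd:
  assumes stable: "\<And>z. eigenvalue B z \<Longrightarrow> Re z < 0" and r: "good_radius r"
  shows "irreducible_wrt psd_space P (lebesgue_psd_on (nbhd r))"
  unfolding irreducible_wrt_def
proof (intro conjI ballI impI)
  have s: "sets (restrict_space lebesgue_sym psd) = sets (psd_space :: (real^'n^'n) measure)"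
    by (rule sets_restrict_space_cong) simp
  then show "sets (lebesgue_psd_on (nbhd r)) = sets psd_space" by (simp add: lebesgue_psd_on_def)
  have n: "nbhd r \<in> sets (psd_space :: (real^'n^'n) measure)" using nbhd_borel by (auto simp: sets_restrict_space_iff nbhd_def)
  have sf: "sigma_finite_measure (restrict_space (lebesgue_sym :: (real^'n^'n) measure) psd)"
    by (rule sigma_finite_measure_restrict_space[OF sigma_finite_lebesgue_sym]) simp
  show "sigma_finite_measure (lebesgue_psd_on (nbhd r))"
    unfolding lebesgue_psd_on_def using n s
    by (subst sigma_finite_measure.sigma_finite_iff_density_finite[OF sf]) (auto simp: indicator_def)
  fix x :: "real^'n^'n" and D assume "x \<in> space psd_space" and D: "D \<in> sets psd_space" "0 < emeasure (lebesgue_psd_on (nbhd r)) D"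
  then have x: "x \<in> psd" by (simp add: space_restrict_space)
  have D0: "emeasure (lebesgue_psd_on (nbhd r)) D \<noteq> 0" using D(2) by simp
  obtain T where T': "T \<ge> 0" "\<And>t. t \<ge> T \<Longrightarrow> 0 < emeasure (P t x) D"
    using eventually_positive[OF stable r D(1) D0 norm_ge_zero[of x]] x by blast
  obtain g where g: "g \<in> borel_measurable borel" "\<And>t. t \<ge> 0 \<Longrightarrow> emeasure (P t x) D = g t"
    using transition_measurable[OF M.prob_space_axioms Y_measurable[OF x] Y_cadlag[OF x] D(1)] by blast
  have "0 < (\<integral>\<^sup>+t. g t * indicator {0..} t \<partial>lborel)"
  proof (rule nn_integral_pos[where A = "{T..T + 1}"])
    show "(\<lambda>t. g t * indicator {0..} t) \<in> borel_measurable lborel" using g(1) by simp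
    show "AE t in lborel. t \<in> {T..T + 1} \<longrightarrow> 0 < g t * indicator {0..} t"
      using T' g(2) by (auto simp: indicator_def)
  qed auto
  also have "(\<integral>\<^sup>+t. g t * indicator {0..} t \<partial>lborel) = (\<integral>\<^sup>+t\<in>{0..}. emeasure (P t x) D \<partial>lborel)"
    using g(2) by (intro nn_integral_cong) (auto simp: indicator_def)
  finally show "0 < (\<integral>\<^sup>+t\<in>{0..}. emeasure (P t x) D \<partial>lborel)" .
qed

end

section \<open>Two consecutive blocks and the small set\<close>

lemma (in gram_density) borel_measurable_u_product:
  assumes [measurable]: "h \<in> borel_measurable borel"
  shows "(\<lambda>S. \<integral>\<^sup>+p. h (symz (fst p)) * u (flow B t S) \<tau> p \<partial>lborel) \<in> borel_measurable borel"
proof -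
  let ?b = "borel \<Otimes>\<^sub>M (lborel :: ((real^'n^'n) \<times> (real^'n^'n)) measure)"
  have s: "snd \<in> borel_measurable ?b" by (rule measurable_compose[OF measurable_snd]) simp
  have f: "(\<lambda>q :: (real^'n^'n) \<times> (real^'n^'n) \<times> (real^'n^'n). fst (snd q)) \<in> borel_measurable ?b"
    by (rule measurable_compose[OF s borel_measurable_fst'])
  have "(\<lambda>q. h (symz (fst (snd q)))) \<in> borel_measurable ?b"
    using f by measurable
  moreover have "(\<lambda>q. u (flow B t (fst q)) \<tau> (snd q)) \<in> borel_measurable ?b"
    by (rule borel_measurable_u) (use s in \<open>auto intro: borel_measurable_flow\<close>)
  ultimately have "(\<lambda>(S, p). h (symz (fst p)) * u (flow B t S) \<tau> p) \<in> borel_measurable ?b"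
    by (simp add: case_prod_unfold borel_measurable_times_ennreal)
  then show ?thesis by (rule sigma_finite_measure.borel_measurable_nn_integral[OF sigma_finite_lborel])
qed

text \<open>Replacing the tail of an i.i.d. sequence after d terms by an independent copy does not
  change its law (\<open>comb_seq\<close>). So \<open>stage_bound\<close> applies to each block
  separately, the second one for fixed jumps of the first. The indicator of \<open>psd\<close> makes
  the middle position an admissible start.\<close>

lemma (in gram_density) two_stage_bound:
  assumes y: "y \<in> psd" and h [measurable]: "h \<in> borel_measurable borel"
  shows "(\<integral>\<^sup>+p. indicator psd (symz (fst p)) * (\<integral>\<^sup>+q. h (symz (fst q)) * u (flow B t (symz (fst p))) \<tau>' q \<partial>lborel) * u y \<tau> p \<partial>lborel)
    \<le> (\<integral>\<^sup>+X. h (run (flow B t (run y \<tau> X CARD('n))) \<tau>' (\<lambda>k. X (CARD('n) + k)) CARD('n)) \<partial>(\<Pi>\<^sub>M k\<in>UNIV. F))"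
proof -
  interpret F0: prob_space F by (rule F)
  interpret PF: sequence_space F ..
  let ?P = "\<Pi>\<^sub>M k\<in>(UNIV :: nat set). F" and ?d = "CARD('n)"
  define g where "g S = (\<integral>\<^sup>+q. h (symz (fst q)) * u (flow B t S) \<tau>' q \<partial>lborel)" for S
  have gm [measurable]: "g \<in> borel_measurable borel"
    unfolding g_def by (rule borel_measurable_u_product[OF h])
  define H where "H X = h (run (flow B t (run y \<tau> X ?d)) \<tau>' (\<lambda>k. X (?d + k)) ?d)" for X
  have comp: "(\<lambda>X. X i) \<in> borel_measurable ?P" for i
    using measurable_component_singleton[of i UNIV "\<lambda>_. F"] F(2) by (simp cong: measurable_cong_sets)
  have "(\<lambda>X. run (flow B t (run y \<tau> X ?d)) \<tau>' (\<lambda>k. X (?d + k)) ?d) \<in> borel_measurable ?P"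
    by (intro borel_measurable_run borel_measurable_flow comp) auto
  then have Hm: "H \<in> borel_measurable ?P" unfolding H_def[abs_def] by measurable
  have "(\<integral>\<^sup>+p. indicator psd (symz (fst p)) * (\<integral>\<^sup>+q. h (symz (fst q)) * u (flow B t (symz (fst p))) \<tau>' q \<partial>lborel) * u y \<tau> p \<partial>lborel)
      = (\<integral>\<^sup>+p. (indicator psd (symz (fst p)) * g (symz (fst p))) * u y \<tau> p \<partial>lborel)" by (simp add: g_def)
  also have "\<dots> \<le> (\<integral>\<^sup>+X. indicator psd (run y \<tau> X ?d) * g (run y \<tau> X ?d) \<partial>?P)"
    using stage_bound[OF y, of "\<lambda>S. indicator psd S * g S" \<tau>] by simp
  also have "\<dots> \<le> (\<integral>\<^sup>+X. \<integral>\<^sup>+X'. h (run (flow B t (run y \<tau> X ?d)) \<tau>' X' ?d) \<partial>?P \<partial>?P)"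
  proof (rule nn_integral_mono)
    fix X
    have "g (run y \<tau> X ?d) \<le> (\<integral>\<^sup>+X'. h (run (flow B t (run y \<tau> X ?d)) \<tau>' X' ?d) \<partial>?P)"
      unfolding g_def by (rule stage_bound[OF flow_psd[OF run_psd[OF y]] h])
    then show "indicator psd (run y \<tau> X ?d) * g (run y \<tau> X ?d) \<le> (\<integral>\<^sup>+X'. h (run (flow B t (run y \<tau> X ?d)) \<tau>' X' ?d) \<partial>?P)"
      using run_psd[OF y, of \<tau> X ?d] by simp
  qed
  also have "\<dots> = (\<integral>\<^sup>+X. \<integral>\<^sup>+X'. H (comb_seq ?d X X') \<partial>?P \<partial>?P)"
  proof (intro nn_integral_cong)
    fix X X' :: "nat \<Rightarrow> real^'n"
    have "run y \<tau> (comb_seq ?d X X') ?d = run y \<tau> X ?d" by (rule run_cong) (rule comb_seq_less)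
    moreover have "(\<lambda>k. comb_seq ?d X X' (?d + k)) = X'" using comb_seq_add[of ?d X X'] by (auto simp: add.commute)
    ultimately show "h (run (flow B t (run y \<tau> X ?d)) \<tau>' X' ?d) = H (comb_seq ?d X X')" by (simp add: H_def)
  qed
  also have "\<dots> = (\<integral>\<^sup>+z. H (case z of (X, X') \<Rightarrow> comb_seq ?d X X') \<partial>(?P \<Otimes>\<^sub>M ?P))"
    by (subst PF.P.nn_integral_fst[symmetric]) (use measurable_compose[OF measurable_comb_seq Hm] in \<open>auto simp: case_prod_unfold\<close>)
  also have "\<dots> = (\<integral>\<^sup>+X. H X \<partial>distr (?P \<Otimes>\<^sub>M ?P) ?P (\<lambda>(X, X'). comb_seq ?d X X'))"
    by (rule nn_integral_distr[OF measurable_comb_seq, symmetric]) (use Hm PF.PiM_comb_seq[of ?d] in \<open>simp\<close>)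
  also have "\<dots> = (\<integral>\<^sup>+X. H X \<partial>?P)" by (simp only: PF.PiM_comb_seq)
  finally show ?thesis by (simp only: H_def)
qed

text \<open>An open set on which \<open>u\<close> is positive for all small starts. Positions within
  s/4 of s times the identity have a form of at least 3s/4, so subtracting a start of norm below s/4
  leaves a positive definite matrix. The ball makes the measure of the set finite; its radius is
  large enough for the center (s times identity, identity).\<close>

lemma (in gram_density) stage_box:
  fixes K :: real
  defines "K \<equiv> norm (mat 1 :: real^'n^'n)"
  assumes r: "good_radius r" and s: "0 < s" "s < 1" "s * (K + 1) < r"
  defines "Q \<equiv> {p :: (real^'n^'n) \<times> (real^'n^'n). norm (symz (fst p) - s *\<^sub>R mat 1) < s / 4 \<and> det (snd p) \<noteq> 0} \<inter> ball 0 (2 * K + 2)"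
  shows "open Q" "emeasure lborel Q \<noteq> 0"
    and "\<And>p. p \<in> Q \<Longrightarrow> symz (fst p) \<in> psd \<and> norm (symz (fst p)) \<le> s * (K + 1)"
    and "\<And>y \<tau>. y \<in> psd \<Longrightarrow> norm y < s / 4 \<Longrightarrow> (\<And>k. k < CARD('n) \<Longrightarrow> \<tau> k \<in> {0..1}) \<Longrightarrow> AE p in lborel. p \<in> Q \<longrightarrow> 0 < u y \<tau> p"
proof -
  have K0: "0 \<le> K" by (simp add: K_def)
  have "Q = {p. norm (symz (fst p) - s *\<^sub>R mat 1) < s / 4} \<inter> (UNIV \<times> {W. det W \<noteq> 0}) \<inter> ball 0 (2 * K + 2)"
    by (auto simp: Q_def)
  moreover have "open {p :: (real^'n^'n) \<times> (real^'n^'n). norm (symz (fst p) - s *\<^sub>R mat 1) < s / 4}"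
    by (intro open_Collect_less continuous_intros)
  ultimately show o: "open Q" using open_Times[OF open_UNIV open_invertible] by (auto intro!: open_Int)
  have "(s *\<^sub>R mat 1, mat 1) \<in> Q"
  proof -
    have "norm (s *\<^sub>R mat 1 :: real^'n^'n, mat 1 :: real^'n^'n) \<le> s * K + K"
      using norm_Pair_le[of "s *\<^sub>R mat 1 :: real^'n^'n" "mat 1 :: real^'n^'n"] s by (simp add: K_def)
    also have "s * K \<le> K" using s K0 by (simp add: mult_left_le_one_le)
    finally have "norm (s *\<^sub>R mat 1 :: real^'n^'n, mat 1 :: real^'n^'n) < 2 * K + 2" by simp
    then show ?thesis using s symz_id[of "s *\<^sub>R mat 1 :: real^'n^'n"] by (simp add: Q_def transpose_scaleR)
  qed
  then show "emeasure lborel Q \<noteq> 0" using open_emeasure_pos[OF o] by blast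
  have low: "3 / 4 * s * (norm v)\<^sup>2 \<le> v \<bullet> (symz (fst p) *v v)" if p: "p \<in> Q" for p v
  proof -
    have "\<bar>v \<bullet> ((symz (fst p) - s *\<^sub>R mat 1) *v v)\<bar> \<le> s / 4 * (norm v)\<^sup>2"
      by (rule order_trans[OF quad_norm_bound mult_right_mono]) (use p in \<open>auto simp: Q_def\<close>)
    moreover have "v \<bullet> ((symz (fst p) - s *\<^sub>R mat 1) *v v) = v \<bullet> (symz (fst p) *v v) - s * (norm v)\<^sup>2"
      by (simp add: matrix_vector_mult_diff_rdistrib scaleR_matrix_vector inner_diff_right dot_square_norm)
    ultimately show ?thesis by linarith
  qed
  have nr: "norm (symz (fst p)) \<le> s / 4 + s * K" if "p \<in> Q" for p
    using norm_triangle_ineq[of "symz (fst p) - s *\<^sub>R mat 1" "s *\<^sub>R mat 1"] that s by (simp add: Q_def K_def)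
  show "symz (fst p) \<in> psd \<and> norm (symz (fst p)) \<le> s * (K + 1)" if p: "p \<in> Q" for p
  proof
    have "0 \<le> v \<bullet> (symz (fst p) *v v)" for v
      by (rule order_trans[OF _ low[OF p]]) (use s in simp)
    then show "symz (fst p) \<in> psd" by (simp add: psd_def)
    show "norm (symz (fst p)) \<le> s * (K + 1)" using nr[OF p] s by (simp add: algebra_simps)
  qed
  fix y :: "real^'n^'n" and \<tau> :: "nat \<Rightarrow> real"
  assume y: "y \<in> psd" "norm y < s / 4" and \<tau>: "\<And>k. k < CARD('n) \<Longrightarrow> \<tau> k \<in> {0..1}"
  have "AE p in lborel. det (snd p) \<noteq> 0 \<and> symz (fst p) - y \<in> pd \<and> norm (symz (fst p) - y) < r \<longrightarrow> 0 < u y \<tau> p"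
    using r y \<tau> unfolding good_radius_def by blast
  then show "AE p in lborel. p \<in> Q \<longrightarrow> 0 < u y \<tau> p"
  proof eventually_elim
    case (elim p)
    show ?case
    proof
      assume p: "p \<in> Q"
      have "symz (fst p) - y \<in> pd" by (rule pd_diff[OF symz_sym low[OF p] y(1)]) (use y s in simp)
      moreover have "norm (symz (fst p) - y) < r"
        using norm_triangle_ineq4[of "symz (fst p)" y] nr[OF p] y s by (simp add: algebra_simps)
      ultimately show "0 < u y \<tau> p" using elim p by (simp add: Q_def)
    qed
  qed
qed

context mucogarch_process
begin

text \<open>No jump up to time 1, then one block from 1 to 2 and one from 2 to 3; this is the time 3
  of the small set. The start is carried from 0 to the end of the first block by
  \<open>flow B 2\<close>, and the middle position through the second block by
  \<open>flow B 1\<close>.\<close>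

lemma two_stage_law:
  assumes x: "x \<in> psd" and E: "E \<in> sets psd_space"
  shows "(\<integral>\<^sup>+n. indicator (jump_pattern 1 (2 * CARD('n))) n * (\<integral>\<^sup>+X. indicator E (run (flow B 1 (run (flow B 2 x) (offs 1 n) X CARD('n))) (offs 2 n)
    (\<lambda>k. X (CARD('n) + k)) CARD('n)) \<partial>PX) \<partial>PN) \<le> emeasure (P 3 x) E"
proof -
  let ?d = "CARD('n)"
  define \<Phi> where "\<Phi> p = run (flow B 1 (run (flow B 2 x) (offs 1 (snd p)) (\<lambda>k. fst p (0 + k)) ?d)) (offs 2 (snd p)) (\<lambda>k. fst p (?d + k)) ?d" for p
  have \<Phi>: "\<Phi> \<in> borel_measurable (seq_space \<Otimes>\<^sub>M path_space)"
    unfolding \<Phi>_def by (intro run_joint_measurable borel_measurable_flow) auto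
  have tick_add: "tick (?d + k) = 1 + tick k" for k by (simp add: tick_def add_divide_distrib)
  have eq: "AE \<omega> in M. Nf \<omega> \<in> jump_pattern 1 (2 * ?d) \<longrightarrow> Y x 3 \<omega> = \<Phi> (Xf \<omega>, Nf \<omega>)"
    using volatility_path_AE[OF x]
  proof eventually_elim
    case (elim \<omega>)
    show ?case
    proof
      assume ev: "Nf \<omega> \<in> jump_pattern 1 (2 * ?d)"
      from elim have path: "volatility_path (Nf \<omega>) (Xf \<omega>) (\<lambda>t. L t \<omega>) A B C (\<lambda>t. Y x t \<omega>)" by simp
      have Y1: "Y x 1 \<omega> = flow B 1 x" using start_flow[OF path, of 1] ev elim by (simp add: jump_pattern_def)
      have N1: "Nf \<omega> 1 = 0" using ev elim by (simp add: jump_pattern_def)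
      have step: "Nf \<omega> (1 + tick (Suc k)) = Suc (Nf \<omega> (1 + tick k))" if "k < 2 * ?d" for k
        using ev that by (simp add: jump_pattern_def)
      have N1k: "Nf \<omega> (1 + tick k) = k" if "k \<le> ?d" for k
        using that by (induction k) (simp_all add: tick N1 step)
      have "Y x (1 + 1) \<omega> = run (flow B 1 (Y x 1 \<omega>)) (offs 1 (Nf \<omega>)) (\<lambda>k. Xf \<omega> (Nf \<omega> 1 + k)) ?d"
        by (rule path_stage(1)[OF path]) (use step in auto)
      then have Y2: "Y x 2 \<omega> = run (flow B 2 x) (offs 1 (Nf \<omega>)) (Xf \<omega>) ?d"
        using flow_add[of B 1 1 x] by (simp add: Y1 N1)
      have N2: "Nf \<omega> 2 = ?d" using N1k[of ?d] by (simp add: tick)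
      have "Y x (2 + 1) \<omega> = run (flow B 1 (Y x 2 \<omega>)) (offs 2 (Nf \<omega>)) (\<lambda>k. Xf \<omega> (Nf \<omega> 2 + k)) ?d"
      proof (rule path_stage(1)[OF path])
        fix k assume "k < ?d"
        then show "Nf \<omega> (2 + tick (Suc k)) = Suc (Nf \<omega> (2 + tick k))"
          using step[of "?d + k"] tick_add[of k] tick_add[of "Suc k"] by (simp add: add.assoc[symmetric])
      qed simp
      then show "Y x 3 \<omega> = \<Phi> (Xf \<omega>, Nf \<omega>)" by (simp add: \<Phi>_def Y2 N2)
    qed
  qed
  from law_lower_bound[OF x _ jump_pattern_sets \<Phi> eq E] show ?thesis by (simp add: \<Phi>_def)
qed

lemma two_stage_density_bound:
  assumes x: "x \<in> psd" and E: "E \<in> sets psd_space"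
  shows "(\<integral>\<^sup>+n. indicator (jump_pattern 1 (2 * CARD('n))) n * (\<integral>\<^sup>+p. indicator psd (symz (fst p)) *
     (\<integral>\<^sup>+q. indicator E (symz (fst q)) * u (flow B 1 (symz (fst p))) (offs 2 n) q \<partial>lborel) * u (flow B 2 x) (offs 1 n) p \<partial>lborel) \<partial>PN)
   \<le> emeasure (P 3 x) E"
proof (rule order_trans[OF nn_integral_mono two_stage_law[OF x E]])
  fix n
  have [measurable]: "E \<in> sets borel" using E by (auto simp: sets_restrict_space_iff)
  show "indicator (jump_pattern 1 (2 * CARD('n))) n * (\<integral>\<^sup>+p. indicator psd (symz (fst p)) *
     (\<integral>\<^sup>+q. indicator E (symz (fst q)) * u (flow B 1 (symz (fst p))) (offs 2 n) q \<partial>lborel) * u (flow B 2 x) (offs 1 n) p \<partial>lborel)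
    \<le> indicator (jump_pattern 1 (2 * CARD('n))) n * (\<integral>\<^sup>+X. indicator E (run (flow B 1 (run (flow B 2 x) (offs 1 n) X CARD('n))) (offs 2 n)
    (\<lambda>k. X (CARD('n) + k)) CARD('n)) \<partial>PX)"
    by (intro mult_left_mono two_stage_bound flow_psd x) simp_all
qed

lemma small_set_exists:
  assumes r: "good_radius r"
  shows "\<exists>D. small_set psd_space P D \<and> D \<subseteq> nbhd r \<and> emeasure lebesgue_sym D \<noteq> 0"
proof -
  let ?d = "CARD('n)"
  have r0: "r > 0" using r by (simp add: good_radius_def)
  define K where "K = norm (mat 1 :: real^'n^'n)"
  have K0: "0 \<le> K" by (simp add: K_def)
  have pick: "\<exists>s. 0 < s \<and> s < 1 \<and> s * (K + 1) < b" if b: "b > 0" for b :: real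
  proof (intro exI[of _ "min (1 / 2) (b / (2 * (K + 1)))"] conjI)
    have "min (1 / 2) (b / (2 * (K + 1))) * (K + 1) \<le> b / (2 * (K + 1)) * (K + 1)" using K0 by (intro mult_right_mono) auto
    also have "\<dots> = b / 2" using K0 by (simp add: field_simps)
    finally show "min (1 / 2) (b / (2 * (K + 1))) * (K + 1) < b" using b by simp
  qed (use b K0 in auto)
  \<comment> \<open>The sizes are chosen backwards: s2 fits the good radius, s1 is so small that the
    middle position, carried on, is below s2/4, and s0 so small that starts near s0 times the
    identity lie in \<open>X0\<close>, whose points carried on are below s1/4.\<close>
  obtain s2 where s2: "0 < s2" "s2 < 1" "s2 * (K + 1) < r" using pick[OF r0] by blast
  define m1 where "m1 = (norm (mexp B 1))\<^sup>2 + 1"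
  define m2 where "m2 = (norm (mexp B 2))\<^sup>2 + 1"
  have m: "m1 > 0" "m2 > 0" by (auto simp: m1_def m2_def add_nonneg_pos)
  obtain s1 where s1: "0 < s1" "s1 < 1" "s1 * (K + 1) < min r (s2 / (4 * m1))"
    using pick[of "min r (s2 / (4 * m1))"] r0 s2 m by auto
  obtain s0 where s0: "0 < s0" "s0 < 1" "s0 * (K + 1) < min (r / 2) (s1 / (4 * m2))"
    using pick[of "min (r / 2) (s1 / (4 * m2))"] r0 s1 m by auto
  define X0 where "X0 = {x \<in> psd :: (real^'n^'n) set. norm x < min (r / 2) (s1 / (4 * m2))}"
  have X0n: "X0 \<subseteq> nbhd r" "X0 \<subseteq> psd" by (auto simp: X0_def nbhd_def)
  have X0b [measurable]: "X0 \<in> sets borel"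
  proof -
    have "X0 = psd \<inter> ball 0 (min (r / 2) (s1 / (4 * m2)))" by (auto simp: X0_def)
    then show ?thesis by auto
  qed
  define Q where "Q s = {p :: (real^'n^'n) \<times> (real^'n^'n). norm (symz (fst p) - s *\<^sub>R mat 1) < s / 4 \<and> det (snd p) \<noteq> 0} \<inter> ball 0 (2 * K + 2)" for s
  note b1 = stage_box[OF r s1(1,2), folded K_def, folded Q_def] and b2 = stage_box[OF r s2(1,2), folded K_def, folded Q_def]
  have s1r: "s1 * (K + 1) < r" using s1 by simp
  note b1 = b1[OF s1r] and b2 = b2[OF s2(3)]
  have Qb: "Q s1 \<in> sets borel" "Q s2 \<in> sets borel" by (rule borel_open[OF b1(1)], rule borel_open[OF b2(1)])
  have start: "norm (flow B 2 x) < s1 / 4" if "x \<in> X0" for x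
  proof -
    have "norm (flow B 2 x) \<le> (norm (mexp B 2))\<^sup>2 * norm x" by (rule norm_flow_le)
    also have "\<dots> \<le> m2 * norm x" by (intro mult_right_mono) (auto simp: m2_def)
    also have "\<dots> < m2 * (s1 / (4 * m2))" using that m by (intro mult_strict_left_mono) (auto simp: X0_def)
    also have "\<dots> = s1 / 4" using m by simp
    finally show ?thesis .
  qed
  have middle: "norm (flow B 1 (symz (fst p))) < s2 / 4" if "p \<in> Q s1" for p
  proof -
    have "norm (flow B 1 (symz (fst p))) \<le> (norm (mexp B 1))\<^sup>2 * norm (symz (fst p))" by (rule norm_flow_le)
    also have "\<dots> \<le> m1 * norm (symz (fst p))" by (intro mult_right_mono) (auto simp: m1_def)
    also have "\<dots> < m1 * (s2 / (4 * m1))"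
      using b1(3)[OF that] s1(3) m by (intro mult_strict_left_mono) auto
    also have "\<dots> = s2 / 4" using m by simp
    finally show ?thesis .
  qed
  \<comment> \<open>The middle lift is integrated over a ball only, because the argument with
    countable labels requires a finite measure.\<close>
  define R :: "((real^'n^'n) \<times> (real^'n^'n)) measure" where "R = density lborel (indicator (ball 0 (2 * K + 2)))"
  have Rs [measurable_cong]: "sets R = sets borel" by (simp add: R_def)
  interpret R: finite_measure R
  proof
    show "emeasure R (space R) \<noteq> \<infinity>"
      using emeasure_lborel_ball_finite[of "0 :: (real^'n^'n) \<times> (real^'n^'n)" "2 * K + 2"] unfolding R_def
      using borel_open[OF open_ball[of "0 :: (real^'n^'n) \<times> (real^'n^'n)" "2 * K + 2"]] by (subst emeasure_density) (auto intro!: borel_measurable_indicator)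
  qed
  interpret PN: prob_space PN by (rule M.prob_space_distr[OF Nf_measurable])
  interpret S: pair_sigma_finite PN R ..
  interpret SS: finite_measure "PN \<Otimes>\<^sub>M R" by (rule finite_measure_pair_measure) unfold_locales
  let ?S = "PN \<Otimes>\<^sub>M R"
  \<comment> \<open>\<open>uu\<close> is the density of the first block from x to the middle,
    \<open>ww\<close> that of the second block from the middle to the lift q. The integrated
    variable s is the pair of counting path and middle lift. The indicators build in the jump
    pattern, the set of starts and psd positions.\<close>
  define uu :: "(real^'n^'n) \<times> (real \<Rightarrow> nat) \<times> ((real^'n^'n) \<times> (real^'n^'n)) \<Rightarrow> ennreal" where "uu = (\<lambda>(x, s). indicator X0 x * (indicator (jump_pattern 1 (2 * ?d)) (fst s) *
     (indicator psd (symz (fst (snd s))) * u (flow B 2 x) (offs 1 (fst s)) (snd s))) :: ennreal)"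
  define ww :: "((real^'n^'n) \<times> (real^'n^'n)) \<times> (real \<Rightarrow> nat) \<times> ((real^'n^'n) \<times> (real^'n^'n)) \<Rightarrow> ennreal" where "ww = (\<lambda>(q, s). indicator psd (symz (fst q)) * u (flow B 1 (symz (fst (snd s)))) (offs 2 (fst s)) q :: ennreal)"
  have offs_m: "(\<lambda>z. offs a (g z) k) \<in> borel_measurable W" if "0 \<le> a" "g \<in> measurable W path_space" for a g k and W :: "'z measure"
    by (rule measurable_compose[OF that(2) offs_measurable[OF that(1)]])
  have ev_m: "(\<lambda>z. indicator (jump_pattern 1 (2 * ?d)) (g z) :: ennreal) \<in> borel_measurable W" if "g \<in> measurable W path_space" for g and W :: "'z measure"
    by (rule measurable_compose[OF that]) (rule borel_measurable_indicator, rule jump_pattern_sets, simp)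
  have sz: "(\<lambda>z. symz (fst (g z))) \<in> borel_measurable W" if "g \<in> borel_measurable W" for g :: "'z \<Rightarrow> (real^'n^'n) \<times> (real^'n^'n)" and W
    by (rule borel_measurable_symz) (rule measurable_compose[OF that borel_measurable_fst'])
  have uu_m: "(\<lambda>z. uu (a z, b z, c z)) \<in> borel_measurable W"
    if "a \<in> borel_measurable W" "b \<in> measurable W path_space" "c \<in> borel_measurable W" for a b c and W :: "'z measure"
    unfolding uu_def prod.case fst_conv snd_conv
    by (intro borel_measurable_times_ennreal ev_m that borel_measurable_u borel_measurable_flow offs_m
        measurable_compose[OF sz borel_measurable_indicator] measurable_compose[OF that(1) borel_measurable_indicator]) auto
  have ww_m: "(\<lambda>z. ww (a z, b z, c z)) \<in> borel_measurable W"
    if "a \<in> borel_measurable W" "b \<in> measurable W path_space" "c \<in> borel_measurable W" for a b c and W :: "'z measure"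
    unfolding ww_def prod.case fst_conv snd_conv
    by (intro borel_measurable_times_ennreal that borel_measurable_u borel_measurable_flow offs_m sz
        measurable_compose[OF sz borel_measurable_indicator]) auto
  have cS: "(\<lambda>z. fst (snd z)) \<in> measurable (W \<Otimes>\<^sub>M ?S) path_space" "(\<lambda>z. snd (snd z)) \<in> borel_measurable (W \<Otimes>\<^sub>M ?S)" for W :: "'z measure"
  proof -
    show "(\<lambda>z. fst (snd z)) \<in> measurable (W \<Otimes>\<^sub>M ?S) path_space"
      by (rule measurable_compose[OF measurable_snd]) (rule measurable_compose[OF measurable_fst], simp)
    have "snd \<in> measurable ?S R" by simp
    then have "snd \<in> borel_measurable ?S" by (simp only: measurable_cong_sets[OF refl Rs])
    then show "(\<lambda>z. snd (snd z)) \<in> borel_measurable (W \<Otimes>\<^sub>M ?S)" by (rule measurable_compose[OF measurable_snd])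
  qed
  have um: "uu \<in> borel_measurable (lebesgue_sym \<Otimes>\<^sub>M ?S)"
    using uu_m[OF _ cS, of fst lebesgue_sym] measurable_compose[OF measurable_fst, of "\<lambda>x. x" lebesgue_sym borel]
    by (simp add: measurable_cong_sets[OF sets_lebesgue_sym refl])
  have wm: "ww \<in> borel_measurable (lborel \<Otimes>\<^sub>M ?S)"
    using ww_m[OF _ cS, of fst lborel] measurable_compose[OF measurable_fst, of "\<lambda>x. x" lborel borel] by simp

  have sfS: "sigma_finite_measure ?S" by unfold_locales
  \<comment> \<open>The preimage of \<open>X0\<close> under \<open>symz\<close> contains an open set
    around s0 times the identity.\<close>
  have X0pos: "emeasure lebesgue_sym X0 \<noteq> 0"
  proof -
    have "{M :: real^'n^'n. norm (symz M - s0 *\<^sub>R mat 1) < s0 / 4} \<subseteq> symz -` X0"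
    proof
      fix Z :: "real^'n^'n" assume "Z \<in> {M. norm (symz M - s0 *\<^sub>R mat 1) < s0 / 4}"
      then have Z: "norm (symz Z - s0 *\<^sub>R mat 1) < s0 / 4" by simp
      have "0 \<le> v \<bullet> (symz Z *v v)" for v
      proof -
        have "\<bar>v \<bullet> ((symz Z - s0 *\<^sub>R mat 1) *v v)\<bar> \<le> s0 / 4 * (norm v)\<^sup>2"
          by (rule order_trans[OF quad_norm_bound mult_right_mono]) (use Z in auto)
        moreover have "v \<bullet> ((symz Z - s0 *\<^sub>R mat 1) *v v) = v \<bullet> (symz Z *v v) - s0 * (norm v)\<^sup>2"
          by (simp add: matrix_vector_mult_diff_rdistrib scaleR_matrix_vector inner_diff_right dot_square_norm)
        moreover have "0 \<le> s0 * (norm v)\<^sup>2" using s0 by simp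
        ultimately show ?thesis by linarith
      qed
      then have "symz Z \<in> psd" by (simp add: psd_def)
      moreover have "norm (symz Z) \<le> s0 / 4 + s0 * K"
        using norm_triangle_ineq[of "symz Z - s0 *\<^sub>R mat 1" "s0 *\<^sub>R mat 1"] Z s0 by (simp add: K_def)
      then have "norm (symz Z) \<le> s0 * (K + 1)" using s0(1) by (simp add: distrib_left)
      ultimately show "Z \<in> symz -` X0" using s0(3) by (simp add: X0_def)
    qed
    moreover have "emeasure lborel {M :: real^'n^'n. norm (symz M - s0 *\<^sub>R mat 1) < s0 / 4} \<noteq> 0"
    proof (rule open_emeasure_pos)
      show "open {M :: real^'n^'n. norm (symz M - s0 *\<^sub>R mat 1) < s0 / 4}"
        by (intro open_Collect_less continuous_intros)
      have "s0 *\<^sub>R mat 1 \<in> {M :: real^'n^'n. norm (symz M - s0 *\<^sub>R mat 1) < s0 / 4}"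
        using s0 symz_id[of "s0 *\<^sub>R mat 1 :: real^'n^'n"] by (simp add: transpose_scaleR)
      then show "{M :: real^'n^'n. norm (symz M - s0 *\<^sub>R mat 1) < s0 / 4} \<noteq> {}" by blast
    qed
    ultimately have "emeasure lborel (symz -` X0) \<noteq> 0"
      using emeasure_mono[of "{M :: real^'n^'n. norm (symz M - s0 *\<^sub>R mat 1) < s0 / 4}" "symz -` X0" lborel] symz_vimage_borel[OF X0b] by auto
    then show ?thesis using lebesgue_sym_null_iff[OF X0b] by simp
  qed
  have joint: "(\<lambda>z. uu (x, snd z) * ww (fst z, snd z)) \<in> borel_measurable (lborel \<Otimes>\<^sub>M ?S)" for x
    using uu_m[OF _ cS, of "\<lambda>_. x" lborel] wm by (auto intro: borel_measurable_times_ennreal)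
  \<comment> \<open>With the integral over the end point innermost, the minorant has the shape of
    the left side of \<open>two_stage_density_bound\<close>.\<close>
  have swap: "(\<integral>\<^sup>+q. k q * (\<integral>\<^sup>+s. uu (x, s) * ww (q, s) \<partial>?S) \<partial>lborel) = (\<integral>\<^sup>+n. \<integral>\<^sup>+p. \<integral>\<^sup>+q. k q * (uu (x, (n, p)) * ww (q, (n, p))) \<partial>lborel \<partial>R \<partial>PN)"
    and swap_m: "(\<lambda>s. \<integral>\<^sup>+q. k q * (uu (x, s) * ww (q, s)) \<partial>lborel) \<in> borel_measurable ?S"
    if k: "k \<in> borel_measurable borel" for k x
  proof -
    interpret LS: pair_sigma_finite lborel ?S by (intro pair_sigma_finite.intro sfS sigma_finite_lborel)
    have km: "(\<lambda>z. k (fst z) * (uu (x, snd z) * ww (fst z, snd z))) \<in> borel_measurable (lborel \<Otimes>\<^sub>M ?S)"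
      by (rule borel_measurable_times_ennreal[OF _ joint]) (rule measurable_compose[OF measurable_fst], simp add: k)
    show m: "(\<lambda>s. \<integral>\<^sup>+q. k q * (uu (x, s) * ww (q, s)) \<partial>lborel) \<in> borel_measurable ?S"
      using measurable_compose[OF measurable_pair_swap' km]
      by (intro sigma_finite_measure.borel_measurable_nn_integral[OF sigma_finite_lborel]) (simp add: case_prod_unfold)
    have "(\<integral>\<^sup>+q. k q * (\<integral>\<^sup>+s. uu (x, s) * ww (q, s) \<partial>?S) \<partial>lborel) = (\<integral>\<^sup>+q. \<integral>\<^sup>+s. k q * (uu (x, s) * ww (q, s)) \<partial>?S \<partial>lborel)"
      by (intro nn_integral_cong nn_integral_cmult[symmetric] measurable_compose[OF measurable_Pair1' joint, simplified])
    also have "\<dots> = (\<integral>\<^sup>+s. \<integral>\<^sup>+q. k q * (uu (x, s) * ww (q, s)) \<partial>lborel \<partial>?S)"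
      using LS.Fubini'[of "\<lambda>q s. k q * (uu (x, s) * ww (q, s))"] km by (simp add: case_prod_unfold)
    also have "\<dots> = (\<integral>\<^sup>+n. \<integral>\<^sup>+p. \<integral>\<^sup>+q. k q * (uu (x, (n, p)) * ww (q, (n, p))) \<partial>lborel \<partial>R \<partial>PN)"
      using R.nn_integral_fst[OF m] by simp
    finally show "(\<integral>\<^sup>+q. k q * (\<integral>\<^sup>+s. uu (x, s) * ww (q, s) \<partial>?S) \<partial>lborel) = (\<integral>\<^sup>+n. \<integral>\<^sup>+p. \<integral>\<^sup>+q. k q * (uu (x, (n, p)) * ww (q, (n, p))) \<partial>lborel \<partial>R \<partial>PN)" .
  qed
  have inner: "0 < (\<integral>\<^sup>+q. \<integral>\<^sup>+s. uu (x, s) * ww (q, s) \<partial>?S \<partial>lborel)" if x: "x \<in> X0" for x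
  proof -
    have xp: "x \<in> psd" using x by (simp add: X0_def)
    let ?G = "\<lambda>n p. \<integral>\<^sup>+q. 1 * (uu (x, (n, p)) * ww (q, (n, p))) \<partial>lborel"
    have Gm: "(\<lambda>(n, p). ?G n p) \<in> borel_measurable ?S" using swap_m[of "\<lambda>_. 1" x] by (simp add: case_prod_unfold)
    have nn: "0 < (\<integral>\<^sup>+p. ?G n p \<partial>R)" if n: "n \<in> jump_pattern 1 (2 * ?d)" for n
    proof (rule nn_integral_pos[where A = "Q s1"])
      have "n \<in> space PN" using n by (simp add: jump_pattern_def)
      then show "?G n \<in> borel_measurable R" using measurable_compose[OF measurable_Pair1' Gm] by simp
      show "Q s1 \<in> sets R" using Qb by (simp only: Rs)
      have "emeasure R (Q s1) = emeasure lborel (Q s1)"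
      proof -
        have "emeasure R (Q s1) = (\<integral>\<^sup>+p. indicator (ball 0 (2 * K + 2)) p * indicator (Q s1) p \<partial>lborel)"
          unfolding R_def by (rule emeasure_density) (use Qb in \<open>auto intro: borel_measurable_indicator\<close>)
        also have "\<dots> = (\<integral>\<^sup>+p. indicator (Q s1) p \<partial>lborel)"
          by (rule nn_integral_cong) (simp add: indicator_def Q_def)
        also have "\<dots> = emeasure lborel (Q s1)" by (rule nn_integral_indicator) (use Qb in simp)
        finally show ?thesis .
      qed
      then show "emeasure R (Q s1) \<noteq> 0" using b1(2) by simp
      have "AE p in lborel. p \<in> Q s1 \<longrightarrow> 0 < u (flow B 2 x) (offs 1 n) p"
        by (rule b1(4)[OF flow_psd[OF xp] start[OF x] offs_bounds])
      then have "AE p in lborel. p \<in> Q s1 \<longrightarrow> 0 < ?G n p"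
      proof eventually_elim
        case (elim p)
        show ?case
        proof
          assume p: "p \<in> Q s1"
          then have up: "0 < u (flow B 2 x) (offs 1 n) p" using elim by blast
          have pp: "symz (fst p) \<in> psd" using b1(3)[OF p] by simp
          show "0 < ?G n p"
          proof (rule nn_integral_pos[where A = "Q s2"])
            have "(n, p) \<in> space ?S" using \<open>n \<in> space PN\<close> by (simp add: space_pair_measure R_def)
            from measurable_compose[OF measurable_Pair2'[OF this] joint]
            show "(\<lambda>q. 1 * (uu (x, (n, p)) * ww (q, (n, p)))) \<in> borel_measurable lborel" by simp
            have "AE q in lborel. q \<in> Q s2 \<longrightarrow> 0 < u (flow B 1 (symz (fst p))) (offs 2 n) q"
              by (rule b2(4)[OF flow_psd[OF pp] middle[OF p] offs_bounds])
            then show "AE q in lborel. q \<in> Q s2 \<longrightarrow> 0 < 1 * (uu (x, (n, p)) * ww (q, (n, p)))"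
            proof eventually_elim
              case (elim q)
              then show ?case using b2(3)[of q] n x up pp by (auto simp: uu_def ww_def ennreal_zero_less_mult_iff)
            qed
          qed (use Qb b2(2) in auto)
        qed
      qed
      then show "AE p in R. p \<in> Q s1 \<longrightarrow> 0 < ?G n p"
        unfolding R_def by (subst AE_density) (auto intro: borel_measurable_indicator)
    qed
    have "0 < (\<integral>\<^sup>+n. \<integral>\<^sup>+p. ?G n p \<partial>R \<partial>PN)"
    proof (rule nn_integral_pos[where A = "jump_pattern 1 (2 * ?d)"])
      show "(\<lambda>n. \<integral>\<^sup>+p. ?G n p \<partial>R) \<in> borel_measurable PN"
        by (rule R.borel_measurable_nn_integral[OF Gm])
      show "jump_pattern 1 (2 * ?d) \<in> sets PN" using jump_pattern_sets[of 1] by simp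
      show "emeasure PN (jump_pattern 1 (2 * ?d)) \<noteq> 0" by (rule jump_pattern_pos) simp
    qed (use nn in auto)
    then show ?thesis using swap[of "\<lambda>_. 1" x] by simp
  qed
  have pos: "(\<integral>\<^sup>+x. \<integral>\<^sup>+q. \<integral>\<^sup>+s. uu (x, s) * ww (q, s) \<partial>?S \<partial>lborel \<partial>lebesgue_sym) \<noteq> 0"
  proof -
    have "0 < (\<integral>\<^sup>+x. \<integral>\<^sup>+q. \<integral>\<^sup>+s. uu (x, s) * ww (q, s) \<partial>?S \<partial>lborel \<partial>lebesgue_sym)"
    proof (rule nn_integral_pos[where A = X0])
      let ?W = "(lebesgue_sym :: (real^'n^'n) measure) \<Otimes>\<^sub>M (lborel :: ((real^'n^'n) \<times> (real^'n^'n)) measure)"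
      have "(\<lambda>z. fst z) \<in> measurable ?W lebesgue_sym" "(\<lambda>z. snd z) \<in> measurable ?W lborel" by auto
      then have "(\<lambda>z. fst z) \<in> borel_measurable ?W" "(\<lambda>z. snd z) \<in> borel_measurable ?W"
        by (simp_all add: measurable_cong_sets[OF refl sets_lebesgue_sym])
      then have fs: "(\<lambda>z. fst (fst z)) \<in> borel_measurable (?W \<Otimes>\<^sub>M ?S)" "(\<lambda>z. snd (fst z)) \<in> borel_measurable (?W \<Otimes>\<^sub>M ?S)"
        using measurable_compose[OF measurable_fst] by blast+
      have "(\<lambda>z. uu (fst (fst z), snd z) * ww (snd (fst z), snd z)) \<in> borel_measurable (?W \<Otimes>\<^sub>M ?S)"
        using uu_m[OF fs(1) cS] ww_m[OF fs(2) cS] by (auto intro: borel_measurable_times_ennreal)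
      then have "(\<lambda>z. \<integral>\<^sup>+s. uu (fst z, s) * ww (snd z, s) \<partial>?S) \<in> borel_measurable ?W"
        by (intro sigma_finite_measure.borel_measurable_nn_integral[OF sfS]) (simp add: case_prod_unfold)
      then show "(\<lambda>x. \<integral>\<^sup>+q. \<integral>\<^sup>+s. uu (x, s) * ww (q, s) \<partial>?S \<partial>lborel) \<in> borel_measurable lebesgue_sym"
        by (intro sigma_finite_measure.borel_measurable_nn_integral[OF sigma_finite_lborel]) (simp add: case_prod_unfold)
    qed (use X0pos inner X0b in auto)
    then show ?thesis by simp
  qed
  obtain D E \<delta> where DE: "D \<in> sets lebesgue_sym" "E \<in> sets lborel" "\<delta> > 0" "emeasure lebesgue_sym D \<noteq> 0" "emeasure lborel E \<noteq> 0"
    and min: "\<And>x q. x \<in> D \<Longrightarrow> q \<in> E \<Longrightarrow> \<delta> \<le> (\<integral>\<^sup>+s. uu (x, s) * ww (q, s) \<partial>?S)"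
    using uniform_minorization[OF SS.finite_measure_axioms sigma_finite_lebesgue_sym sigma_finite_lborel um wm pos] by blast

  have Eb: "E \<in> sets borel" and Db: "D \<in> sets borel" using DE by auto
  have "E \<noteq> {}" "D \<noteq> {}" using DE by auto
  \<comment> \<open>The lower bound \<delta> is positive, so on D and E the indicators inside
    \<open>uu\<close> and \<open>ww\<close> cannot vanish.\<close>
  have supp: "x \<in> X0 \<and> symz (fst q) \<in> psd" if "x \<in> D" "q \<in> E" for x q
  proof (rule ccontr)
    assume "\<not> (x \<in> X0 \<and> symz (fst q) \<in> psd)"
    then have z: "uu (x, s) * ww (q, s) = 0" for s by (auto simp: uu_def ww_def case_prod_unfold)
    have "(\<integral>\<^sup>+s. uu (x, s) * ww (q, s) \<partial>?S) = 0" unfolding z by simp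
    then show False using min[OF that] DE(3) by simp
  qed
  have DX: "D \<subseteq> X0" using supp \<open>E \<noteq> {}\<close> by blast
  have Ds: "D \<in> sets psd_space" using Db DX X0n(2) by (auto simp: sets_restrict_space_iff)
  \<comment> \<open>Reads off the end position from its lift; the value 0 elsewhere only serves to
    stay in the state space, since lifts in E are psd.\<close>
  define g where "g p = (if symz (fst p) \<in> psd then symz (fst p) else 0)" for p :: "(real^'n^'n) \<times> (real^'n^'n)"
  have szb: "(\<lambda>p :: (real^'n^'n) \<times> (real^'n^'n). symz (fst p)) \<in> borel_measurable borel"
    by (rule sz) simp
  have "g \<in> borel_measurable borel"
    unfolding g_def[abs_def] using szb measurable_sets[OF szb psd_borel]
    by (intro measurable_If szb) (auto simp: vimage_def)
  then have gm: "g \<in> measurable lborel psd_space"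
    by (intro measurable_restrict_space2) (auto simp: g_def)
  define \<mu> where "\<mu> = density lborel (\<lambda>p. \<delta> * indicator E p)"
  have gm': "g \<in> measurable \<mu> psd_space" using gm by (simp add: \<mu>_def)
  \<comment> \<open>The minorizing measure: \<delta> times Lebesgue measure on E, pushed down to the
    end position. Its mass is \<delta> times the measure of E.\<close>
  define \<nu> where "\<nu> = distr \<mu> psd_space g"
  have nu: "emeasure \<nu> E' = (\<integral>\<^sup>+p. \<delta> * indicator E p * indicator (g -` E') p \<partial>lborel)" if "E' \<in> sets psd_space" for E'
  proof -
    have "g -` E' \<in> sets lborel" using measurable_sets[OF gm that] by simp
    then show ?thesis
      unfolding \<nu>_def using that Eb gm' by (subst emeasure_distr) (auto simp: \<mu>_def emeasure_density)
  qed
  have "emeasure \<nu> (space psd_space) \<noteq> 0"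
  proof -
    have "g p \<in> space psd_space" for p by (auto simp: g_def space_restrict_space)
    then have "g -` space psd_space = UNIV" by auto
    then have "emeasure \<nu> (space psd_space) = (\<integral>\<^sup>+p. \<delta> * indicator E p \<partial>lborel)"
      unfolding nu[OF sets.top] by simp
    also have "\<dots> = \<delta> * emeasure lborel E" using Eb by (intro nn_integral_cmult_indicator) auto
    finally show ?thesis using DE(3,5) by simp
  qed
  moreover have "emeasure \<nu> E' \<le> emeasure (P 3 x) E'" if x: "x \<in> D" and E': "E' \<in> sets psd_space" for x E'
  proof -
    have E'b: "E' \<in> sets borel" "E' \<subseteq> psd" using E' by (auto simp: sets_restrict_space_iff)
    have xX: "x \<in> X0" "x \<in> psd" using x DX X0n(2) by auto
    have km: "(\<lambda>q :: (real^'n^'n) \<times> (real^'n^'n). indicator E' (symz (fst q)) :: ennreal) \<in> borel_measurable borel"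
      using E'b by (intro measurable_compose[OF szb]) auto
    have "emeasure \<nu> E' \<le> (\<integral>\<^sup>+q. indicator E' (symz (fst q)) * (\<integral>\<^sup>+s. uu (x, s) * ww (q, s) \<partial>?S) \<partial>lborel)"
      unfolding nu[OF E']
    proof (rule nn_integral_mono)
      fix q
      show "\<delta> * indicator E q * indicator (g -` E') q \<le> indicator E' (symz (fst q)) * (\<integral>\<^sup>+s. uu (x, s) * ww (q, s) \<partial>?S)"
        using min[OF x, of q] supp[OF x, of q] by (auto simp: indicator_def g_def)
    qed
    also have "\<dots> = (\<integral>\<^sup>+n. \<integral>\<^sup>+p. \<integral>\<^sup>+q. indicator E' (symz (fst q)) * (uu (x, (n, p)) * ww (q, (n, p))) \<partial>lborel \<partial>R \<partial>PN)"
      by (rule swap[OF km])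
    also have "\<dots> \<le> (\<integral>\<^sup>+n. indicator (jump_pattern 1 (2 * ?d)) n * (\<integral>\<^sup>+p. indicator psd (symz (fst p)) *
       (\<integral>\<^sup>+q. indicator E' (symz (fst q)) * u (flow B 1 (symz (fst p))) (offs 2 n) q \<partial>lborel) * u (flow B 2 x) (offs 1 n) p \<partial>lborel) \<partial>PN)"
    proof (rule nn_integral_mono)
      fix n assume n: "n \<in> space PN"
      let ?U = "\<lambda>p. \<integral>\<^sup>+q. indicator E' (symz (fst q)) * u (flow B 1 (symz (fst p))) (offs 2 n) q \<partial>lborel"
      let ?H = "\<lambda>p. indicator psd (symz (fst p)) * ?U p * u (flow B 2 x) (offs 1 n) p"
      have Um: "(\<lambda>p :: (real^'n^'n) \<times> (real^'n^'n). ?U p) \<in> borel_measurable borel"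
        using measurable_compose[OF szb borel_measurable_u_product[of "indicator E'"]] E'b by simp
      have Hm: "?H \<in> borel_measurable borel"
        by (intro borel_measurable_times_ennreal Um borel_measurable_u measurable_compose[OF szb borel_measurable_indicator]) auto
      have "(\<integral>\<^sup>+q. indicator E' (symz (fst q)) * (uu (x, (n, p)) * ww (q, (n, p))) \<partial>lborel) \<le> indicator (jump_pattern 1 (2 * ?d)) n * ?H p" for p
      proof -
        have "(\<integral>\<^sup>+q. indicator E' (symz (fst q)) * (uu (x, (n, p)) * ww (q, (n, p))) \<partial>lborel)
          \<le> (\<integral>\<^sup>+q. uu (x, (n, p)) * (indicator E' (symz (fst q)) * u (flow B 1 (symz (fst p))) (offs 2 n) q) \<partial>lborel)"
          by (rule nn_integral_mono) (auto simp: ww_def indicator_def)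
        also have "\<dots> = uu (x, (n, p)) * ?U p"
          by (intro nn_integral_cmult borel_measurable_times_ennreal) (use km in \<open>auto intro: borel_measurable_u\<close>)
        also have "\<dots> = indicator (jump_pattern 1 (2 * ?d)) n * ?H p" using xX by (simp add: uu_def mult_ac)
        finally show ?thesis .
      qed
      then have "(\<integral>\<^sup>+p. \<integral>\<^sup>+q. indicator E' (symz (fst q)) * (uu (x, (n, p)) * ww (q, (n, p))) \<partial>lborel \<partial>R)
        \<le> (\<integral>\<^sup>+p. indicator (jump_pattern 1 (2 * ?d)) n * ?H p \<partial>R)" by (rule nn_integral_mono)
      also have "\<dots> = (\<integral>\<^sup>+p. indicator (ball 0 (2 * K + 2)) p * (indicator (jump_pattern 1 (2 * ?d)) n * ?H p) \<partial>lborel)"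
        unfolding R_def using Hm by (subst nn_integral_density) (auto intro!: borel_measurable_times_ennreal borel_measurable_indicator)
      also have "\<dots> \<le> (\<integral>\<^sup>+p. indicator (jump_pattern 1 (2 * ?d)) n * ?H p \<partial>lborel)"
        by (rule nn_integral_mono) (auto simp: indicator_def)
      also have "\<dots> = indicator (jump_pattern 1 (2 * ?d)) n * (\<integral>\<^sup>+p. ?H p \<partial>lborel)"
        by (rule nn_integral_cmult) (use Hm in simp)
      finally show "(\<integral>\<^sup>+p. \<integral>\<^sup>+q. indicator E' (symz (fst q)) * (uu (x, (n, p)) * ww (q, (n, p))) \<partial>lborel \<partial>R)
        \<le> indicator (jump_pattern 1 (2 * ?d)) n * (\<integral>\<^sup>+p. ?H p \<partial>lborel)" .
    qed
    also have "\<dots> \<le> emeasure (P 3 x) E'" by (rule two_stage_density_bound[OF xX(2) E'])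
    finally show ?thesis .
  qed
  moreover have "sets \<nu> = sets psd_space" by (simp add: \<nu>_def)
  ultimately have "small_set psd_space P D"
    unfolding small_set_def using Ds \<open>D \<noteq> {}\<close> by (intro conjI exI[of _ 3] exI[of _ \<nu>]) auto
  then show ?thesis using DX X0n(1) DE(4) by blast
qed

end

section \<open>Density of the jump law, aperiodicity and the theorem\<close>

text \<open>One of the two absolute continuities gives the density by the Radon-Nikodym theorem. The
  other gives its positivity: the zeros of f in V form a \<nu>-null set, which is then a Lebesgue
  null set.\<close>

lemma ac_component_density:
  fixes F :: "(real^'n) measure"
  assumes F: "has_ac_component_near_0 F" "sets F = sets borel"
  obtains f V where "f \<in> borel_measurable borel"
    "\<And>h. h \<in> borel_measurable borel \<Longrightarrow> (\<integral>\<^sup>+x. h x * f x \<partial>lborel) \<le> (\<integral>\<^sup>+x. h x \<partial>F)"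
    "open V" "0 \<in> V" "AE x in lborel. x \<in> V \<longrightarrow> 0 < f x"
proof -
  obtain \<nu> \<rho> V where s: "sets \<nu> = sets borel" and split: "\<And>E. E \<in> sets borel \<Longrightarrow> emeasure F E = emeasure \<nu> E + emeasure \<rho> E"
    and V: "open V" "0 \<in> V" and ac: "absolutely_continuous \<nu> (density lborel (indicator V))" "absolutely_continuous (density lborel (indicator V)) \<nu>"
    using F(1) unfolding has_ac_component_near_0_def by blast
  have Vb: "V \<in> sets borel" using V by (rule_tac borel_open)
  have "absolutely_continuous lborel (density lborel (indicator V))"
    by (rule absolutely_continuousI_density) (use Vb in simp)
  then have "absolutely_continuous lborel \<nu>" using ac(2) by (auto simp: absolutely_continuous_def)
  then obtain f where f: "f \<in> borel_measurable borel" "density lborel f = \<nu>"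
    using sigma_finite_measure.Radon_Nikodym[OF sigma_finite_lborel, of \<nu>] s by auto
  have le: "\<nu> \<le> F" using s F(2) split by (subst le_measure) auto
  have f_le: "(\<integral>\<^sup>+x. h x * f x \<partial>lborel) \<le> (\<integral>\<^sup>+x. h x \<partial>F)" if h: "h \<in> borel_measurable borel" for h
  proof -
    have "(\<integral>\<^sup>+x. h x * f x \<partial>lborel) = (\<integral>\<^sup>+x. h x \<partial>\<nu>)"
      unfolding f(2)[symmetric] using f(1) h by (subst nn_integral_density) (auto simp: mult.commute)
    also have "\<dots> \<le> (\<integral>\<^sup>+x. h x \<partial>F)" by (rule nn_integral_mono_measure[OF _ le]) (use s F in simp)
    finally show ?thesis .
  qed
  define Z where "Z = {x \<in> V. f x = 0}"
  have Zb: "Z \<in> sets borel"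
  proof -
    have "Z = V \<inter> f -` {0}" by (auto simp: Z_def)
    then show ?thesis using Vb measurable_sets[OF f(1), of "{0}"] by auto
  qed
  have "emeasure \<nu> Z = (\<integral>\<^sup>+x. f x * indicator Z x \<partial>lborel)"
    unfolding f(2)[symmetric] using f(1) Zb by (subst emeasure_density) auto
  also have "\<dots> = (\<integral>\<^sup>+x. 0 \<partial>(lborel :: (real^'n) measure))"
    by (rule nn_integral_cong) (auto simp: Z_def indicator_def)
  finally have "Z \<in> null_sets \<nu>" using s Zb by (simp add: null_sets_def)
  then have "Z \<in> null_sets (density lborel (indicator V))" using ac(1) by (auto simp: absolutely_continuous_def)
  then have "AE x in lborel. x \<in> Z \<longrightarrow> (indicator V x :: ennreal) = 0"
    using null_sets_density_iff[of "indicator V :: _ \<Rightarrow> ennreal" lborel Z] Vb by (auto intro: borel_measurable_indicator)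
  then have "AE x in lborel. x \<in> V \<longrightarrow> 0 < f x"
    by eventually_elim (auto simp: Z_def indicator_def zero_less_iff_neq_zero)
  then show ?thesis using that[OF f(1) f_le V] by blast
qed

text \<open>The small set lies in the bounded set \<open>nbhd r\<close>, so one time T serves all
  its points. Its positive Lebesgue measure passes to the maximal irreducibility measure, which
  dominates Lebesgue measure near 0.\<close>

lemma (in mucogarch_process) aperiodic:
  assumes stable: "\<And>z. eigenvalue B z \<Longrightarrow> Re z < 0"
  shows "aperiodic psd_space P"
proof -
  obtain r where r: "good_radius r" using good_radius_exists by blast
  have r0: "r > 0" using r by (simp add: good_radius_def)
  obtain D where D: "small_set psd_space P D" "D \<subseteq> nbhd r" "emeasure lebesgue_sym D \<noteq> 0"
    using small_set_exists[OF r] by blast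
  have Ds: "D \<in> sets psd_space" using D(1) by (simp add: small_set_def)
  have Dpos: "emeasure (lebesgue_psd_on (nbhd r)) D \<noteq> 0"
    using D(2,3) emeasure_lebesgue_psd_on[OF Ds, of r] by (simp add: Int_absorb1)
  have x0: "(0 :: real^'n^'n) \<in> psd" by (rule psd_zero)
  \<comment> \<open>Domination from the single state 0 is enough: an irreducibility measure cannot
    charge a set that is not reached from 0.\<close>
  obtain m where m: "finite_measure m" "sets m = sets psd_space"
    "\<And>D. D \<in> sets psd_space \<Longrightarrow> emeasure m D = 0 \<Longrightarrow> (\<integral>\<^sup>+t\<in>{0..}. emeasure (P t 0) D \<partial>lborel) = 0"
    using dominating_measure[OF M.prob_space_axioms Y_measurable[OF x0] Y_cadlag[OF x0]] by blast
  have "\<exists>\<psi>. maximal_irreducibility_measure psd_space P \<psi>"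
  proof (rule maximal_irreducibility_measure_exists[OF m(1,2)])
    fix D :: "(real^'n^'n) set"
    assume "D \<in> sets psd_space" "emeasure m D = 0"
    then have "(\<integral>\<^sup>+t\<in>{0..}. emeasure (P t 0) D \<partial>lborel) = 0" by (rule m(3))
    moreover have "0 \<in> space (psd_space :: (real^'n^'n) measure)" using x0 by (simp add: space_restrict_space)
    ultimately show "\<exists>x\<in>space psd_space. (\<integral>\<^sup>+t\<in>{0..}. emeasure (P t x) D \<partial>lborel) = 0" by blast
  qed simp
  then obtain \<psi> where \<psi>: "maximal_irreducibility_measure psd_space P \<psi>" by blast
  have "absolutely_continuous \<psi> (lebesgue_psd_on (nbhd r))"
    using \<psi> irreducible_nbhd[OF stable r] unfolding maximal_irreducibility_measure_def by blast
  moreover have "sets \<psi> = sets psd_space"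
    using \<psi> unfolding maximal_irreducibility_measure_def irreducible_wrt_def by blast
  ultimately have "emeasure \<psi> D \<noteq> 0"
    using Dpos Ds unfolding absolutely_continuous_def by (auto simp: null_sets_def)
  then have \<psi>D: "0 < emeasure \<psi> D" by (simp add: zero_less_iff_neq_zero)
  obtain T where T: "T \<ge> 0" "\<And>t x. t \<ge> T \<Longrightarrow> x \<in> psd \<Longrightarrow> norm x \<le> r / 2 \<Longrightarrow> 0 < emeasure (P t x) D"
    using eventually_positive[OF stable r Ds Dpos, of "r / 2"] r0 by auto
  have "\<forall>t\<ge>T. \<forall>x\<in>D. 0 < emeasure (P t x) D"
    using T(2) D(2) by (force simp: nbhd_def)
  then show ?thesis unfolding aperiodic_def using \<psi> D(1) \<psi>D T(1) by blast
qed

theorem corollary5p2: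
  fixes M :: "'w measure"
    and L :: "real \<Rightarrow> 'w \<Rightarrow> real^'n"
    and F :: "(real^'n) measure"
    and A B C :: "real^'n^'n"
    and Y :: "real^'n^'n \<Rightarrow> real \<Rightarrow> 'w \<Rightarrow> real^'n^'n"
    and P :: "real \<Rightarrow> real^'n^'n \<Rightarrow> (real^'n^'n) measure"
  assumes L: "compound_poisson_process M L F"
    and A: "invertible A"
    and B: "\<And>z. eigenvalue B z \<Longrightarrow> Re z < 0"
    and C: "C \<in> pd"
    and Y: "\<And>x. x \<in> psd \<Longrightarrow> mucogarch_volatility M L A B C (Y x) \<and> (AE \<omega> in M. Y x 0 \<omega> = x)"
    and P: "\<And>t x. P t x = distr M psd_space (Y x t)"
    and F: "has_ac_component_near_0 F"
  shows "(\<exists>U. openin (top_of_set psd) U \<and> 0 \<in> U \<and> irreducible_wrt psd_space P (lebesgue_psd_on U)) \<and>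
         aperiodic psd_space P"
proof -
  obtain rate N X where N: "poisson_process M rate N"
    and X: "prob_space.indep_vars M (\<lambda>_. borel) X UNIV" "\<And>i. distr M borel (X i) = F"
    and NX: "prob_space.indep_set M
         (sets (vimage_algebra (space M) (\<lambda>\<omega> i. X i \<omega>) (\<Pi>\<^sub>M i\<in>UNIV. borel)))
         (sets (vimage_algebra (space M) (\<lambda>\<omega>. \<lambda>t\<in>{0..}. N t \<omega>) (\<Pi>\<^sub>M t\<in>{0..}. count_space UNIV)))"
    and LX: "\<And>t \<omega>. 0 \<le> t \<Longrightarrow> \<omega> \<in> space M \<Longrightarrow> L t \<omega> = (\<Sum>i<N t \<omega>. X i \<omega>)"
    using L unfolding compound_poisson_process_def by blast
  interpret M: prob_space M using N by (simp add: poisson_process_def)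
  have "X 0 \<in> borel_measurable M" using X(1) unfolding M.indep_vars_def by blast
  then have F': "prob_space F" "sets F = sets borel"
    using M.prob_space_distr[of "X 0" borel] X(2)[of 0] by auto
  obtain f V where f: "f \<in> borel_measurable borel"
    "\<And>h. h \<in> borel_measurable borel \<Longrightarrow> (\<integral>\<^sup>+x. h x * f x \<partial>lborel) \<le> (\<integral>\<^sup>+x. h x \<partial>F)"
    "open V" "0 \<in> V" "AE x in lborel. x \<in> V \<longrightarrow> 0 < f x"
    using ac_component_density[OF F F'(2)] by blast
  obtain j :: "(real^'n^'n) \<times> (real^'n^'n) \<Rightarrow> ennreal" where j: "j \<in> borel_measurable borel"
    "\<And>h. h \<in> borel_measurable borel \<Longrightarrow> (\<integral>\<^sup>+p. h (polar p) * j p \<partial>lborel) \<le> (\<integral>\<^sup>+V. h V \<partial>lborel)"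
    "AE p in lborel. p \<in> polar_dom \<longrightarrow> 0 < j p"
    "\<And>N :: (real^'n^'n) set. N \<in> null_sets lborel \<Longrightarrow> AE p in lborel. p \<in> polar_dom \<longrightarrow> polar p \<notin> N"
    "\<And>p. p \<notin> polar_dom \<Longrightarrow> j p = 0"
    using gram_disintegration by blast
  interpret jump_density A B C F f V
    by (intro jump_density.intro A C F' f)
  interpret gram_density A B C F f V j
    by unfold_locales (fact j)+
  interpret mucogarch_process A B C F f V j M rate N X L Y
    by unfold_locales (use N X NX LX Y in blast)+
  have P_eq: "P = (\<lambda>t x. distr M psd_space (Y x t))" by (intro ext P)
  obtain r where r: "good_radius r" using good_radius_exists by blast
  have "nbhd r = psd \<inter> ball 0 (r / 2)" by (auto simp: nbhd_def)
  then have "openin (top_of_set psd) (nbhd r)" by (simp add: openin_open_Int)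
  moreover have "0 \<in> nbhd r" using r psd_zero by (simp add: nbhd_def good_radius_def)
  moreover have "irreducible_wrt psd_space P (lebesgue_psd_on (nbhd r))"
    unfolding P_eq by (rule irreducible_nbhd[OF B r])
  moreover have "aperiodic psd_space P" unfolding P_eq by (rule aperiodic[OF B])
  ultimately show ?thesis by blast
qed

end
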